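(* Let $\mathcal{F}\in\{\mathbb{R},\mathbb{C}\}$, let $m=3$ if $\mathcal{F}=\mathbb{R}$ and $m=4$ if $\mathcal{F}=\mathbb{C}$, and consider the homogeneous quadratic problem $(HQP_m)$ over $\mathcal{F}$ with $c_m\neq 0$, its semidefinite relaxation $(SP_m)$ and the dual $(SD_m)$ of that relaxation, as described in the context. Let $\Omega$ be the feasible set of $(HQP_m)$. Assume that both $(SP_m)$ and $(SD_m)$ satisfy the Slater condition. Let $\hat X$ and $(\hat Z,\hat\mu_1,\dots,\hat\mu_m)$ be any optimal solution pair of $(SP_m)$ and $(SD_m)$. Then $$v^*(SP_m)<v^*(HQP_m)\quad\text{or alternatively}\quad \Omega=\emptyset$$ if and only if the pair satisfies Property $\mathcal{I}$. Moreover, if the pair does not satisfy Property $\mathcal{I}$, then one can find a global optimal solution to $(HQP_m)$ from the pair in polynomial time.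
   Context: Notation. $\mathcal{F}$ is $\mathbb{R}$ or $\mathbb{C}$; $x^H$ is the conjugate transpose (the transpose if $\mathcal F=\mathbb R$). $\mathcal{HF}^n$ is the set of $n\times n$ Hermitian matrices over $\mathcal{F}$ (real symmetric if $\mathcal F=\mathbb R$). $A\bullet B=\mathrm{tr}(B^HA)$. $X\succeq 0$ (resp. $\succ 0$) means positive semidefinite (resp. positive definite). $\mathrm{Re}$ and $\mathrm{Im}$ are real and imaginary parts. Problems. Let $A_0,A_1,\dots,A_m\in\mathcal{HF}^n$, $c_1,\dots,c_m\in\mathbb{R}$ with $c_m\ne0$, and for each $i$ let $\unlhd_i\in\{\le,=\}$ be a fixed choice of relation. $(HQP_m)$: minimize $x^HA_0x$ over $x\in\mathcal{F}^n$ subject to $x^HA_ix\unlhd_i c_i$, $i=1,\dots,m$. $(SP_m)$: minimize $A_0\bullet X$ over $X\in\mathcal{HF}^n$ subject to $A_i\bullet X\unlhd_i c_i$ ($i=1,\dots,m$) and $X\succeq0$. $(SD_m)$: maximize $-\sum_{i=1}^m c_i\mu_i$ subject to $Z=A_0+\sum_{i=1}^m\mu_iA_i\succeq0$, $\mu_i\in\mathbb{R}$, with $\mu_i\ge0$ whenever $\unlhd_i$ is $\le$ ($\mu_i$ unrestricted in sign when $\unlhd_i$ is $=$). $v^*(\cdot)$ denotes the optimal objective value of a problem. Slater condition. $(SP_m)$ satisfies the Slater condition if there is $\tilde X\succ0$ with $A_i\bullet\tilde X<c_i$ whenever $\unlhd_i$ is $\le$ and $A_i\bullet\tilde X=c_i$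 whenever $\unlhd_i$ is $=$. $(SD_m)$ satisfies the Slater condition if there are real $\tilde\mu_1,\dots,\tilde\mu_m$ with $A_0+\sum_{i=1}^m\tilde\mu_iA_i\succ0$ and $\tilde\mu_i>0$ whenever $\unlhd_i$ is $\le$. An optimal solution pair consists of an optimal solution $\hat X$ of $(SP_m)$ and an optimal solution $(\hat Z,\hat\mu_1,\dots,\hat\mu_m)$ of $(SD_m)$. Property $\mathcal{I}$. Write $B_i=A_i-\frac{c_i}{c_m}A_m$. An optimal solution pair has Property $\mathcal{I}$ if all of the following hold: (I.1) $\hat\mu_i\neq0$ for each $i\in\{1,\dots,m\}$ for which $\unlhd_i$ is $\le$; (I.2) $\mathrm{rank}(\hat Z)=n-2$; (I.3) $\mathrm{rank}(\hat X)=2$; (I.4) there is a rank-one decomposition $\hat X=\hat x_1\hat x_1^H+\hat x_2\hat x_2^H$ with $\hat x_1,\hat x_2\in\mathcal F^n$ such that (I.4.1) $\hat x_1^HB_1\hat x_1=\hat x_2^HB_1\hat x_2=0$ and $\mathrm{Re}(\hat x_1^HB_1\hat x_2)\neq0$; (I.4.2) (required only when $\mathcal F=\mathbb C$, $m=4$) $\hat x_1^HB_2\hat x_1=\hat x_2^HB_2\hat x_2=0$, $\mathrm{Re}(\hat x_1^HB_2\hat x_2)=0$ and $\mathrm{Im}(\hat x_1^HB_2\hat x_2)\neq0$; (I.4.3) $(\hat x_1^HB_{m-1}\hat x_1)(\hat x_2^HB_{m-1}\hat x_2)<0$. *)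

theory Defs
  imports
    "HOL-Library.Extended_Real"
    "Jordan_Normal_Form.Schur_Decomposition"
    "Jordan_Normal_Form.DL_Rank"
begin

section \<open>Homogeneous quadratic problems and their semidefinite relaxations\<close>

text \<open>
  The base field is a subset \<open>F\<close> of the complex numbers, either \<open>\<real>\<close> or \<open>UNIV\<close>; vectors and matrices
  over \<open>F\<close> are complex vectors and matrices all of whose entries lie in \<open>F\<close>. For \<open>F = \<real>\<close>
  the adjoint is the transpose, and the rank over the complex numbers of a matrix with real entries
  is its rank over the reals.
\<close>

definition Fvec :: "complex set \<Rightarrow> nat \<Rightarrow> complex vec set" where
  "Fvec F n = {x \<in> carrier_vec n. \<forall>i<n. x $ i \<in> F}"

definition HF :: "complex set \<Rightarrow> nat \<Rightarrow> complex mat set" where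
  "HF F n = {X \<in> carrier_mat n n. (\<forall>i<n. \<forall>j<n. X $$ (i, j) \<in> F) \<and> mat_adjoint X = X}"

text \<open>\<open>sesq B x y\<close> is $x^H B y$; note that \<open>v \<bullet>c x\<close> conjugates its second argument.\<close>

definition sesq :: "complex mat \<Rightarrow> complex vec \<Rightarrow> complex vec \<Rightarrow> complex" where
  "sesq B x y = (B *\<^sub>v y) \<bullet>c x"

definition mtrace :: "complex mat \<Rightarrow> complex" where
  "mtrace M = (\<Sum>i<dim_row M. M $$ (i, i))"

definition mat_inner :: "complex mat \<Rightarrow> complex mat \<Rightarrow> complex"  (infixl "\<bullet>\<^sub>m" 70) where
  "A \<bullet>\<^sub>m B = mtrace (mat_adjoint B * A)"

definition outer :: "complex vec \<Rightarrow> complex mat" where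
  "outer x = mat (dim_vec x) (dim_vec x) (\<lambda>(i, j). x $ i * cnj (x $ j))"

text \<open>
  For Hermitian matrices, $x^H A x$ and $A \bullet X$ are real numbers, which \<open>Re\<close> extracts.
\<close>

definition psd :: "complex set \<Rightarrow> nat \<Rightarrow> complex mat \<Rightarrow> bool" where
  "psd F n X \<longleftrightarrow> X \<in> HF F n \<and> (\<forall>x \<in> Fvec F n. Re (sesq X x x) \<ge> 0)"

definition pd :: "complex set \<Rightarrow> nat \<Rightarrow> complex mat \<Rightarrow> bool" where
  "pd F n X \<longleftrightarrow> X \<in> HF F n \<and> (\<forall>x \<in> Fvec F n. x \<noteq> 0\<^sub>v n \<longrightarrow> Re (sesq X x x) > 0)"

abbreviation mrank :: "nat \<Rightarrow> complex mat \<Rightarrow> nat" where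
  "mrank n X \<equiv> vec_space.rank n X"

datatype relation = Le | Eq

fun holds :: "relation \<Rightarrow> real \<Rightarrow> real \<Rightarrow> bool" where
  "holds Le a b \<longleftrightarrow> a \<le> b"
| "holds Eq a b \<longleftrightarrow> a = b"

text \<open>
  A problem is given by \<open>F\<close>, \<open>n\<close>, \<open>m\<close>, matrices \<open>A 0, ..., A m\<close>, numbers \<open>c 1, ..., c m\<close> and
  relations \<open>r 1, ..., r m\<close>; the values of \<open>A\<close>, \<open>c\<close>, \<open>r\<close> at other indices are irrelevant.
\<close>

definition problem_data ::
  "complex set \<Rightarrow> nat \<Rightarrow> nat \<Rightarrow> (nat \<Rightarrow> complex mat) \<Rightarrow> (nat \<Rightarrow> real) \<Rightarrow> bool" where
  "problem_data F n m A c \<longleftrightarrow> n \<ge> 1 \<and> (\<forall>i\<le>m. A i \<in> HF F n) \<and> c m \<noteq> 0"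

definition HQP_feasible ::
  "complex set \<Rightarrow> nat \<Rightarrow> nat \<Rightarrow> (nat \<Rightarrow> complex mat) \<Rightarrow> (nat \<Rightarrow> real) \<Rightarrow> (nat \<Rightarrow> relation)
    \<Rightarrow> complex vec set" where
  "HQP_feasible F n m A c r =
     {x \<in> Fvec F n. \<forall>i\<in>{1..m}. holds (r i) (Re (sesq (A i) x x)) (c i)}"

definition HQP_optimal ::
  "complex set \<Rightarrow> nat \<Rightarrow> nat \<Rightarrow> (nat \<Rightarrow> complex mat) \<Rightarrow> (nat \<Rightarrow> real) \<Rightarrow> (nat \<Rightarrow> relation)
    \<Rightarrow> complex vec \<Rightarrow> bool" where
  "HQP_optimal F n m A c r x \<longleftrightarrow>
     x \<in> HQP_feasible F n m A c r \<and>
     (\<forall>y \<in> HQP_feasible F n m A c r. Re (sesq (A 0) x x) \<le> Re (sesq (A 0) y y))"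

definition SP_feasible ::
  "complex set \<Rightarrow> nat \<Rightarrow> nat \<Rightarrow> (nat \<Rightarrow> complex mat) \<Rightarrow> (nat \<Rightarrow> real) \<Rightarrow> (nat \<Rightarrow> relation)
    \<Rightarrow> complex mat set" where
  "SP_feasible F n m A c r =
     {X. psd F n X \<and> (\<forall>i\<in>{1..m}. holds (r i) (Re (A i \<bullet>\<^sub>m X)) (c i))}"

definition SP_optimal ::
  "complex set \<Rightarrow> nat \<Rightarrow> nat \<Rightarrow> (nat \<Rightarrow> complex mat) \<Rightarrow> (nat \<Rightarrow> real) \<Rightarrow> (nat \<Rightarrow> relation)
    \<Rightarrow> complex mat \<Rightarrow> bool" where
  "SP_optimal F n m A c r X \<longleftrightarrow>
     X \<in> SP_feasible F n m A c r \<and>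
     (\<forall>Y \<in> SP_feasible F n m A c r. Re (A 0 \<bullet>\<^sub>m X) \<le> Re (A 0 \<bullet>\<^sub>m Y))"

text \<open>Optimal values are extended reals; the infimum over an empty feasible set is \<open>\<infinity>\<close>.\<close>

definition v_HQP ::
  "complex set \<Rightarrow> nat \<Rightarrow> nat \<Rightarrow> (nat \<Rightarrow> complex mat) \<Rightarrow> (nat \<Rightarrow> real) \<Rightarrow> (nat \<Rightarrow> relation)
    \<Rightarrow> ereal" where
  "v_HQP F n m A c r = (INF x \<in> HQP_feasible F n m A c r. ereal (Re (sesq (A 0) x x)))"

definition v_SP ::
  "complex set \<Rightarrow> nat \<Rightarrow> nat \<Rightarrow> (nat \<Rightarrow> complex mat) \<Rightarrow> (nat \<Rightarrow> real) \<Rightarrow> (nat \<Rightarrow> relation)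
    \<Rightarrow> ereal" where
  "v_SP F n m A c r = (INF X \<in> SP_feasible F n m A c r. ereal (Re (A 0 \<bullet>\<^sub>m X)))"

text \<open>\<open>dual_slack n m A \<mu>\<close> is $A_0 + \sum_{i=1}^m \mu_i A_i$.\<close>

definition dual_slack ::
  "nat \<Rightarrow> nat \<Rightarrow> (nat \<Rightarrow> complex mat) \<Rightarrow> (nat \<Rightarrow> real) \<Rightarrow> complex mat" where
  "dual_slack n m A \<mu> =
     mat n n (\<lambda>(j, k). A 0 $$ (j, k) + (\<Sum>i=1..m. complex_of_real (\<mu> i) * A i $$ (j, k)))"

definition SD_feasible ::
  "complex set \<Rightarrow> nat \<Rightarrow> nat \<Rightarrow> (nat \<Rightarrow> complex mat) \<Rightarrow> (nat \<Rightarrow> relation)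
    \<Rightarrow> (complex mat \<times> (nat \<Rightarrow> real)) set" where
  "SD_feasible F n m A r =
     {(Z, \<mu>). Z = dual_slack n m A \<mu> \<and> psd F n Z \<and> (\<forall>i\<in>{1..m}. r i = Le \<longrightarrow> \<mu> i \<ge> 0)}"

definition SD_optimal ::
  "complex set \<Rightarrow> nat \<Rightarrow> nat \<Rightarrow> (nat \<Rightarrow> complex mat) \<Rightarrow> (nat \<Rightarrow> real) \<Rightarrow> (nat \<Rightarrow> relation)
    \<Rightarrow> complex mat \<Rightarrow> (nat \<Rightarrow> real) \<Rightarrow> bool" where
  "SD_optimal F n m A c r Z \<mu> \<longleftrightarrow>
     (Z, \<mu>) \<in> SD_feasible F n m A r \<and>
     (\<forall>(Y, \<nu>) \<in> SD_feasible F n m A r. - (\<Sum>i=1..m. c i * \<nu> i) \<le> - (\<Sum>i=1..m. c i * \<mu> i))"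

definition SP_slater ::
  "complex set \<Rightarrow> nat \<Rightarrow> nat \<Rightarrow> (nat \<Rightarrow> complex mat) \<Rightarrow> (nat \<Rightarrow> real) \<Rightarrow> (nat \<Rightarrow> relation)
    \<Rightarrow> bool" where
  "SP_slater F n m A c r \<longleftrightarrow>
     (\<exists>X. pd F n X \<and>
        (\<forall>i\<in>{1..m}. (r i = Le \<longrightarrow> Re (A i \<bullet>\<^sub>m X) < c i) \<and> (r i = Eq \<longrightarrow> Re (A i \<bullet>\<^sub>m X) = c i)))"

definition SD_slater ::
  "complex set \<Rightarrow> nat \<Rightarrow> nat \<Rightarrow> (nat \<Rightarrow> complex mat) \<Rightarrow> (nat \<Rightarrow> relation) \<Rightarrow> bool" where
  "SD_slater F n m A r \<longleftrightarrow>
     (\<exists>\<mu>. pd F n (dual_slack n m A \<mu>) \<and> (\<forall>i\<in>{1..m}. r i = Le \<longrightarrow> \<mu> i > 0))"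

definition Bmat :: "nat \<Rightarrow> (nat \<Rightarrow> complex mat) \<Rightarrow> (nat \<Rightarrow> real) \<Rightarrow> nat \<Rightarrow> complex mat" where
  "Bmat m A c i = A i - complex_of_real (c i / c m) \<cdot>\<^sub>m A m"

text \<open>
  The rank of \<open>Z\<close> is compared with \<open>n - 2\<close> over the integers, to avoid truncated subtraction.
\<close>

definition property_I ::
  "complex set \<Rightarrow> nat \<Rightarrow> nat \<Rightarrow> (nat \<Rightarrow> complex mat) \<Rightarrow> (nat \<Rightarrow> real) \<Rightarrow> (nat \<Rightarrow> relation)
    \<Rightarrow> complex mat \<Rightarrow> complex mat \<Rightarrow> (nat \<Rightarrow> real) \<Rightarrow> bool" where
  "property_I F n m A c r X Z \<mu> \<longleftrightarrow>
     (\<forall>i\<in>{1..m}. r i = Le \<longrightarrow> \<mu> i \<noteq> 0) \<and>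
     int (mrank n Z) = int n - 2 \<and>
     mrank n X = 2 \<and>
     (\<exists>x1 \<in> Fvec F n. \<exists>x2 \<in> Fvec F n.
        let B = Bmat m A c in
        X = outer x1 + outer x2 \<and>
        (sesq (B 1) x1 x1 = 0 \<and> sesq (B 1) x2 x2 = 0 \<and> Re (sesq (B 1) x1 x2) \<noteq> 0) \<and>
        (F = UNIV \<and> m = 4 \<longrightarrow>
           sesq (B 2) x1 x1 = 0 \<and> sesq (B 2) x2 x2 = 0 \<and>
           Re (sesq (B 2) x1 x2) = 0 \<and> Im (sesq (B 2) x1 x2) \<noteq> 0) \<and>
        Re (sesq (B (m - 1)) x1 x1) * Re (sesq (B (m - 1)) x2 x2) < 0)"

definition slater_optimal_pair ::
  "complex set \<Rightarrow> nat \<Rightarrow> nat \<Rightarrow> (nat \<Rightarrow> complex mat) \<Rightarrow> (nat \<Rightarrow> real) \<Rightarrow> (nat \<Rightarrow> relation)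
    \<Rightarrow> complex mat \<Rightarrow> complex mat \<Rightarrow> (nat \<Rightarrow> real) \<Rightarrow> bool" where
  "slater_optimal_pair F n m A c r X Z \<mu> \<longleftrightarrow>
     problem_data F n m A c \<and>
     SP_slater F n m A c r \<and> SD_slater F n m A r \<and>
     SP_optimal F n m A c r X \<and> SD_optimal F n m A c r Z \<mu>"


section \<open>Polynomial time: a real-number random access machine\<close>

text \<open>
  Data and optimal solutions are exact real or complex numbers, so running time is measured in the
  real-number model: exact arithmetic and comparisons at unit cost. Programs are while-programs over
  two kinds of storage. Index registers hold natural numbers and support only addition and
  truncated subtraction, so that unit cost is reasonable for them. Data cells hold
  complex numbers and are organised in arrays: cell \<open>(i, j)\<close> of array \<open>a\<close>, where the array number
  \<open>a\<close> is fixed in the program text and \<open>i\<close>, \<open>j\<close> are computed indices.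

  Data operations are field operations, conjugation, comparison of real parts, and \<open>Root es\<close>, the
  least real root of the nonzero real polynomial with coefficients \<open>Re e\<close> for \<open>e\<close> in \<open>es\<close>, lowest
  degree first (\<open>0\<close> if there is none). Its degree is bounded by the program text
  and hence independent of the input. It covers the square roots used in
  rank-one decompositions as well as the polynomial equations of bounded degree that arise
  from solving quadratic systems in a bounded number of unknowns.
\<close>

datatype nexp = NNum nat | NReg nat | NAdd nexp nexp | NSub nexp nexp

datatype cexp =
    CNum int | CUnit | Cell nat nexp nexp
  | CAdd cexp cexp | CSub cexp cexp | CMul cexp cexp | CDiv cexp cexp
  | Conj cexp | Root "cexp list"

datatype bexp = NLess nexp nexp | ReLess cexp cexp | BNot bexp | BAnd bexp bexp

datatype prog =
    Skip | SetReg nat nexp | SetCell nat nexp nexp cexp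
  | Then prog prog | IfElse bexp prog prog | Loop bexp prog

type_synonym regs = "nat \<Rightarrow> nat"
type_synonym cells = "nat \<Rightarrow> nat \<Rightarrow> nat \<Rightarrow> complex"
type_synonym state = "regs \<times> cells"

definition least_real_root :: "real poly \<Rightarrow> real" where
  "least_real_root p =
     (if p \<noteq> 0 \<and> (\<exists>x. poly p x = 0) then Min {x. poly p x = 0} else 0)"

primrec nval :: "regs \<Rightarrow> nexp \<Rightarrow> nat" where
  "nval R (NNum k) = k"
| "nval R (NReg k) = R k"
| "nval R (NAdd a b) = nval R a + nval R b"
| "nval R (NSub a b) = nval R a - nval R b"

fun cval :: "state \<Rightarrow> cexp \<Rightarrow> complex" where
  "cval s (CNum k) = of_int k"
| "cval s CUnit = \<i>"
| "cval s (Cell a i j) = snd s a (nval (fst s) i) (nval (fst s) j)"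
| "cval s (CAdd d e) = cval s d + cval s e"
| "cval s (CSub d e) = cval s d - cval s e"
| "cval s (CMul d e) = cval s d * cval s e"
| "cval s (CDiv d e) = cval s d / cval s e"
| "cval s (Conj e) = cnj (cval s e)"
| "cval s (Root es) =
     complex_of_real (least_real_root (Poly (map (\<lambda>e. Re (cval s e)) es)))"

primrec bval :: "state \<Rightarrow> bexp \<Rightarrow> bool" where
  "bval s (NLess a b) \<longleftrightarrow> nval (fst s) a < nval (fst s) b"
| "bval s (ReLess d e) \<longleftrightarrow> Re (cval s d) < Re (cval s e)"
| "bval s (BNot b) \<longleftrightarrow> \<not> bval s b"
| "bval s (BAnd a b) \<longleftrightarrow> bval s a \<and> bval s b"

fun set_cell :: "cells \<Rightarrow> nat \<Rightarrow> nat \<Rightarrow> nat \<Rightarrow> complex \<Rightarrow> cells" where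
  "set_cell M a i j z = M(a := (M a)(i := (M a i)(j := z)))"

text \<open>
  \<open>exec P s t s'\<close>: started in \<open>s\<close>, the program \<open>P\<close> halts in \<open>s'\<close> after \<open>t\<close> steps. Each assignment
  and each evaluation of a guard counts as one step, since the expressions in a fixed program
  have bounded size.
\<close>

inductive exec :: "prog \<Rightarrow> state \<Rightarrow> nat \<Rightarrow> state \<Rightarrow> bool" where
  Skip: "exec Skip s 1 s"
| SetReg: "exec (SetReg k a) (R, M) 1 (R(k := nval R a), M)"
| SetCell: "exec (SetCell a i j e) (R, M) 1
             (R, set_cell M a (nval R i) (nval R j) (cval (R, M) e))"
| Then: "exec P s t s' \<Longrightarrow> exec Q s' u s'' \<Longrightarrow> exec (Then P Q) s (t + u) s''"
| IfTrue: "bval s b \<Longrightarrow> exec P s t s' \<Longrightarrow> exec (IfElse b P Q) s (1 + t) s'"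
| IfFalse: "\<not> bval s b \<Longrightarrow> exec Q s t s' \<Longrightarrow> exec (IfElse b P Q) s (1 + t) s'"
| LoopFalse: "\<not> bval s b \<Longrightarrow> exec (Loop b P) s 1 s"
| LoopTrue: "bval s b \<Longrightarrow> exec P s t s' \<Longrightarrow> exec (Loop b P) s' u s'' \<Longrightarrow>
             exec (Loop b P) s (1 + t + u) s''"

text \<open>
  Input: register \<open>0\<close> holds \<open>n\<close>; arrays \<open>0, ..., m\<close> hold \<open>A 0, ..., A m\<close>; arrays \<open>m + 1\<close> and
  \<open>m + 2\<close> hold \<open>X\<close> and \<open>Z\<close>; in array \<open>m + 3\<close>, row \<open>i\<close> with \<open>1 \<le> i \<le> m\<close> holds \<open>c i\<close>, \<open>\<mu> i\<close>
  and a \<open>0\<close>/\<open>1\<close> flag for the \<open>i\<close>-th relation. Everything else is zero. The output vector is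
  read off column \<open>0\<close> of array \<open>m + 4\<close>.
\<close>

definition mat_cells :: "nat \<Rightarrow> complex mat \<Rightarrow> nat \<Rightarrow> nat \<Rightarrow> complex" where
  "mat_cells n M i j = (if i < n \<and> j < n then M $$ (i, j) else 0)"

definition input_state ::
  "nat \<Rightarrow> nat \<Rightarrow> (nat \<Rightarrow> complex mat) \<Rightarrow> (nat \<Rightarrow> real) \<Rightarrow> (nat \<Rightarrow> relation)
    \<Rightarrow> complex mat \<Rightarrow> complex mat \<Rightarrow> (nat \<Rightarrow> real) \<Rightarrow> state" where
  "input_state n m A c r X Z \<mu> =
     ((\<lambda>k. if k = 0 then n else 0),
      (\<lambda>a i j.
         if a \<le> m then mat_cells n (A a) i j
         else if a = m + 1 then mat_cells n X i j
         else if a = m + 2 then mat_cells n Z i j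
         else if a = m + 3 \<and> 1 \<le> i \<and> i \<le> m then
           (if j = 0 then complex_of_real (c i)
            else if j = 1 then complex_of_real (\<mu> i)
            else if j = 2 then (if r i = Le then 1 else 0)
            else 0)
         else 0))"

definition output_vec :: "nat \<Rightarrow> nat \<Rightarrow> state \<Rightarrow> complex vec" where
  "output_vec n m s = vec n (\<lambda>i. snd s (m + 4) i 0)"

end

theory Submission
  imports Defs "HOL-Analysis.Starlike"
begin

text \<open>
  By strong duality an optimal pair satisfies $\hat Z \bullet \hat X = 0$ and complementary slackness.
  Hence a feasible $x$ attains $v^*(SP_m)$ iff $x^H \hat Z x = 0$ and all constraints with
  $\hat\mu_i \neq 0$ are active at $x$ (a \<open>certificate\<close>). The Slater condition of the dual makes sublevel
  sets compact, so there is a gap or $\Omega = \emptyset$ iff no certificate exists.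

  Rotations of pairs of summands of a rank-one decomposition of $\hat X$ make all but one of the
  forms $A_i - (a_i / a_{i_0}) A_{i_0}$, where $a_i = A_i \bullet \hat X$, vanish on every summand. If
  $\hat\mu_j = 0$ for an inequality $j$, the last form belongs to $j$ and needs only a sign, which
  some summand has because the form vanishes against $\hat X$; the dual Slater condition shows that this
  summand can be scaled to a certificate. If all multipliers of inequalities are nonzero, take two
  summands $x_1$, $x_2$ on which the last form has opposite signs. Either a phase makes the remaining forms
  vanish on a real plane in their span, and a quadratic equation gives a certificate, or one needs a third
  vector of $\ker \hat Z$ orthogonal to $x_1$ and $x_2$; then a cubic and a quartic equation suffice.
  If there is no third vector, $\ker \hat Z$ is spanned by $x_1$ and $x_2$, and this is Property I. Conversely,
  under Property I the forms $B_1$ (and $B_2$) vanish in $\ker \hat Z$ only at multiples of $\hat x_1$ and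
  $\hat x_2$, where $B_{m-1}$ does not vanish.
\<close>

text \<open>Both claims rest on one correctness proof: the program is verified to produce a
  certificate whenever Property I fails, and the existence of this run also proves that a gap
  implies Property I. The program does not test Property I; its failure enters only as the guarantee
  that a third kernel vector exists at the one point where it is asked for.

  The degrees have a geometric origin. When two forms are left on a real three-dimensional space,
  one of them vanishes, in suitable coordinates, on a hyperbola \<open>a b = \<kappa>\<close>;
  inserting \<open>b = \<kappa> / a\<close> in the other form and clearing denominators gives the
  quartic. With three forms over the complex numbers, some real combination of two of them is
  degenerate on the span, and the determinant that finds it is the cubic. Odd degree, or end
  coefficients of opposite sign, guarantee a real root, so no discriminants are inspected.

  Vectors and matrices are functions on indices, as in the store, and only entries below n are
  meaningful. The time bound is read off the program text, since every loop counts to n.\<close>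

hide_const (open) Finite_Cartesian_Product.mat Finite_Cartesian_Product.vec Finite_Cartesian_Product.row
hide_type (open) Finite_Cartesian_Product.vec
unbundle no vec_syntax

section \<open>Programs and running time\<close>

text \<open>A bound in the value n of register 0, computed from the text alone. The clause for
  \<open>Loop\<close> is sound only for loops with at most n rounds; \<open>For\<close> is the only
  source of loops. Both branches of \<open>IfElse\<close> are added because a maximum of polynomials
  is in general not a polynomial.\<close>

fun time_bound :: "prog \<Rightarrow> nat poly" where
  "time_bound Skip = 1"
| "time_bound (SetReg k a) = 1"
| "time_bound (SetCell a i j e) = 1"
| "time_bound (Then P Q) = time_bound P + time_bound Q"
| "time_bound (IfElse b P Q) = 1 + time_bound P + time_bound Q"
| "time_bound (Loop b P) = 1 + [:0, 1:] * (1 + time_bound P)"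

text \<open>Total correctness and the time bound in one predicate transformer. Registers must be
  back at R at the end, so that the same R, and hence the same n, serves every rule; only the store
  varies.\<close>

definition wp :: "regs \<Rightarrow> prog \<Rightarrow> (cells \<Rightarrow> bool) \<Rightarrow> cells \<Rightarrow> bool" where
  "wp R P Q M \<longleftrightarrow> (\<exists>t M'. t \<le> poly (time_bound P) (R 0) \<and> exec P (R, M) t (R, M') \<and> Q M')"

lemma wp_Skip: "Q M \<Longrightarrow> wp R Skip Q M"
  unfolding wp_def by (auto intro!: exI[of _ 1] exec.Skip)

lemma wp_SetCell:
  "Q (set_cell M a (nval R i) (nval R j) (cval (R, M) e)) \<Longrightarrow> wp R (SetCell a i j e) Q M"
  unfolding wp_def using exec.SetCell[of a i j e R M] by fastforce

lemma wp_Then: "wp R P (wp R Q W) M \<Longrightarrow> wp R (Then P Q) W M"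
  unfolding wp_def
proof (elim exE conjE)
  fix t M' u M''
  assume "t \<le> poly (time_bound P) (R 0)" "exec P (R, M) t (R, M')"
    "u \<le> poly (time_bound Q) (R 0)" "exec Q (R, M') u (R, M'')" "W M''"
  then show "\<exists>t M'. t \<le> poly (time_bound (Then P Q)) (R 0) \<and> exec (Then P Q) (R, M) t (R, M') \<and> W M'"
    by (intro exI[of _ "t + u"] exI[of _ M'']) (auto intro: exec.Then)
qed

lemma wp_IfElse:
  assumes "bval (R, M) b \<Longrightarrow> wp R P W M" and "\<not> bval (R, M) b \<Longrightarrow> wp R Q W M"
  shows "wp R (IfElse b P Q) W M"
proof (cases "bval (R, M) b")
  case True
  from assms(1)[OF True] obtain t M' where "t \<le> poly (time_bound P) (R 0)"
    "exec P (R, M) t (R, M')" "W M'" unfolding wp_def by blast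
  with exec.IfTrue[OF True] show ?thesis
    unfolding wp_def by (intro exI[of _ "1 + t"] exI[of _ M']) auto
next
  case False
  from assms(2)[OF False] obtain t M' where "t \<le> poly (time_bound Q) (R 0)"
    "exec Q (R, M) t (R, M')" "W M'" unfolding wp_def by blast
  with exec.IfFalse[OF False] show ?thesis
    unfolding wp_def by (intro exI[of _ "1 + t"] exI[of _ M']) auto
qed

text \<open>The loop register is reset at the end, so that programs leave all registers unchanged.\<close>

definition For :: "nat \<Rightarrow> prog \<Rightarrow> prog" where
  "For k P = Then (Loop (NLess (NReg k) (NReg 0)) (Then P (SetReg k (NAdd (NReg k) (NNum 1)))))
               (SetReg k (NNum 0))"

lemma wp_For:
  assumes "k \<noteq> 0" "R k = 0" "I 0 M"
    and step: "\<And>i M. i < R 0 \<Longrightarrow> I i M \<Longrightarrow> wp (R(k := i)) P (I (Suc i)) M"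
    and Q: "\<And>M. I (R 0) M \<Longrightarrow> Q M"
  shows "wp R (For k P) Q M"
proof -
  let ?b = "NLess (NReg k) (NReg 0)" and ?P = "Then P (SetReg k (NAdd (NReg k) (NNum 1)))"
  let ?T = "poly (time_bound P) (R 0)"
  \<comment> \<open>Induction on the number of remaining rounds. Each round costs the body plus 2,
    for the guard and the increment; the final 1 is the guard that fails.\<close>
  have *: "\<exists>t M'. t \<le> (R 0 - i) * (?T + 2) + 1 \<and> exec (Loop ?b ?P) (R(k := i), M) t (R(k := R 0), M')
            \<and> I (R 0) M'" if "I i M" "i \<le> R 0" for i M
    using that
  proof (induction "R 0 - i" arbitrary: i M)
    case 0
    then have "i = R 0" by simp
    moreover have "\<not> bval (R(k := R 0), M) ?b" using assms(1) by simp
    ultimately show ?case using 0 exec.LoopFalse by (intro exI[of _ 1] exI[of _ M]) auto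
  next
    case (Suc d)
    then have i: "i < R 0" "R 0 - i = Suc (R 0 - Suc i)" by auto
    from step[OF i(1) Suc.prems(1)] obtain t M1 where
      t: "t \<le> ?T" "exec P (R(k := i), M) t (R(k := i), M1)" "I (Suc i) M1"
      unfolding wp_def using assms(1) by auto
    have "exec ?P (R(k := i), M) (t + 1) (R(k := Suc i), M1)"
      using exec.Then[OF t(2) exec.SetReg[of k "NAdd (NReg k) (NNum 1)"]] by simp
    moreover obtain u M2 where u: "u \<le> (R 0 - Suc i) * (?T + 2) + 1"
      "exec (Loop ?b ?P) (R(k := Suc i), M1) u (R(k := R 0), M2)" "I (R 0) M2"
      using Suc(1)[of "Suc i" M1] Suc(2) t(3) i by auto
    moreover have "bval (R(k := i), M) ?b" using i assms(1) by simp
    ultimately have "exec (Loop ?b ?P) (R(k := i), M) (1 + (t + 1) + u) (R(k := R 0), M2)"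
      by (blast intro: exec.LoopTrue)
    moreover have "1 + (t + 1) + u \<le> (R 0 - i) * (?T + 2) + 1"
      using t(1) u(1) unfolding i(2) by simp
    ultimately show ?case using u(3) by blast
  qed
  have R: "R(k := 0) = R" using assms(2) by auto
  from *[of 0 M] assms(3) obtain t M' where
    t: "t \<le> R 0 * (?T + 2) + 1" "exec (Loop ?b ?P) (R, M) t (R(k := R 0), M')" "I (R 0) M'"
    unfolding R by auto
  have "exec (For k P) (R, M) (t + 1) (R, M')"
    unfolding For_def using exec.Then[OF t(2) exec.SetReg[of k "NNum 0"]] R by simp
  then show ?thesis
    unfolding wp_def using t(1,3) Q
    by (intro exI[of _ "t + 1"] exI[of _ M']) (auto simp: For_def algebra_simps)
qed

section \<open>Writing columns and matrices entry by entry\<close>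

definition Map1 :: "nat \<Rightarrow> nexp \<Rightarrow> cexp \<Rightarrow> prog" where
  "Map1 a c e = For 3 (SetCell a (NReg 3) c e)"

definition Map2 :: "nat \<Rightarrow> cexp \<Rightarrow> prog" where
  "Map2 a e = For 3 (For 4 (SetCell a (NReg 3) (NReg 4) e))"

definition put_col :: "nat \<Rightarrow> nat \<Rightarrow> nat \<Rightarrow> (nat \<Rightarrow> complex) \<Rightarrow> cells \<Rightarrow> cells" where
  "put_col n a c v M = M(a := \<lambda>i j. if i < n \<and> j = c then v i else M a i j)"

definition put_mat :: "nat \<Rightarrow> nat \<Rightarrow> (nat \<Rightarrow> nat \<Rightarrow> complex) \<Rightarrow> cells \<Rightarrow> cells" where
  "put_mat n a v M = M(a := \<lambda>i j. if i < n \<and> j < n then v i j else M a i j)"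

text \<open>While an array is being overwritten, an expression has to give its value in every store
  that agrees with the initial one off the cells written so far. In this way the map rules state
  that reading does not interfere with writing.\<close>

definition agree_but :: "(nat \<times> nat \<times> nat) set \<Rightarrow> cells \<Rightarrow> cells \<Rightarrow> bool" where
  "agree_but S M M' \<longleftrightarrow> (\<forall>a i j. (a, i, j) \<notin> S \<longrightarrow> M' a i j = M a i j)"

lemma wp_Map1:
  assumes "R 3 = 0" "k = nval R c" "\<And>i. nval (R(3 := i)) c = nval R c"
    and v: "\<And>i M'. i < R 0 \<Longrightarrow> agree_but {(a, j, k) |j. j < i} M M' \<Longrightarrow> cval (R(3 := i), M') e = v i"
    and Q: "Q (put_col (R 0) a k v M)"
  shows "wp R (Map1 a c e) Q M"
  unfolding Map1_def
proof (rule wp_For[where I = "\<lambda>l M'. M' = put_col l a k v M"])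
  fix i M' assume i: "i < R 0" and M': "M' = put_col i a k v M"
  show "wp (R(3 := i)) (SetCell a (NReg 3) c e) (\<lambda>M'. M' = put_col (Suc i) a k v M) M'"
  proof (rule wp_SetCell)
    have "cval (R(3 := i), M') e = v i"
      by (rule v[OF i]) (auto simp: M' agree_but_def put_col_def)
    then show "set_cell M' a (nval (R(3 := i)) (NReg 3)) (nval (R(3 := i)) c) (cval (R(3 := i), M') e)
       = put_col (Suc i) a k v M"
      using assms(2,3)
      by (auto simp: M' put_col_def fun_eq_iff less_Suc_eq)
  qed
qed (use assms in \<open>auto simp: put_col_def\<close>)

text \<open>The cell (i, j) is not among those written before round (i, j), so the expression may
  read the entry that it replaces. This permits matrices to be updated in place.\<close>

lemma wp_Map2:
  assumes "R 3 = 0" "R 4 = 0"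
    and v: "\<And>i j M'. i < R 0 \<Longrightarrow> j < R 0 \<Longrightarrow> agree_but {(a, k, l) |k l. k < i \<or> k = i \<and> l < j} M M' \<Longrightarrow>
              cval (R(3 := i, 4 := j), M') e = v i j"
    and Q: "Q (put_mat (R 0) a v M)"
  shows "wp R (Map2 a e) Q M"
  unfolding Map2_def
proof (rule wp_For[where I = "\<lambda>r M'. M' = M(a := \<lambda>i j. if i < r \<and> j < R 0 then v i j else M a i j)"])
  fix i M' assume i: "i < R 0" and M': "M' = M(a := \<lambda>k j. if k < i \<and> j < R 0 then v k j else M a k j)"
  show "wp (R(3 := i)) (For 4 (SetCell a (NReg 3) (NReg 4) e))
    (\<lambda>M'. M' = M(a := \<lambda>k j. if k < Suc i \<and> j < R 0 then v k j else M a k j)) M'"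
  proof (rule wp_For[where I = "\<lambda>r M'. M' = M(a := \<lambda>k j. if k < i \<and> j < R 0 \<or> k = i \<and> j < r then v k j else M a k j)"])
    fix j M'' assume j: "j < (R(3 := i)) 0"
      and M'': "M'' = M(a := \<lambda>k l. if k < i \<and> l < R 0 \<or> k = i \<and> l < j then v k l else M a k l)"
    show "wp (R(3 := i, 4 := j)) (SetCell a (NReg 3) (NReg 4) e) (\<lambda>M'. M' = M(a := \<lambda>k l. if k < i \<and> l < R 0 \<or> k = i \<and> l < Suc j then v k l else M a k l)) M''"
    proof (rule wp_SetCell)
      have "cval (R(3 := i, 4 := j), M'') e = v i j"
        using i j by (intro v) (auto simp: M'' agree_but_def)
      then show "set_cell M'' a (nval (R(3 := i, 4 := j)) (NReg 3)) (nval (R(3 := i, 4 := j)) (NReg 4))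
          (cval (R(3 := i, 4 := j), M'') e)
        = M(a := \<lambda>k l. if k < i \<and> l < R 0 \<or> k = i \<and> l < Suc j then v k l else M a k l)"
        by (auto simp: M'' fun_eq_iff less_Suc_eq)
    qed
  next
    show "M' = M(a := \<lambda>k j. if k < i \<and> j < R 0 \<or> k = i \<and> j < 0 then v k j else M a k j)"
      by (simp add: M')
  qed (use assms in \<open>auto simp: fun_eq_iff less_Suc_eq\<close>)
qed (use assms in \<open>auto simp: put_mat_def\<close>)

abbreviation Sc :: "nat \<Rightarrow> cexp" where "Sc t \<equiv> Cell 24 (NNum t) (NNum 0)"

definition put :: "nat \<Rightarrow> complex \<Rightarrow> cells \<Rightarrow> cells" where
  "put t z M = set_cell M 24 t 0 z"

abbreviation SetSc :: "nat \<Rightarrow> cexp \<Rightarrow> prog" where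
  "SetSc t e \<equiv> SetCell 24 (NNum t) (NNum 0) e"

lemma wp_SetSc: "Q (put t (cval (R, M) e) M) \<Longrightarrow> wp R (SetSc t e) Q M"
  by (rule wp_SetCell) (simp add: put_def)

definition Sum2 :: "nat \<Rightarrow> cexp \<Rightarrow> prog" where
  "Sum2 t e = Then (SetSc t (CNum 0)) (For 3 (For 4 (SetSc t (CAdd (Sc t) e))))"

lemma put_put [simp]: "put t z (put t w M) = put t z M"
  by (auto simp: put_def fun_eq_iff)

lemma put_at [simp]: "put t z M 24 t 0 = z"
  by (simp add: put_def)

text \<open>The premise on e ranges over all values w of the accumulator, which expresses that e
  does not read it.\<close>

lemma wp_Sum2:
  assumes "R 3 = 0" "R 4 = 0"
    and v: "\<And>i j w. i < R 0 \<Longrightarrow> j < R 0 \<Longrightarrow> cval (R(3 := i, 4 := j), put t w M) e = v i j"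
    and Q: "Q (put t (\<Sum>i<R 0. \<Sum>j<R 0. v i j) M)"
  shows "wp R (Sum2 t e) Q M"
  unfolding Sum2_def
proof (intro wp_Then wp_SetSc)
  let ?M = "put t (cval (R, M) (CNum 0)) M"
  show "wp R (For 3 (For 4 (SetSc t (CAdd (Sc t) e)))) Q ?M"
  proof (rule wp_For[where I = "\<lambda>r M'. M' = put t (\<Sum>i<r. \<Sum>j<R 0. v i j) M"])
    fix i M' assume i: "i < R 0" and M': "M' = put t (\<Sum>i<i. \<Sum>j<R 0. v i j) M"
    show "wp (R(3 := i)) (For 4 (SetSc t (CAdd (Sc t) e)))
            (\<lambda>M'. M' = put t (\<Sum>i<Suc i. \<Sum>j<R 0. v i j) M) M'"
    proof (rule wp_For[where I = "\<lambda>r M'. M' = put t ((\<Sum>i<i. \<Sum>j<R 0. v i j) + (\<Sum>j<r. v i j)) M"])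
      fix j M'' assume j: "j < (R(3 := i)) 0"
        and M'': "M'' = put t ((\<Sum>i<i. \<Sum>j<R 0. v i j) + (\<Sum>j<j. v i j)) M"
      show "wp (R(3 := i, 4 := j)) (SetSc t (CAdd (Sc t) e))
        (\<lambda>M'. M' = put t ((\<Sum>i<i. \<Sum>j<R 0. v i j) + (\<Sum>j<Suc j. v i j)) M) M''"
        using i j by (intro wp_SetSc) (simp add: M'' v add.assoc)
    qed (use assms M' in auto)
  qed (use assms in auto)
qed

text \<open>A vector reference \<open>(a, c)\<close> denotes column \<open>c\<close> of array \<open>a\<close>.\<close>

type_synonym vref = "nat \<times> nexp"

definition vecof :: "regs \<Rightarrow> cells \<Rightarrow> vref \<Rightarrow> nat \<Rightarrow> complex" where
  "vecof R M v i = M (fst v) i (nval R (snd v))"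

text \<open>The value x^H B y on index functions rather than on \<open>mat\<close> and
  \<open>vec\<close>, so that an array of the store is itself a matrix. Values at indices \<ge> n
  have no influence, hence the congruence rules.\<close>

definition sform :: "nat \<Rightarrow> (nat \<Rightarrow> nat \<Rightarrow> complex) \<Rightarrow> (nat \<Rightarrow> complex) \<Rightarrow> (nat \<Rightarrow> complex) \<Rightarrow> complex" where
  "sform n B x y = (\<Sum>i<n. \<Sum>j<n. cnj (x i) * B i j * y j)"

definition Form :: "nat \<Rightarrow> nat \<Rightarrow> vref \<Rightarrow> vref \<Rightarrow> prog" where
  "Form t b u v = Sum2 t (CMul (CMul (Conj (Cell (fst u) (NReg 3) (snd u))) (Cell b (NReg 3) (NReg 4)))
                     (Cell (fst v) (NReg 4) (snd v)))"

lemma put_other: "a \<noteq> 24 \<Longrightarrow> put t w M a = M a"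
  by (auto simp: put_def)

lemma wp_Form:
  assumes "R 3 = 0" "R 4 = 0" "b \<noteq> 24" "fst u \<noteq> 24" "fst v \<noteq> 24"
    and "\<And>i j. nval (R(3 := i, 4 := j)) (snd u) = nval R (snd u)"
    and "\<And>i j. nval (R(3 := i, 4 := j)) (snd v) = nval R (snd v)"
    and Q: "Q (put t (sform (R 0) (M b) (vecof R M u) (vecof R M v)) M)"
  shows "wp R (Form t b u v) Q M"
  unfolding Form_def using assms
  by (intro wp_Sum2[where v = "\<lambda>i j. cnj (vecof R M u i) * M b i j * vecof R M v j"])
     (auto simp: put_other vecof_def sform_def)

section \<open>Hermitian forms\<close>

definition hermitian_fun :: "nat \<Rightarrow> (nat \<Rightarrow> nat \<Rightarrow> complex) \<Rightarrow> bool" where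
  "hermitian_fun n B \<longleftrightarrow> (\<forall>i<n. \<forall>j<n. B j i = cnj (B i j))"

lemma sform_add_left: "sform n B (\<lambda>i. x i + y i) z = sform n B x z + sform n B y z"
  by (simp add: sform_def algebra_simps sum.distrib)

lemma sform_add_right: "sform n B z (\<lambda>i. x i + y i) = sform n B z x + sform n B z y"
  by (simp add: sform_def algebra_simps sum.distrib)

lemma sform_diff_left: "sform n B (\<lambda>i. x i - y i) z = sform n B x z - sform n B y z"
  by (simp add: sform_def algebra_simps sum_subtractf)

lemma sform_diff_right: "sform n B z (\<lambda>i. x i - y i) = sform n B z x - sform n B z y"
  by (simp add: sform_def algebra_simps sum_subtractf)

lemma sform_scale_left: "sform n B (\<lambda>i. a * x i) y = cnj a * sform n B x y"
  by (simp add: sform_def sum_distrib_left algebra_simps)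

lemma sform_scale_right: "sform n B x (\<lambda>i. a * y i) = a * sform n B x y"
  by (simp add: sform_def sum_distrib_left algebra_simps)

lemmas sform_linear = sform_add_left sform_add_right sform_diff_left sform_diff_right
  sform_scale_left sform_scale_right

lemma sform_zero [simp]: "sform n B (\<lambda>i. 0) y = 0" "sform n B x (\<lambda>i. 0) = 0"
  by (simp_all add: sform_def)

lemma sform_cong:
  "(\<And>i j. i < n \<Longrightarrow> j < n \<Longrightarrow> B i j = C i j) \<Longrightarrow> (\<And>i. i < n \<Longrightarrow> x i = x' i) \<Longrightarrow>
   (\<And>i. i < n \<Longrightarrow> y i = y' i) \<Longrightarrow> sform n B x y = sform n C x' y'"
  by (simp add: sform_def)

lemma sform_mat_comb:
  "sform n (\<lambda>i j. A i j - k * B i j) x y = sform n A x y - k * sform n B x y"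
  "sform n (\<lambda>i j. A i j + k * B i j) x y = sform n A x y + k * sform n B x y"
  by (simp_all add: sform_def sum_distrib_left sum_subtractf sum.distrib algebra_simps)

lemma sform_herm:
  assumes "hermitian_fun n B"
  shows "sform n B y x = cnj (sform n B x y)"
proof -
  have "cnj (sform n B x y) = (\<Sum>i<n. \<Sum>j<n. cnj (y j) * cnj (B i j) * x i)"
    by (simp add: sform_def algebra_simps)
  also have "\<dots> = (\<Sum>i<n. \<Sum>j<n. cnj (y j) * B j i * x i)"
    using assms unfolding hermitian_fun_def by (intro sum.cong refl) (metis complex_cnj_cnj lessThan_iff)
  also have "\<dots> = sform n B y x"
    unfolding sform_def by (rule sum.swap)
  finally show ?thesis by simp
qed

definition qform :: "nat \<Rightarrow> (nat \<Rightarrow> nat \<Rightarrow> complex) \<Rightarrow> (nat \<Rightarrow> complex) \<Rightarrow> real" where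
  "qform n B x = Re (sform n B x x)"

lemma sform_self: "hermitian_fun n B \<Longrightarrow> sform n B x x = complex_of_real (qform n B x)"
  using sform_herm[of n B x x] by (simp add: qform_def complex_eq_iff)

lemma cmod_mult_self: "cmod z * cmod z = Re z * Re z + Im z * Im z"
  using cmod_power2[of z] by (simp add: power2_eq_square)

lemma qform_comb2:
  assumes "hermitian_fun n B"
  shows "qform n B (\<lambda>i. a * x i + b * y i)
    = (cmod a)\<^sup>2 * qform n B x + (cmod b)\<^sup>2 * qform n B y + 2 * Re (cnj a * b * sform n B x y)"
proof -
  have "sform n B (\<lambda>i. a * x i + b * y i) (\<lambda>i. a * x i + b * y i)
    = a * cnj a * qform n B x + b * cnj b * qform n B y
      + (cnj a * b * sform n B x y + cnj (cnj a * b * sform n B x y))"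
    by (simp add: sform_linear sform_self[OF assms] sform_herm[OF assms, of y x] algebra_simps)
  then show ?thesis
    unfolding qform_def complex_add_cnj by (simp flip: complex_norm_square qform_def)
qed

lemma qform_comb3:
  fixes a b c :: real and x y z :: "nat \<Rightarrow> complex"
  assumes "hermitian_fun n B"
  shows "qform n B (\<lambda>i. a * x i + b * y i + c * z i)
    = a\<^sup>2 * qform n B x + b\<^sup>2 * qform n B y + c\<^sup>2 * qform n B z + 2 * a * b * Re (sform n B x y)
      + 2 * a * c * Re (sform n B x z) + 2 * b * c * Re (sform n B y z)"
proof -
  have "sform n B (\<lambda>i. a * x i + b * y i + c * z i) (\<lambda>i. a * x i + b * y i + c * z i)
    = a\<^sup>2 * qform n B x + b\<^sup>2 * qform n B y + c\<^sup>2 * qform n B z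
      + a * b * (sform n B x y + cnj (sform n B x y)) + a * c * (sform n B x z + cnj (sform n B x z))
      + b * c * (sform n B y z + cnj (sform n B y z))"
    by (simp add: sform_linear sform_self[OF assms] sform_herm[OF assms, of y x]
        sform_herm[OF assms, of z x] sform_herm[OF assms, of z y] algebra_simps power2_eq_square)
  then show ?thesis
    unfolding qform_def complex_add_cnj by (simp flip: qform_def)
qed

lemma qform_scale: "hermitian_fun n B \<Longrightarrow> qform n B (\<lambda>i. a * x i) = (cmod a)\<^sup>2 * qform n B x"
  using qform_comb2[of n B a x 0 x] by simp

lemma qform_zero [simp]: "qform n B (\<lambda>i. 0) = 0"
  by (simp add: qform_def)

lemma qform_cong: "(\<And>i. i < n \<Longrightarrow> x i = x' i) \<Longrightarrow> qform n B x = qform n B x'"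
  unfolding qform_def by (simp cong: sform_cong)

lemma hermitian_fun_comb:
  "hermitian_fun n A \<Longrightarrow> hermitian_fun n B \<Longrightarrow> hermitian_fun n (\<lambda>i j. A i j - complex_of_real k * B i j)"
  "hermitian_fun n A \<Longrightarrow> hermitian_fun n B \<Longrightarrow> hermitian_fun n (\<lambda>i j. A i j + complex_of_real k * B i j)"
  unfolding hermitian_fun_def
  by (metis complex_cnj_diff complex_cnj_mult complex_cnj_complex_of_real,
      metis complex_cnj_add complex_cnj_mult complex_cnj_complex_of_real)

text \<open>The identity as a form makes inner products and norms computable by the same program as
  all other forms; \<open>qform n idm x = 0\<close> is how vanishing of x below n is expressed
  throughout.\<close>

definition idm :: "nat \<Rightarrow> nat \<Rightarrow> complex" where
  "idm i j = (if i = j then 1 else 0)"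

lemma hermitian_idm [simp]: "hermitian_fun n idm"
  by (simp add: hermitian_fun_def idm_def)

lemma sform_idm: "sform n idm x y = (\<Sum>i<n. cnj (x i) * y i)"
proof -
  have "cnj (x i) * idm i j * y j = (if j = i then cnj (x i) * y i else 0)" for i j
    by (simp add: idm_def)
  then show ?thesis by (simp add: sform_def)
qed

lemma qform_idm: "qform n idm x = (\<Sum>i<n. (cmod (x i))\<^sup>2)"
  by (simp add: qform_def sform_idm cmod_power2 flip: power2_eq_square)

lemma qform_idm_zero_iff: "qform n idm x = 0 \<longleftrightarrow> (\<forall>i<n. x i = 0)"
  unfolding qform_idm by (subst sum_nonneg_eq_0_iff) auto

lemma qform_idm_nonneg: "qform n idm x \<ge> 0"
  unfolding qform_idm by (rule sum_nonneg) simp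

section \<open>Base fields\<close>

locale base_field =
  fixes F :: "complex set"
  assumes F: "F = \<real> \<or> F = UNIV"
begin

lemma F_arith [simp, intro]:
  "0 \<in> F" "1 \<in> F" "complex_of_real r \<in> F" "of_int k \<in> F"
  "a \<in> F \<Longrightarrow> b \<in> F \<Longrightarrow> a + b \<in> F" "a \<in> F \<Longrightarrow> b \<in> F \<Longrightarrow> a - b \<in> F"
  "a \<in> F \<Longrightarrow> b \<in> F \<Longrightarrow> a * b \<in> F" "a \<in> F \<Longrightarrow> b \<in> F \<Longrightarrow> a / b \<in> F"
  "a \<in> F \<Longrightarrow> - a \<in> F" "a \<in> F \<Longrightarrow> cnj a \<in> F"
  using F by (auto simp: Reals_cnj_iff)

lemma F_sum [intro]: "(\<And>i. i \<in> S \<Longrightarrow> f i \<in> F) \<Longrightarrow> sum f S \<in> F"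
  by (induction S rule: infinite_finite_induct) auto

definition vecF :: "nat \<Rightarrow> (nat \<Rightarrow> complex) \<Rightarrow> bool" where
  "vecF n x \<longleftrightarrow> (\<forall>i<n. x i \<in> F)"

definition matF :: "nat \<Rightarrow> (nat \<Rightarrow> nat \<Rightarrow> complex) \<Rightarrow> bool" where
  "matF n B \<longleftrightarrow> (\<forall>i<n. \<forall>j<n. B i j \<in> F)"

lemma sform_F: "matF n B \<Longrightarrow> vecF n x \<Longrightarrow> vecF n y \<Longrightarrow> sform n B x y \<in> F"
  unfolding sform_def matF_def vecF_def by (intro F_sum) auto

lemma vecF_comb:
  "vecF n x \<Longrightarrow> vecF n y \<Longrightarrow> a \<in> F \<Longrightarrow> b \<in> F \<Longrightarrow> vecF n (\<lambda>i. a * x i + b * y i)"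
  "vecF n x \<Longrightarrow> vecF n y \<Longrightarrow> vecF n z \<Longrightarrow> a \<in> F \<Longrightarrow> b \<in> F \<Longrightarrow> c \<in> F \<Longrightarrow>
     vecF n (\<lambda>i. a * x i + b * y i + c * z i)"
  "vecF n x \<Longrightarrow> vecF n y \<Longrightarrow> a \<in> F \<Longrightarrow> vecF n (\<lambda>i. x i - a * y i)"
  "vecF n x \<Longrightarrow> a \<in> F \<Longrightarrow> vecF n (\<lambda>i. a * x i)"
  by (auto simp: vecF_def)

definition psd_fun :: "nat \<Rightarrow> (nat \<Rightarrow> nat \<Rightarrow> complex) \<Rightarrow> bool" where
  "psd_fun n B \<longleftrightarrow> hermitian_fun n B \<and> matF n B \<and> (\<forall>x. vecF n x \<longrightarrow> qform n B x \<ge> 0)"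

text \<open>Otherwise \<open>x - k s a\<close> with large real k makes the form negative: as the
  form vanishes at a, the value is affine in k. The chosen k makes it exactly -1.\<close>

lemma psd_zero:
  assumes B: "psd_fun n B" and a: "vecF n a" "qform n B a = 0" and x: "vecF n x"
  shows "sform n B a x = 0"
proof (rule ccontr)
  assume n0: "sform n B a x \<noteq> 0"
  define s where "s = sform n B a x"
  define k where "k = (qform n B x + 1) / (2 * (cmod s)\<^sup>2)"
  have h: "hermitian_fun n B" and s: "s \<in> F"
    using B a x by (auto simp: psd_fun_def s_def intro: sform_F)
  have "vecF n (\<lambda>i. (- (complex_of_real k * s)) * a i + 1 * x i)"
    using a x s by (intro vecF_comb) auto
  then have "0 \<le> qform n B (\<lambda>i. (- (complex_of_real k * s)) * a i + 1 * x i)"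
    using B unfolding psd_fun_def by blast
  also have "\<dots> = qform n B x - 2 * k * (cmod s)\<^sup>2"
    unfolding qform_comb2[OF h] a(2)
    by (simp add: s_def[symmetric] power2_eq_square cmod_mult_self algebra_simps)
  also have "\<dots> = -1"
    using n0 by (simp add: k_def s_def field_simps)
  finally show False by simp
qed

text \<open>Nonnegativity at x minus its projection on a with respect to the form; where the form
  vanishes at a there is no projection, and \<open>psd_zero\<close> takes over.\<close>

lemma psd_cauchy_schwarz:
  assumes B: "psd_fun n B" and a: "vecF n a" and x: "vecF n x"
  shows "(cmod (sform n B a x))\<^sup>2 \<le> qform n B a * qform n B x"
proof (cases "qform n B a = 0")
  case True
  then show ?thesis using psd_zero[OF B a _ x] by simp
next
  case False
  define s where "s = sform n B a x"
  have h: "hermitian_fun n B" and s: "s \<in> F" and pos: "qform n B a > 0"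
    using B a x False by (auto simp: psd_fun_def s_def less_le intro: sform_F)
  have "vecF n (\<lambda>i. (- (s / complex_of_real (qform n B a))) * a i + 1 * x i)"
    using a x s by (intro vecF_comb) auto
  then have "0 \<le> qform n B (\<lambda>i. (- (s / complex_of_real (qform n B a))) * a i + 1 * x i)"
    using B unfolding psd_fun_def by blast
  also have "\<dots> = qform n B x - (cmod s)\<^sup>2 / qform n B a"
    unfolding qform_comb2[OF h]
    using pos by (simp add: s_def[symmetric] norm_divide power2_eq_square cmod_mult_self field_simps)
  finally show ?thesis using pos by (simp add: s_def field_simps)
qed

end

section \<open>Real roots\<close>

lemma least_real_root_is_root:
  assumes "p \<noteq> 0" "poly p x = 0"
  shows "poly p (least_real_root p) = 0"
proof -
  have "Min {x. poly p x = 0} \<in> {x. poly p x = 0}"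
    using assms poly_roots_finite[of p] by (intro Min_in) auto
  then show ?thesis using assms by (auto simp: least_real_root_def)
qed

lemma poly_root_opposite:
  fixes a b :: real
  assumes "poly p a < 0" "poly p b > 0"
  shows "\<exists>x. poly p x = 0"
proof (cases "a < b")
  case True
  then show ?thesis using poly_IVT_pos[OF True assms] by blast
next
  case False
  then have "b < a" using assms by (cases "a = b") auto
  then show ?thesis using poly_IVT_neg[OF _ assms(2,1)] by blast
qed

text \<open>The polynomial is negative at 0 and positive far to the right, so a root is found
  without looking at the parity of the degree.\<close>

lemma poly_root_even:
  fixes p :: "real poly"
  assumes "coeff p 0 < 0" "lead_coeff p > 0"
  shows "\<exists>x. poly p x = 0"
proof -
  obtain N where "\<forall>x\<ge>N. poly p x \<ge> lead_coeff p"
    using poly_pinfty_gt_lc[OF assms(2)] by blast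
  then have "poly p N > 0" using assms(2) by force
  moreover have "poly p 0 < 0" using assms(1) by (simp add: poly_0_coeff_0)
  ultimately show ?thesis by (rule poly_root_opposite[rotated])
qed

lemma root_quadratic:
  fixes c0 c1 c2 :: real
  assumes "c0 * c2 < (0::real)"
  defines "t \<equiv> least_real_root (Poly [c0, c1, c2])"
  shows "c0 + c1 * t + c2 * t\<^sup>2 = 0"
proof -
  have ne: "c2 \<noteq> 0" using assms by auto
  then have "Poly [c0, c1, c2] \<noteq> 0" by auto
  moreover have "\<exists>x. poly (Poly [c0, c1, c2]) x = 0"
  proof (cases "c2 > 0")
    case True
    then show ?thesis using assms by (intro poly_root_even) (auto simp: mult_less_0_iff)
  next
    case False
    then have "\<exists>x. poly (Poly [- c0, - c1, - c2]) x = 0"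
      using assms ne by (intro poly_root_even) (auto simp: mult_less_0_iff)
    then obtain x where "poly (Poly [- c0, - c1, - c2]) x = 0" ..
    then show ?thesis by (intro exI[of _ x]) (simp add: algebra_simps)
  qed
  ultimately have "poly (Poly [c0, c1, c2]) t = 0"
    unfolding t_def using least_real_root_is_root by blast
  then show ?thesis by (simp add: power2_eq_square algebra_simps)
qed

lemma root_sqrt:
  assumes "s \<ge> (0::real)"
  shows "(least_real_root (Poly [- s, 0, 1]))\<^sup>2 = s"
proof -
  have "poly (Poly [- s, 0, 1]) (sqrt s) = 0" using assms by (simp add: power2_eq_square)
  moreover have "Poly [- s, 0, 1] \<noteq> 0" by auto
  ultimately have "poly (Poly [- s, 0, 1]) (least_real_root (Poly [- s, 0, 1])) = 0"
    using least_real_root_is_root by blast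
  then show ?thesis by (simp add: power2_eq_square algebra_simps)
qed

lemma root_quartic:
  fixes c0 c1 c2 c3 c4 :: real
  assumes "c0 < (0::real)" "c4 > 0"
  defines "t \<equiv> least_real_root (Poly [c0, c1, c2, c3, c4])"
  shows "c0 + c1 * t + c2 * t\<^sup>2 + c3 * t^3 + c4 * t^4 = 0" "t \<noteq> 0"
proof -
  have "Poly [c0, c1, c2, c3, c4] \<noteq> 0" using assms by auto
  moreover have "\<exists>x. poly (Poly [c0, c1, c2, c3, c4]) x = 0"
    using assms by (intro poly_root_even) auto
  ultimately have *: "poly (Poly [c0, c1, c2, c3, c4]) t = 0"
    unfolding t_def using least_real_root_is_root by blast
  then show "c0 + c1 * t + c2 * t\<^sup>2 + c3 * t^3 + c4 * t^4 = 0"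
    by (simp add: eval_nat_numeral algebra_simps)
  show "t \<noteq> 0" using * assms(1) by auto
qed

text \<open>Substituting -x and negating the polynomial reduce all sign combinations to the growth
  at plus infinity for a positive leading coefficient.\<close>

lemma root_cubic:
  fixes c0 c1 c2 c3 :: real
  assumes "c3 \<noteq> (0::real)"
  defines "t \<equiv> least_real_root (Poly [c0, c1, c2, c3])"
  shows "c0 + c1 * t + c2 * t\<^sup>2 + c3 * t^3 = 0"
proof -
  have ev: "\<exists>x. poly (Poly [c0, c1, c2, c3]) x > 0" if "c3 > 0" for c0 c1 c2 c3 :: real
  proof -
    have lc: "lead_coeff (Poly [c0, c1, c2, c3]) = c3" using that by simp
    have "0 < lead_coeff (Poly [c0, c1, c2, c3])" unfolding lc by (rule that)
    from poly_pinfty_gt_lc[OF this] obtain N where "\<forall>x\<ge>N. poly (Poly [c0, c1, c2, c3]) x \<ge> c3"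
      unfolding lc by blast
    then show ?thesis using that by (intro exI[of _ N]) force
  qed
  have "\<exists>x. poly (Poly [c0, c1, c2, c3]) x > 0"
  proof (cases "c3 > 0")
    case False
    then obtain x where "poly (Poly [c0, - c1, c2, - c3]) x > 0" using ev[of "- c3" c0 "- c1" c2] assms by force
    then show ?thesis by (intro exI[of _ "- x"]) (simp add: algebra_simps)
  qed (use ev in blast)
  moreover have "\<exists>x. poly (Poly [c0, c1, c2, c3]) x < 0"
  proof (cases "c3 > 0")
    case True
    then obtain x where "poly (Poly [- c0, c1, - c2, c3]) x > 0" using ev[of "c3" "- c0" c1 "- c2"] by force
    then show ?thesis by (intro exI[of _ "- x"]) (simp add: algebra_simps)
  next
    case False
    then obtain x where "poly (Poly [- c0, - c1, - c2, - c3]) x > 0" using ev[of "- c3" "- c0" "- c1" "- c2"] assms by force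
    then show ?thesis by (intro exI[of _ "x"]) (simp add: algebra_simps)
  qed
  ultimately have "\<exists>x. poly (Poly [c0, c1, c2, c3]) x = 0"
    using poly_root_opposite by blast
  moreover have "Poly [c0, c1, c2, c3] \<noteq> 0" using assms by auto
  ultimately have "poly (Poly [c0, c1, c2, c3]) t = 0"
    unfolding t_def using least_real_root_is_root by blast
  then show ?thesis by (simp add: eval_nat_numeral algebra_simps)
qed

section \<open>Deflation and rank-one decompositions\<close>

definition mv :: "nat \<Rightarrow> (nat \<Rightarrow> nat \<Rightarrow> complex) \<Rightarrow> (nat \<Rightarrow> complex) \<Rightarrow> nat \<Rightarrow> complex" where
  "mv n S a i = (\<Sum>k<n. S i k * a k)"

definition unitf :: "nat \<Rightarrow> nat \<Rightarrow> complex" where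
  "unitf k i = (if i = k then 1 else 0)"

text \<open>Wedderburn's rank reduction, the elimination step of a Cholesky factorisation:
  \<open>S - (S a) (S a)^H / (a^H S a)\<close>. A semidefinite S stays semidefinite and its kernel
  gains a. The same step yields rank-one decompositions and orthogonal projections.\<close>

definition defl :: "nat \<Rightarrow> (nat \<Rightarrow> complex) \<Rightarrow> (nat \<Rightarrow> nat \<Rightarrow> complex) \<Rightarrow> nat \<Rightarrow> nat \<Rightarrow> complex" where
  "defl n a S i j = S i j - mv n S a i * cnj (mv n S a j) / complex_of_real (qform n S a)"

lemma sform_mv: "sform n S b a = (\<Sum>i<n. cnj (b i) * mv n S a i)"
  by (simp add: sform_def mv_def sum_distrib_left mult.assoc)

lemma sform_unitf: "i < n \<Longrightarrow> sform n S (unitf i) a = mv n S a i"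
proof -
  assume i: "i < n"
  have "cnj (unitf i j) * mv n S a j = (if j = i then mv n S a i else 0)" for j
    by (simp add: unitf_def)
  then show ?thesis using i by (simp add: sform_mv)
qed

lemma mv_unitf: "k < n \<Longrightarrow> mv n S (unitf k) i = S i k"
proof -
  assume k: "k < n"
  have "S i j * unitf k j = (if j = k then S i k else 0)" for j
    by (simp add: unitf_def)
  then show ?thesis using k by (simp add: mv_def)
qed

lemma sform_rank_one: "sform n (\<lambda>i j. u i * cnj (v j)) x y = (\<Sum>i<n. cnj (x i) * u i) * (\<Sum>j<n. cnj (v j) * y j)"
  by (simp add: sform_def sum_product mult.assoc)

lemma sform_outer: "qform n (\<lambda>i j. u i * cnj (u j)) x = (cmod (\<Sum>i<n. cnj (u i) * x i))\<^sup>2"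
proof -
  define s where "s = (\<Sum>i<n. cnj (u i) * x i)"
  have "(\<Sum>i<n. cnj (x i) * u i) = cnj s"
    by (simp add: s_def mult.commute)
  then have "sform n (\<lambda>i j. u i * cnj (u j)) x x = complex_of_real ((cmod s)\<^sup>2)"
    unfolding sform_rank_one complex_norm_square by (simp add: s_def)
  then show ?thesis by (simp add: qform_def s_def)
qed

lemma sform_defl:
  assumes "hermitian_fun n S"
  shows "sform n (defl n a S) x y = sform n S x y - sform n S x a * sform n S a y / complex_of_real (qform n S a)"
proof -
  have "defl n a S = (\<lambda>i j. S i j - (1 / complex_of_real (qform n S a)) * (mv n S a i * cnj (mv n S a j)))"
    by (simp add: defl_def fun_eq_iff)
  then have "sform n (defl n a S) x y = sform n S x y - (1 / complex_of_real (qform n S a))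
      * (sform n S x a * (\<Sum>j<n. cnj (mv n S a j) * y j))"
    by (simp only: sform_mat_comb sform_rank_one flip: sform_mv)
  also have "(\<Sum>j<n. cnj (mv n S a j) * y j) = cnj (sform n S y a)"
    by (simp add: sform_mv mult.commute)
  also have "\<dots> = sform n S a y"
    using sform_herm[OF assms, of y a] by simp
  finally show ?thesis by simp
qed

lemma hermitian_defl: "hermitian_fun n S \<Longrightarrow> hermitian_fun n (defl n a S)"
  unfolding hermitian_fun_def
proof (intro allI impI)
  fix i j assume S: "\<forall>i<n. \<forall>j<n. S j i = cnj (S i j)" and ij: "i < n" "j < n"
  then have "S j i = cnj (S i j)" by blast
  then show "defl n a S j i = cnj (defl n a S i j)" by (simp add: defl_def mult.commute)
qed

text \<open>The entries of a matrix-vector product are the values of the form against unit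
  vectors.\<close>

lemma mv_defl:
  assumes "hermitian_fun n S" "i < n"
  shows "mv n (defl n a S) b i = mv n S b i - mv n S a i * sform n S a b / complex_of_real (qform n S a)"
  using sform_defl[OF assms(1), of a "unitf i" b] by (simp add: sform_unitf assms)

context base_field begin

lemma vecF_unitf: "vecF n (unitf k)"
  by (simp add: vecF_def unitf_def)

lemma vecF_mv: "matF n S \<Longrightarrow> vecF n a \<Longrightarrow> vecF n (mv n S a)"
  unfolding vecF_def matF_def mv_def by (auto intro!: F_sum)

lemma psd_mv_zero:
  assumes "psd_fun n S" "vecF n a" "qform n S a = 0" "i < n"
  shows "mv n S a i = 0"
proof -
  have "sform n S a (unitf i) = 0"
    by (rule psd_zero) (use assms vecF_unitf in auto)
  then show ?thesis
    using sform_herm[of n S a "unitf i"] assms by (simp add: sform_unitf psd_fun_def)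
qed

text \<open>Nonnegativity of the deflated form at x is the Cauchy-Schwarz inequality for a and
  x.\<close>

lemma psd_defl:
  assumes S: "psd_fun n S" and a: "vecF n a"
  shows "psd_fun n (defl n a S)"
  unfolding psd_fun_def
proof (intro conjI allI impI)
  have h: "hermitian_fun n S" and m: "matF n S" using S by (auto simp: psd_fun_def)
  show "hermitian_fun n (defl n a S)" by (rule hermitian_defl[OF h])
  show "matF n (defl n a S)"
    using vecF_mv[OF m a] m unfolding matF_def defl_def vecF_def by auto
  fix x assume x: "vecF n x"
  have "sform n S x a * sform n S a x = complex_of_real ((cmod (sform n S a x))\<^sup>2)"
    unfolding sform_herm[OF h, of x a] complex_norm_square by simp
  then have "qform n (defl n a S) x = qform n S x - (cmod (sform n S a x))\<^sup>2 / qform n S a"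
    unfolding qform_def sform_defl[OF h] by (simp flip: of_real_divide)
  also have "\<dots> \<ge> 0"
  proof (cases "qform n S a = 0")
    case False
    then have "qform n S a > 0" using S a by (auto simp: psd_fun_def less_le)
    then show ?thesis using psd_cauchy_schwarz[OF S a x] by (simp add: field_simps)
  qed (use S x in \<open>simp add: psd_fun_def\<close>)
  finally show "0 \<le> qform n (defl n a S) x" .
qed

text \<open>For \<open>a^H S a = 0\<close> the quotient is 0 and S is not changed, but then S a
  vanishes already.\<close>

lemma mv_defl_self:
  assumes S: "psd_fun n S" and a: "vecF n a" and i: "i < n"
  shows "mv n (defl n a S) a i = 0"
proof -
  have h: "hermitian_fun n S" using S by (auto simp: psd_fun_def)
  show ?thesis
    unfolding mv_defl[OF h i] sform_self[OF h]
    using psd_mv_zero[OF S a _ i] by simp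
qed

lemma mv_defl_kernel:
  assumes S: "psd_fun n S" and i: "i < n" and b: "\<And>i. i < n \<Longrightarrow> mv n S b i = 0"
  shows "mv n (defl n a S) b i = 0"
proof -
  have h: "hermitian_fun n S" using S by (auto simp: psd_fun_def)
  have "sform n S a b = 0" using b by (simp add: sform_mv)
  then show ?thesis unfolding mv_defl[OF h i] using b i by simp
qed

text \<open>Prepares the computation of projections: deflating the identity leaves those vectors
  fixed that are orthogonal to all directions used.\<close>

lemma mv_defl_fixed:
  assumes S: "psd_fun n S" and i: "i < n" and b: "\<And>i. i < n \<Longrightarrow> mv n S b i = b i"
    and orth: "(\<Sum>i<n. cnj (a i) * b i) = 0"
  shows "mv n (defl n a S) b i = b i"
proof -
  have h: "hermitian_fun n S" using S by (auto simp: psd_fun_def)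
  have "sform n S a b = (\<Sum>i<n. cnj (a i) * b i)" using b by (simp add: sform_mv)
  then show ?thesis unfolding mv_defl[OF h i] using b i orth by simp
qed

text \<open>Cholesky factorisation by deflating at the unit vectors in turn. After k steps the first
  k columns of the remainder S vanish, so nothing remains after n steps. No pivoting is involved: a
  zero pivot of a semidefinite matrix comes with a zero column.\<close>

lemma psd_decomposition:
  assumes X: "psd_fun n X"
  shows "\<exists>x. (\<forall>k. vecF n (x k)) \<and> (\<forall>i<n. \<forall>j<n. X i j = (\<Sum>k<n. x k i * cnj (x k j)))"
proof -
  have "\<exists>x S. (\<forall>k. vecF n (x k)) \<and> psd_fun n S \<and> (\<forall>l<k. \<forall>i<n. S i l = 0)
      \<and> (\<forall>i<n. \<forall>j<n. X i j = S i j + (\<Sum>l<k. x l i * cnj (x l j)))" if "k \<le> n" for k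
    using that
  proof (induction k)
    case 0
    have "vecF n (\<lambda>i. 0)" by (simp add: vecF_def)
    then show ?case using X by - (rule exI[of _ "\<lambda>k i. 0"], rule exI[of _ X], auto)
  next
    case (Suc k)
    then obtain x S where IH: "\<And>k. vecF n (x k)" "psd_fun n S" "\<forall>l<k. \<forall>i<n. S i l = 0"
      "\<forall>i<n. \<forall>j<n. X i j = S i j + (\<Sum>l<k. x l i * cnj (x l j))" and k: "k < n" by auto
    let ?u = "unitf k" and ?S = "defl n (unitf k) S"
    let ?q = "qform n S ?u"
    define w where "w i = mv n S ?u i / complex_of_real (sqrt ?q)" for i
    have q: "?q \<ge> 0" using IH(2) vecF_unitf by (simp add: psd_fun_def)
    have w: "vecF n w"
      using vecF_mv[OF _ vecF_unitf, of n S k] IH(2) by (auto simp: vecF_def w_def psd_fun_def)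
    have kernel: "mv n ?S (unitf l) i = 0" if "l < Suc k" "i < n" for l i
    proof (cases "l = k")
      case True
      then show ?thesis using mv_defl_self[OF IH(2) vecF_unitf that(2)] by simp
    next
      case False
      then show ?thesis
        using that k IH(3) by (intro mv_defl_kernel[OF IH(2)]) (auto simp: mv_unitf)
    qed
    have "complex_of_real (sqrt ?q) * complex_of_real (sqrt ?q) = complex_of_real ?q"
      using q by (simp flip: of_real_mult)
    \<comment> \<open>For \<open>?q = 0\<close> the quotients in \<open>defl\<close> and in
      \<open>w\<close> are both 0, so the identity holds in that case too.\<close>
    then have ww: "S i j = ?S i j + w i * cnj (w j)" for i j
      by (simp add: defl_def w_def)
    show ?case
    proof (rule exI[of _ "x(k := w)"], rule exI[of _ ?S], intro conjI allI impI)
      fix l i assume "l < Suc k" "i < n"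
      then show "?S i l = 0" using kernel[of l i] k by (simp add: mv_unitf)
    next
      fix i j assume "i < n" "j < n"
      then show "X i j = ?S i j + (\<Sum>l<Suc k. (x(k := w)) l i * cnj ((x(k := w)) l j))"
        using IH(4) ww[of i j] by simp
    qed (use IH(1) w psd_defl[OF IH(2) vecF_unitf] in auto)
  qed
  from this[OF order_refl] obtain x S where *: "\<forall>k. vecF n (x k)" "\<forall>l<n. \<forall>i<n. S i l = 0"
      "\<forall>i<n. \<forall>j<n. X i j = S i j + (\<Sum>l<n. x l i * cnj (x l j))" by blast
  then show ?thesis by (intro exI[of _ x]) auto
qed

end

section \<open>Inner products of semidefinite matrices\<close>

definition minner :: "nat \<Rightarrow> (nat \<Rightarrow> nat \<Rightarrow> complex) \<Rightarrow> (nat \<Rightarrow> nat \<Rightarrow> complex) \<Rightarrow> real" where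
  "minner n A X = Re (\<Sum>i<n. \<Sum>j<n. cnj (X i j) * A i j)"

lemma minner_comb:
  "minner n (\<lambda>i j. A i j + complex_of_real k * B i j) X = minner n A X + k * minner n B X"
  by (simp add: minner_def algebra_simps sum.distrib sum_distrib_left)

lemma minner_sum: "minner n (\<lambda>i j. \<Sum>k\<in>K. complex_of_real (u k) * B k i j) X = (\<Sum>k\<in>K. u k * minner n (B k) X)"
proof (induction K rule: infinite_finite_induct)
  case (insert k K)
  then show ?case
    using minner_comb[of n "\<lambda>i j. \<Sum>k\<in>K. complex_of_real (u k) * B k i j" "u k" "B k" X]
    by (simp add: add.commute)
qed (simp_all add: minner_def)

lemma qform_sum: "qform n (\<lambda>i j. \<Sum>k\<in>K. complex_of_real (u k) * B k i j) x = (\<Sum>k\<in>K. u k * qform n (B k) x)"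
proof (induction K rule: infinite_finite_induct)
  case (insert k K)
  then show ?case
    using sform_mat_comb(2)[of n "\<lambda>i j. \<Sum>k\<in>K. complex_of_real (u k) * B k i j" "complex_of_real (u k)" "B k" x x]
    by (simp add: add.commute qform_def)
qed (simp_all add: qform_def sform_def)

lemma minner_decomp:
  assumes "\<And>i j. i < n \<Longrightarrow> j < n \<Longrightarrow> X i j = (\<Sum>k\<in>K. x k i * cnj (x k j))"
  shows "minner n A X = (\<Sum>k\<in>K. qform n A (x k))"
proof -
  have "(\<Sum>i<n. \<Sum>j<n. cnj (X i j) * A i j) = (\<Sum>i<n. \<Sum>j<n. \<Sum>k\<in>K. cnj (x k i) * A i j * x k j)"
    by (intro sum.cong refl) (simp add: assms sum_distrib_left sum_distrib_right algebra_simps)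
  also have "\<dots> = (\<Sum>k\<in>K. sform n A (x k) (x k))"
    unfolding sform_def by (subst sum.swap[of _ K], subst sum.swap[of _ K]) simp
  finally show ?thesis by (simp add: minner_def qform_def)
qed

context base_field begin

text \<open>Decomposing X turns the inner product into a sum of values of the form W.\<close>

lemma minner_psd_nonneg:
  assumes "psd_fun n W" "psd_fun n X"
  shows "minner n W X \<ge> 0"
proof -
  obtain x where x: "\<And>k. vecF n (x k)" "\<And>i j. i < n \<Longrightarrow> j < n \<Longrightarrow> X i j = (\<Sum>k<n. x k i * cnj (x k j))"
    using psd_decomposition[OF assms(2)] by blast
  have "minner n W X = (\<Sum>k<n. qform n W (x k))" by (rule minner_decomp) (rule x(2))
  then show ?thesis using assms(1) x(1) by (auto simp: psd_fun_def intro!: sum_nonneg)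
qed

text \<open>The inner product is a sum of nonnegative values of W; if it is 0, so is each of them.
  With W = Z this places every summand of X in the kernel of Z.\<close>

lemma minner_zero_decomp:
  assumes "psd_fun n W" "minner n W X = 0" "finite K"
    and "\<And>k. k \<in> K \<Longrightarrow> vecF n (x k)" "\<And>i j. i < n \<Longrightarrow> j < n \<Longrightarrow> X i j = (\<Sum>k\<in>K. x k i * cnj (x k j))"
    and "k \<in> K"
  shows "qform n W (x k) = 0"
proof -
  have "minner n W X = (\<Sum>k\<in>K. qform n W (x k))" by (rule minner_decomp) (rule assms(5))
  moreover have "\<And>k. k \<in> K \<Longrightarrow> 0 \<le> qform n W (x k)" using assms(1,4) by (auto simp: psd_fun_def)
  ultimately show ?thesis using assms(2,3,6) by (simp add: sum_nonneg_eq_0_iff)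
qed

text \<open>The columns of W are orthogonal to every summand of X, so X vanishes at them, and
  definiteness makes them zero.\<close>

lemma minner_pd_zero:
  assumes W: "psd_fun n W" and X: "psd_fun n X" "minner n W X = 0"
    and pd: "\<And>x. vecF n x \<Longrightarrow> qform n X x = 0 \<Longrightarrow> \<forall>i<n. x i = 0"
    and ij: "i < n" "j < n"
  shows "W i j = 0"
proof -
  obtain x where x: "\<And>k. vecF n (x k)" "\<And>i j. i < n \<Longrightarrow> j < n \<Longrightarrow> X i j = (\<Sum>k<n. x k i * cnj (x k j))"
    using psd_decomposition[OF X(1)] by blast
  let ?u = "mv n W (unitf j)"
  have u: "vecF n ?u" using W by (intro vecF_mv vecF_unitf) (auto simp: psd_fun_def)
  have "(\<Sum>i<n. cnj (x k i) * ?u i) = 0" if k: "k < n" for k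
  proof -
    have "qform n W (x k) = 0" using x k by (intro minner_zero_decomp[OF W X(2), of "{..<n}"]) auto
    from psd_zero[OF W x(1) this vecF_unitf[of n j]] show ?thesis by (simp add: sform_mv)
  qed
  then have "qform n (\<lambda>i j. x k i * cnj (x k j)) ?u = 0" if "k < n" for k
    using that by (simp add: sform_outer)
  then have "(\<Sum>k<n. 1 * qform n (\<lambda>i j. x k i * cnj (x k j)) ?u) = 0" by simp
  then have "qform n (\<lambda>i j. \<Sum>k<n. complex_of_real 1 * (x k i * cnj (x k j))) ?u = 0"
    unfolding qform_sum .
  then have "qform n X ?u = 0"
    unfolding qform_def by (subst sform_cong[of n X "\<lambda>i j. \<Sum>k<n. x k i * cnj (x k j)"]) (auto simp: x(2))
  from pd[OF u this] show ?thesis using ij by (simp add: mv_unitf)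
qed

end

section \<open>Strong duality\<close>

text \<open>The objective and at most four constraints give five real coordinates, in a concrete
  Euclidean space to which separation by a hyperplane applies.\<close>

definition tup :: "(nat \<Rightarrow> real) \<Rightarrow> real \<times> real \<times> real \<times> real \<times> real" where
  "tup f = (f 0, f 1, f 2, f 3, f 4)"

lemma atMost_4: "{..4::nat} = {0, 1, 2, 3, 4}"
  by auto

lemma inner_tup: "inner (tup f) (tup g) = (\<Sum>i\<le>4. f i * g i)"
  by (simp add: tup_def inner_prod_def atMost_4)

lemma tup_surj: "\<exists>f. a = tup f"
proof -
  obtain p q s t u where "a = (p, q, s, t, u)" by (cases a) auto
  then show ?thesis
    by (intro exI[of _ "\<lambda>i. [p, q, s, t, u] ! i"]) (simp add: tup_def eval_nat_numeral)
qed

lemma minner_comb_right: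
  "minner n A (\<lambda>i j. complex_of_real u * X i j + complex_of_real v * Y i j) = u * minner n A X + v * minner n A Y"
  by (simp add: minner_def algebra_simps sum.distrib sum_distrib_left)

lemma minner_zero_right [simp]: "minner n A (\<lambda>i j. 0) = 0"
  by (simp add: minner_def)

lemma qform_comb_mat:
  "qform n (\<lambda>i j. complex_of_real u * X i j + complex_of_real v * Y i j) x = u * qform n X x + v * qform n Y x"
  by (simp add: qform_def sform_def algebra_simps sum.distrib sum_distrib_left)

lemma hermitian_comb_mat:
  assumes "hermitian_fun n X" "hermitian_fun n Y"
  shows "hermitian_fun n (\<lambda>i j. complex_of_real u * X i j + complex_of_real v * Y i j)"
  unfolding hermitian_fun_def
proof (intro allI impI)
  fix i j assume "i < n" "j < n"
  then have "X j i = cnj (X i j)" "Y j i = cnj (Y i j)"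
    using assms unfolding hermitian_fun_def by blast+
  then show "complex_of_real u * X j i + complex_of_real v * Y j i
    = cnj (complex_of_real u * X i j + complex_of_real v * Y i j)" by simp
qed

lemma hermitian_sum_mat:
  assumes "\<And>k. k \<in> K \<Longrightarrow> hermitian_fun n (B k)"
  shows "hermitian_fun n (\<lambda>i j. \<Sum>k\<in>K. complex_of_real (u k) * B k i j)"
  unfolding hermitian_fun_def
proof (intro allI impI)
  fix i j assume "i < n" "j < n"
  then have "\<And>k. k \<in> K \<Longrightarrow> B k j i = cnj (B k i j)"
    using assms unfolding hermitian_fun_def by blast
  then show "(\<Sum>k\<in>K. complex_of_real (u k) * B k j i) = cnj (\<Sum>k\<in>K. complex_of_real (u k) * B k i j)"
    by simp
qed

lemma hermitian_fun_cong:
  "(\<And>i j. i < n \<Longrightarrow> j < n \<Longrightarrow> B i j = C i j) \<Longrightarrow> hermitian_fun n B \<longleftrightarrow> hermitian_fun n C"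
  by (simp add: hermitian_fun_def)

lemma qform_mat_cong:
  "(\<And>i j. i < n \<Longrightarrow> j < n \<Longrightarrow> B i j = C i j) \<Longrightarrow> qform n B x = qform n C x"
  unfolding qform_def by (simp cong: sform_cong)

context base_field begin

lemma matF_sum: "(\<And>k. k \<in> K \<Longrightarrow> matF n (B k)) \<Longrightarrow> matF n (\<lambda>i j. \<Sum>k\<in>K. complex_of_real (u k) * B k i j)"
  unfolding matF_def by (auto intro!: F_sum)

lemma psd_comb_mat:
  "psd_fun n X \<Longrightarrow> psd_fun n Y \<Longrightarrow> u \<ge> 0 \<Longrightarrow> v \<ge> 0 \<Longrightarrow>
    psd_fun n (\<lambda>i j. complex_of_real u * X i j + complex_of_real v * Y i j)"
  by (auto simp: psd_fun_def qform_comb_mat matF_def intro!: hermitian_comb_mat)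

lemma psd_fun_cong:
  "(\<And>i j. i < n \<Longrightarrow> j < n \<Longrightarrow> B i j = C i j) \<Longrightarrow> psd_fun n B \<longleftrightarrow> psd_fun n C"
  unfolding psd_fun_def using hermitian_fun_cong[of n B C] qform_mat_cong[of n B C]
  by (auto simp: matF_def)

lemma psd_outer:
  assumes "vecF n x"
  shows "psd_fun n (\<lambda>i j. x i * cnj (x j))"
  using assms by (auto simp: psd_fun_def sform_outer hermitian_fun_def matF_def vecF_def)

lemma psd_zero_mat: "psd_fun n (\<lambda>i j. 0)"
  by (auto simp: psd_fun_def qform_def sform_def hermitian_fun_def matF_def)

lemma minner_outer: "minner n A (\<lambda>i j. x i * cnj (x j)) = qform n A x"
  using minner_decomp[of n "\<lambda>i j. x i * cnj (x j)" "\<lambda>_. x" "{0::nat}" A] by simp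

text \<open>Suppose that some v lies strictly between d and p. Then the convex set of all residuals
  misses 0, a hyperplane separates it from 0, and its normal, divided by the objective component, is
  a dual point of value at least v. The Slater point S handles the case in which that component is
  0.\<close>

lemma strong_duality:
  fixes A :: "nat \<Rightarrow> nat \<Rightarrow> nat \<Rightarrow> complex" and n m :: nat and r :: "nat \<Rightarrow> relation" and c :: "nat \<Rightarrow> real" and p d :: real
  defines "feas \<equiv> \<lambda>Y. psd_fun n Y \<and> (\<forall>i\<in>{1..m}. holds (r i) (minner n (A i) Y) (c i))"
  defines "slack \<equiv> \<lambda>\<nu> i j. A 0 i j + (\<Sum>k=1..m. complex_of_real (\<nu> k) * A k i j)"
  assumes m: "m \<le> 4"
    and A: "\<And>i. i \<le> m \<Longrightarrow> hermitian_fun n (A i) \<and> matF n (A i)"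
    and P: "\<And>Y. feas Y \<Longrightarrow> p \<le> minner n (A 0) Y"
    and D: "\<And>\<nu>. psd_fun n (slack \<nu>) \<Longrightarrow> (\<And>i. i \<in> {1..m} \<Longrightarrow> r i = Le \<Longrightarrow> \<nu> i \<ge> 0) \<Longrightarrow>
               - (\<Sum>i=1..m. c i * \<nu> i) \<le> d"
    and S: "psd_fun n S" "\<And>x. vecF n x \<Longrightarrow> qform n S x = 0 \<Longrightarrow> \<forall>i<n. x i = 0"
      "\<And>i. i \<in> {1..m} \<Longrightarrow> (r i = Le \<longrightarrow> minner n (A i) S < c i) \<and> (r i = Eq \<longrightarrow> minner n (A i) S = c i)"
  shows "p \<le> d"
proof (rule ccontr)
  assume "\<not> p \<le> d"
  then obtain v where v: "d < v" "v < p" using dense[of d p] by auto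
  define z where "z = (\<lambda>i. if i = 0 then v else c i)"
  \<comment> \<open>Residuals of objective and constraints for a matrix Y and slacks s, with target
    v in component 0. A zero residual vector amounts to a feasible Y with objective at most
    v.\<close>
  define fe where "fe Y s i = (if i \<le> m then minner n (A i) Y + s i - z i else 0)" for Y s i
  define ok where "ok s \<longleftrightarrow> s 0 \<ge> 0 \<and> (\<forall>i\<in>{1..m}. s i \<ge> 0 \<and> (r i = Eq \<longrightarrow> s i = 0))" for s :: "nat \<Rightarrow> real"
  define G where "G = {tup (fe Y s) |Y s. psd_fun n Y \<and> ok s}"
  have "convex G"
    unfolding convex_def
  proof (intro ballI allI impI)
    fix x y and u w :: real assume xy: "x \<in> G" "y \<in> G" and uw: "0 \<le> u" "0 \<le> w" "u + w = 1"
    then obtain Y s Y' s' where 1: "x = tup (fe Y s)" "psd_fun n Y" "ok s"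
      "y = tup (fe Y' s')" "psd_fun n Y'" "ok s'" unfolding G_def by blast
    define Y'' where "Y'' = (\<lambda>i j. complex_of_real u * Y i j + complex_of_real w * Y' i j)"
    define s'' where "s'' = (\<lambda>i. u * s i + w * s' i)"
    have "psd_fun n Y''" "ok s''"
      using 1 uw psd_comb_mat by (auto simp: Y''_def ok_def s''_def)
    moreover have "fe Y'' s'' i = u * fe Y s i + w * fe Y' s' i" for i
    proof -
      have "z i = u * z i + w * z i" using uw(3) by (metis distrib_right mult_1)
      then show ?thesis by (simp add: fe_def Y''_def s''_def minner_comb_right algebra_simps)
    qed
    then have "u *\<^sub>R x + w *\<^sub>R y = tup (fe Y'' s'')" by (simp add: 1 tup_def)
    ultimately show "u *\<^sub>R x + w *\<^sub>R y \<in> G" unfolding G_def by blast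
  qed
  moreover have in_G: "tup (fe Y s) \<in> G" if "psd_fun n Y" "ok s" for Y s
    using that unfolding G_def by blast
  have "G \<noteq> {}" using in_G[OF psd_zero_mat, of "\<lambda>_. 0"] by (auto simp: ok_def)
  moreover have "0 \<notin> G"
  proof
    assume "0 \<in> G"
    then obtain Y s where Y: "tup (fe Y s) = 0" "psd_fun n Y" "ok s" unfolding G_def by force
    then have "inner (tup (fe Y s)) (tup (fe Y s)) = 0" by simp
    then have "\<forall>i\<in>{..4}. fe Y s i * fe Y s i = 0"
      unfolding inner_tup by (subst (asm) sum_nonneg_eq_0_iff) auto
    then have z: "minner n (A i) Y + s i = z i" if "i \<le> m" for i
    proof -
      have "i \<in> {..4}" using that m by simp
      with \<open>\<forall>i\<in>{..4}. fe Y s i * fe Y s i = 0\<close> have "fe Y s i = 0" by fastforce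
      then show ?thesis by (simp add: fe_def that)
    qed
    have "feas Y" unfolding feas_def
    proof (intro conjI ballI)
      fix i assume i: "i \<in> {1..m}"
      then have "minner n (A i) Y + s i = c i" "s i \<ge> 0" "r i = Eq \<Longrightarrow> s i = 0"
        using z[of i] Y(3) by (auto simp: ok_def z_def)
      then show "holds (r i) (minner n (A i) Y) (c i)"
        by (cases "r i") auto
    qed (use Y in auto)
    from P[OF this] z[of 0] Y(3) v show False by (auto simp: ok_def z_def)
  qed
  \<comment> \<open>The normal is taken inside \<open>span G\<close>. It is therefore not orthogonal
    to all of G, which rules out the degenerate case even for linearly dependent equality
    constraints.\<close>
  ultimately obtain a where a: "a \<in> span G" "a \<noteq> 0" "\<And>x. x \<in> G \<Longrightarrow> 0 \<le> inner a x"
    using separating_hyperplane_set_0_inspan[of G] by metis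
  obtain l where l: "a = tup l" using tup_surj by blast
  define W where "W = (\<lambda>i j. \<Sum>k\<le>m. complex_of_real (l k) * A k i j)"
  have inner_fe: "inner a (tup (fe Y s)) = minner n W Y + (\<Sum>i\<le>m. l i * s i) - (\<Sum>i\<le>m. l i * z i)" for Y s
  proof -
    have "inner a (tup (fe Y s)) = (\<Sum>i\<le>m. l i * fe Y s i)"
      unfolding l inner_tup using m by (intro sum.mono_neutral_right) (auto simp: fe_def)
    also have "\<dots> = (\<Sum>i\<le>m. l i * minner n (A i) Y + l i * s i - l i * z i)"
      by (intro sum.cong) (auto simp: fe_def algebra_simps)
    finally show ?thesis by (simp add: W_def minner_sum sum.distrib sum_subtractf)
  qed
  note key = a(3)[OF in_G, unfolded inner_fe]
  have lz: "(\<Sum>i\<le>m. l i * z i) \<le> 0"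
    using key[OF psd_zero_mat, of "\<lambda>_. 0"] by (simp add: ok_def)
  \<comment> \<open>A linear function that is bounded below along a ray is nonnegative in its
    direction; rays of slacks and of semidefinite matrices give the sign conditions.\<close>
  have bdd: "x \<ge> 0" if "\<And>K. K \<ge> 0 \<Longrightarrow> K * x \<ge> (b::real)" for x b
  proof (rule ccontr)
    assume x: "\<not> x \<ge> 0"
    have "0 \<le> (\<bar>b\<bar> + 1) / (- x)" using x by (simp add: field_simps)
    from that[OF this] have "b \<le> - (\<bar>b\<bar> + 1)" using x by simp
    then show False by linarith
  qed
  have l_nonneg: "l i \<ge> 0" if "i = 0 \<or> i \<in> {1..m} \<and> r i = Le" for i
  proof (rule bdd)
    fix K :: real assume "K \<ge> 0"
    then have "ok (\<lambda>j. if j = i then K else 0)" using that by (auto simp: ok_def)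
    from key[OF psd_zero_mat this] have "(\<Sum>i\<le>m. l i * z i) \<le> (\<Sum>j\<le>m. if j = i then l i * K else 0)"
      by (simp add: if_distrib[of "\<lambda>x. _ * x"] cong: if_cong)
    then show "(\<Sum>i\<le>m. l i * z i) \<le> K * l i"
      using that by (auto simp: mult.commute)
  qed
  have W_nonneg: "minner n W Y \<ge> 0" if "psd_fun n Y" for Y
  proof (rule bdd)
    fix K :: real assume "K \<ge> 0"
    then have "psd_fun n (\<lambda>i j. complex_of_real K * Y i j + complex_of_real 0 * Y i j)"
      using that by (intro psd_comb_mat) auto
    from key[OF this, of "\<lambda>_. 0"] show "(\<Sum>i\<le>m. l i * z i) \<le> K * minner n W Y"
      unfolding minner_comb_right by (simp add: ok_def)
  qed
  have W: "psd_fun n W"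
    unfolding psd_fun_def
  proof (intro conjI allI impI)
    show "hermitian_fun n W" unfolding W_def using A by (intro hermitian_sum_mat) auto
    show "matF n W" unfolding W_def using A by (intro matF_sum) auto
    fix x assume "vecF n x"
    then show "0 \<le> qform n W x"
      using W_nonneg[OF psd_outer] by (simp add: minner_outer)
  qed
  have split0: "(\<Sum>i\<le>m. f i) = f 0 + (\<Sum>i=1..m. f i)" for f :: "nat \<Rightarrow> 'b::comm_monoid_add"
    by (metis atMost_atLeast0 sum.atLeast_Suc_atMost le0 One_nat_def)
  show False
  proof (cases "l 0 > 0")
    case True
    define \<nu> where "\<nu> i = l i / l 0" for i
    have "slack \<nu> i j = complex_of_real (1 / l 0) * W i j + complex_of_real 0 * W i j" for i j
      using True by (simp add: slack_def W_def split0 \<nu>_def sum_divide_distrib distrib_left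
          add_divide_distrib)
    then have "slack \<nu> = (\<lambda>i j. complex_of_real (1 / l 0) * W i j + complex_of_real 0 * W i j)"
      by blast
    then have "psd_fun n (slack \<nu>)" using psd_comb_mat[OF W W, of "1 / l 0" 0] True by simp
    from D[OF this] have "- (\<Sum>i=1..m. c i * \<nu> i) \<le> d"
      using l_nonneg True by (auto simp: \<nu>_def)
    moreover have "(\<Sum>i\<le>m. l i * z i) = l 0 * (v + (\<Sum>i=1..m. c i * \<nu> i))"
      using True by (simp add: split0 z_def \<nu>_def distrib_left sum_distrib_left mult.commute)
    then have "v + (\<Sum>i=1..m. c i * \<nu> i) \<le> 0"
      using lz True by (simp add: mult_le_0_iff)
    ultimately show False using v by linarith
  next
    case False
    \<comment> \<open>Evaluation at S squeezes all inequalities to equalities: multipliers of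
      inequality constraints vanish by strictness, W vanishes by definiteness of S, and the normal
      becomes orthogonal to G, hence to itself.\<close>
    then have l0: "l 0 = 0" using l_nonneg[of 0] by simp
    have le: "l i * minner n (A i) S \<le> l i * c i" if "i \<in> {1..m}" for i
      using S(3)[OF that] l_nonneg[of i] that by (cases "r i") (auto intro: mult_left_mono)
    have "minner n W S = (\<Sum>i=1..m. l i * minner n (A i) S)"
      by (simp add: W_def minner_sum split0 l0)
    also have "\<dots> \<le> (\<Sum>i=1..m. l i * c i)" using le by (rule sum_mono)
    also have "\<dots> = (\<Sum>i\<le>m. l i * z i)" by (simp add: split0 l0 z_def)
    finally have 0: "minner n W S = 0" "(\<Sum>i\<le>m. l i * z i) = 0"
      and "(\<Sum>i=1..m. l i * minner n (A i) S) = (\<Sum>i=1..m. l i * c i)"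
      using W_nonneg[OF S(1)] lz by (auto simp: W_def minner_sum split0 l0 z_def)
    then have "(\<Sum>i=1..m. l i * c i - l i * minner n (A i) S) = 0" by (simp add: sum_subtractf)
    then have eq: "l i * c i - l i * minner n (A i) S = 0" if "i \<in> {1..m}" for i
      using that le by (subst (asm) sum_nonneg_eq_0_iff) auto
    have l_Le: "l i = 0" if "i \<in> {1..m}" "r i = Le" for i
      using eq[OF that(1)] S(3)[OF that(1)] that(2) by (simp flip: right_diff_distrib)
    have "W i j = 0" if "i < n" "j < n" for i j
      using minner_pd_zero[OF W S(1) 0(1) S(2) that] .
    then have W0: "minner n W Y = 0" for Y by (simp add: minner_def)
    have "inner a x = 0" if "x \<in> G" for x
    proof -
      obtain Y s where x: "x = tup (fe Y s)" "ok s" using \<open>x \<in> G\<close> unfolding G_def by blast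
      have "l i * s i = 0" if "i \<le> m" for i
        using that x(2) l0 l_Le[of i] by (cases "i = 0"; cases "r i") (auto simp: ok_def)
      then have "(\<Sum>i\<le>m. l i * s i) = 0" by (intro sum.neutral) simp
      then show ?thesis unfolding x(1) inner_fe W0 0(2) by simp
    qed
    then have "span G \<subseteq> {x. inner a x = 0}"
      by (intro span_minimal subspace_hyperplane) auto
    then show False using a(1,2) by auto
  qed
qed

end

section \<open>Optimal pairs\<close>

lemma mat_adjoint_index:
  fixes A :: "complex mat"
  assumes "A \<in> carrier_mat n n" "i < n" "j < n"
  shows "mat_adjoint A $$ (i, j) = cnj (A $$ (j, i))"
  using assms by (simp add: mat_adjoint_def mat_of_rows_def)

lemma mat_adjoint_carrier:
  fixes A :: "complex mat"
  assumes "A \<in> carrier_mat n n"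
  shows "mat_adjoint A \<in> carrier_mat n n"
  using assms by (auto simp: mat_adjoint_def mat_of_rows_def)

lemma mat_inner_minner:
  assumes "A \<in> carrier_mat n n" "X \<in> carrier_mat n n"
  shows "Re (A \<bullet>\<^sub>m X) = minner n (mat_cells n A) (mat_cells n X)"
proof -
  have "(mat_adjoint X * A) $$ (j, j) = (\<Sum>i<n. cnj (X $$ (i, j)) * A $$ (i, j))" if "j < n" for j
    using that assms mat_adjoint_carrier[OF assms(2)]
    by (simp add: scalar_prod_def mat_adjoint_index atLeast0LessThan)
  then have "A \<bullet>\<^sub>m X = (\<Sum>j<n. \<Sum>i<n. cnj (X $$ (i, j)) * A $$ (i, j))"
    using assms mat_adjoint_carrier[OF assms(2)] by (simp add: mat_inner_def mtrace_def)
  also have "\<dots> = (\<Sum>i<n. \<Sum>j<n. cnj (mat_cells n X i j) * mat_cells n A i j)"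
    by (subst sum.swap) (simp add: mat_cells_def)
  finally show ?thesis by (simp add: minner_def)
qed

lemma sesq_sform:
  assumes "B \<in> carrier_mat n n" "x \<in> carrier_vec n" "y \<in> carrier_vec n"
  shows "sesq B x y = sform n (mat_cells n B) (vec_index x) (vec_index y)"
  using assms
  by (simp add: sesq_def scalar_prod_def sform_def mat_cells_def atLeast0LessThan
      sum_distrib_left sum_distrib_right algebra_simps)

lemma outer_cells: "x \<in> carrier_vec n \<Longrightarrow> i < n \<Longrightarrow> j < n \<Longrightarrow> mat_cells n (outer x) i j = x $ i * cnj (x $ j)"
  by (simp add: mat_cells_def outer_def)

lemma HF_hermitian:
  assumes "B \<in> HF F n"
  shows "hermitian_fun n (mat_cells n B)"
  unfolding hermitian_fun_def
proof (intro allI impI)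
  fix i j assume ij: "i < n" "j < n"
  have "mat_adjoint B $$ (j, i) = cnj (B $$ (i, j))"
    using assms ij by (intro mat_adjoint_index) (auto simp: HF_def)
  then show "mat_cells n B j i = cnj (mat_cells n B i j)"
    using assms ij by (simp add: HF_def mat_cells_def)
qed

lemma HF_intro:
  assumes "hermitian_fun n f" "\<And>i j. i < n \<Longrightarrow> j < n \<Longrightarrow> f i j \<in> F"
  shows "mat n n (\<lambda>(i, j). f i j) \<in> HF F n"
proof -
  let ?M = "mat n n (\<lambda>(i, j). f i j)"
  have "mat_adjoint ?M = ?M"
  proof (rule eq_matI)
    fix i j assume "i < dim_row ?M" "j < dim_col ?M"
    then have ij: "i < n" "j < n" by auto
    then have "f i j = cnj (f j i)" using assms(1) unfolding hermitian_fun_def by blast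
    then show "mat_adjoint ?M $$ (i, j) = ?M $$ (i, j)"
      using ij by (subst mat_adjoint_index[of _ n]) auto
  qed (use mat_adjoint_carrier[of ?M n] in auto)
  then show ?thesis using assms(2) by (auto simp: HF_def)
qed

lemma mat_cells_mat: "i < n \<Longrightarrow> j < n \<Longrightarrow> mat_cells n (mat n n (\<lambda>(i, j). f i j)) i j = f i j"
  by (simp add: mat_cells_def)

lemma Fvec_carrier: "x \<in> Fvec F n \<Longrightarrow> x \<in> carrier_vec n"
  by (simp add: Fvec_def)

context base_field begin

lemma HF_matF: "B \<in> HF F n \<Longrightarrow> matF n (mat_cells n B)"
  by (auto simp: HF_def matF_def mat_cells_def)

lemma Fvec_vecF: "x \<in> Fvec F n \<Longrightarrow> vecF n (vec_index x)"
  by (auto simp: Fvec_def vecF_def)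

lemma vecF_Fvec: "vecF n x \<Longrightarrow> vec n x \<in> Fvec F n"
  by (auto simp: Fvec_def vecF_def)

lemma sesq_vec: "B \<in> carrier_mat n n \<Longrightarrow> Re (sesq B (vec n x) (vec n x)) = qform n (mat_cells n B) x"
  by (subst sesq_sform[of _ n]) (auto simp: qform_def intro!: arg_cong[of _ _ Re] sform_cong)

lemma psd_iff: "psd F n X \<longleftrightarrow> X \<in> HF F n \<and> psd_fun n (mat_cells n X)"
proof (cases "X \<in> HF F n")
  case True
  then have X: "X \<in> carrier_mat n n" by (simp add: HF_def)
  have "(\<forall>x\<in>Fvec F n. Re (sesq X x x) \<ge> 0) \<longleftrightarrow> (\<forall>x. vecF n x \<longrightarrow> qform n (mat_cells n X) x \<ge> 0)"
  proof safe
    fix x assume "\<forall>x\<in>Fvec F n. Re (sesq X x x) \<ge> 0" "vecF n x"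
    then show "qform n (mat_cells n X) x \<ge> 0" using vecF_Fvec sesq_vec[OF X] by metis
  next
    fix x assume *: "\<forall>x. vecF n x \<longrightarrow> qform n (mat_cells n X) x \<ge> 0" "x \<in> Fvec F n"
    then show "0 \<le> Re (sesq X x x)"
      using Fvec_vecF[OF *(2)] Fvec_carrier[OF *(2)] X by (simp add: sesq_sform qform_def)
  qed
  then show ?thesis using True HF_hermitian HF_matF by (auto simp: psd_def psd_fun_def)
qed (simp add: psd_def)

lemma pd_imp:
  assumes "pd F n X"
  shows "psd_fun n (mat_cells n X)"
    and "vecF n x \<Longrightarrow> \<exists>i<n. x i \<noteq> 0 \<Longrightarrow> qform n (mat_cells n X) x > 0"
proof -
  have X: "X \<in> HF F n" "X \<in> carrier_mat n n" using assms by (auto simp: pd_def HF_def)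
  have *: "qform n (mat_cells n X) x > 0" if "vecF n x" "\<exists>i<n. x i \<noteq> 0" for x
  proof -
    from that(2) obtain i where i: "i < n" "x i \<noteq> 0" by blast
    have "vec n x \<noteq> 0\<^sub>v n"
    proof
      assume "vec n x = 0\<^sub>v n"
      then have "vec n x $ i = 0\<^sub>v n $ i" by simp
      then show False using i by simp
    qed
    then show ?thesis
      using assms vecF_Fvec[OF that(1)] sesq_vec[OF X(2), of x] unfolding pd_def by metis
  qed
  then show "vecF n x \<Longrightarrow> \<exists>i<n. x i \<noteq> 0 \<Longrightarrow> qform n (mat_cells n X) x > 0" .
  have "qform n (mat_cells n X) x \<ge> 0" if "vecF n x" for x
  proof (cases "\<exists>i<n. x i \<noteq> 0")
    case False
    then have "qform n (mat_cells n X) x = qform n (mat_cells n X) (\<lambda>i. 0)" by (intro qform_cong) auto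
    then show ?thesis by simp
  qed (use *[OF that] in auto)
  then show "psd_fun n (mat_cells n X)"
    using HF_hermitian[OF X(1)] HF_matF[OF X(1)] by (auto simp: psd_fun_def)
qed

end

definition slack_fun :: "nat \<Rightarrow> (nat \<Rightarrow> nat \<Rightarrow> nat \<Rightarrow> complex) \<Rightarrow> (nat \<Rightarrow> real) \<Rightarrow> nat \<Rightarrow> nat \<Rightarrow> complex" where
  "slack_fun m A \<mu> i j = A 0 i j + (\<Sum>k=1..m. complex_of_real (\<mu> k) * A k i j)"

lemma dual_slack_cells:
  "i < n \<Longrightarrow> j < n \<Longrightarrow> mat_cells n (dual_slack n m A \<mu>) i j = slack_fun m (\<lambda>k. mat_cells n (A k)) \<mu> i j"
  by (simp add: mat_cells_def dual_slack_def slack_fun_def)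

lemma sum_split0: "(\<Sum>i\<le>m. f i) = f 0 + (\<Sum>i=1..m. f i)" for f :: "nat \<Rightarrow> 'b::comm_monoid_add"
  by (metis atMost_atLeast0 sum.atLeast_Suc_atMost le0 One_nat_def)

text \<open>The coefficient 1 at index 0 makes the rules for finite sums of matrices applicable to
  the slack.\<close>

lemma slack_fun_sum:
  "slack_fun m A \<mu> = (\<lambda>i j. \<Sum>k\<le>m. complex_of_real (if k = 0 then 1 else \<mu> k) * A k i j)"
  by (simp add: slack_fun_def sum_split0 fun_eq_iff)

lemma qform_slack: "qform n (slack_fun m A \<mu>) x = qform n (A 0) x + (\<Sum>k=1..m. \<mu> k * qform n (A k) x)"
  unfolding slack_fun_sum qform_sum by (simp add: sum_split0)

lemma minner_slack: "minner n (slack_fun m A \<mu>) X = minner n (A 0) X + (\<Sum>k=1..m. \<mu> k * minner n (A k) X)"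
  unfolding slack_fun_sum minner_sum by (simp add: sum_split0)

lemma minner_cong:
  "(\<And>i j. i < n \<Longrightarrow> j < n \<Longrightarrow> A i j = B i j) \<Longrightarrow> (\<And>i j. i < n \<Longrightarrow> j < n \<Longrightarrow> X i j = Y i j) \<Longrightarrow>
    minner n A X = minner n B Y"
  by (simp add: minner_def)

text \<open>What the later arguments use of an optimal pair: optimality is replaced by the
  consequences of strong duality, namely \<open>ZX\<close> and \<open>slackness\<close>.
  \<open>dual_strict\<close> is the Slater condition of the dual, read on vectors.\<close>

locale optimal_pair = base_field +
  fixes n m :: nat and A :: "nat \<Rightarrow> nat \<Rightarrow> nat \<Rightarrow> complex" and c :: "nat \<Rightarrow> real"
    and r :: "nat \<Rightarrow> relation" and X Z :: "nat \<Rightarrow> nat \<Rightarrow> complex" and \<mu> :: "nat \<Rightarrow> real"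
  assumes A: "\<And>i. i \<le> m \<Longrightarrow> hermitian_fun n (A i) \<and> matF n (A i)"
    and X: "psd_fun n X" and Z: "psd_fun n Z"
    and Z_eq: "\<And>i j. i < n \<Longrightarrow> j < n \<Longrightarrow> Z i j = slack_fun m A \<mu> i j"
    and ZX: "minner n Z X = 0"
    and feas: "\<And>i. i \<in> {1..m} \<Longrightarrow> holds (r i) (minner n (A i) X) (c i)"
    and mu_nonneg: "\<And>i. i \<in> {1..m} \<Longrightarrow> r i = Le \<Longrightarrow> \<mu> i \<ge> 0"
    and slackness: "\<And>i. i \<in> {1..m} \<Longrightarrow> \<mu> i = 0 \<or> minner n (A i) X = c i"
    and c_m: "c m \<noteq> 0"
    and dual_strict: "\<exists>\<nu>. (\<forall>x. vecF n x \<longrightarrow> (\<exists>i<n. x i \<noteq> 0) \<longrightarrow> qform n (slack_fun m A \<nu>) x > 0)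
        \<and> (\<forall>i\<in>{1..m}. r i = Le \<longrightarrow> \<nu> i > 0)"
begin

definition certificate :: "(nat \<Rightarrow> complex) \<Rightarrow> bool" where
  "certificate y \<longleftrightarrow> vecF n y \<and> qform n Z y = 0 \<and>
     (\<forall>i\<in>{1..m}. holds (r i) (qform n (A i) y) (c i) \<and> (\<mu> i = 0 \<or> qform n (A i) y = c i))"

lemma qform_Z: "qform n Z x = qform n (A 0) x + (\<Sum>k=1..m. \<mu> k * qform n (A k) x)"
  by (subst qform_mat_cong[of n Z "slack_fun m A \<mu>"]) (auto simp: Z_eq qform_slack)

lemma certificate_value:
  assumes "certificate y"
  shows "qform n (A 0) y = - (\<Sum>i=1..m. c i * \<mu> i)"
proof -
  have "(\<Sum>k=1..m. \<mu> k * qform n (A k) y) = (\<Sum>i=1..m. c i * \<mu> i)"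
    using assms by (intro sum.cong) (auto simp: certificate_def)
  then show ?thesis using assms qform_Z[of y] by (simp add: certificate_def)
qed

lemma X_value: "minner n (A 0) X = - (\<Sum>i=1..m. c i * \<mu> i)"
proof -
  have "minner n Z X = minner n (A 0) X + (\<Sum>k=1..m. \<mu> k * minner n (A k) X)"
    by (subst minner_cong[of n Z "slack_fun m A \<mu>" X X]) (auto simp: Z_eq minner_slack)
  also have "(\<Sum>k=1..m. \<mu> k * minner n (A k) X) = (\<Sum>i=1..m. c i * \<mu> i)"
    using slackness by (intro sum.cong) auto
  finally show ?thesis using ZX by simp
qed

text \<open>The gap between the objective at y and the dual value is the sum of y^H Z y and the
  terms \<open>\<mu> k * (c k - qform n (A k) y)\<close>. All of these are nonnegative, so the gap
  closes only if each of them is zero.\<close>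

lemma weak_duality:
  assumes "vecF n y" "\<And>i. i \<in> {1..m} \<Longrightarrow> holds (r i) (qform n (A i) y) (c i)"
  shows "qform n (A 0) y \<ge> - (\<Sum>i=1..m. c i * \<mu> i)"
    and "qform n (A 0) y \<le> - (\<Sum>i=1..m. c i * \<mu> i) \<Longrightarrow> certificate y"
proof -
  have le: "\<mu> k * qform n (A k) y \<le> c k * \<mu> k" if "k \<in> {1..m}" for k
    using assms(2)[OF that] mu_nonneg[OF that] that
    by (cases "r k") (auto simp: mult.commute[of "c k"] intro: mult_left_mono)
  then have s: "(\<Sum>k=1..m. \<mu> k * qform n (A k) y) \<le> (\<Sum>i=1..m. c i * \<mu> i)" by (intro sum_mono)
  have Zy: "qform n Z y \<ge> 0" using Z assms(1) by (simp add: psd_fun_def)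
  show "qform n (A 0) y \<ge> - (\<Sum>i=1..m. c i * \<mu> i)" using Zy s qform_Z[of y] by linarith
  assume "qform n (A 0) y \<le> - (\<Sum>i=1..m. c i * \<mu> i)"
  then have 0: "qform n Z y = 0" "(\<Sum>k=1..m. \<mu> k * qform n (A k) y) = (\<Sum>i=1..m. c i * \<mu> i)"
    using Zy s qform_Z[of y] by linarith+
  then have "(\<Sum>k=1..m. c k * \<mu> k - \<mu> k * qform n (A k) y) = 0" by (simp add: sum_subtractf)
  then have "c k * \<mu> k - \<mu> k * qform n (A k) y = 0" if "k \<in> {1..m}" for k
    using le that by (subst (asm) sum_nonneg_eq_0_iff) auto
  then have "\<mu> k = 0 \<or> qform n (A k) y = c k" if "k \<in> {1..m}" for k
    using that by (metis mult.commute mult_right_cancel right_minus_eq)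
  then show "certificate y" using 0 assms by (auto simp only: certificate_def)
qed

text \<open>\<delta> is the difference of a Slater point of the dual and \<mu>. Where Z vanishes,
  the positive definite slack equals the \<delta>-combination of the constraint forms. This later
  fixes the sign of scaling factors.\<close>

lemma dual_kernel:
  obtains \<delta> where "\<And>x. vecF n x \<Longrightarrow> \<exists>i<n. x i \<noteq> 0 \<Longrightarrow> qform n Z x = 0 \<Longrightarrow> (\<Sum>i=1..m. \<delta> i * qform n (A i) x) > 0"
    and "\<And>i. i \<in> {1..m} \<Longrightarrow> r i = Le \<Longrightarrow> \<mu> i = 0 \<Longrightarrow> \<delta> i > 0"
proof -
  obtain \<nu> where \<nu>: "\<And>x. vecF n x \<Longrightarrow> (\<exists>i<n. x i \<noteq> 0) \<Longrightarrow> qform n (slack_fun m A \<nu>) x > 0"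
        "\<And>i. i \<in> {1..m} \<Longrightarrow> r i = Le \<Longrightarrow> \<nu> i > 0" using dual_strict by blast
  show ?thesis
  proof (rule that[of "\<lambda>i. \<nu> i - \<mu> i"])
    fix x assume "vecF n x" "\<exists>i<n. x i \<noteq> 0" "qform n Z x = 0"
    then show "(\<Sum>i=1..m. (\<nu> i - \<mu> i) * qform n (A i) x) > 0"
      using \<nu>(1)[of x] by (simp add: qform_Z qform_slack left_diff_distrib sum_subtractf)
  qed (use \<nu>(2) in auto)
qed

end

lemma (in base_field) optimal_pair_of_slater:
  assumes sl: "slater_optimal_pair F n m A c r X Z \<mu>" and m: "1 \<le> m" "m \<le> 4"
  shows "optimal_pair F n m (\<lambda>k. mat_cells n (A k)) c r (mat_cells n X) (mat_cells n Z) \<mu>"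
proof -
  let ?A = "\<lambda>k. mat_cells n (A k)" and ?X = "mat_cells n X" and ?Z = "mat_cells n Z"
  have pr: "n \<ge> 1" "\<And>i. i \<le> m \<Longrightarrow> A i \<in> HF F n" "c m \<noteq> 0"
    using sl by (auto simp: slater_optimal_pair_def problem_data_def)
  have Ac: "A i \<in> carrier_mat n n" if "i \<le> m" for i using pr(2)[OF that] by (simp add: HF_def)
  have Xo: "SP_optimal F n m A c r X" and Zo: "SD_optimal F n m A c r Z \<mu>"
    using sl by (auto simp: slater_optimal_pair_def)
  have A: "hermitian_fun n (?A i) \<and> matF n (?A i)" if "i \<le> m" for i
    using HF_hermitian[OF pr(2)[OF that]] HF_matF[OF pr(2)[OF that]] by simp
  have X: "psd F n X" "\<And>i. i \<in> {1..m} \<Longrightarrow> holds (r i) (Re (A i \<bullet>\<^sub>m X)) (c i)"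
    using Xo by (auto simp: SP_optimal_def SP_feasible_def)
  have Xc: "X \<in> carrier_mat n n" "psd_fun n ?X" using X(1) by (auto simp: psd_iff HF_def)
  have feas: "holds (r i) (minner n (?A i) ?X) (c i)" if "i \<in> {1..m}" for i
    using X(2)[OF that] that mat_inner_minner[OF Ac Xc(1), of i] by simp
  have opt: "minner n (?A 0) ?X \<le> minner n (?A 0) Y"
    if Y: "psd_fun n Y" "\<forall>i\<in>{1..m}. holds (r i) (minner n (?A i) Y) (c i)" for Y
  proof -
    let ?Y = "mat n n (\<lambda>(i, j). Y i j)"
    have "?Y \<in> HF F n" using Y(1) by (intro HF_intro) (auto simp: psd_fun_def matF_def)
    moreover have "psd_fun n (mat_cells n ?Y)"
      using Y(1) psd_fun_cong[of n "mat_cells n ?Y" Y] by (simp add: mat_cells_mat)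
    moreover have mi: "Re (A i \<bullet>\<^sub>m ?Y) = minner n (?A i) Y" if "i \<le> m" for i
      using Ac[OF that] by (subst mat_inner_minner[of _ n]) (auto intro!: minner_cong simp: mat_cells_mat)
    ultimately have "?Y \<in> SP_feasible F n m A c r"
      using Y(2) by (auto simp: SP_feasible_def psd_iff)
    then have "Re (A 0 \<bullet>\<^sub>m X) \<le> Re (A 0 \<bullet>\<^sub>m ?Y)" using Xo by (auto simp: SP_optimal_def)
    then show ?thesis using mi[of 0] Ac[of 0] Xc by (simp add: mat_inner_minner)
  qed
  have slack_psd: "psd F n (dual_slack n m A \<nu>) \<longleftrightarrow> psd_fun n (slack_fun m ?A \<nu>)" for \<nu>
  proof -
    have "psd_fun n (mat_cells n (dual_slack n m A \<nu>)) \<longleftrightarrow> psd_fun n (slack_fun m ?A \<nu>)"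
      by (rule psd_fun_cong) (rule dual_slack_cells)
    moreover have "dual_slack n m A \<nu> \<in> HF F n" if "psd_fun n (slack_fun m ?A \<nu>)"
    proof -
      have "dual_slack n m A \<nu> = mat n n (\<lambda>(i, j). slack_fun m ?A \<nu> i j)"
        by (rule eq_matI) (auto simp: dual_slack_def slack_fun_def mat_cells_def)
      moreover have "mat n n (\<lambda>(i, j). slack_fun m ?A \<nu> i j) \<in> HF F n"
        using that by (intro HF_intro) (auto simp: psd_fun_def matF_def)
      ultimately show ?thesis by simp
    qed
    ultimately show ?thesis by (auto simp: psd_iff)
  qed
  have Z: "Z = dual_slack n m A \<mu>" "psd F n Z" and mu: "\<And>i. i \<in> {1..m} \<Longrightarrow> r i = Le \<Longrightarrow> \<mu> i \<ge> 0"
    using Zo by (auto simp: SD_optimal_def SD_feasible_def)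
  have Zp: "psd_fun n ?Z" using Z(2) by (simp add: psd_iff)
  have Z_eq: "?Z i j = slack_fun m ?A \<mu> i j" if "i < n" "j < n" for i j
    unfolding Z(1) using that by (rule dual_slack_cells)
  have dopt: "- (\<Sum>i=1..m. c i * \<nu> i) \<le> - (\<Sum>i=1..m. c i * \<mu> i)"
    if "psd_fun n (slack_fun m ?A \<nu>)" "\<And>i. i \<in> {1..m} \<Longrightarrow> r i = Le \<Longrightarrow> \<nu> i \<ge> 0" for \<nu>
  proof -
    have "(dual_slack n m A \<nu>, \<nu>) \<in> SD_feasible F n m A r"
      using that by (auto simp: SD_feasible_def slack_psd)
    then show ?thesis using Zo unfolding SD_optimal_def by blast
  qed
  obtain S where S: "pd F n S" "\<And>i. i \<in> {1..m} \<Longrightarrow>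
      (r i = Le \<longrightarrow> Re (A i \<bullet>\<^sub>m S) < c i) \<and> (r i = Eq \<longrightarrow> Re (A i \<bullet>\<^sub>m S) = c i)"
    using sl unfolding slater_optimal_pair_def SP_slater_def by blast
  have Sc: "S \<in> carrier_mat n n" using S(1) by (simp add: pd_def HF_def)
  have "minner n (?A 0) ?X \<le> - (\<Sum>i=1..m. c i * \<mu> i)"
  proof (rule strong_duality[of m n ?A r c, OF m(2) A])
    show "- (\<Sum>i = 1..m. c i * \<nu> i) \<le> - (\<Sum>i = 1..m. c i * \<mu> i)"
      if "psd_fun n (\<lambda>i j. ?A 0 i j + (\<Sum>k = 1..m. complex_of_real (\<nu> k) * ?A k i j))"
        "\<And>i. i \<in> {1..m} \<Longrightarrow> r i = Le \<Longrightarrow> 0 \<le> \<nu> i" for \<nu>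
      using dopt[of \<nu>] that by (simp add: slack_fun_def[abs_def])
    show "psd_fun n (mat_cells n S)" by (rule pd_imp(1)[OF S(1)])
    show "\<forall>i<n. x i = 0" if "vecF n x" "qform n (mat_cells n S) x = 0" for x
      using pd_imp(2)[OF S(1) that(1)] that(2) by force
    show "(r i = Le \<longrightarrow> minner n (?A i) (mat_cells n S) < c i) \<and>
         (r i = Eq \<longrightarrow> minner n (?A i) (mat_cells n S) = c i)" if "i \<in> {1..m}" for i
      using S(2)[OF that] that Ac[of i] Sc by (simp add: mat_inner_minner)
  qed (use opt in auto)
  note le0 = this
  have mZ: "minner n ?Z ?X = minner n (?A 0) ?X + (\<Sum>k=1..m. \<mu> k * minner n (?A k) ?X)"
    by (subst minner_cong[of n ?Z "slack_fun m ?A \<mu>" ?X ?X]) (auto simp: Z_eq minner_slack)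
  have le: "\<mu> k * minner n (?A k) ?X \<le> c k * \<mu> k" if "k \<in> {1..m}" for k
    using feas[OF that] mu[OF that] that
    by (cases "r k") (auto simp: mult.commute[of "c k"] intro: mult_left_mono)
  have "(\<Sum>k=1..m. \<mu> k * minner n (?A k) ?X) \<le> (\<Sum>i=1..m. c i * \<mu> i)" by (rule sum_mono) (rule le)
  moreover have "minner n ?Z ?X \<ge> 0" by (rule minner_psd_nonneg[OF Zp Xc(2)])
  \<comment> \<open>The inner product of Z and X and the defect in complementary slackness are
    nonnegative, and \<open>le0\<close> bounds their sum by 0.\<close>
  ultimately have ZX: "minner n ?Z ?X = 0"
    and "(\<Sum>k=1..m. \<mu> k * minner n (?A k) ?X) = (\<Sum>i=1..m. c i * \<mu> i)"
    using le0 mZ by linarith+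
  then have "(\<Sum>k=1..m. c k * \<mu> k - \<mu> k * minner n (?A k) ?X) = 0" by (simp add: sum_subtractf)
  then have "c k * \<mu> k - \<mu> k * minner n (?A k) ?X = 0" if "k \<in> {1..m}" for k
    using le that by (subst (asm) sum_nonneg_eq_0_iff) auto
  then have slackness: "\<mu> k = 0 \<or> minner n (?A k) ?X = c k" if "k \<in> {1..m}" for k
    using that by (metis mult.commute mult_right_cancel right_minus_eq)
  obtain \<nu> where \<nu>: "pd F n (dual_slack n m A \<nu>)" "\<forall>i\<in>{1..m}. r i = Le \<longrightarrow> \<nu> i > 0"
    using sl unfolding slater_optimal_pair_def SD_slater_def by blast
  have "qform n (slack_fun m ?A \<nu>) x > 0" if "vecF n x" "\<exists>i<n. x i \<noteq> 0" for x
    using pd_imp(2)[OF \<nu>(1) that] qform_mat_cong[of n "mat_cells n (dual_slack n m A \<nu>)" "slack_fun m ?A \<nu>" x]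
    by (simp add: dual_slack_cells)
  then show ?thesis
    using A Xc Zp Z_eq ZX feas mu slackness pr(3) \<nu>(2)
    by unfold_locales blast+
qed

section \<open>Program phases\<close>

text \<open>
  Array \<open>10\<close> is never written and serves as the zero form; \<open>11\<close>, \<open>12\<close>, \<open>13\<close> hold the forms that the
  output has to annihilate, \<open>14\<close> the identity, \<open>20\<close> the form being deflated, \<open>21\<close> the vectors of the
  rank-one decomposition as columns, \<open>23\<close> the numbers \<open>A i \<bullet> X\<close>, and \<open>24\<close> scalars.
  Array \<open>22\<close> holds work vectors as columns: \<open>0\<close> the result, \<open>1\<close>, \<open>2\<close>, \<open>3\<close> the vectors that span
  the search space, \<open>5\<close> and \<open>6\<close> the arguments of a deflation step, \<open>4\<close> and \<open>7\<close> copies.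
\<close>

definition Vc :: "cells \<Rightarrow> nat \<Rightarrow> nat \<Rightarrow> complex" where
  "Vc M k = (\<lambda>i. M 22 i k)"

definition Sv :: "cells \<Rightarrow> nat \<Rightarrow> complex" where
  "Sv M t = M 24 t 0"

text \<open>The effect of writing n entries of a column: new values below n, and whatever was there
  from n on. Forms and matrix products do not see the tail.\<close>

definition cut :: "nat \<Rightarrow> (nat \<Rightarrow> complex) \<Rightarrow> (nat \<Rightarrow> complex) \<Rightarrow> nat \<Rightarrow> complex" where
  "cut n v w i = (if i < n then v i else w i)"

definition setV :: "nat \<Rightarrow> nat \<Rightarrow> (nat \<Rightarrow> complex) \<Rightarrow> cells \<Rightarrow> cells" where
  "setV n k v M = put_col n 22 k v M"

lemma Sv_put [simp]: "Sv (put t z M) u = (if u = t then z else Sv M u)"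
  by (simp add: Sv_def put_def)

lemma Vc_put [simp]: "Vc (put t z M) k = Vc M k"
  by (simp add: Vc_def put_def)

lemma arr_put [simp]: "b \<noteq> 24 \<Longrightarrow> put t z M b = M b"
  by (rule put_other)

lemma Vc_setV [simp]: "Vc (setV n k v M) l = (if l = k then cut n v (Vc M k) else Vc M l)"
  by (auto simp: Vc_def setV_def put_col_def cut_def fun_eq_iff)

lemma Sv_setV [simp]: "Sv (setV n k v M) t = Sv M t"
  by (simp add: Sv_def setV_def put_col_def)

lemma arr_setV [simp]: "b \<noteq> 22 \<Longrightarrow> setV n k v M b = M b"
  by (simp add: setV_def put_col_def)

lemma put_col_other [simp]: "b \<noteq> a \<Longrightarrow> put_col n a c v M b = M b"
  by (simp add: put_col_def)

lemma put_mat_other [simp]: "b \<noteq> a \<Longrightarrow> put_mat n a v M b = M b"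
  by (simp add: put_mat_def)

lemma put_mat_in [simp]: "i < n \<Longrightarrow> j < n \<Longrightarrow> put_mat n a v M a i j = v i j"
  by (simp add: put_mat_def)

lemma Vc_put_col [simp]: "a \<noteq> 22 \<Longrightarrow> Vc (put_col n a c v M) k = Vc M k"
  by (simp add: Vc_def)

lemma Sv_put_col [simp]: "a \<noteq> 24 \<Longrightarrow> Sv (put_col n a c v M) k = Sv M k"
  by (simp add: Sv_def)

lemma Vc_put_mat [simp]: "a \<noteq> 22 \<Longrightarrow> Vc (put_mat n a v M) k = Vc M k"
  by (simp add: Vc_def)

lemma Sv_put_mat [simp]: "a \<noteq> 24 \<Longrightarrow> Sv (put_mat n a v M) k = Sv M k"
  by (simp add: Sv_def)

lemma cut_less [simp]: "i < n \<Longrightarrow> cut n v w i = v i"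
  by (simp add: cut_def)

lemma sform_cut [simp]: "sform n B (cut n v w) y = sform n B v y" "sform n B y (cut n v w) = sform n B y v"
  by (simp_all add: sform_def)

lemma qform_cut [simp]: "qform n B (cut n v w) = qform n B v"
  by (simp add: qform_def)

lemma mv_cut [simp]: "mv n S (cut n v w) = mv n S v"
  by (simp add: mv_def fun_eq_iff)

lemma (in base_field) vecF_cut [simp]: "vecF n (cut n v w) = vecF n v"
  by (simp add: vecF_def)

lemma defl_cut [simp]: "defl n (cut n v w) S = defl n v S"
  by (simp add: defl_def fun_eq_iff)

section \<open>Evaluating forms and deflating in the store\<close>

definition FormV :: "nat \<Rightarrow> nat \<Rightarrow> nat \<Rightarrow> nat \<Rightarrow> prog" where
  "FormV t b p q = Form t b (22, NNum p) (22, NNum q)"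

lemma wp_FormV:
  assumes "R 3 = 0" "R 4 = 0" "b \<noteq> 24" and "Q (put t (sform (R 0) (M b) (Vc M p) (Vc M q)) M)"
  shows "wp R (FormV t b p q) Q M"
proof -
  have "vecof R M (22, NNum p) = Vc M p" for p by (simp add: vecof_def Vc_def fun_eq_iff)
  then show ?thesis unfolding FormV_def using assms by (intro wp_Form) auto
qed

definition Comb :: "nat \<Rightarrow> nat \<Rightarrow> nat \<Rightarrow> nat \<Rightarrow> nat \<Rightarrow> nat \<Rightarrow> nat \<Rightarrow> prog" where
  "Comb k a p b q c s = Map1 22 (NNum k)
     (CAdd (CAdd (CMul (Sc a) (Cell 22 (NReg 3) (NNum p))) (CMul (Sc b) (Cell 22 (NReg 3) (NNum q))))
       (CMul (Sc c) (Cell 22 (NReg 3) (NNum s))))"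

lemma wp_Comb:
  assumes "R 3 = 0"
    and "Q (setV (R 0) k (\<lambda>i. Sv M a * Vc M p i + Sv M b * Vc M q i + Sv M c * Vc M s i) M)"
  shows "wp R (Comb k a p b q c s) Q M"
  unfolding Comb_def using assms unfolding setV_def
  by (intro wp_Map1[where v = "\<lambda>i. Sv M a * Vc M p i + Sv M b * Vc M q i + Sv M c * Vc M s i"])
     (auto simp: agree_but_def Sv_def Vc_def)

definition Copy :: "nat \<Rightarrow> nat \<Rightarrow> nexp \<Rightarrow> prog" where
  "Copy k a c = Map1 22 (NNum k) (Cell a (NReg 3) c)"

lemma wp_Copy:
  assumes "R 3 = 0" "\<And>i. nval (R(3 := i)) c = nval R c"
    and "Q (setV (R 0) k (\<lambda>i. M a i (nval R c)) M)"
  shows "wp R (Copy k a c) Q M"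
  unfolding Copy_def using assms unfolding setV_def
  by (intro wp_Map1[where v = "\<lambda>i. M a i (nval R c)"]) (auto simp: agree_but_def)

definition MatVec :: prog where
  "MatVec = For 3 (Then (SetCell 22 (NReg 3) (NNum 6) (CNum 0))
     (For 4 (SetCell 22 (NReg 3) (NNum 6) (CAdd (Cell 22 (NReg 3) (NNum 6))
        (CMul (Cell 20 (NReg 3) (NReg 4)) (Cell 22 (NReg 4) (NNum 5)))))))"

lemma wp_MatVec:
  assumes "R 3 = 0" "R 4 = 0" and Q: "Q (setV (R 0) 6 (mv (R 0) (M 20) (Vc M 5)) M)"
  shows "wp R MatVec Q M"
  unfolding MatVec_def
proof (rule wp_For[where I = "\<lambda>l M'. M' = setV l 6 (mv (R 0) (M 20) (Vc M 5)) M"])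
  fix i M' assume i: "i < R 0" and M': "M' = setV i 6 (mv (R 0) (M 20) (Vc M 5)) M"
  let ?N = "\<lambda>z. M'(22 := (M' 22)(i := (M' 22 i)(6 := z)))"
  have N: "?N (mv (R 0) (M 20) (Vc M 5) i) = setV (Suc i) 6 (mv (R 0) (M 20) (Vc M 5)) M"
    by (auto simp: M' setV_def put_col_def fun_eq_iff less_Suc_eq)
  show "wp (R(3 := i)) (Then (SetCell 22 (NReg 3) (NNum 6) (CNum 0))
     (For 4 (SetCell 22 (NReg 3) (NNum 6) (CAdd (Cell 22 (NReg 3) (NNum 6))
        (CMul (Cell 20 (NReg 3) (NReg 4)) (Cell 22 (NReg 4) (NNum 5)))))))
      (\<lambda>M'. M' = setV (Suc i) 6 (mv (R 0) (M 20) (Vc M 5)) M) M'"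
  proof (intro wp_Then wp_SetCell wp_For[where I = "\<lambda>l M''. M'' = ?N (\<Sum>k<l. M 20 i k * Vc M 5 k)"])
    fix j M'' assume "M'' = ?N (\<Sum>k<j. M 20 i k * Vc M 5 k)"
    then show "set_cell M'' 22 (nval (R(3 := i, 4 := j)) (NReg 3)) (nval (R(3 := i, 4 := j)) (NNum 6))
         (cval (R(3 := i, 4 := j), M'') (CAdd (Cell 22 (NReg 3) (NNum 6))
            (CMul (Cell 20 (NReg 3) (NReg 4)) (Cell 22 (NReg 4) (NNum 5)))))
       = ?N (\<Sum>k<Suc j. M 20 i k * Vc M 5 k)"
      by (simp add: M' Vc_def setV_def put_col_def)
  next
    fix M'' assume "M'' = ?N (\<Sum>k<(R(3 := i)) 0. M 20 i k * Vc M 5 k)"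
    then show "M'' = setV (Suc i) 6 (mv (R 0) (M 20) (Vc M 5)) M"
      unfolding N[symmetric] by (simp add: mv_def)
  qed (use assms in auto)
qed (use assms in \<open>auto simp: setV_def put_col_def\<close>)

text \<open>Column 6 receives S a and scalar 0 receives a^H S a before any entry of S changes, so
  that the final map can work in place on array 20.\<close>

definition Deflate :: prog where
  "Deflate = Then MatVec (Then (FormV 0 20 5 5)
     (Map2 20 (CSub (Cell 20 (NReg 3) (NReg 4))
        (CDiv (CMul (Cell 22 (NReg 3) (NNum 6)) (Conj (Cell 22 (NReg 4) (NNum 6)))) (Sc 0)))))"

text \<open>If \<open>a\<close> is in the kernel of the form, the division by zero leaves the form unchanged.\<close>

lemma wp_Deflate:
  assumes R: "R 3 = 0" "R 4 = 0" "R 0 = n" and h: "hermitian_fun n (M 20)"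
    and Q: "\<And>M'. (\<And>b. b \<notin> {20, 22, 24} \<Longrightarrow> M' b = M b) \<Longrightarrow> (\<And>k. k \<noteq> 6 \<Longrightarrow> Vc M' k = Vc M k) \<Longrightarrow>
        (\<And>i. i < n \<Longrightarrow> Vc M' 6 i = mv n (M 20) (Vc M 5) i) \<Longrightarrow>
        Sv M' 0 = complex_of_real (qform n (M 20) (Vc M 5)) \<Longrightarrow>
        (\<And>i j. i < n \<Longrightarrow> j < n \<Longrightarrow> M' 20 i j = defl n (Vc M 5) (M 20) i j) \<Longrightarrow> Q M'"
  shows "wp R Deflate Q M"
  unfolding Deflate_def
proof (intro wp_Then wp_MatVec wp_FormV)
  let ?M1 = "setV (R 0) 6 (mv (R 0) (M 20) (Vc M 5)) M"
  let ?M2 = "put 0 (sform (R 0) (?M1 20) (Vc ?M1 5) (Vc ?M1 5)) ?M1"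
  show "wp R (Map2 20 (CSub (Cell 20 (NReg 3) (NReg 4))
        (CDiv (CMul (Cell 22 (NReg 3) (NNum 6)) (Conj (Cell 22 (NReg 4) (NNum 6)))) (Sc 0)))) Q ?M2"
  proof (rule wp_Map2[where v = "defl n (Vc M 5) (M 20)"])
    fix i j M' assume ij: "i < R 0" "j < R 0"
      and M': "agree_but {(20, k, l) |k l. k < i \<or> k = i \<and> l < j} ?M2 M'"
    have "M' 20 i j = ?M2 20 i j" "M' 22 k 6 = Vc ?M2 6 k" "M' 24 0 0 = Sv ?M2 0" for k
      using M' by (auto simp: agree_but_def Vc_def Sv_def)
    then show "cval (R(3 := i, 4 := j), M') (CSub (Cell 20 (NReg 3) (NReg 4))
        (CDiv (CMul (Cell 22 (NReg 3) (NNum 6)) (Conj (Cell 22 (NReg 4) (NNum 6)))) (Sc 0)))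
      = defl n (Vc M 5) (M 20) i j"
      using ij R by (simp add: defl_def sform_self[OF h])
  next
    show "Q (put_mat (R 0) 20 (defl n (Vc M 5) (M 20)) ?M2)"
      using R by (intro Q) (auto simp: sform_self[OF h])
  qed (use R in auto)
qed (use R in auto)

definition SetIdentity :: prog where
  "SetIdentity = For 3 (SetCell 14 (NReg 3) (NReg 3) (CNum 1))"

lemma wp_SetIdentity:
  assumes R: "R 3 = 0" "R 0 = n" and M: "M 14 = (\<lambda>i j. 0)"
    and Q: "\<And>M'. (\<And>b. b \<noteq> 14 \<Longrightarrow> M' b = M b) \<Longrightarrow> (\<And>i j. i < n \<Longrightarrow> j < n \<Longrightarrow> M' 14 i j = idm i j) \<Longrightarrow> Q M'"
  shows "wp R SetIdentity Q M"
  unfolding SetIdentity_def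
proof (rule wp_For[where I = "\<lambda>l M'. (\<forall>b. b \<noteq> 14 \<longrightarrow> M' b = M b) \<and>
     (\<forall>i j. M' 14 i j = (if i = j \<and> i < l then 1 else 0))"])
  fix i M' assume "(\<forall>b. b \<noteq> 14 \<longrightarrow> M' b = M b) \<and> (\<forall>k j. M' 14 k j = (if k = j \<and> k < i then 1 else 0))"
  then show "wp (R(3 := i)) (SetCell 14 (NReg 3) (NReg 3) (CNum 1))
     (\<lambda>M'. (\<forall>b. b \<noteq> 14 \<longrightarrow> M' b = M b) \<and> (\<forall>k j. M' 14 k j = (if k = j \<and> k < Suc i then 1 else 0))) M'"
    by (intro wp_SetCell) auto
next
  fix M' assume "(\<forall>b. b \<noteq> 14 \<longrightarrow> M' b = M b) \<and> (\<forall>i j. M' 14 i j = (if i = j \<and> i < R 0 then 1 else 0))"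
  then show "Q M'" using R by (intro Q) (auto simp: idm_def)
qed (use R M in auto)

section \<open>Computing a rank-one decomposition\<close>

definition Lc :: "cells \<Rightarrow> nat \<Rightarrow> nat \<Rightarrow> complex" where
  "Lc M k = (\<lambda>i. M 21 i k)"

lemma Lc_setV [simp]: "Lc (setV n k v M) l = Lc M l"
  by (simp add: Lc_def)

lemma Lc_put_col [simp]: "Lc (put_col n 21 k v M) l = (if l = k then cut n v (Lc M k) else Lc M l)"
  by (auto simp: Lc_def put_col_def cut_def fun_eq_iff)

definition decomp :: "nat \<Rightarrow> (nat \<Rightarrow> nat \<Rightarrow> complex) \<Rightarrow> nat \<Rightarrow> (nat \<Rightarrow> nat \<Rightarrow> complex) \<Rightarrow> bool" where
  "decomp n X l x \<longleftrightarrow> (\<forall>i<n. \<forall>j<n. X i j = (\<Sum>k<l. x k i * cnj (x k j)))"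

text \<open>The least root of \<open>x\<^sup>2 - d\<close> is \<open>- sqrt d\<close>; the sign does not affect the rank-one term.\<close>

definition Decompose :: "nat \<Rightarrow> prog" where
  "Decompose xa = Then (Map2 20 (Cell xa (NReg 3) (NReg 4)))
     (For 1 (Then (Copy 5 14 (NReg 1)) (Then Deflate
        (Map1 21 (NReg 1) (CDiv (Cell 22 (NReg 3) (NNum 6)) (Root [CSub (CNum 0) (Sc 0), CNum 0, CNum 1]))))))"

text \<open>The loop is the elimination of \<open>psd_decomposition\<close>, with the columns of the
  identity in array 14 as unit vectors; its invariant extends the statement proved by induction
  there.\<close>

lemma (in base_field) wp_Decompose:
  assumes R: "R 1 = 0" "R 3 = 0" "R 4 = 0" "R 0 = n" and xa: "xa \<notin> {20, 21, 22, 24}"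
    and X: "psd_fun n (M xa)" and I: "\<And>i j. i < n \<Longrightarrow> j < n \<Longrightarrow> M 14 i j = idm i j"
    and Q: "\<And>M'. (\<And>b. b \<notin> {20, 21, 22, 24} \<Longrightarrow> M' b = M b) \<Longrightarrow> (\<And>k. k \<notin> {5, 6} \<Longrightarrow> Vc M' k = Vc M k) \<Longrightarrow>
       (\<And>k. k < n \<Longrightarrow> vecF n (Lc M' k)) \<Longrightarrow> decomp n (M xa) n (Lc M') \<Longrightarrow> Q M'"
  shows "wp R (Decompose xa) Q M"
  unfolding Decompose_def
proof (rule wp_Then, rule wp_Map2[where v = "M xa"])
  show "cval (R(3 := i, 4 := j), M') (Cell xa (NReg 3) (NReg 4)) = M xa i j"
    if "agree_but {(20, k, l) |k l. k < i \<or> k = i \<and> l < j} M M'" for i j M'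
    using that xa by (auto simp: agree_but_def)
  let ?M1 = "put_mat (R 0) 20 (M xa) M"
  let ?I = "\<lambda>k M'. (\<forall>b. b \<notin> {20, 21, 22, 24} \<longrightarrow> M' b = M b) \<and> (\<forall>k. k \<notin> {5, 6} \<longrightarrow> Vc M' k = Vc M k) \<and>
     psd_fun n (M' 20) \<and> (\<forall>l<k. \<forall>i<n. M' 20 i l = 0) \<and> (\<forall>l<k. vecF n (Lc M' l)) \<and>
     (\<forall>i<n. \<forall>j<n. M xa i j = M' 20 i j + (\<Sum>l<k. Lc M' l i * cnj (Lc M' l j)))"
  let ?P = "Then (Copy 5 14 (NReg 1)) (Then Deflate
        (Map1 21 (NReg 1) (CDiv (Cell 22 (NReg 3) (NNum 6)) (Root [CSub (CNum 0) (Sc 0), CNum 0, CNum 1]))))"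
  show "wp R (For 1 ?P) Q ?M1"
  proof (rule wp_For[where I = ?I])
    have "psd_fun n (?M1 20)"
      using psd_fun_cong[of n "?M1 20" "M xa"] X R by (simp add: put_mat_def)
    moreover have "?M1 20 i j = M xa i j" if "i < n" "j < n" for i j
      using that R by (simp add: put_mat_def)
    ultimately show "?I 0 ?M1" by auto
  next
    fix M' assume "?I (R 0) M'"
    then show "Q M'" using R by (intro Q) (auto simp: decomp_def)
  next
    fix k M' assume k: "k < R 0" and I': "?I k M'"
    let ?u = "\<lambda>i. M' 14 i k"
    let ?M2 = "setV n 5 ?u M'"
    let ?S = "M' 20"
    have S: "psd_fun n ?S" "hermitian_fun n ?S" using I' by (auto simp: psd_fun_def)
    have M'14: "M' 14 = M 14" using conjunct1[OF I'] by simp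
    have u: "?u i = unitf k i" if "i < n" for i
      using I[OF that, of k] k R by (simp add: M'14 idm_def unitf_def)
    have mvu: "mv n T ?u = mv n T (unitf k)" for T by (simp add: mv_def fun_eq_iff u)
    have qu: "qform n T ?u = qform n T (unitf k)" for T by (rule qform_cong) (rule u)
    have du: "defl n ?u T = defl n (unitf k) T" for T by (simp add: defl_def mvu qu fun_eq_iff)
    let ?q = "qform n ?S (unitf k)"
    define \<rho> where "\<rho> = complex_of_real (least_real_root (Poly [- ?q, 0, 1]))"
    have q: "?q \<ge> 0" using S vecF_unitf by (simp add: psd_fun_def)
    have rho: "\<rho> * cnj \<rho> = complex_of_real ?q" "\<rho> \<in> F"
      using root_sqrt[OF q] by (simp_all add: \<rho>_def power2_eq_square flip: of_real_mult)
    define w where "w i = mv n ?S (unitf k) i / \<rho>" for i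
    have w: "vecF n w"
      using vecF_mv[OF _ vecF_unitf, of n ?S k] S(1) rho(2) by (auto simp: vecF_def w_def psd_fun_def)
    have ww: "?S i j = defl n (unitf k) ?S i j + w i * cnj (w j)" for i j
      by (simp add: defl_def w_def rho(1))
    have kernel: "defl n (unitf k) ?S i l = 0" if "l < Suc k" "i < n" for l i
    proof -
      have "mv n (defl n (unitf k) ?S) (unitf l) i = 0"
      proof (cases "l = k")
        case True
        then show ?thesis using mv_defl_self[OF S(1) vecF_unitf that(2)] by simp
      next
        case False
        then show ?thesis using that k R I'
          by (intro mv_defl_kernel[OF S(1)]) (auto simp: mv_unitf)
      qed
      then show ?thesis using that k R by (simp add: mv_unitf)
    qed
    show "wp (R(1 := k)) ?P (?I (Suc k)) M'"
    proof (intro wp_Then wp_Copy)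
      show "wp (R(1 := k)) Deflate (wp (R(1 := k)) (Map1 21 (NReg 1)
          (CDiv (Cell 22 (NReg 3) (NNum 6)) (Root [CSub (CNum 0) (Sc 0), CNum 0, CNum 1]))) (?I (Suc k)))
        (setV ((R(1 := k)) 0) 5 (\<lambda>i. M' 14 i (nval (R(1 := k)) (NReg 1))) M')"
      proof (rule wp_Deflate[where n = n])
        fix M3 assume "\<And>b. b \<notin> {20, 22, 24} \<Longrightarrow> M3 b = setV ((R(1 := k)) 0) 5 (\<lambda>i. M' 14 i (nval (R(1 := k)) (NReg 1))) M' b"
          and "\<And>l. l \<noteq> 6 \<Longrightarrow> Vc M3 l = Vc (setV ((R(1 := k)) 0) 5 (\<lambda>i. M' 14 i (nval (R(1 := k)) (NReg 1))) M') l"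
          and "\<And>i. i < n \<Longrightarrow> Vc M3 6 i = mv n (setV ((R(1 := k)) 0) 5 (\<lambda>i. M' 14 i (nval (R(1 := k)) (NReg 1))) M' 20)
                 (Vc (setV ((R(1 := k)) 0) 5 (\<lambda>i. M' 14 i (nval (R(1 := k)) (NReg 1))) M') 5) i"
          and "Sv M3 0 = complex_of_real (qform n (setV ((R(1 := k)) 0) 5 (\<lambda>i. M' 14 i (nval (R(1 := k)) (NReg 1))) M' 20)
                 (Vc (setV ((R(1 := k)) 0) 5 (\<lambda>i. M' 14 i (nval (R(1 := k)) (NReg 1))) M') 5))"
          and "\<And>i j. i < n \<Longrightarrow> j < n \<Longrightarrow> M3 20 i j
              = defl n (Vc (setV ((R(1 := k)) 0) 5 (\<lambda>i. M' 14 i (nval (R(1 := k)) (NReg 1))) M') 5)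
                  (setV ((R(1 := k)) 0) 5 (\<lambda>i. M' 14 i (nval (R(1 := k)) (NReg 1))) M' 20) i j"
        then have 3: "\<And>b. b \<notin> {20, 22, 24} \<Longrightarrow> M3 b = M' b" "\<And>l. l \<notin> {5, 6} \<Longrightarrow> Vc M3 l = Vc M' l"
          "\<And>i. i < n \<Longrightarrow> Vc M3 6 i = mv n ?S (unitf k) i" "Sv M3 0 = complex_of_real ?q"
          "\<And>i j. i < n \<Longrightarrow> j < n \<Longrightarrow> M3 20 i j = defl n (unitf k) ?S i j"
          using R by (simp_all add: mvu qu du)
        show "wp (R(1 := k)) (Map1 21 (NReg 1)
          (CDiv (Cell 22 (NReg 3) (NNum 6)) (Root [CSub (CNum 0) (Sc 0), CNum 0, CNum 1]))) (?I (Suc k)) M3"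
        proof (rule wp_Map1[where v = w and k = k])
          fix i M4 assume i: "i < (R(1 := k)) 0" and M4: "agree_but {(21, j, k) |j. j < i} M3 M4"
          have "M4 22 i 6 = Vc M3 6 i" "M4 24 0 0 = Sv M3 0"
            using M4 by (auto simp: agree_but_def Vc_def Sv_def)
          then show "cval ((R(1 := k))(3 := i), M4) (CDiv (Cell 22 (NReg 3) (NNum 6))
              (Root [CSub (CNum 0) (Sc 0), CNum 0, CNum 1])) = w i"
            using i R 3(3,4) by (simp add: w_def \<rho>_def)
        next
          let ?M5 = "put_col n 21 k w M3"
          have psd3: "psd_fun n (M3 20)"
            using psd_fun_cong[of n "M3 20" "defl n (unitf k) ?S"] 3(5) psd_defl[OF S(1) vecF_unitf] by simp
          have L3: "Lc M3 l = Lc M' l" for l using 3(1)[of 21] by (simp add: Lc_def)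
          have "vecF n (Lc ?M5 l)" if "l < Suc k" for l
            using that w I' by (cases "l = k") (auto simp: L3)
          moreover have "M xa i j = ?M5 20 i j + (\<Sum>l<Suc k. Lc ?M5 l i * cnj (Lc ?M5 l j))"
            if "i < n" "j < n" for i j
            using I' that ww[of i j] 3(5)[OF that] by (simp add: L3)
          ultimately have "?I (Suc k) ?M5"
            using I' 3 kernel k R psd3 by auto
          then show "?I (Suc k) (put_col ((R(1 := k)) 0) 21 k w M3)" using R by simp
        qed (use R in auto)
      qed (use R S in auto)
    qed (use R in auto)
  qed (use R in auto)
qed (use R in auto)

section \<open>Finding a third kernel vector\<close>

definition AddConstraint :: "nat \<Rightarrow> nexp \<Rightarrow> prog" where
  "AddConstraint a c = Then (Copy 5 a c) Deflate"

lemma (in base_field) wp_AddConstraint: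
  assumes R: "R 3 = 0" "R 4 = 0" "R 0 = n" "\<And>i. nval (R(3 := i)) c = nval R c"
    and h: "psd_fun n (M 20)"
    and Q: "\<And>M'. (\<And>b. b \<notin> {20, 22, 24} \<Longrightarrow> M' b = M b) \<Longrightarrow> (\<And>k. k \<notin> {5, 6} \<Longrightarrow> Vc M' k = Vc M k) \<Longrightarrow>
        (\<And>i j. i < n \<Longrightarrow> j < n \<Longrightarrow> M' 20 i j = defl n (\<lambda>i. M a i (nval R c)) (M 20) i j) \<Longrightarrow> Q M'"
  shows "wp R (AddConstraint a c) Q M"
  unfolding AddConstraint_def
proof (intro wp_Then wp_Copy)
  show "wp R Deflate Q (setV (R 0) 5 (\<lambda>i. M a i (nval R c)) M)"
    by (rule wp_Deflate[where n = n])
       (use R h in \<open>auto simp: psd_fun_def intro!: Q\<close>)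
qed (use R in auto)

text \<open>Deflating the identity by all columns of Z and by the two given vectors leaves the
  orthogonal projection onto their common complement. As Z is Hermitian, this complement lies in its
  kernel, and any nonzero column of the projection will do. If there is none, vector 3 keeps its
  initial value.\<close>

definition FindKernel :: "nat \<Rightarrow> prog" where
  "FindKernel za = Then (Map2 20 (Cell 14 (NReg 3) (NReg 4)))
    (Then (For 1 (AddConstraint za (NReg 1)))
    (Then (AddConstraint 22 (NNum 1)) (Then (AddConstraint 22 (NNum 2))
    (For 1 (Then (Copy 4 20 (NReg 1)) (Then (FormV 1 14 4 4)
       (IfElse (ReLess (CNum 0) (Sc 1)) (Copy 3 22 (NNum 4)) Skip)))))))"

context base_field begin

text \<open>S is the orthogonal projection onto the complement of T, described by its action on T
  and on the complement because a deflation step preserves this description.\<close>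

definition ker_inv :: "nat \<Rightarrow> (nat \<Rightarrow> complex) set \<Rightarrow> (nat \<Rightarrow> nat \<Rightarrow> complex) \<Rightarrow> bool" where
  "ker_inv n T S \<longleftrightarrow> psd_fun n S \<and> (\<forall>a\<in>T. \<forall>i<n. mv n S a i = 0) \<and>
     (\<forall>b. (\<forall>a\<in>T. sform n idm a b = 0) \<longrightarrow> (\<forall>i<n. mv n S b i = b i))"

lemma mv_cong: "(\<And>i j. i < n \<Longrightarrow> j < n \<Longrightarrow> S i j = S' i j) \<Longrightarrow> i < n \<Longrightarrow> mv n S a i = mv n S' a i"
  by (simp add: mv_def)

lemma ker_inv_cong:
  assumes "\<And>i j. i < n \<Longrightarrow> j < n \<Longrightarrow> S i j = S' i j"
  shows "ker_inv n T S \<longleftrightarrow> ker_inv n T S'"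
  unfolding ker_inv_def using psd_fun_cong[of n S S'] mv_cong[of n S S'] assms by simp

lemma ker_inv_idm: "ker_inv n {} idm"
proof -
  have "matF n idm" by (auto simp: matF_def idm_def)
  moreover have "mv n idm b i = b i" if "i < n" for b i
  proof -
    have "idm i k * b k = (if k = i then b i else 0)" for k by (simp add: idm_def)
    then show ?thesis using that by (simp add: mv_def)
  qed
  ultimately show ?thesis by (auto simp: ker_inv_def psd_fun_def qform_idm_nonneg)
qed

lemma ker_inv_defl:
  assumes "ker_inv n T S" "vecF n a"
  shows "ker_inv n (insert a T) (defl n a S)"
  using assms psd_defl mv_defl_self mv_defl_kernel mv_defl_fixed
  unfolding ker_inv_def by (auto simp: sform_idm)

lemma ker_inv_col:
  assumes S: "ker_inv n T S" and k: "k < n"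
  shows "vecF n (\<lambda>i. S i k)" and "a \<in> T \<Longrightarrow> sform n idm a (\<lambda>i. S i k) = 0"
proof -
  have p: "psd_fun n S" using S by (simp add: ker_inv_def)
  then show "vecF n (\<lambda>i. S i k)" using k by (auto simp: psd_fun_def matF_def vecF_def)
  assume "a \<in> T"
  then have "mv n S a k = 0" using S k by (simp add: ker_inv_def)
  moreover have "S k i = cnj (S i k)" if "i < n" for i
    using p that k unfolding psd_fun_def hermitian_fun_def by blast
  then have "mv n S a k = (\<Sum>i<n. cnj (S i k) * a i)" by (simp add: mv_def)
  then have "mv n S a k = cnj (sform n idm a (\<lambda>i. S i k))" by (simp add: sform_idm mult.commute)
  ultimately show "sform n idm a (\<lambda>i. S i k) = 0" by simp
qed

text \<open>A nonzero y orthogonal to T is fixed by S, so S cannot have only zero columns.\<close>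

lemma ker_inv_nonzero:
  assumes S: "ker_inv n T S" and y: "\<And>a. a \<in> T \<Longrightarrow> sform n idm a y = 0" "qform n idm y \<noteq> 0"
  shows "\<exists>k<n. qform n idm (\<lambda>i. S i k) \<noteq> 0"
proof (rule ccontr)
  assume "\<not> ?thesis"
  then have "S i k = 0" if "i < n" "k < n" for i k
    using that qform_idm_zero_iff by metis
  then have "mv n S y i = 0" if "i < n" for i using that by (simp add: mv_def)
  moreover have "mv n S y i = y i" if "i < n" for i
    using that S y(1) by (simp add: ker_inv_def)
  ultimately show False using y(2) qform_idm_zero_iff by metis
qed

lemma qform_idm_cong_mat:
  assumes "\<And>i j. i < n \<Longrightarrow> j < n \<Longrightarrow> B i j = idm i j"
  shows "sform n B x y = sform n idm x y" "qform n B x = qform n idm x"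
  using assms by (auto simp: qform_def intro!: sform_cong arg_cong[of _ _ Re])

lemma wp_FindKernel:
  assumes R: "R 1 = 0" "R 3 = 0" "R 4 = 0" "R 0 = n" and za: "za \<notin> {20, 22, 24}"
    and I: "\<And>i j. i < n \<Longrightarrow> j < n \<Longrightarrow> M 14 i j = idm i j" and Z: "hermitian_fun n (M za)" "matF n (M za)"
    and V: "vecF n (Vc M 1)" "vecF n (Vc M 2)" "\<And>i. i < n \<Longrightarrow> Vc M 3 i = 0"
    and Q: "\<And>M'. (\<And>b. b \<notin> {20, 22, 24} \<Longrightarrow> M' b = M b) \<Longrightarrow> (\<And>k. k \<notin> {3, 4, 5, 6} \<Longrightarrow> Vc M' k = Vc M k) \<Longrightarrow>
      vecF n (Vc M' 3) \<Longrightarrow> (\<And>i. i < n \<Longrightarrow> mv n (M za) (Vc M' 3) i = 0) \<Longrightarrow>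
      sform n idm (Vc M 1) (Vc M' 3) = 0 \<Longrightarrow> sform n idm (Vc M 2) (Vc M' 3) = 0 \<Longrightarrow>
      (\<And>y. qform n idm y \<noteq> 0 \<Longrightarrow> (\<And>i. i < n \<Longrightarrow> mv n (M za) y i = 0) \<Longrightarrow>
         sform n idm (Vc M 1) y = 0 \<Longrightarrow> sform n idm (Vc M 2) y = 0 \<Longrightarrow> qform n idm (Vc M' 3) \<noteq> 0) \<Longrightarrow> Q M'"
  shows "wp R (FindKernel za) Q M"
  unfolding FindKernel_def
proof (rule wp_Then, rule wp_Map2[where v = "M 14"])
  show "cval (R(3 := i, 4 := j), M') (Cell 14 (NReg 3) (NReg 4)) = M 14 i j"
    if "agree_but {(20, k, l) |k l. k < i \<or> k = i \<and> l < j} M M'" for i j M'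
    using that by (auto simp: agree_but_def)
  let ?M1 = "put_mat (R 0) 20 (M 14) M"
  let ?col = "\<lambda>l i. M za i l"
  let ?fr = "\<lambda>M'. (\<forall>b. b \<notin> {20, 22, 24} \<longrightarrow> M' b = M b) \<and> (\<forall>k. k \<notin> {5, 6} \<longrightarrow> Vc M' k = Vc M k)"
  let ?P = "Then (Copy 4 20 (NReg 1)) (Then (FormV 1 14 4 4)
       (IfElse (ReLess (CNum 0) (Sc 1)) (Copy 3 22 (NNum 4)) Skip))"
  show "wp R (Then (For 1 (AddConstraint za (NReg 1)))
    (Then (AddConstraint 22 (NNum 1)) (Then (AddConstraint 22 (NNum 2)) (For 1 ?P)))) Q ?M1"
  proof (rule wp_Then, rule wp_For[where I = "\<lambda>l M'. ?fr M' \<and> ker_inv n (?col ` {..<l}) (M' 20)"])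
    have "?M1 20 i j = idm i j" if "i < n" "j < n" for i j
      using that I R by simp
    then have "ker_inv n {} (?M1 20)" using ker_inv_cong[of n "?M1 20" idm] ker_inv_idm by simp
    then show "?fr ?M1 \<and> ker_inv n (?col ` {..<0}) (?M1 20)" by simp
  next
    fix l M' assume l: "l < R 0" and M': "?fr M' \<and> ker_inv n (?col ` {..<l}) (M' 20)"
    have zl: "vecF n (?col l)" using Z l R by (auto simp: matF_def vecF_def)
    have Mza: "M' za = M za" using za conjunct1[OF conjunct1[OF M']] by simp
    show "wp (R(1 := l)) (AddConstraint za (NReg 1)) (\<lambda>M'. ?fr M' \<and> ker_inv n (?col ` {..<Suc l}) (M' 20)) M'"
    proof (rule wp_AddConstraint[where n = n])
      fix M2 assume 2: "\<And>b. b \<notin> {20, 22, 24} \<Longrightarrow> M2 b = M' b" "\<And>k. k \<notin> {5, 6} \<Longrightarrow> Vc M2 k = Vc M' k"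
        "\<And>i j. i < n \<Longrightarrow> j < n \<Longrightarrow> M2 20 i j = defl n (\<lambda>i. M' za i (nval (R(1 := l)) (NReg 1))) (M' 20) i j"
      then have "\<And>i j. i < n \<Longrightarrow> j < n \<Longrightarrow> M2 20 i j = defl n (?col l) (M' 20) i j" by (simp add: Mza)
      from ker_inv_cong[of n "M2 20", OF this]
      have "ker_inv n (?col ` {..<Suc l}) (M2 20)"
        using ker_inv_defl[OF conjunct2[OF M'] zl] by (simp add: lessThan_Suc)
      then show "?fr M2 \<and> ker_inv n (?col ` {..<Suc l}) (M2 20)" using 2 M' by simp
    qed (use R M' in \<open>auto simp: ker_inv_def\<close>)
  next
    fix M' assume M': "?fr M' \<and> ker_inv n (?col ` {..<R 0}) (M' 20)"
    have M'V: "(\<lambda>i. M' 22 i (nval R (NNum 1))) = Vc M 1" using M' by (simp flip: Vc_def)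
    show "wp R (Then (AddConstraint 22 (NNum 1)) (Then (AddConstraint 22 (NNum 2)) (For 1 ?P))) Q M'"
    proof (rule wp_Then, rule wp_AddConstraint[where n = n])
      fix M2 assume 2: "\<And>b. b \<notin> {20, 22, 24} \<Longrightarrow> M2 b = M' b" "\<And>k. k \<notin> {5, 6} \<Longrightarrow> Vc M2 k = Vc M' k"
        "\<And>i j. i < n \<Longrightarrow> j < n \<Longrightarrow> M2 20 i j = defl n (\<lambda>i. M' 22 i (nval R (NNum 1))) (M' 20) i j"
      have M2: "?fr M2" using M' 2 by simp
      have k2: "ker_inv n (insert (Vc M 1) (?col ` {..<n})) (M2 20)"
        using ker_inv_cong[of n "M2 20", OF 2(3)[unfolded M'V]] ker_inv_defl[OF conjunct2[OF M'] V(1)] R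
        by simp
      have M2V: "(\<lambda>i. M2 22 i (nval R (NNum 2))) = Vc M 2" using M2 by (simp flip: Vc_def)
      show "wp R (Then (AddConstraint 22 (NNum 2)) (For 1 ?P)) Q M2"
      proof (rule wp_Then, rule wp_AddConstraint[where n = n])
        fix M3 assume 3: "\<And>b. b \<notin> {20, 22, 24} \<Longrightarrow> M3 b = M2 b" "\<And>k. k \<notin> {5, 6} \<Longrightarrow> Vc M3 k = Vc M2 k"
        "\<And>i j. i < n \<Longrightarrow> j < n \<Longrightarrow> M3 20 i j = defl n (\<lambda>i. M2 22 i (nval R (NNum 2))) (M2 20) i j"
        let ?T = "insert (Vc M 2) (insert (Vc M 1) (?col ` {..<n}))"
        have M3: "?fr M3" using M2 3 by simp
        have k3: "ker_inv n ?T (M3 20)"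
          using ker_inv_cong[of n "M3 20", OF 3(3)[unfolded M2V]] ker_inv_defl[OF k2 V(2)] by simp
        \<comment> \<open>The columns of a Hermitian matrix are the conjugates of its rows, so
          orthogonality to all columns means membership in the kernel.\<close>
        have Zorth: "(\<forall>i<n. mv n (M za) y i = 0) \<longleftrightarrow> (\<forall>l<n. sform n idm (?col l) y = 0)" for y
        proof -
          have "sform n idm (?col l) y = mv n (M za) y l" if "l < n" for l
          proof -
            have "M za l i = cnj (M za i l)" if "i < n" for i
              using Z(1) that \<open>l < n\<close> unfolding hermitian_fun_def by blast
            then show ?thesis by (simp add: sform_idm mv_def)
          qed
          then show ?thesis by simp
        qed
        let ?orth = "\<lambda>y. \<forall>a\<in>?T. sform n idm a y = 0"
        let ?J = "\<lambda>k M'. (\<forall>b. b \<notin> {20, 22, 24} \<longrightarrow> M' b = M b) \<and> (\<forall>k. k \<notin> {3, 4, 5, 6} \<longrightarrow> Vc M' k = Vc M k) \<and>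
          M' 20 = M3 20 \<and> vecF n (Vc M' 3) \<and> ?orth (Vc M' 3) \<and>
          ((\<exists>l<k. qform n idm (\<lambda>i. M3 20 i l) \<noteq> 0) \<longrightarrow> qform n idm (Vc M' 3) \<noteq> 0)"
        show "wp R (For 1 ?P) Q M3"
        proof (rule wp_For[where I = ?J])
          have "Vc M3 3 = Vc M 3" using M3 by simp
          moreover have "sform n idm a (Vc M 3) = 0" for a using V(3) by (simp add: sform_idm)
          ultimately show "?J 0 M3" using M3 V(3) by (auto simp: vecF_def)
        next
          fix k M4 assume k: "k < R 0" and M4: "?J k M4"
          let ?c = "\<lambda>i. M3 20 i k"
          have c: "vecF n ?c" "?orth ?c" using ker_inv_col[OF k3] k R by auto
          note id4 = qform_idm_cong_mat[of n "M 14", OF I, folded R(4)]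
          have sc: "sform n idm ?c ?c = complex_of_real (qform n idm ?c)" by (rule sform_self) simp
          show "wp (R(1 := k)) ?P (?J (Suc k)) M4"
          proof (intro wp_Then wp_Copy wp_FormV wp_IfElse wp_Skip; (simp only:)?)
          qed (use R c M4 sc qform_idm_nonneg[of n ?c] in \<open>auto simp: less_Suc_eq id4 simp flip: Sv_def Vc_def\<close>)
        next
          fix M4 assume M4: "?J (R 0) M4"
          have "qform n idm (Vc M4 3) \<noteq> 0" if "qform n idm y \<noteq> 0" "?orth y" for y
            using ker_inv_nonzero[OF k3, of y] that M4 R by auto
          moreover have "?orth y \<longleftrightarrow> sform n idm (Vc M 2) y = 0 \<and> sform n idm (Vc M 1) y = 0 \<and> (\<forall>i<n. mv n (M za) y i = 0)" for y
            unfolding Zorth by auto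
          ultimately show "Q M4" using M4 by (intro Q) auto
        qed (use R in auto)
      qed (use R k2 in \<open>auto simp: ker_inv_def\<close>)
    qed (use R M' in \<open>auto simp: ker_inv_def\<close>)
  qed (use R in auto)
qed (use R in auto)

end

section \<open>Rotating the summands of a decomposition\<close>

lemma Lc_put [simp]: "Lc (put t z M) = Lc M"
  by (simp add: Lc_def fun_eq_iff)

lemma sum_two:
  fixes g :: "'a \<Rightarrow> 'b::comm_monoid_add"
  assumes "finite K" "p \<in> K" "q \<in> K" "p \<noteq> q"
  shows "sum g K = g p + g q + sum g (K - {p, q})"
proof -
  have "sum g K = g p + (g q + sum g (K - {p} - {q}))"
    using assms by (simp add: sum.remove[of K p] sum.remove[of "K - {p}" q])
  then show ?thesis by (simp add: add.assoc Diff_insert2[symmetric] insert_commute)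
qed

text \<open>
  A Givens rotation of two terms of a rank-one decomposition: it preserves the sum of the two
  rank-one matrices and, if the angle is chosen as a root of a quadratic equation, makes the form
  \<open>f\<close> vanish at the first vector. A phase \<open>\<omega>\<close> with \<open>Re (\<omega> x\<^sup>H g y) = 0\<close> keeps the
  form \<open>g\<close> zero.
\<close>

locale rotation =
  fixes n :: nat and x y :: "nat \<Rightarrow> complex" and \<tau> \<sigma> :: complex
  assumes sigma: "\<sigma> * cnj \<sigma> = 1 + \<tau> * cnj \<tau>"
begin

definition "xr i = (x i + \<tau> * y i) / \<sigma>"
definition "yr i = (y i - cnj \<tau> * x i) / \<sigma>"

lemma sigma_ne: "\<sigma> \<noteq> 0"
proof
  assume "\<sigma> = 0"
  then have "1 + \<tau> * cnj \<tau> = 0" using sigma by simp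
  then have "Re (1 + \<tau> * cnj \<tau>) = 0" by simp
  then have "1 + ((Re \<tau>)\<^sup>2 + (Im \<tau>)\<^sup>2) = 0" by (simp add: power2_eq_square)
  then show False by (smt (verit) sum_power2_ge_zero)
qed

text \<open>The choice of \<sigma> makes the transformation from (x, y) to (xr, yr) unitary.\<close>

lemma outer_sum: "xr i * cnj (xr j) + yr i * cnj (yr j) = x i * cnj (x j) + y i * cnj (y j)"
proof -
  have "xr i * cnj (xr j) + yr i * cnj (yr j)
    = ((x i + \<tau> * y i) * cnj (x j + \<tau> * y j) + (y i - cnj \<tau> * x i) * cnj (y j - cnj \<tau> * x j)) / (\<sigma> * cnj \<sigma>)"
    unfolding xr_def yr_def complex_cnj_divide times_divide_times_eq by (rule add_divide_distrib[symmetric])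
  also have "\<dots> = (1 + \<tau> * cnj \<tau>) * (x i * cnj (x j) + y i * cnj (y j)) / (\<sigma> * cnj \<sigma>)"
    by (simp add: algebra_simps)
  also have "\<dots> = x i * cnj (x j) + y i * cnj (y j)"
    unfolding sigma[symmetric] using sigma_ne by simp
  finally show ?thesis .
qed

lemma xr_comb: "xr = (\<lambda>i. (1 / \<sigma>) * x i + (\<tau> / \<sigma>) * y i)"
  by (simp add: xr_def fun_eq_iff add_divide_distrib)

lemma yr_comb: "yr = (\<lambda>i. (- cnj \<tau> / \<sigma>) * x i + (1 / \<sigma>) * y i)"
  by (simp add: yr_def fun_eq_iff diff_divide_distrib)

lemma qform_xr:
  assumes "hermitian_fun n f"
  shows "qform n f xr = (qform n f x + 2 * Re (\<tau> * sform n f x y) + (cmod \<tau>)\<^sup>2 * qform n f y) / (cmod \<sigma>)\<^sup>2"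
proof -
  have "Re (cnj (1 / \<sigma>) * (\<tau> / \<sigma>) * sform n f x y) = Re (\<tau> * sform n f x y / complex_of_real ((cmod \<sigma>)\<^sup>2))"
    unfolding complex_norm_square by (simp add: mult.commute)
  also have "\<dots> = Re (\<tau> * sform n f x y) / (cmod \<sigma>)\<^sup>2" by (rule Re_divide_of_real)
  finally show ?thesis
    unfolding xr_comb qform_comb2[OF assms]
    by (simp add: norm_divide power_divide add_divide_distrib)
qed

text \<open>With g zero at x and y, the values at the rotated vectors consist of cross terms only,
  and these are real multiples of \<open>Re (\<tau> * sform n g x y)\<close>.\<close>

lemma qform_xr_zero:
  assumes "hermitian_fun n g" "qform n g x = 0" "qform n g y = 0" "Re (\<tau> * sform n g x y) = 0"
  shows "qform n g xr = 0" "qform n g yr = 0"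
proof -
  show "qform n g xr = 0" unfolding qform_xr[OF assms(1)] using assms by simp
  have "cnj (- cnj \<tau> / \<sigma>) * (1 / \<sigma>) * sform n g x y = - (\<tau> * sform n g x y / complex_of_real ((cmod \<sigma>)\<^sup>2))"
    unfolding complex_norm_square by (simp add: mult.commute)
  then have "Re (cnj (- cnj \<tau> / \<sigma>) * (1 / \<sigma>) * sform n g x y) = - (Re (\<tau> * sform n g x y) / (cmod \<sigma>)\<^sup>2)"
    by (simp only: Re_divide_of_real uminus_complex.sel)
  then show "qform n g yr = 0"
    unfolding yr_comb qform_comb2[OF assms(1)] using assms by simp
qed

end

text \<open>Deliberately not of modulus one: \<open>\<i> * cnj z\<close> costs no square root, and
  only the direction matters since it is multiplied by a real t. For z = 0, which is always the case
  with the zero form, it is 1, and this keeps the real case within the reals.\<close>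

definition phase :: "complex \<Rightarrow> complex" where
  "phase z = (if z = 0 then 1 else \<i> * cnj z)"

lemma phase_ne [simp]: "phase z \<noteq> 0"
  by (simp add: phase_def)

lemma phase_orth: "Re (complex_of_real t * phase z * z) = 0"
  by (simp add: phase_def)

text \<open>Expects the values of f at the two columns in scalars 0 and 1, their cross term in 2 and
  the phase in 4. Scalar 5 becomes \<tau>, and 6 becomes a square root \<sigma> of
  \<open>1 + |\<tau>|^2\<close>. Real parts of the coefficients are taken by \<open>Root\<close>
  itself.\<close>

definition Rotate :: prog where
  "Rotate = Then (SetSc 5 (CMul (Root [Sc 0, CMul (CNum 2) (CMul (Sc 4) (Sc 2)), CMul (CMul (Sc 4) (Conj (Sc 4))) (Sc 1)]) (Sc 4)))
    (Then (SetSc 6 (Root [CSub (CNum 0) (CAdd (CNum 1) (CMul (Sc 5) (Conj (Sc 5)))), CNum 0, CNum 1]))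
    (Then (Copy 7 21 (NReg 1))
    (Then (Map1 21 (NReg 1) (CDiv (CAdd (Cell 22 (NReg 3) (NNum 7)) (CMul (Sc 5) (Cell 21 (NReg 3) (NReg 2)))) (Sc 6)))
          (Map1 21 (NReg 2) (CDiv (CSub (Cell 21 (NReg 3) (NReg 2)) (CMul (Conj (Sc 5)) (Cell 22 (NReg 3) (NNum 7)))) (Sc 6))))))"

lemma nonzero_test: "0 < Re (z * cnj z) \<longleftrightarrow> z \<noteq> 0"
proof -
  have "z * cnj z = complex_of_real ((cmod z)\<^sup>2)" by (rule complex_norm_square[symmetric])
  then show ?thesis by simp
qed

text \<open>Opposite signs of f at the two columns make the quadratic equation for t solvable: the
  product of its end coefficients is negative.\<close>

lemma (in base_field) wp_Rotate:
  assumes R: "R 3 = 0" "R 0 = n" "R 1 = p" "R 2 = q" "p \<noteq> q"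
    and f: "hermitian_fun n f" and g: "hermitian_fun n g"
    and vF: "vecF n (Lc M p)" "vecF n (Lc M q)"
    and S: "Sv M 0 = complex_of_real (qform n f (Lc M p))" "Sv M 1 = complex_of_real (qform n f (Lc M q))"
      "Sv M 2 = sform n f (Lc M p) (Lc M q)" "Sv M 4 = phase (sform n g (Lc M p) (Lc M q))"
    and om: "phase (sform n g (Lc M p) (Lc M q)) \<in> F"
    and neg: "qform n f (Lc M p) * qform n f (Lc M q) < 0"
    and g0: "qform n g (Lc M p) = 0" "qform n g (Lc M q) = 0"
    and Q: "\<And>M'. (\<And>b. b \<notin> {21, 22, 24} \<Longrightarrow> M' b = M b) \<Longrightarrow> (\<And>k. k \<noteq> 7 \<Longrightarrow> Vc M' k = Vc M k) \<Longrightarrow>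
      (\<And>k. k \<notin> {p, q} \<Longrightarrow> Lc M' k = Lc M k) \<Longrightarrow> vecF n (Lc M' p) \<Longrightarrow> vecF n (Lc M' q) \<Longrightarrow>
      (\<And>i j. i < n \<Longrightarrow> j < n \<Longrightarrow> Lc M' p i * cnj (Lc M' p j) + Lc M' q i * cnj (Lc M' q j)
         = Lc M p i * cnj (Lc M p j) + Lc M q i * cnj (Lc M q j)) \<Longrightarrow>
      qform n f (Lc M' p) = 0 \<Longrightarrow> qform n g (Lc M' p) = 0 \<Longrightarrow> qform n g (Lc M' q) = 0 \<Longrightarrow> Q M'"
  shows "wp R Rotate Q M"
proof -
  let ?x = "Lc M p" and ?y = "Lc M q"
  define om where "om = phase (sform n g ?x ?y)"
  define t where "t = least_real_root (Poly [qform n f ?x, 2 * Re (om * sform n f ?x ?y), (cmod om)\<^sup>2 * qform n f ?y])"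
  define \<tau> where "\<tau> = complex_of_real t * om"
  define \<sigma> where "\<sigma> = complex_of_real (least_real_root (Poly [- (1 + (cmod \<tau>)\<^sup>2), 0, 1]))"
  have tt: "\<tau> * cnj \<tau> = complex_of_real ((cmod \<tau>)\<^sup>2)" by (rule complex_norm_square[symmetric])
  have "(least_real_root (Poly [- (1 + (cmod \<tau>)\<^sup>2), 0, 1]))\<^sup>2 = 1 + (cmod \<tau>)\<^sup>2"
    by (rule root_sqrt) simp
  moreover have "\<sigma> * cnj \<sigma> = complex_of_real ((least_real_root (Poly [- (1 + (cmod \<tau>)\<^sup>2), 0, 1]))\<^sup>2)"
    unfolding \<sigma>_def power2_eq_square by simp
  ultimately have "\<sigma> * cnj \<sigma> = 1 + \<tau> * cnj \<tau>"
    unfolding tt by (simp only: of_real_add of_real_1)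
  then interpret rotation n ?x ?y \<tau> \<sigma> by unfold_locales
  have om0: "(cmod om)\<^sup>2 > 0" by (simp add: om_def)
  have "qform n f ?x + 2 * Re (om * sform n f ?x ?y) * t + (cmod om)\<^sup>2 * qform n f ?y * t\<^sup>2 = 0"
    unfolding t_def
  proof (rule root_quadratic)
    have "qform n f ?x * ((cmod om)\<^sup>2 * qform n f ?y) = (cmod om)\<^sup>2 * (qform n f ?x * qform n f ?y)" by simp
    then show "qform n f ?x * ((cmod om)\<^sup>2 * qform n f ?y) < 0" using neg om0 by (simp only: mult_pos_neg)
  qed
  moreover have "Re (\<tau> * sform n f ?x ?y) = t * Re (om * sform n f ?x ?y)"
    unfolding \<tau>_def mult.assoc by simp
  ultimately have fx: "qform n f xr = 0"
    unfolding qform_xr[OF f] by (simp add: \<tau>_def norm_mult power_mult_distrib algebra_simps)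
  have gx: "qform n g xr = 0" "qform n g yr = 0"
    using qform_xr_zero[OF g g0] phase_orth by (auto simp: \<tau>_def om_def)
  have "\<tau> \<in> F" "\<sigma> \<in> F" using om by (auto simp: \<tau>_def \<sigma>_def om_def)
  then have F': "vecF n xr" "vecF n yr"
    using vF by (auto simp: vecF_def xr_def yr_def)
  let ?M1 = "put 5 \<tau> M"
  let ?M2 = "put 6 \<sigma> ?M1"
  let ?M3 = "setV n 7 ?x ?M2"
  let ?M4 = "put_col n 21 p xr ?M3"
  let ?M5 = "put_col n 21 q yr ?M4"
  have c1: "cval (R, M) (CMul (Root [Sc 0, CMul (CNum 2) (CMul (Sc 4) (Sc 2)), CMul (CMul (Sc 4) (Conj (Sc 4))) (Sc 1)]) (Sc 4)) = \<tau>"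
  proof -
    have "Re om * Re om + Im om * Im om = (cmod om)\<^sup>2" by (simp add: cmod_power2 flip: power2_eq_square)
    then show ?thesis
      using S by (simp add: \<tau>_def t_def om_def[symmetric] flip: Sv_def)
  qed
  have c2: "cval (R, ?M1) (Root [CSub (CNum 0) (CAdd (CNum 1) (CMul (Sc 5) (Conj (Sc 5)))), CNum 0, CNum 1]) = \<sigma>"
    by (simp add: \<sigma>_def tt del: times_complex.sel flip: Sv_def)
  show ?thesis
    unfolding Rotate_def
  proof (intro wp_Then wp_SetSc wp_Copy, unfold c1, unfold c2)
    have "(\<lambda>i. ?M2 21 i (nval R (NReg 1))) = ?x" using R by (simp add: Lc_def)
    then have M3: "setV (R 0) 7 (\<lambda>i. ?M2 21 i (nval R (NReg 1))) ?M2 = ?M3" using R by simp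
    show "wp R (Map1 21 (NReg 1) (CDiv (CAdd (Cell 22 (NReg 3) (NNum 7)) (CMul (Sc 5) (Cell 21 (NReg 3) (NReg 2)))) (Sc 6)))
       (wp R (Map1 21 (NReg 2) (CDiv (CSub (Cell 21 (NReg 3) (NReg 2)) (CMul (Conj (Sc 5)) (Cell 22 (NReg 3) (NNum 7)))) (Sc 6))) Q)
       (setV (R 0) 7 (\<lambda>i. ?M2 21 i (nval R (NReg 1))) ?M2)"
      unfolding M3
    proof (rule wp_Map1[where v = xr and k = p])
      fix i M' assume i: "i < R 0" and M': "agree_but {(21, j, p) |j. j < i} ?M3 M'"
      have "M' 22 i 7 = Vc ?M3 7 i" "M' 24 5 0 = Sv ?M3 5" "M' 24 6 0 = Sv ?M3 6" "M' 21 i q = Lc ?M3 q i"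
        using M' R by (auto simp: agree_but_def Vc_def Sv_def Lc_def)
      then show "cval (R(3 := i), M') (CDiv (CAdd (Cell 22 (NReg 3) (NNum 7)) (CMul (Sc 5) (Cell 21 (NReg 3) (NReg 2)))) (Sc 6)) = xr i"
        using R i by (simp add: xr_def)
    next
      have "wp R (Map1 21 (NReg 2) (CDiv (CSub (Cell 21 (NReg 3) (NReg 2)) (CMul (Conj (Sc 5)) (Cell 22 (NReg 3) (NNum 7)))) (Sc 6))) Q ?M4"
      proof (rule wp_Map1[where v = yr and k = q])
        fix i M' assume i: "i < R 0" and M': "agree_but {(21, j, q) |j. j < i} ?M4 M'"
        have "M' 22 i 7 = Vc ?M4 7 i" "M' 24 5 0 = Sv ?M4 5" "M' 24 6 0 = Sv ?M4 6" "M' 21 i q = Lc ?M4 q i"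
          using M' R by (auto simp: agree_but_def Vc_def Sv_def Lc_def)
        then show "cval (R(3 := i), M') (CDiv (CSub (Cell 21 (NReg 3) (NReg 2)) (CMul (Conj (Sc 5)) (Cell 22 (NReg 3) (NNum 7)))) (Sc 6)) = yr i"
          using R i by (simp add: yr_def)
      next
        have "Q ?M5"
        proof (rule Q)
          show "?M5 b = M b" if "b \<notin> {21, 22, 24}" for b using that by simp
          fix i j assume "i < n" "j < n"
          then show "Lc ?M5 p i * cnj (Lc ?M5 p j) + Lc ?M5 q i * cnj (Lc ?M5 q j)
             = ?x i * cnj (?x j) + ?y i * cnj (?y j)"
            using outer_sum[of i j] R by simp
        qed (use R F' fx gx in auto)
        then show "Q (put_col (R 0) 21 q yr ?M4)" using R by simp
      qed (use R in auto)
      then show "wp R (Map1 21 (NReg 2) (CDiv (CSub (Cell 21 (NReg 3) (NReg 2)) (CMul (Conj (Sc 5)) (Cell 22 (NReg 3) (NNum 7)))) (Sc 6))) Q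
           (put_col (R 0) 21 p xr ?M3)" using R by simp
    qed (use R in auto)
  qed (use R in auto)
qed

definition FormL :: "nat \<Rightarrow> nat \<Rightarrow> nat \<Rightarrow> nat \<Rightarrow> prog" where
  "FormL t b i j = Form t b (21, NReg i) (21, NReg j)"

lemma wp_FormL:
  assumes "R 3 = 0" "R 4 = 0" "b \<noteq> 24" "i \<notin> {3, 4}" "j \<notin> {3, 4}"
    and "Q (put t (sform (R 0) (M b) (Lc M (R i)) (Lc M (R j))) M)"
  shows "wp R (FormL t b i j) Q M"
proof -
  have "vecof R M (21, NReg i) = Lc M (R i)" for i by (simp add: vecof_def Lc_def fun_eq_iff)
  then show ?thesis unfolding FormL_def using assms by (intro wp_Form) auto
qed

lemma wp_Then_FormL:
  "wp R P Q (put t v M) \<Longrightarrow> v = sform (R 0) (M b) (Lc M (R i)) (Lc M (R j)) \<Longrightarrow>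
    R 3 = 0 \<Longrightarrow> R 4 = 0 \<Longrightarrow> b \<noteq> 24 \<Longrightarrow> i \<notin> {3, 4} \<Longrightarrow> j \<notin> {3, 4} \<Longrightarrow> wp R (Then (FormL t b i j) P) Q M"
  by (intro wp_Then wp_FormL) auto

lemma wp_Then_FormV:
  "wp R P Q (put t v M) \<Longrightarrow> v = sform (R 0) (M b) (Vc M p) (Vc M q) \<Longrightarrow>
    R 3 = 0 \<Longrightarrow> R 4 = 0 \<Longrightarrow> b \<noteq> 24 \<Longrightarrow> wp R (Then (FormV t b p q) P) Q M"
  by (intro wp_Then wp_FormV) auto

lemma wp_Then_Comb:
  "wp R P Q (setV n k v M) \<Longrightarrow> v = (\<lambda>i. Sv M a * Vc M p i + Sv M b * Vc M q i + Sv M c * Vc M s i) \<Longrightarrow>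
    R 3 = 0 \<Longrightarrow> R 0 = n \<Longrightarrow> wp R (Then (Comb k a p b q c s) P) Q M"
  by (intro wp_Then wp_Comb) auto

lemma wp_Then_SetSc:
  "wp R P Q (put t v M) \<Longrightarrow> v = cval (R, M) e \<Longrightarrow> wp R (Then (SetSc t e) P) Q M"
  by (intro wp_Then wp_SetSc) auto

definition Pass :: "nat \<Rightarrow> nat \<Rightarrow> prog" where
  "Pass f g = For 1 (For 2 (Then (FormL 0 f 1 1) (Then (FormL 1 f 2 2) (Then (FormL 2 f 1 2) (Then (FormL 3 g 1 2)
     (IfElse (ReLess (CMul (Sc 0) (Sc 1)) (CNum 0))
        (Then (IfElse (ReLess (CNum 0) (CMul (Sc 3) (Conj (Sc 3)))) (SetSc 4 (CMul CUnit (Conj (Sc 3)))) (SetSc 4 (CNum 1)))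
              Rotate)
        Skip))))))"

text \<open>After the inner loop f vanishes at column p: if no rotation has achieved this, no value
  of f has the sign opposite to the value at p, yet the values add up to the inner product of f and
  X, which is 0. The premise \<open>real\<close> reflects that over the reals no phase is available
  to protect a second form g.\<close>

lemma (in base_field) wp_Pass:
  assumes R: "R 1 = 0" "R 2 = 0" "R 3 = 0" "R 4 = 0" "R 0 = n"
    and fg: "fa \<notin> {21, 22, 24}" "ga \<notin> {21, 22, 24}" "M fa = f" "M ga = g"
    and f: "hermitian_fun n f" and g: "hermitian_fun n g"
    and real: "F = UNIV \<or> g = (\<lambda>i j. 0)"
    and X: "decomp n X n (Lc M)" "minner n f X = 0"
    and vF: "\<And>k. k < n \<Longrightarrow> vecF n (Lc M k)"
    and g0: "\<And>k. k < n \<Longrightarrow> qform n g (Lc M k) = 0"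
    and Q: "\<And>M'. (\<And>b. b \<notin> {21, 22, 24} \<Longrightarrow> M' b = M b) \<Longrightarrow> (\<And>k. k \<noteq> 7 \<Longrightarrow> Vc M' k = Vc M k) \<Longrightarrow>
      decomp n X n (Lc M') \<Longrightarrow> (\<And>k. k < n \<Longrightarrow> vecF n (Lc M' k)) \<Longrightarrow>
      (\<And>k. k < n \<Longrightarrow> qform n g (Lc M' k) = 0) \<Longrightarrow> (\<And>k. k < n \<Longrightarrow> qform n f (Lc M' k) = 0) \<Longrightarrow> Q M'"
  shows "wp R (Pass fa ga) Q M"
  unfolding Pass_def
proof -
  let ?C = "\<lambda>M'. (\<forall>b. b \<notin> {21, 22, 24} \<longrightarrow> M' b = M b) \<and> (\<forall>k. k \<noteq> 7 \<longrightarrow> Vc M' k = Vc M k) \<and>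
     decomp n X n (Lc M') \<and> (\<forall>k<n. vecF n (Lc M' k)) \<and> (\<forall>k<n. qform n g (Lc M' k) = 0)"
  let ?I = "\<lambda>p M'. ?C M' \<and> (\<forall>k<p. qform n f (Lc M' k) = 0)"
  let ?J = "\<lambda>p q M'. ?I p M' \<and> (\<forall>k<q. qform n f (Lc M' p) * qform n f (Lc M' k) \<ge> 0)"
  let ?In = "Then (IfElse (ReLess (CNum 0) (CMul (Sc 3) (Conj (Sc 3)))) (SetSc 4 (CMul CUnit (Conj (Sc 3)))) (SetSc 4 (CNum 1)))
              Rotate"
  let ?B = "Then (FormL 0 fa 1 1) (Then (FormL 1 fa 2 2) (Then (FormL 2 fa 1 2) (Then (FormL 3 ga 1 2)
     (IfElse (ReLess (CMul (Sc 0) (Sc 1)) (CNum 0)) ?In Skip))))"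
  show "wp R (For 1 (For 2 ?B)) Q M"
  proof (rule wp_For[where I = ?I])
    show "?I 0 M" using X vF g0 by auto
  next
    fix M' assume "?I (R 0) M'"
    then show "Q M'" using R by (intro Q) auto
  next
    fix p M' assume p: "p < R 0" and M': "?I p M'"
    show "wp (R(1 := p)) (For 2 ?B) (?I (Suc p)) M'"
    proof (rule wp_For[where I = "?J p"])
      show "?J p 0 M'" using M' by simp
    next
      fix M2 assume M2: "?J p ((R(1 := p)) 0) M2"
      let ?c = "\<lambda>k. qform n f (Lc M2 k)"
      have "minner n f X = (\<Sum>k<n. ?c k)"
        using M2 by (intro minner_decomp) (auto simp: decomp_def)
      \<comment> \<open>Multiplied by \<open>?c p\<close>, the vanishing sum has only nonnegative
        terms, among them the square of \<open>?c p\<close>.\<close>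
      then have "(\<Sum>k<n. ?c p * ?c k) = 0" using X(2) by (simp flip: sum_distrib_left)
      then have "?c p * ?c p = 0"
        using M2 p R by (subst (asm) sum_nonneg_eq_0_iff) auto
      then show "?I (Suc p) M2" using M2 by (auto simp: less_Suc_eq)
    next
      fix q M2 assume q: "q < (R(1 := p)) 0" and M2: "?J p q M2"
      let ?R = "R(1 := p, 2 := q)"
      have pq: "p < n" "q < n" using p q R by auto
      have fa: "M2 fa = f" "M2 ga = g" using M2 fg by auto
      let ?M3 = "put 3 (sform n g (Lc M2 p) (Lc M2 q)) (put 2 (sform n f (Lc M2 p) (Lc M2 q))
         (put 1 (sform n f (Lc M2 q) (Lc M2 q)) (put 0 (sform n f (Lc M2 p) (Lc M2 p)) M2)))"
      have om: "phase (sform n g (Lc M2 p) (Lc M2 q)) \<in> F"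
        using real by (auto simp: phase_def sform_def)
      have In: "wp ?R Rotate (?J p (Suc q)) M4"
        if neg: "qform n f (Lc M2 p) * qform n f (Lc M2 q) < 0"
          and M4: "M4 = put 4 (phase (sform n g (Lc M2 p) (Lc M2 q))) ?M3" for M4
      proof -
        have ne: "p \<noteq> q" using neg by (auto simp: mult_less_0_iff)
        \<comment> \<open>Columns before p already have value 0 and never take part in a rotation;
          only later columns are changed along with p.\<close>
        have qp: "p < q" if "qform n f (Lc M2 q) \<noteq> 0"
          using that ne M2 by (metis linorder_neqE_nat)
        show ?thesis
        proof (rule wp_Rotate[of ?R n p q f g])
          fix M5 assume 5: "\<And>b. b \<notin> {21, 22, 24} \<Longrightarrow> M5 b = M4 b" "\<And>k. k \<noteq> 7 \<Longrightarrow> Vc M5 k = Vc M4 k"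
            "\<And>k. k \<notin> {p, q} \<Longrightarrow> Lc M5 k = Lc M4 k" "vecF n (Lc M5 p)" "vecF n (Lc M5 q)"
            "\<And>i j. i < n \<Longrightarrow> j < n \<Longrightarrow> Lc M5 p i * cnj (Lc M5 p j) + Lc M5 q i * cnj (Lc M5 q j)
               = Lc M4 p i * cnj (Lc M4 p j) + Lc M4 q i * cnj (Lc M4 q j)"
            "qform n f (Lc M5 p) = 0" "qform n g (Lc M5 p) = 0" "qform n g (Lc M5 q) = 0"
          have L4: "Lc M4 k = Lc M2 k" for k by (simp add: M4)
          have "decomp n X n (Lc M5)"
            unfolding decomp_def
          proof (intro allI impI)
            fix i j assume ij: "i < n" "j < n"
            let ?g = "\<lambda>L k. L k i * cnj (L k j)"
            have "X i j = (\<Sum>k<n. ?g (Lc M2) k)" using M2 ij by (auto simp: decomp_def)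
            also have "\<dots> = ?g (Lc M2) p + ?g (Lc M2) q + sum (?g (Lc M2)) ({..<n} - {p, q})"
              by (rule sum_two) (use pq ne in auto)
            also have "\<dots> = ?g (Lc M5) p + ?g (Lc M5) q + sum (?g (Lc M5)) ({..<n} - {p, q})"
              using 5(3) 5(6)[OF ij] by (simp add: L4)
            also have "\<dots> = (\<Sum>k<n. ?g (Lc M5) k)"
              by (rule sum_two[symmetric]) (use pq ne in auto)
            finally show "X i j = (\<Sum>k<n. ?g (Lc M5) k)" .
          qed
          moreover have "vecF n (Lc M5 k) \<and> qform n g (Lc M5 k) = 0" if "k < n" for k
            using that 5 M2 L4 by (cases "k = p"; cases "k = q") auto
          moreover have "p < q" using neg qp by (cases "qform n f (Lc M2 q) = 0") auto
          then have "qform n f (Lc M5 k) = 0" if "k < p" for k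
            using that 5(3)[of k] M2 L4 by auto
          ultimately show "?J p (Suc q) M5" using 5 M2 by (auto simp: M4)
        qed (use R ne M2 pq om neg in \<open>auto simp: M4 sform_self[OF f] f g\<close>)
      qed
      show "wp ?R ?B (?J p (Suc q)) M2"
      proof (rule wp_Then_FormL[where v = "sform n f (Lc M2 p) (Lc M2 p)"],
          rule wp_Then_FormL[where v = "sform n f (Lc M2 q) (Lc M2 q)"],
          rule wp_Then_FormL[where v = "sform n f (Lc M2 p) (Lc M2 q)"],
          rule wp_Then_FormL[where v = "sform n g (Lc M2 p) (Lc M2 q)"])
        have "wp ?R (IfElse (ReLess (CMul (Sc 0) (Sc 1)) (CNum 0)) ?In Skip) (?J p (Suc q)) ?M3"
        proof (rule wp_IfElse)
          assume "bval (?R, ?M3) (ReLess (CMul (Sc 0) (Sc 1)) (CNum 0))"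
          then have neg: "qform n f (Lc M2 p) * qform n f (Lc M2 q) < 0"
            by (simp add: sform_self[OF f] flip: Sv_def)
          have test: "bval (?R, ?M3) (ReLess (CNum 0) (CMul (Sc 3) (Conj (Sc 3)))) \<longleftrightarrow> sform n g (Lc M2 p) (Lc M2 q) \<noteq> 0"
            using nonzero_test[of "sform n g (Lc M2 p) (Lc M2 q)"]
            by (simp del: times_complex.sel flip: Sv_def)
          show "wp ?R ?In (?J p (Suc q)) ?M3"
          proof (intro wp_Then wp_IfElse wp_SetSc, unfold test)
            assume "sform n g (Lc M2 p) (Lc M2 q) \<noteq> 0"
            then show "wp ?R Rotate (?J p (Suc q)) (put 4 (cval (?R, ?M3) (CMul CUnit (Conj (Sc 3)))) ?M3)"
              by (intro In neg) (simp add: phase_def flip: Sv_def)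
          next
            assume "\<not> sform n g (Lc M2 p) (Lc M2 q) \<noteq> 0"
            then show "wp ?R Rotate (?J p (Suc q)) (put 4 (cval (?R, ?M3) (CNum 1)) ?M3)"
              by (intro In neg) (simp add: phase_def flip: Sv_def)
          qed
        next
          assume "\<not> bval (?R, ?M3) (ReLess (CMul (Sc 0) (Sc 1)) (CNum 0))"
          then have "qform n f (Lc M2 p) * qform n f (Lc M2 q) \<ge> 0"
            by (simp add: sform_self[OF f] flip: Sv_def)
          then show "wp ?R Skip (?J p (Suc q)) ?M3"
            using M2 by (intro wp_Skip) (auto simp: less_Suc_eq)
        qed
        then show "wp ?R (IfElse (ReLess (CMul (Sc 0) (Sc 1)) (CNum 0)) ?In Skip) (?J p (Suc q)) ?M3" .
      qed (use R fg fa in auto)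
    qed (use R in auto)
  qed (use R in auto)
qed

lemma wp_Then_Copy:
  "wp R P Q (setV n k v M) \<Longrightarrow> v = (\<lambda>i. M a i (nval R c)) \<Longrightarrow> R 3 = 0 \<Longrightarrow> R 0 = n \<Longrightarrow>
    (\<And>i. nval (R(3 := i)) c = nval R c) \<Longrightarrow> wp R (Then (Copy k a c) P) Q M"
  by (intro wp_Then wp_Copy) auto

section \<open>Classifying columns by the sign of a form\<close>

definition Scan :: "nat \<Rightarrow> prog" where
  "Scan e = For 1 (Then (Copy 4 21 (NReg 1)) (Then (FormV 0 e 4 4) (Then (FormV 1 14 4 4)
     (IfElse (ReLess (CNum 0) (Sc 1))
       (IfElse (ReLess (Sc 0) (CNum 0)) (Copy 2 22 (NNum 4))
         (IfElse (ReLess (CNum 0) (Sc 0)) (Copy 1 22 (NNum 4)) (Copy 0 22 (NNum 4))))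
       Skip))))"

text \<open>The zero vector stands for the absence of a hit, so that the program can test for it by
  a norm. Which hit is kept is left open.\<close>

definition found :: "nat \<Rightarrow> nat \<Rightarrow> (nat \<Rightarrow> nat \<Rightarrow> complex) \<Rightarrow> (nat \<Rightarrow> bool) \<Rightarrow> (nat \<Rightarrow> complex) \<Rightarrow> bool" where
  "found n l x P v \<longleftrightarrow> (if \<exists>k<l. P k then \<exists>k<l. P k \<and> (\<forall>i<n. v i = x k i) else \<forall>i<n. v i = 0)"

lemma found_Suc:
  assumes "found n l x P v"
  shows "\<not> P l \<Longrightarrow> found n (Suc l) x P v" and "P l \<Longrightarrow> (\<And>i. i < n \<Longrightarrow> w i = x l i) \<Longrightarrow> found n (Suc l) x P w"
proof -
  assume "\<not> P l"
  then have a: "(\<exists>k<Suc l. P k) \<longleftrightarrow> (\<exists>k<l. P k)"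
    and b: "(\<exists>k<Suc l. P k \<and> (\<forall>i<n. v i = x k i)) \<longleftrightarrow> (\<exists>k<l. P k \<and> (\<forall>i<n. v i = x k i))"
    by (auto simp: less_Suc_eq)
  show "found n (Suc l) x P v" using assms unfolding found_def a b .
next
  assume "P l" "\<And>i. i < n \<Longrightarrow> w i = x l i"
  then show "found n (Suc l) x P w" unfolding found_def by (auto simp: less_Suc_eq)
qed

lemma found_cut: "found n l x P (cut n v w) \<longleftrightarrow> found n l x P v"
proof -
  have "(\<forall>i<n. cut n v w i = f i) \<longleftrightarrow> (\<forall>i<n. v i = f i)" for f by simp
  then show ?thesis unfolding found_def by (simp only:)
qed

lemma qform_idm_vec_zero: "qform n idm x = 0 \<Longrightarrow> qform n B x = 0"
proof -
  assume "qform n idm x = 0"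
  then have "qform n B x = qform n B (\<lambda>i. 0)" by (intro qform_cong) (simp add: qform_idm_zero_iff)
  then show ?thesis by simp
qed

lemma (in base_field) wp_Scan:
  assumes R: "R 1 = 0" "R 3 = 0" "R 4 = 0" "R 0 = n" and ea: "ea \<notin> {22, 24}" "M ea = e"
    and e: "hermitian_fun n e" and I: "\<And>i j. i < n \<Longrightarrow> j < n \<Longrightarrow> M 14 i j = idm i j"
    and V: "\<And>k i. k < 3 \<Longrightarrow> i < n \<Longrightarrow> Vc M k i = 0"
    and Q: "\<And>M'. (\<And>b. b \<notin> {22, 24} \<Longrightarrow> M' b = M b) \<Longrightarrow> (\<And>k. k \<notin> {0, 1, 2, 4} \<Longrightarrow> Vc M' k = Vc M k) \<Longrightarrow>
      found n n (Lc M) (\<lambda>k. qform n e (Lc M k) = 0 \<and> qform n idm (Lc M k) \<noteq> 0) (Vc M' 0) \<Longrightarrow>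
      found n n (Lc M) (\<lambda>k. qform n e (Lc M k) > 0) (Vc M' 1) \<Longrightarrow>
      found n n (Lc M) (\<lambda>k. qform n e (Lc M k) < 0) (Vc M' 2) \<Longrightarrow> Q M'"
  shows "wp R (Scan ea) Q M"
  unfolding Scan_def
proof -
  let ?I = "\<lambda>k M'. (\<forall>b. b \<notin> {22, 24} \<longrightarrow> M' b = M b) \<and> (\<forall>k. k \<notin> {0, 1, 2, 4} \<longrightarrow> Vc M' k = Vc M k) \<and>
      found n k (Lc M) (\<lambda>k. qform n e (Lc M k) = 0 \<and> qform n idm (Lc M k) \<noteq> 0) (Vc M' 0) \<and>
      found n k (Lc M) (\<lambda>k. qform n e (Lc M k) > 0) (Vc M' 1) \<and>
      found n k (Lc M) (\<lambda>k. qform n e (Lc M k) < 0) (Vc M' 2)"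
  let ?P = "Then (Copy 4 21 (NReg 1)) (Then (FormV 0 ea 4 4) (Then (FormV 1 14 4 4)
     (IfElse (ReLess (CNum 0) (Sc 1))
       (IfElse (ReLess (Sc 0) (CNum 0)) (Copy 2 22 (NNum 4))
         (IfElse (ReLess (CNum 0) (Sc 0)) (Copy 1 22 (NNum 4)) (Copy 0 22 (NNum 4))))
       Skip)))"
  show "wp R (For 1 ?P) Q M"
proof (rule wp_For[where I = ?I])
  show "?I 0 M" using V by (auto simp: found_def)
next
  fix M' assume "?I (R 0) M'"
  then show "Q M'" using R by (intro Q) auto
next
  fix k M' assume k: "k < R 0" and M': "?I k M'"
  let ?c = "Lc M k"
  let ?M2 = "setV n 4 ?c M'"
  let ?M3 = "put 1 (complex_of_real (qform n idm ?c)) (put 0 (complex_of_real (qform n e ?c)) ?M2)"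
  have L: "(\<lambda>i. M' 21 i k) = ?c" using M' by (simp add: Lc_def)
  have M'e: "M' ea = e" "M' 14 = M 14" using M' ea by auto
  have f14: "sform n (M 14) ?c ?c = complex_of_real (qform n idm ?c)"
    by (simp add: qform_idm_cong_mat[of n "M 14", OF I] sform_self)
  have zero: "qform n e ?c = 0" if "qform n idm ?c = 0" using that by (rule qform_idm_vec_zero)
  note f0 = M'[THEN conjunct2, THEN conjunct2, THEN conjunct1]
    and f1 = M'[THEN conjunct2, THEN conjunct2, THEN conjunct2, THEN conjunct1]
    and f2 = M'[THEN conjunct2, THEN conjunct2, THEN conjunct2, THEN conjunct2]
  note s0 = found_Suc(1)[OF f0] found_Suc(2)[OF f0, of ?c, OF _ refl]
  note s1 = found_Suc(1)[OF f1] found_Suc(2)[OF f1, of ?c, OF _ refl]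
  note s2 = found_Suc(1)[OF f2] found_Suc(2)[OF f2, of ?c, OF _ refl]
  have V4: "(\<lambda>i. ?M3 22 i (nval (R(1 := k)) (NNum 4))) = cut n ?c (Vc M' 4)"
    by (simp flip: Vc_def)
  have main: "wp (R(1 := k)) (IfElse (ReLess (CNum 0) (Sc 1))
       (IfElse (ReLess (Sc 0) (CNum 0)) (Copy 2 22 (NNum 4))
         (IfElse (ReLess (CNum 0) (Sc 0)) (Copy 1 22 (NNum 4)) (Copy 0 22 (NNum 4))))
       Skip) (?I (Suc k)) ?M3"
  proof (intro wp_IfElse)
    assume "bval (R(1 := k), ?M3) (ReLess (CNum 0) (Sc 1))" "bval (R(1 := k), ?M3) (ReLess (Sc 0) (CNum 0))"
    then have "qform n e ?c < 0" by (simp flip: Sv_def)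
    then show "wp (R(1 := k)) (Copy 2 22 (NNum 4)) (?I (Suc k)) ?M3"
      using M' R by (intro wp_Copy; (unfold V4)?) (use s0 s1 s2 in \<open>simp_all add: found_cut\<close>)
  next
    assume "bval (R(1 := k), ?M3) (ReLess (CNum 0) (Sc 1))" "bval (R(1 := k), ?M3) (ReLess (CNum 0) (Sc 0))"
    then have "qform n e ?c > 0" by (simp flip: Sv_def)
    then show "wp (R(1 := k)) (Copy 1 22 (NNum 4)) (?I (Suc k)) ?M3"
      using M' R by (intro wp_Copy; (unfold V4)?) (use s0 s1 s2 in \<open>simp_all add: found_cut\<close>)
  next
    assume "bval (R(1 := k), ?M3) (ReLess (CNum 0) (Sc 1))" "\<not> bval (R(1 := k), ?M3) (ReLess (Sc 0) (CNum 0))"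
      "\<not> bval (R(1 := k), ?M3) (ReLess (CNum 0) (Sc 0))"
    then have "qform n e ?c = 0" "qform n idm ?c \<noteq> 0" by (auto simp flip: Sv_def)
    then show "wp (R(1 := k)) (Copy 0 22 (NNum 4)) (?I (Suc k)) ?M3"
      using M' R by (intro wp_Copy; (unfold V4)?) (use s0 s1 s2 in \<open>simp_all add: found_cut\<close>)
  next
    assume "\<not> bval (R(1 := k), ?M3) (ReLess (CNum 0) (Sc 1))"
    then have "qform n idm ?c = 0" using qform_idm_nonneg[of n ?c] by (simp flip: Sv_def)
    then show "wp (R(1 := k)) Skip (?I (Suc k)) ?M3"
      using M' R zero by (intro wp_Skip) (use s0 s1 s2 in simp)
  qed
  show "wp (R(1 := k)) ?P (?I (Suc k)) M'"
    by (rule wp_Then_Copy[where v = ?c and n = n], rule wp_Then_FormV[where v = "complex_of_real (qform n e ?c)"],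
        rule wp_Then_FormV[where v = "complex_of_real (qform n idm ?c)"], rule main)
       (use R ea M'e f14 sform_self[OF e, of ?c] in \<open>simp_all add: L\<close>)
qed (use R in auto)
qed

section \<open>Two forms on three vectors\<close>

text \<open>Let D vanish at v1 and v2, and let h be the nonzero real part of their cross term.
  Shifting v3 by real multiples of v1 and v2 gives a vector w whose cross terms with both have real
  part 0; then D at \<open>a v1 + b v2 + w\<close> is \<open>2 a b h + \<gamma>\<close>. For
  \<gamma> \<noteq> 0 its zero set is a hyperbola, parametrised by a. For \<gamma> = 0 it consists
  of the two axes, and the axis is chosen along whose direction E has the sign opposite to E at
  w.\<close>

definition Three :: "nat \<Rightarrow> nat \<Rightarrow> prog" where
  "Three d e = Then (FormV 2 d 1 2) (Then (FormV 3 d 1 3) (Then (FormV 4 d 2 3)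
    (Then (SetSc 5 (CDiv (CSub (CNum 0) (CAdd (Sc 4) (Conj (Sc 4)))) (CAdd (Sc 2) (Conj (Sc 2)))))
    (Then (SetSc 6 (CDiv (CSub (CNum 0) (CAdd (Sc 3) (Conj (Sc 3)))) (CAdd (Sc 2) (Conj (Sc 2)))))
    (Then (SetSc 7 (CNum 1)) (Then (Comb 3 5 1 6 2 7 3) (Then (FormV 5 d 3 3)
    (Then (SetSc 6 (CDiv (CSub (CNum 0) (Sc 5)) (CAdd (Sc 2) (Conj (Sc 2)))))
    (Then (FormV 10 e 1 1) (Then (FormV 11 e 2 2) (Then (FormV 12 e 3 3)
    (Then (FormV 13 e 1 2) (Then (FormV 14 e 1 3) (Then (FormV 15 e 2 3)
    (Then (IfElse (ReLess (CNum 0) (CMul (Sc 5) (Sc 5)))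
        (Then (SetSc 8 (Root [CMul (CMul (Sc 6) (Sc 6)) (Sc 11), CMul (CNum 2) (CMul (Sc 6) (Sc 15)),
               CAdd (Sc 12) (CMul (CNum 2) (CMul (Sc 6) (Sc 13))), CMul (CNum 2) (Sc 14), Sc 10]))
              (SetSc 9 (CDiv (Sc 6) (Sc 8))))
        (IfElse (ReLess (Sc 12) (CNum 0))
          (Then (SetSc 8 (Root [Sc 12, CMul (CNum 2) (Sc 14), Sc 10])) (SetSc 9 (CNum 0)))
          (IfElse (ReLess (CNum 0) (Sc 12))
            (Then (SetSc 8 (CNum 0)) (SetSc 9 (Root [Sc 12, CMul (CNum 2) (Sc 15), Sc 11])))
            (Then (SetSc 8 (CNum 0)) (SetSc 9 (CNum 0))))))
      (Comb 0 8 1 9 2 7 3))))))))))))))))"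

lemma qform_comb_split:
  fixes a b :: real and v1 v2 w :: "nat \<Rightarrow> complex"
  assumes D: "hermitian_fun n D" and "Re (sform n D v1 w) = 0" "Re (sform n D v2 w) = 0"
    "qform n D v1 = 0" "qform n D v2 = 0"
  shows "qform n D (\<lambda>i. a * v1 i + b * v2 i + w i) = 2 * a * b * Re (sform n D v1 v2) + qform n D w"
  using qform_comb3[OF D, of a v1 b v2 1 w] assms by simp

text \<open>On the hyperbola \<open>b = \<kappa> / a\<close>, multiplying E by \<open>a^2\<close>
  gives a quartic with constant coefficient \<open>\<kappa>^2 E(v2) < 0\<close> and leading
  coefficient \<open>E(v1) > 0\<close>. Its root is nonzero, so the division by it is
  legitimate.\<close>

lemma three_quartic:
  fixes \<kappa> a :: real and v1 v2 w :: "nat \<Rightarrow> complex"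
  assumes E: "hermitian_fun n E" and E1: "qform n E v1 > 0" "qform n E v2 < 0" and k: "\<kappa> \<noteq> 0"
  defines "a \<equiv> least_real_root (Poly [\<kappa>\<^sup>2 * qform n E v2, 2 * (\<kappa> * Re (sform n E v2 w)),
      qform n E w + 2 * (\<kappa> * Re (sform n E v1 v2)), 2 * Re (sform n E v1 w), qform n E v1])"
  shows "a \<noteq> 0" "qform n E (\<lambda>i. a * v1 i + (\<kappa> / a) * v2 i + w i) = 0"
proof -
  have c0: "\<kappa>\<^sup>2 * qform n E v2 < 0" using k E1 by (simp add: mult_pos_neg)
  note r = root_quartic[OF c0 E1(1), of "2 * (\<kappa> * Re (sform n E v2 w))"
      "qform n E w + 2 * (\<kappa> * Re (sform n E v1 v2))" "2 * Re (sform n E v1 w)", folded a_def]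
  show a: "a \<noteq> 0" by (rule r(2))
  have "a\<^sup>2 * qform n E (\<lambda>i. a * v1 i + (\<kappa> / a) * v2 i + w i)
    = \<kappa>\<^sup>2 * qform n E v2 + 2 * (\<kappa> * Re (sform n E v2 w)) * a
      + (qform n E w + 2 * (\<kappa> * Re (sform n E v1 v2))) * a\<^sup>2 + 2 * Re (sform n E v1 w) * a ^ 3 + qform n E v1 * a ^ 4"
    using qform_comb3[OF E, of a v1 "\<kappa> / a" v2 1 w] a
    by (simp add: power2_eq_square power3_eq_cube power4_eq_xxxx field_simps)
  then show "qform n E (\<lambda>i. a * v1 i + (\<kappa> / a) * v2 i + w i) = 0"
    using r(1) a by simp
qed

lemma three_quadratic:
  fixes a :: real and v w :: "nat \<Rightarrow> complex"
  assumes E: "hermitian_fun n E" and "qform n E w * qform n E v < 0"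
  defines "a \<equiv> least_real_root (Poly [qform n E w, 2 * Re (sform n E v w), qform n E v])"
  shows "qform n E (\<lambda>i. a * v i + w i) = 0"
  using root_quadratic[OF assms(2), of "2 * Re (sform n E v w)", folded a_def]
    qform_comb3[OF E, of a v 0 v 1 w] by (simp add: algebra_simps)

lemma minus_cnj: "- z - cnj z = - complex_of_real (2 * Re z)"
  by (simp add: complex_eq_iff)

lemma wp_Three:
  assumes R: "R 3 = 0" "R 4 = 0" "R 0 = n" and arr: "da \<notin> {22, 24}" "ea \<notin> {22, 24}" "M da = D" "M ea = E"
    and D: "hermitian_fun n D" and E: "hermitian_fun n E"
    and D0: "qform n D (Vc M 1) = 0" "qform n D (Vc M 2) = 0" "Re (sform n D (Vc M 1) (Vc M 2)) \<noteq> 0"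
    and E0: "qform n E (Vc M 1) > 0" "qform n E (Vc M 2) < 0"
    and Q: "\<And>M' a b. (\<And>b. b \<notin> {22, 24} \<Longrightarrow> M' b = M b) \<Longrightarrow>
      (\<And>i. i < n \<Longrightarrow> Vc M' 0 i = complex_of_real a * Vc M 1 i + complex_of_real b * Vc M 2 i + Vc M 3 i) \<Longrightarrow>
      qform n D (Vc M' 0) = 0 \<Longrightarrow> qform n E (Vc M' 0) = 0 \<Longrightarrow> Q M'"
  shows "wp R (Three da ea) Q M"
proof -
  define v1 v2 v3 where v: "v1 = Vc M 1" "v2 = Vc M 2" "v3 = Vc M 3"
  define h where "h = sform n D v1 v2"
  \<comment> \<open>As D vanishes at v1 and v2, a shift by v1 affects only the real pairing with v2,
    and conversely; hence s comes from v2 and t from v1.\<close>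
  define s where "s = - Re (sform n D v2 v3) / Re h"
  define t where "t = - Re (sform n D v1 v3) / Re h"
  define w where "w i = complex_of_real s * v1 i + complex_of_real t * v2 i + v3 i" for i
  have h: "Re h \<noteq> 0" using D0 by (simp add: h_def v)
  have D0': "qform n D v1 = 0" "qform n D v2 = 0" and E0': "qform n E v1 > 0" "qform n E v2 < 0"
    using D0 E0 by (simp_all add: v)
  have s1: "sform n D v1 v1 = 0" "sform n D v2 v2 = 0" using D0' by (simp_all add: sform_self[OF D])
  have hh: "sform n D v2 v1 = cnj h" unfolding h_def by (rule sform_herm[OF D])
  have w1: "Re (sform n D v1 w) = 0" "Re (sform n D v2 w) = 0"
    using h by (simp_all add: w_def[abs_def] sform_linear s1 hh h_def[symmetric]) (simp_all add: s_def t_def)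
  define \<gamma> where "\<gamma> = qform n D w"
  define \<kappa> where "\<kappa> = - \<gamma> / (2 * Re h)"
  define e11 e22 e33 where ee: "e11 = qform n E v1" "e22 = qform n E v2" "e33 = qform n E w"
  define e12 e13 e23 where ec: "e12 = sform n E v1 v2" "e13 = sform n E v1 w" "e23 = sform n E v2 w"
  define P where "P = (\<lambda>a b. qform n D (\<lambda>i. complex_of_real a * v1 i + complex_of_real b * v2 i + w i) = 0 \<and>
     qform n E (\<lambda>i. complex_of_real a * v1 i + complex_of_real b * v2 i + w i) = 0)"
  have PD: "qform n D (\<lambda>i. complex_of_real a * v1 i + complex_of_real b * v2 i + w i) = 2 * a * b * Re h + \<gamma>" for a b
    unfolding \<gamma>_def h_def by (rule qform_comb_split[OF D w1 D0'])
  have P1: "P (least_real_root (Poly [\<kappa>\<^sup>2 * e22, 2 * (\<kappa> * Re e23), e33 + 2 * (\<kappa> * Re e12), 2 * Re e13, e11]))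
      (\<kappa> / least_real_root (Poly [\<kappa>\<^sup>2 * e22, 2 * (\<kappa> * Re e23), e33 + 2 * (\<kappa> * Re e12), 2 * Re e13, e11]))"
    if "\<gamma> \<noteq> 0"
  proof -
    have k: "\<kappa> \<noteq> 0" using that h by (simp add: \<kappa>_def)
    show ?thesis
      using three_quartic[OF E E0' k, of w] h unfolding P_def PD ee ec by (simp add: \<kappa>_def)
  qed
  have P2: "P (least_real_root (Poly [e33, 2 * Re e13, e11])) 0" if "\<gamma> = 0" "e33 < 0"
  proof -
    have "qform n E w * qform n E v1 < 0" using that(2) E0' by (simp add: ee mult_neg_pos)
    from three_quadratic[OF E this] show ?thesis using that(1) unfolding P_def PD ee ec by simp
  qed
  have P3: "P 0 (least_real_root (Poly [e33, 2 * Re e23, e22]))" if "\<gamma> = 0" "e33 > 0"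
  proof -
    have "qform n E w * qform n E v2 < 0" using that(2) E0' by (simp add: ee mult_pos_neg)
    from three_quadratic[OF E this] show ?thesis using that(1) unfolding P_def PD ee ec by simp
  qed
  have P4: "P 0 0" if "\<gamma> = 0" "e33 = 0"
    using that unfolding P_def PD ee by simp
  have w_eq: "(\<lambda>i. complex_of_real s * v1 i + complex_of_real t * v2 i + v3 i) = w"
    by (simp add: w_def fun_eq_iff)
  have Rh: "h + cnj h = complex_of_real (2 * Re h)" by (rule complex_add_cnj)
  let ?M3 = "put 4 (sform n D v2 v3) (put 3 (sform n D v1 v3) (put 2 h M))"
  let ?M6 = "put 7 1 (put 6 (complex_of_real t) (put 5 (complex_of_real s) ?M3))"
  let ?M7 = "setV n 3 w ?M6"
  let ?M9 = "put 6 (complex_of_real \<kappa>) (put 5 (complex_of_real \<gamma>) ?M7)"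
  let ?N = "put 15 e23 (put 14 e13 (put 13 e12 (put 12 (complex_of_real e33)
      (put 11 (complex_of_real e22) (put 10 (complex_of_real e11) ?M9)))))"
  have Vs: "Vc M 1 = v1" "Vc M (Suc 0) = v1" "Vc M 2 = v2" "Vc M 3 = v3" by (simp_all add: v)
  have fin: "wp R (Comb 0 8 1 9 2 7 3) Q M'"
    if M': "M' = put 9 (complex_of_real b) (put 8 (complex_of_real a) ?N)" and P: "P a b" for M' a b
  proof (rule wp_Comb)
    let ?y = "\<lambda>i. complex_of_real a * v1 i + complex_of_real b * v2 i + w i"
    have y: "qform n E (\<lambda>i. Sv M' 8 * Vc M' 1 i + Sv M' 9 * Vc M' 2 i + Sv M' 7 * Vc M' 3 i) = qform n E ?y" for E
      by (rule qform_cong) (simp add: M' Vs)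
    show "Q (setV (R 0) 0 (\<lambda>i. Sv M' 8 * Vc M' 1 i + Sv M' 9 * Vc M' 2 i + Sv M' 7 * Vc M' 3 i) M')"
    \<comment> \<open>The coefficients are reported relative to the original third vector, so the
      shift is added back.\<close>
    proof (rule Q[of _ "a + s" "b + t"])
      fix i assume "i < n"
      then show "Vc (setV (R 0) 0 (\<lambda>i. Sv M' 8 * Vc M' 1 i + Sv M' 9 * Vc M' 2 i + Sv M' 7 * Vc M' 3 i) M') 0 i
        = complex_of_real (a + s) * Vc M 1 i + complex_of_real (b + t) * Vc M 2 i + Vc M 3 i"
        using R by (simp add: M' Vs w_def algebra_simps)
    next
      have c: "qform n B (Vc (setV n 0 u M') 0) = qform n B u" for B u by simp
      show "qform n D (Vc (setV (R 0) 0 (\<lambda>i. Sv M' 8 * Vc M' 1 i + Sv M' 9 * Vc M' 2 i + Sv M' 7 * Vc M' 3 i) M') 0) = 0"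
        "qform n E (Vc (setV (R 0) 0 (\<lambda>i. Sv M' 8 * Vc M' 1 i + Sv M' 9 * Vc M' 2 i + Sv M' 7 * Vc M' 3 i) M') 0) = 0"
        using P unfolding R(3) c y P_def by blast+
    qed (simp add: M')
  qed (use R in auto)
  show ?thesis
    unfolding Three_def
  proof (rule wp_Then_FormV[where v = h], rule wp_Then_FormV[where v = "sform n D v1 v3"],
      rule wp_Then_FormV[where v = "sform n D v2 v3"],
      rule wp_Then_SetSc[where v = "complex_of_real s"], rule wp_Then_SetSc[where v = "complex_of_real t"],
      rule wp_Then_SetSc[where v = 1], rule wp_Then_Comb[where v = w],
      rule wp_Then_FormV[where v = "complex_of_real \<gamma>"], rule wp_Then_SetSc[where v = "complex_of_real \<kappa>"],
      rule wp_Then_FormV[where v = "complex_of_real e11"], rule wp_Then_FormV[where v = "complex_of_real e22"],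
      rule wp_Then_FormV[where v = "complex_of_real e33"], rule wp_Then_FormV[where v = e12],
      rule wp_Then_FormV[where v = e13], rule wp_Then_FormV[where v = e23])
    let ?q4 = "Poly [\<kappa>\<^sup>2 * e22, 2 * (\<kappa> * Re e23), e33 + 2 * (\<kappa> * Re e12), 2 * Re e13, e11]"
    show "wp R (Then (IfElse (ReLess (CNum 0) (CMul (Sc 5) (Sc 5)))
        (Then (SetSc 8 (Root [CMul (CMul (Sc 6) (Sc 6)) (Sc 11), CMul (CNum 2) (CMul (Sc 6) (Sc 15)),
               CAdd (Sc 12) (CMul (CNum 2) (CMul (Sc 6) (Sc 13))), CMul (CNum 2) (Sc 14), Sc 10]))
              (SetSc 9 (CDiv (Sc 6) (Sc 8))))
        (IfElse (ReLess (Sc 12) (CNum 0))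
          (Then (SetSc 8 (Root [Sc 12, CMul (CNum 2) (Sc 14), Sc 10])) (SetSc 9 (CNum 0)))
          (IfElse (ReLess (CNum 0) (Sc 12))
            (Then (SetSc 8 (CNum 0)) (SetSc 9 (Root [Sc 12, CMul (CNum 2) (Sc 15), Sc 11])))
            (Then (SetSc 8 (CNum 0)) (SetSc 9 (CNum 0))))))
      (Comb 0 8 1 9 2 7 3)) Q ?N" (is "wp R (Then (IfElse ?b1 ?p1 (IfElse ?b2 ?p2 (IfElse ?b3 ?p3 ?p4))) ?c) Q ?N")
    proof (rule wp_Then, intro wp_IfElse)
      assume "bval (R, ?N) ?b1"
      then have "\<gamma> \<noteq> 0" by (auto simp flip: Sv_def)
      from P1[OF this] show "wp R ?p1 (wp R ?c Q) ?N"
        by (intro wp_Then_SetSc[where v = "complex_of_real (least_real_root ?q4)"] wp_SetSc, elim fin[rotated])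
           (simp_all add: power2_eq_square flip: Sv_def)
    next
      assume "\<not> bval (R, ?N) ?b1" "bval (R, ?N) ?b2"
      then have "\<gamma> = 0" "e33 < 0" by (auto simp: zero_less_mult_iff simp flip: Sv_def)
      from P2[OF this] show "wp R ?p2 (wp R ?c Q) ?N"
        by (intro wp_Then_SetSc[where v = "complex_of_real (least_real_root (Poly [e33, 2 * Re e13, e11]))"] wp_SetSc, elim fin[rotated])
           (simp_all flip: Sv_def)
    next
      assume "\<not> bval (R, ?N) ?b1" "bval (R, ?N) ?b3"
      then have "\<gamma> = 0" "e33 > 0" by (auto simp: zero_less_mult_iff simp flip: Sv_def)
      from P3[OF this] show "wp R ?p3 (wp R ?c Q) ?N"
        by (intro wp_Then_SetSc[where v = "0"] wp_SetSc, elim fin[rotated])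
           (simp_all flip: Sv_def)
    next
      assume "\<not> bval (R, ?N) ?b1" "\<not> bval (R, ?N) ?b2" "\<not> bval (R, ?N) ?b3"
      then have "\<gamma> = 0" "e33 = 0" by (auto simp: zero_less_mult_iff simp flip: Sv_def)
      from P4[OF this] show "wp R ?p4 (wp R ?c Q) ?N"
        by (intro wp_Then_SetSc[where v = "0"] wp_SetSc, elim fin[rotated])
           (simp_all flip: Sv_def)
    qed
  qed (use R arr h in \<open>simp_all add: Vs h_def[symmetric] Rh w_eq ee ec sform_self[OF D] sform_self[OF E] flip: Sv_def\<close>,
     simp_all add: s_def t_def \<kappa>_def \<gamma>_def minus_cnj)
qed

lemma setV_cong: "(\<And>i. i < n \<Longrightarrow> v i = v' i) \<Longrightarrow> setV n k v M = setV n k v' M"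
  by (auto simp: setV_def put_col_def fun_eq_iff)

section \<open>One form on a real plane\<close>

definition Line :: "nat \<Rightarrow> prog" where
  "Line e = Then (FormV 2 e 1 1) (Then (FormV 3 e 1 2) (Then (FormV 4 e 2 2)
    (Then (SetSc 5 (CMul (Root [Sc 2, CMul (CNum 2) (CMul (Sc 1) (Sc 3)), CMul (CMul (Sc 1) (Conj (Sc 1))) (Sc 4)]) (Sc 1)))
    (Then (SetSc 6 (CNum 0)) (Then (SetSc 7 (CNum 1)) (Comb 0 7 1 5 2 6 2))))))"

text \<open>E is positive at vector 1 and negative at vector 2, so the end coefficients of the
  quadratic have opposite signs. Annihilating further forms is left to the choice of the phase
  \<open>om\<close>.\<close>

lemma wp_Line:
  assumes R: "R 3 = 0" "R 4 = 0" "R 0 = n" and arr: "ea \<notin> {22, 24}" "M ea = E" and E: "hermitian_fun n E"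
    and E0: "qform n E (Vc M 1) > 0" "qform n E (Vc M 2) < 0" and om: "Sv M 1 = om" "om \<noteq> 0"
    and Q: "\<And>M' t. (\<And>b. b \<notin> {22, 24} \<Longrightarrow> M' b = M b) \<Longrightarrow>
      (\<And>i. i < n \<Longrightarrow> Vc M' 0 i = Vc M 1 i + (complex_of_real t * om) * Vc M 2 i) \<Longrightarrow> qform n E (Vc M' 0) = 0 \<Longrightarrow> Q M'"
  shows "wp R (Line ea) Q M"
proof -
  define x y where xy: "x = Vc M 1" "y = Vc M 2"
  define t where "t = least_real_root (Poly [qform n E x, 2 * Re (om * sform n E x y), (cmod om)\<^sup>2 * qform n E y])"
  have "qform n E x + 2 * Re (om * sform n E x y) * t + (cmod om)\<^sup>2 * qform n E y * t\<^sup>2 = 0"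
    unfolding t_def using om E0 by (intro root_quadratic) (simp add: xy mult_pos_neg)
  then have y0: "qform n E (\<lambda>i. 1 * x i + (complex_of_real t * om) * y i) = 0"
    unfolding qform_comb2[OF E] by (simp add: norm_mult power_mult_distrib algebra_simps)
  have omm: "Re om * Re om + Im om * Im om = (cmod om)\<^sup>2" by (simp add: cmod_power2 flip: power2_eq_square)
  let ?u = "\<lambda>i. x i + (complex_of_real t * om) * y i"
  have Vs: "Vc M 1 = x" "Vc M (Suc 0) = x" "Vc M 2 = y" by (simp_all add: xy)
  show ?thesis
    unfolding Line_def
  proof (rule wp_Then_FormV[where v = "complex_of_real (qform n E x)"], rule wp_Then_FormV[where v = "sform n E x y"],
      rule wp_Then_FormV[where v = "complex_of_real (qform n E y)"], rule wp_Then_SetSc[where v = "complex_of_real t * om"],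
      rule wp_Then_SetSc[where v = 0], rule wp_Then_SetSc[where v = 1], rule wp_Comb)
    let ?M = "put 7 1 (put 6 0 (put 5 (complex_of_real t * om) (put 4 (complex_of_real (qform n E y))
         (put 3 (sform n E x y) (put 2 (complex_of_real (qform n E x)) M)))))"
    show "Q (setV (R 0) 0 (\<lambda>i. Sv ?M 7 * Vc ?M 1 i + Sv ?M 5 * Vc ?M 2 i + Sv ?M 6 * Vc ?M 2 i) ?M)"
      using R y0 by (intro Q[of _ t]) (auto simp: Vs)
  qed (use R arr om in \<open>simp_all add: Vs sform_self[OF E] t_def omm flip: Sv_def\<close>)
qed

text \<open>x1 and x2 form a hyperbolic pair for C, so z can be made C-orthogonal to both; as the
  pair is isotropic, the coefficient of x1 comes from the pairing with x2 and conversely. The value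
  in the third claim is the determinant of the Gram matrix of x1, x2, z divided by
  \<open>- |\<beta>|^2\<close>.\<close>

lemma adjust:
  fixes x1 x2 z :: "nat \<Rightarrow> complex"
  assumes C: "hermitian_fun n C" "qform n C x1 = 0" "qform n C x2 = 0" and b: "sform n C x1 x2 = \<beta>" "\<beta> \<noteq> 0"
  defines "z' \<equiv> \<lambda>i. (- (sform n C x2 z / cnj \<beta>)) * x1 i + (- (sform n C x1 z / \<beta>)) * x2 i + z i"
  shows "sform n C x1 z' = 0" "sform n C x2 z' = 0"
    "qform n C z' = qform n C z - 2 * Re (sform n C x2 z * cnj (sform n C x1 z) * \<beta>) / (cmod \<beta>)\<^sup>2"
proof -
  have s: "sform n C x1 x1 = 0" "sform n C x2 x2 = 0" "sform n C x2 x1 = cnj \<beta>"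
    using C b by (simp_all add: sform_self sform_herm[OF C(1), of x2 x1])
  show 1: "sform n C x1 z' = 0" "sform n C x2 z' = 0"
    unfolding z'_def sform_linear s b(1) using b(2) by simp_all
  define g h where gh: "g = sform n C x1 z" "h = sform n C x2 z"
  have "sform n C z' z' = sform n C z z'"
    by (subst (1) z'_def) (simp only: sform_add_left sform_scale_left 1 mult_zero_right add_0)
  also have "\<dots> = sform n C z z - (h / cnj \<beta> * cnj g + g / \<beta> * cnj h)"
    unfolding z'_def sform_linear sform_herm[OF C(1), of z x1] sform_herm[OF C(1), of z x2] gh by simp
  also have "h / cnj \<beta> * cnj g + g / \<beta> * cnj h = h * cnj g * \<beta> / (\<beta> * cnj \<beta>) + cnj (h * cnj g * \<beta>) / (\<beta> * cnj \<beta>)"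
    using b by (simp add: field_simps)
  also have "\<dots> = (h * cnj g * \<beta> + cnj (h * cnj g * \<beta>)) / complex_of_real ((cmod \<beta>)\<^sup>2)"
    by (simp only: add_divide_distrib complex_norm_square)
  also have "\<dots> = complex_of_real (2 * Re (h * cnj g * \<beta>) / (cmod \<beta>)\<^sup>2)"
    unfolding complex_add_cnj by simp
  finally have "sform n C z' z' = sform n C z z - complex_of_real (2 * Re (h * cnj g * \<beta>) / (cmod \<beta>)\<^sup>2)" .
  then show "qform n C z' = qform n C z - 2 * Re (sform n C x2 z * cnj (sform n C x1 z) * \<beta>) / (cmod \<beta>)\<^sup>2"
    unfolding qform_def gh by (simp only: minus_complex.sel Re_complex_of_real)
qed

section \<open>Three forms on a complex span\<close>

definition PhaseThree :: "nat \<Rightarrow> nat \<Rightarrow> nat \<Rightarrow> prog" where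
  "PhaseThree b d e = Then (SetSc 9 (CMul CUnit (Conj (Sc b)))) (Then (SetSc 8 (CNum 0))
     (Then (Comb 2 9 2 8 2 8 2) (Three d e)))"

text \<open>
  With the phase \<open>\<omega> = \<i> cnj \<beta>\<close>, where \<open>\<beta> = v1\<^sup>H C v2\<close>, the form \<open>C\<close> vanishes on the real span of
  \<open>v1\<close>, \<open>\<omega> v2\<close>, \<open>v3\<close>. Only two real forms on a real three-dimensional space are left.
\<close>

lemma wp_PhaseThree:
  assumes R: "R 3 = 0" "R 4 = 0" "R 0 = n" and arr: "da \<notin> {22, 24}" "ea \<notin> {22, 24}" "M da = D" "M ea = E"
    and C: "hermitian_fun n C" and D: "hermitian_fun n D" and E: "hermitian_fun n E"
    and b: "Sv M b = \<beta>" "sform n C (Vc M 1) (Vc M 2) = \<beta>" "\<beta> \<noteq> 0"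
    and C0: "qform n C (Vc M 1) = 0" "qform n C (Vc M 2) = 0" "qform n C (Vc M 3) = 0"
      "sform n C (Vc M 1) (Vc M 3) = 0" "sform n C (Vc M 2) (Vc M 3) = 0"
    and D0: "qform n D (Vc M 1) = 0" "qform n D (Vc M 2) = 0" "Im (cnj \<beta> * sform n D (Vc M 1) (Vc M 2)) \<noteq> 0"
    and E0: "qform n E (Vc M 1) > 0" "qform n E (Vc M 2) < 0"
    and Q: "\<And>M' a b. (\<And>b. b \<notin> {22, 24} \<Longrightarrow> M' b = M b) \<Longrightarrow>
      (\<And>i. i < n \<Longrightarrow> Vc M' 0 i = a * Vc M 1 i + b * Vc M 2 i + Vc M 3 i) \<Longrightarrow>
      qform n C (Vc M' 0) = 0 \<Longrightarrow> qform n D (Vc M' 0) = 0 \<Longrightarrow> qform n E (Vc M' 0) = 0 \<Longrightarrow> Q M'"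
  shows "wp R (PhaseThree b da ea) Q M"
proof -
  define x1 x2 x3 where x: "x1 = Vc M 1" "x2 = Vc M 2" "x3 = Vc M 3"
  define om where "om = \<i> * cnj \<beta>"
  define v2 where "v2 = (\<lambda>i. om * x2 i)"
  have Vs: "Vc M 1 = x1" "Vc M (Suc 0) = x1" "Vc M 2 = x2" "Vc M 3 = x3" by (simp_all add: x)
  have om: "om \<noteq> 0" using b by (simp add: om_def)
  have q2: "qform n B v2 = (cmod om)\<^sup>2 * qform n B x2" if "hermitian_fun n B" for B
    unfolding v2_def by (rule qform_scale[OF that])
  have "Re (om * sform n D x1 x2) = - Im (cnj \<beta> * sform n D x1 x2)" by (simp add: om_def)
  then have reD: "Re (sform n D x1 v2) \<noteq> 0" using D0 by (simp add: v2_def sform_scale_right Vs)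
  have "sform n C x1 v2 = \<i> * complex_of_real ((cmod \<beta>)\<^sup>2)"
    unfolding complex_norm_square using b by (simp add: v2_def sform_scale_right Vs om_def mult.commute mult.left_commute)
  then have reC: "Re (sform n C x1 v2) = 0" by simp
  let ?M = "setV n 2 v2 (put 8 0 (put 9 om M))"
  show ?thesis
    unfolding PhaseThree_def
  proof (rule wp_Then_SetSc[where v = om], rule wp_Then_SetSc[where v = 0], rule wp_Then_Comb[where v = v2 and n = n])
    show "wp R (Three da ea) Q ?M"
    proof (rule wp_Three[where n = n and D = D and E = E])
      fix M' and a c :: real
      assume M': "\<And>b. b \<notin> {22, 24} \<Longrightarrow> M' b = ?M b"
        "\<And>i. i < n \<Longrightarrow> Vc M' 0 i = complex_of_real a * Vc ?M 1 i + complex_of_real c * Vc ?M 2 i + Vc ?M 3 i"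
        "qform n D (Vc M' 0) = 0" "qform n E (Vc M' 0) = 0"
      have V0: "Vc M' 0 i = complex_of_real a * x1 i + complex_of_real c * v2 i + complex_of_real 1 * x3 i" if "i < n" for i
        using M'(2)[OF that] that by (simp add: Vs)
      have "qform n C (Vc M' 0) = qform n C (\<lambda>i. complex_of_real a * x1 i + complex_of_real c * v2 i + complex_of_real 1 * x3 i)"
        by (rule qform_cong) (rule V0)
      also have "\<dots> = 0"
        unfolding qform_comb3[OF C] using C0 reC by (simp add: q2[OF C] Vs) (simp add: v2_def sform_scale_left C0 Vs)
      finally show "Q M'"
        using M' V0 by (intro Q[of _ "complex_of_real a" "complex_of_real c * om"]) (auto simp: Vs v2_def)
    qed (use R arr D E D0 E0 reD om in \<open>auto simp: Vs q2 mult_pos_neg\<close>)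
  qed (use R b in \<open>auto simp: Vs om_def v2_def simp flip: Sv_def\<close>)
qed

text \<open>The correction of \<open>adjust\<close> as a program: the pairings of x1 and x2 with the
  third vector are expected in scalars 2 and 3, and \<beta> in scalar b.\<close>

definition OrthThird :: "nat \<Rightarrow> prog \<Rightarrow> prog" where
  "OrthThird b P = Then (SetSc 5 (CSub (CNum 0) (CDiv (Sc 3) (Conj (Sc b))))) (Then (SetSc 6 (CSub (CNum 0) (CDiv (Sc 2) (Sc b))))
     (Then (SetSc 7 (CNum 1)) (Then (Comb 3 5 1 6 2 7 3) P)))"

lemma wp_OrthThird:
  assumes R: "R 3 = 0" "R 0 = n" and b: "b \<notin> {5, 6}"
    and "wp R P Q (setV n 3 (\<lambda>i. (- (Sv M 3 / cnj (Sv M b))) * Vc M 1 i + (- (Sv M 2 / Sv M b)) * Vc M 2 i + Vc M 3 i)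
        (put 7 1 (put 6 (- (Sv M 2 / Sv M b)) (put 5 (- (Sv M 3 / cnj (Sv M b))) M))))"
  shows "wp R (OrthThird b P) Q M"
  unfolding OrthThird_def
  by (rule wp_Then_SetSc[where v = "- (Sv M 3 / cnj (Sv M b))"], rule wp_Then_SetSc[where v = "- (Sv M 2 / Sv M b)"],
      rule wp_Then_SetSc[where v = 1], rule wp_Then_Comb, rule assms(4))
     (use R b in \<open>auto simp flip: Sv_def\<close>)

text \<open>
  On the span of the three vectors the determinant of \<open>G + t D\<close> is a cubic polynomial in \<open>t\<close>.
  At a root \<open>t\<close> the third vector, made orthogonal to the other two with respect to \<open>G + t D\<close>,
  is isotropic for \<open>G + t D\<close>.
\<close>

definition CubicStep :: "nat \<Rightarrow> nat \<Rightarrow> nat \<Rightarrow> prog" where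
  "CubicStep g d e = Then (FormV 2 g 1 3) (Then (FormV 3 g 2 3) (Then (FormV 5 g 3 3)
     (Then (SetSc 8 (Root
       [CSub (CMul (CNum 2) (CMul (CMul (Sc 3) (Conj (Sc 2))) (Sc 0))) (CMul (CMul (Sc 0) (Conj (Sc 0))) (Sc 5)),
        CSub (CSub (CMul (CNum 2) (CMul (CMul (Sc 3) (Conj (Sc 2))) (Sc 1))) (CMul (CMul (Sc 0) (Conj (Sc 0))) (Sc 4)))
          (CMul (CMul (CNum 2) (CMul (Sc 0) (Conj (Sc 1)))) (Sc 5)),
        CSub (CSub (CNum 0) (CMul (CMul (Sc 1) (Conj (Sc 1))) (Sc 5))) (CMul (CMul (CNum 2) (CMul (Sc 0) (Conj (Sc 1)))) (Sc 4)),
        CSub (CNum 0) (CMul (CMul (Sc 1) (Conj (Sc 1))) (Sc 4))]))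
     (Then (SetSc 0 (CAdd (Sc 0) (CMul (Sc 8) (Sc 1)))) (OrthThird 0 (PhaseThree 0 d e))))))"

text \<open>The third vector is made D-orthogonal to the other two before anything else. The leading
  coefficient of the cubic is then \<open>- |\<beta>2|^2\<close> times the value of D at it. If that
  value is 0, D itself is the degenerate member of the pencil, the one at infinity, and D and G
  change roles.\<close>

definition Pencil :: "nat \<Rightarrow> nat \<Rightarrow> nat \<Rightarrow> prog" where
  "Pencil g d e = Then (FormV 2 d 1 3) (Then (FormV 3 d 2 3) (OrthThird 1 (Then (FormV 4 d 3 3)
    (IfElse (ReLess (CNum 0) (CMul (Sc 4) (Sc 4)))
      (CubicStep g d e)
      (PhaseThree 1 g e)))))"

lemma wp_Pencil:
  assumes R: "R 3 = 0" "R 4 = 0" "R 0 = n"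
    and arr: "ga \<notin> {22, 24}" "da \<notin> {22, 24}" "ea \<notin> {22, 24}" "M ga = G" "M da = D" "M ea = E"
    and G: "hermitian_fun n G" and D: "hermitian_fun n D" and E: "hermitian_fun n E"
    and b: "Sv M 0 = \<beta>1" "sform n G (Vc M 1) (Vc M 2) = \<beta>1" "Sv M 1 = \<beta>2" "sform n D (Vc M 1) (Vc M 2) = \<beta>2"
      "Im (cnj \<beta>1 * \<beta>2) \<noteq> 0"
    and G0: "qform n G (Vc M 1) = 0" "qform n G (Vc M 2) = 0"
    and D0: "qform n D (Vc M 1) = 0" "qform n D (Vc M 2) = 0"
    and E0: "qform n E (Vc M 1) > 0" "qform n E (Vc M 2) < 0"
    and Q: "\<And>M' a b. (\<And>b. b \<notin> {22, 24} \<Longrightarrow> M' b = M b) \<Longrightarrow>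
      (\<And>i. i < n \<Longrightarrow> Vc M' 0 i = a * Vc M 1 i + b * Vc M 2 i + Vc M 3 i) \<Longrightarrow>
      qform n G (Vc M' 0) = 0 \<Longrightarrow> qform n D (Vc M' 0) = 0 \<Longrightarrow> qform n E (Vc M' 0) = 0 \<Longrightarrow> Q M'"
  shows "wp R (Pencil ga da ea) Q M"
proof -
  define x1 x2 x3 where x: "x1 = Vc M 1" "x2 = Vc M 2" "x3 = Vc M 3"
  have Vs: "Vc M 1 = x1" "Vc M (Suc 0) = x1" "Vc M 2 = x2" "Vc M 3 = x3" by (simp_all add: x)
  have b1: "\<beta>1 \<noteq> 0" and b2: "\<beta>2 \<noteq> 0" using b(5) by auto
  have bx: "sform n G x1 x2 = \<beta>1" "sform n D x1 x2 = \<beta>2" using b by (simp_all add: Vs)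
  have G0': "qform n G x1 = 0" "qform n G x2 = 0" and D0': "qform n D x1 = 0" "qform n D x2 = 0"
    and E0': "qform n E x1 > 0" "qform n E x2 < 0" using G0 D0 E0 by (simp_all add: Vs)
  define z where "z = (\<lambda>i. (- (sform n D x2 x3 / cnj \<beta>2)) * x1 i + (- (sform n D x1 x3 / \<beta>2)) * x2 i + x3 i)"
  note z = adjust(1,2)[OF D D0' bx(2) b2, of x3, folded z_def]
  define e2 where "e2 = qform n D z"
  let ?M1 = "put 3 (sform n D x2 x3) (put 2 (sform n D x1 x3) M)"
  let ?M2 = "setV n 3 z (put 7 1 (put 6 (- (sform n D x1 x3 / \<beta>2)) (put 5 (- (sform n D x2 x3 / cnj \<beta>2)) ?M1)))"
  let ?M3 = "put 4 (complex_of_real e2) ?M2"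
  have case2: "wp R (PhaseThree 1 ga ea) Q ?M3" if e2: "e2 = 0"
  proof (rule wp_PhaseThree[where n = n and C = D and D = G and E = E and \<beta> = \<beta>2])
    have "Im (cnj \<beta>2 * \<beta>1) = - Im (cnj \<beta>1 * \<beta>2)" by simp
    then show "Im (cnj \<beta>2 * sform n G (Vc ?M3 1) (Vc ?M3 2)) \<noteq> 0" using b(5) by (simp add: Vs bx mult.commute)
    fix M' a c assume M': "\<And>b. b \<notin> {22, 24} \<Longrightarrow> M' b = ?M3 b"
      "\<And>i. i < n \<Longrightarrow> Vc M' 0 i = a * Vc ?M3 1 i + c * Vc ?M3 2 i + Vc ?M3 3 i"
      "qform n D (Vc M' 0) = 0" "qform n G (Vc M' 0) = 0" "qform n E (Vc M' 0) = 0"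
    show "Q M'"
    proof (rule Q[of _ "a - sform n D x2 x3 / cnj \<beta>2" "c - sform n D x1 x3 / \<beta>2"])
      fix i assume "i < n"
      then show "Vc M' 0 i = (a - sform n D x2 x3 / cnj \<beta>2) * Vc M 1 i + (c - sform n D x1 x3 / \<beta>2) * Vc M 2 i + Vc M 3 i"
        using M'(2)[of i] by (simp add: Vs z_def algebra_simps)
    qed (use M' in auto)
  qed (use R arr G D E b2 z e2 G0' D0' E0' b in \<open>auto simp: Vs bx e2_def\<close>)
  define g1 h1 e1 where gh: "g1 = sform n G x1 z" "h1 = sform n G x2 z" "e1 = qform n G z"
  \<comment> \<open>Coefficients in l of the Gram determinant of \<open>G + l D\<close> on x1, x2,
    z. The cross terms g1 and h1 do not depend on l because z is D-orthogonal to x1 and x2.\<close>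
  define c0 c1 c2 c3 where cs: "c0 = 2 * Re (h1 * cnj g1 * \<beta>1) - (cmod \<beta>1)\<^sup>2 * e1"
    "c1 = 2 * Re (h1 * cnj g1 * \<beta>2) - (cmod \<beta>1)\<^sup>2 * e2 - 2 * Re (\<beta>1 * cnj \<beta>2) * e1"
    "c2 = - ((cmod \<beta>2)\<^sup>2 * e1) - 2 * Re (\<beta>1 * cnj \<beta>2) * e2" "c3 = - ((cmod \<beta>2)\<^sup>2 * e2)"
  define l where "l = least_real_root (Poly [c0, c1, c2, c3])"
  define \<beta> where "\<beta> = \<beta>1 + complex_of_real l * \<beta>2"
  define C where "C = (\<lambda>i j. G i j + complex_of_real l * D i j)"
  have C: "hermitian_fun n C" unfolding C_def by (rule hermitian_fun_comb(2)[OF G D])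
  have sC: "sform n C u v = sform n G u v + complex_of_real l * sform n D u v" for u v
    by (simp add: C_def sform_mat_comb)
  have qC: "qform n C u = qform n G u + l * qform n D u" for u
    by (simp add: qform_def sC)
  \<comment> \<open>Adding a real multiple of \<beta>2 does not change this imaginary part, so the
    modified \<beta> stays nonzero and independent of \<beta>2.\<close>
  have imb: "Im (cnj \<beta> * \<beta>2) = Im (cnj \<beta>1 * \<beta>2)" by (simp add: \<beta>_def algebra_simps)
  then have b0: "\<beta> \<noteq> 0" using b(5) by auto
  have C0: "qform n C x1 = 0" "qform n C x2 = 0" "sform n C x1 x2 = \<beta>"
    by (simp_all add: qC sC G0' D0' bx \<beta>_def)
  have Cz: "sform n C x1 z = g1" "sform n C x2 z = h1" "qform n C z = e1 + l * e2"
    by (simp_all add: sC qC z gh e2_def)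
  define w where "w = (\<lambda>i. (- (h1 / cnj \<beta>)) * x1 i + (- (g1 / \<beta>)) * x2 i + z i)"
  note w = adjust[OF C C0 b0, of z, unfolded Cz, folded w_def]
  have Cw: "qform n C w = 0" if "e2 \<noteq> 0"
  proof -
    have "c3 \<noteq> 0" using that b2 by (simp add: cs)
    from root_cubic[OF this, of c0 c1 c2, folded l_def]
    have "c0 + c1 * l + c2 * l\<^sup>2 + c3 * l ^ 3 = 0" .
    moreover have "(cmod \<beta>)\<^sup>2 = (cmod \<beta>1)\<^sup>2 + 2 * l * Re (\<beta>1 * cnj \<beta>2) + l\<^sup>2 * (cmod \<beta>2)\<^sup>2"
      by (simp add: \<beta>_def power2_eq_square cmod_mult_self algebra_simps)
    moreover have "Re (h1 * cnj g1 * \<beta>) = Re (h1 * cnj g1 * \<beta>1) + l * Re (h1 * cnj g1 * \<beta>2)"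
      by (simp add: \<beta>_def distrib_left algebra_simps)
    ultimately have "2 * Re (h1 * cnj g1 * \<beta>) = (e1 + l * e2) * (cmod \<beta>)\<^sup>2"
      by (simp add: cs algebra_simps power2_eq_square power3_eq_cube)
    then show ?thesis using w(3) b0 by simp
  qed
  let ?M4 = "put 0 \<beta> (put 8 (complex_of_real l) (put 5 (complex_of_real e1) (put 3 h1 (put 2 g1 ?M3))))"
  let ?M5 = "setV n 3 w (put 7 1 (put 6 (- (g1 / \<beta>)) (put 5 (- (h1 / cnj \<beta>)) ?M4)))"
  have case1: "wp R (PhaseThree 0 da ea) Q ?M5" if e2: "e2 \<noteq> 0"
  proof (rule wp_PhaseThree[where n = n and C = C and D = D and E = E and \<beta> = \<beta>])
    show "Im (cnj \<beta> * sform n D (Vc ?M5 1) (Vc ?M5 2)) \<noteq> 0" using b(5) imb by (simp add: Vs bx)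
    fix M' a c assume M': "\<And>b. b \<notin> {22, 24} \<Longrightarrow> M' b = ?M5 b"
      "\<And>i. i < n \<Longrightarrow> Vc M' 0 i = a * Vc ?M5 1 i + c * Vc ?M5 2 i + Vc ?M5 3 i"
      "qform n C (Vc M' 0) = 0" "qform n D (Vc M' 0) = 0" "qform n E (Vc M' 0) = 0"
    show "Q M'"
    proof (rule Q[of _ "a - h1 / cnj \<beta> - sform n D x2 x3 / cnj \<beta>2" "c - g1 / \<beta> - sform n D x1 x3 / \<beta>2"])
      fix i assume "i < n"
      then show "Vc M' 0 i = (a - h1 / cnj \<beta> - sform n D x2 x3 / cnj \<beta>2) * Vc M 1 i + (c - g1 / \<beta> - sform n D x1 x3 / \<beta>2) * Vc M 2 i + Vc M 3 i"
        using M'(2)[of i] by (simp add: Vs w_def z_def algebra_simps)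
    next
      show "qform n G (Vc M' 0) = 0" using M'(3,4) by (simp add: qC)
    qed (use M' in auto)
  qed (use R arr C D E b0 w Cw[OF e2] C0 D0' E0' in \<open>auto simp: Vs\<close>)
  have bb: "\<beta>1 * cnj \<beta>1 = complex_of_real ((cmod \<beta>1)\<^sup>2)" "\<beta>2 * cnj \<beta>2 = complex_of_real ((cmod \<beta>2)\<^sup>2)"
    unfolding complex_norm_square by simp_all
  show ?thesis
    unfolding Pencil_def
  proof (rule wp_Then_FormV[where v = "sform n D x1 x3"], rule wp_Then_FormV[where v = "sform n D x2 x3"], rule wp_OrthThird[where n = n])
    have "wp R (Then (FormV 4 da 3 3) (IfElse (ReLess (CNum 0) (CMul (Sc 4) (Sc 4)))
      (CubicStep ga da ea)
      (PhaseThree 1 ga ea))) Q ?M2"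
    proof (rule wp_Then_FormV[where v = "complex_of_real e2"], rule wp_IfElse)
      assume "bval (R, ?M3) (ReLess (CNum 0) (CMul (Sc 4) (Sc 4)))"
      then have e2: "e2 \<noteq> 0" by (auto simp flip: Sv_def)
      show "wp R (CubicStep ga da ea) Q ?M3"
      proof -
        have "setV n 3 (\<lambda>i. (- (Sv ?M4 3 / cnj (Sv ?M4 0))) * Vc ?M4 1 i + (- (Sv ?M4 2 / Sv ?M4 0)) * Vc ?M4 2 i + Vc ?M4 3 i)
          (put 7 1 (put 6 (- (Sv ?M4 2 / Sv ?M4 0)) (put 5 (- (Sv ?M4 3 / cnj (Sv ?M4 0))) ?M4))) = ?M5"
          by (simp add: Vs) (rule setV_cong, simp add: w_def)
        then have main: "wp R (PhaseThree 0 da ea) Q (setV n 3 (\<lambda>i. (- (Sv ?M4 3 / cnj (Sv ?M4 0))) * Vc ?M4 1 i + (- (Sv ?M4 2 / Sv ?M4 0)) * Vc ?M4 2 i + Vc ?M4 3 i)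
          (put 7 1 (put 6 (- (Sv ?M4 2 / Sv ?M4 0)) (put 5 (- (Sv ?M4 3 / cnj (Sv ?M4 0))) ?M4))))"
          using case1[OF e2] by (simp only:)
        have re: "Re \<beta>1 * Re \<beta>1 + Im \<beta>1 * Im \<beta>1 = (cmod \<beta>1)\<^sup>2" "Re \<beta>2 * Re \<beta>2 + Im \<beta>2 * Im \<beta>2 = (cmod \<beta>2)\<^sup>2"
          by (simp_all add: cmod_power2 flip: power2_eq_square)
        show ?thesis
          unfolding CubicStep_def
          by (rule wp_Then_FormV[where v = g1], rule wp_Then_FormV[where v = h1], rule wp_Then_FormV[where v = "complex_of_real e1"],
              rule wp_Then_SetSc[where v = "complex_of_real l"], rule wp_Then_SetSc[where v = \<beta>],
              rule wp_OrthThird[where n = n], use R in simp, use R in simp, simp, rule main)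
             (use R arr b in \<open>simp_all add: Vs gh \<beta>_def sform_self[OF G] l_def cs re flip: Sv_def\<close>)
      qed
    next
      assume "\<not> bval (R, ?M3) (ReLess (CNum 0) (CMul (Sc 4) (Sc 4)))"
      then have "e2 = 0" by (auto simp: zero_less_mult_iff simp flip: Sv_def)
      then show "wp R (PhaseThree 1 ga ea) Q ?M3" by (rule case2)
    qed (use R arr in \<open>auto simp: sform_self[OF D] e2_def\<close>)
    then show "wp R (Then (FormV 4 da 3 3) (IfElse (ReLess (CNum 0) (CMul (Sc 4) (Sc 4)))
      (CubicStep ga da ea)
      (PhaseThree 1 ga ea))) Q (setV n 3 (\<lambda>i. (- (Sv ?M1 3 / cnj (Sv ?M1 1))) * Vc ?M1 1 i + (- (Sv ?M1 2 / Sv ?M1 1)) * Vc ?M1 2 i + Vc ?M1 3 i)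
        (put 7 1 (put 6 (- (Sv ?M1 2 / Sv ?M1 1)) (put 5 (- (Sv ?M1 3 / cnj (Sv ?M1 1))) ?M1))))"
      using b by (simp add: Vs z_def)
  qed (use R arr in \<open>auto simp: Vs\<close>)
qed

section \<open>Treating two columns of opposite sign\<close>

definition PairR :: "nat \<Rightarrow> nat \<Rightarrow> nat \<Rightarrow> prog" where
  "PairR d e z = Then (FormV 0 d 1 2) (IfElse (ReLess (CNum 0) (CMul (Sc 0) (Conj (Sc 0))))
     (Then (FindKernel z) (Three d e)) (Then (SetSc 1 (CNum 1)) (Line e)))"

text \<open>Scalar 2 is -2 times the imaginary part of \<open>cnj \<beta>G * \<beta>D\<close> for
  the cross terms \<beta>G and \<beta>D. It vanishes iff they are real multiples of one complex
  number, and then a single phase serves both forms. The cross terms are evaluated again after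
  \<open>FindKernel\<close>, which overwrites scalars 0 and 1.\<close>

definition PairC :: "nat \<Rightarrow> nat \<Rightarrow> nat \<Rightarrow> nat \<Rightarrow> prog" where
  "PairC g d e z = Then (FormV 0 g 1 2) (Then (FormV 1 d 1 2)
    (Then (SetSc 2 (CAdd (CMul (CMul CUnit (Conj (Sc 0))) (Sc 1)) (Conj (CMul (CMul CUnit (Conj (Sc 0))) (Sc 1)))))
    (IfElse (ReLess (CNum 0) (CMul (Sc 2) (Sc 2)))
      (Then (FindKernel z) (Then (FormV 0 g 1 2) (Then (FormV 1 d 1 2) (Pencil g d e))))
      (Then (IfElse (ReLess (CNum 0) (CMul (Sc 0) (Conj (Sc 0)))) (SetSc 1 (CMul CUnit (Conj (Sc 0))))
               (IfElse (ReLess (CNum 0) (CMul (Sc 1) (Conj (Sc 1)))) (SetSc 1 (CMul CUnit (Conj (Sc 1)))) (SetSc 1 (CNum 1))))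
            (Line e)))))"

lemma mv_comb:
  "mv n Z (\<lambda>i. a * x i + b * y i) i = a * mv n Z x i + b * mv n Z y i"
  by (simp add: mv_def distrib_left sum.distrib sum_distrib_left mult.left_commute)

lemma mv_cong_vec: "(\<And>i. i < n \<Longrightarrow> x i = x' i) \<Longrightarrow> mv n Z x i = mv n Z x' i"
  by (simp add: mv_def)

lemma sform_idm_nonzero:
  assumes "sform n idm y x \<noteq> 0" shows "qform n idm x \<noteq> 0"
proof
  assume "qform n idm x = 0"
  then have "\<forall>i<n. x i = 0" by (simp add: qform_idm_zero_iff)
  then show False using assms by (simp add: sform_idm)
qed

text \<open>The pairing of v3 with y is the squared norm of v3, since v3 is orthogonal to v1 and v2
  and enters with coefficient 1; hence y is not zero.\<close>

lemma span_solution: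
  assumes y: "\<And>i. i < n \<Longrightarrow> y i = a * v1 i + b * v2 i + v3 i"
    and mv: "\<And>i. i < n \<Longrightarrow> mv n Z v1 i = 0" "\<And>i. i < n \<Longrightarrow> mv n Z v2 i = 0" "\<And>i. i < n \<Longrightarrow> mv n Z v3 i = 0"
    and orth: "sform n idm v1 v3 = 0" "sform n idm v2 v3 = 0" "qform n idm v3 \<noteq> 0"
  shows "i < n \<Longrightarrow> mv n Z y i = 0" and "qform n idm y \<noteq> 0"
proof -
  have "mv n Z y i = mv n Z (\<lambda>i. 1 * (a * v1 i + b * v2 i) + 1 * v3 i) i"
    by (rule mv_cong_vec) (simp add: y)
  then show "i < n \<Longrightarrow> mv n Z y i = 0" unfolding mv_comb using mv by simp
  have "sform n idm v3 y = sform n idm v3 (\<lambda>i. a * v1 i + b * v2 i + v3 i)"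
    by (rule sform_cong) (simp_all add: y)
  also have "\<dots> = a * sform n idm v3 v1 + b * sform n idm v3 v2 + sform n idm v3 v3"
    by (simp only: sform_linear)
  also have "\<dots> = complex_of_real (qform n idm v3)"
    using orth sform_herm[of n idm v3 v1] sform_herm[of n idm v3 v2] by (simp add: sform_self)
  finally have "sform n idm v3 y \<noteq> 0" using orth(3) by simp
  then show "qform n idm y \<noteq> 0" by (rule sform_idm_nonzero)
qed

text \<open>If y vanished, v1 would be \<open>- \<tau>\<close> times v2, and E could not be positive
  at v1 and negative at v2.\<close>

lemma line_solution:
  assumes y: "\<And>i. i < n \<Longrightarrow> y i = v1 i + \<tau> * v2 i"
    and mv: "\<And>i. i < n \<Longrightarrow> mv n Z v1 i = 0" "\<And>i. i < n \<Longrightarrow> mv n Z v2 i = 0"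
    and E: "hermitian_fun n E" "qform n E v1 > 0" "qform n E v2 < 0"
  shows "i < n \<Longrightarrow> mv n Z y i = 0" and "qform n idm y \<noteq> 0"
    and "hermitian_fun n G \<Longrightarrow> qform n G v1 = 0 \<Longrightarrow> qform n G v2 = 0 \<Longrightarrow> Re (\<tau> * sform n G v1 v2) = 0 \<Longrightarrow> qform n G y = 0"
proof -
  have "mv n Z y i = mv n Z (\<lambda>i. 1 * v1 i + \<tau> * v2 i) i"
    by (rule mv_cong_vec) (simp add: y)
  then show "i < n \<Longrightarrow> mv n Z y i = 0" unfolding mv_comb using mv by simp
  have q: "qform n B y = qform n B (\<lambda>i. 1 * v1 i + \<tau> * v2 i)" for B
    by (rule qform_cong) (simp add: y)
  show "qform n G y = 0" if "hermitian_fun n G" "qform n G v1 = 0" "qform n G v2 = 0" "Re (\<tau> * sform n G v1 v2) = 0"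
    using that unfolding q qform_comb2[OF that(1)] by simp
  show "qform n idm y \<noteq> 0"
  proof
    assume "qform n idm y = 0"
    then have "\<forall>i<n. v1 i = - \<tau> * v2 i" using y by (simp add: qform_idm_zero_iff add_eq_0_iff)
    then have "qform n E v1 = qform n E (\<lambda>i. - \<tau> * v2 i)" by (intro qform_cong) simp
    also have "\<dots> = (cmod \<tau>)\<^sup>2 * qform n E v2" unfolding qform_scale[OF E(1)] by simp
    also have "\<dots> \<le> 0" using E by (simp add: mult_nonneg_nonpos)
    finally show False using E by simp
  qed
qed

lemma wp_Then_FindKernel:
  assumes "base_field F" "R 1 = 0" "R 3 = 0" "R 4 = 0" "R 0 = n" "za \<notin> {20, 22, 24}"
    "\<And>i j. i < n \<Longrightarrow> j < n \<Longrightarrow> M 14 i j = idm i j" "hermitian_fun n (M za)" "base_field.matF F n (M za)"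
    "base_field.vecF F n (Vc M 1)" "base_field.vecF F n (Vc M 2)" "\<And>i. i < n \<Longrightarrow> Vc M 3 i = 0"
    and "\<And>M'. (\<And>b. b \<notin> {20, 22, 24} \<Longrightarrow> M' b = M b) \<Longrightarrow> (\<And>k. k \<notin> {3, 4, 5, 6} \<Longrightarrow> Vc M' k = Vc M k) \<Longrightarrow>
      base_field.vecF F n (Vc M' 3) \<Longrightarrow> (\<And>i. i < n \<Longrightarrow> mv n (M za) (Vc M' 3) i = 0) \<Longrightarrow>
      sform n idm (Vc M 1) (Vc M' 3) = 0 \<Longrightarrow> sform n idm (Vc M 2) (Vc M' 3) = 0 \<Longrightarrow>
      (\<And>y. qform n idm y \<noteq> 0 \<Longrightarrow> (\<And>i. i < n \<Longrightarrow> mv n (M za) y i = 0) \<Longrightarrow>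
         sform n idm (Vc M 1) y = 0 \<Longrightarrow> sform n idm (Vc M 2) y = 0 \<Longrightarrow> qform n idm (Vc M' 3) \<noteq> 0) \<Longrightarrow> wp R P Q M'"
  shows "wp R (Then (FindKernel za) P) Q M"
  by (rule wp_Then, rule base_field.wp_FindKernel[OF assms(1-5)]) (use assms(6-) in auto)

context base_field begin

definition third_vector :: "nat \<Rightarrow> (nat \<Rightarrow> nat \<Rightarrow> complex) \<Rightarrow> (nat \<Rightarrow> complex) \<Rightarrow> (nat \<Rightarrow> complex) \<Rightarrow> bool" where
  "third_vector n Z x1 x2 \<longleftrightarrow> (\<exists>y. qform n idm y \<noteq> 0 \<and> (\<forall>i<n. mv n Z y i = 0) \<and>
     sform n idm x1 y = 0 \<and> sform n idm x2 y = 0)"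

text \<open>
  \<open>independent_pair\<close> says that no phase \<open>\<omega>\<close> in the base field makes both forms vanish on the real span
  of \<open>x1\<close> and \<open>\<omega> x2\<close>; this is where the conditions (I.4.1) and (I.4.2) come from.
\<close>

definition independent_pair :: "nat \<Rightarrow> (nat \<Rightarrow> nat \<Rightarrow> complex) \<Rightarrow> (nat \<Rightarrow> nat \<Rightarrow> complex) \<Rightarrow>
    (nat \<Rightarrow> complex) \<Rightarrow> (nat \<Rightarrow> complex) \<Rightarrow> bool" where
  "independent_pair n G D x1 x2 \<longleftrightarrow>
     (if F = \<real> then sform n D x1 x2 \<noteq> 0 else Im (cnj (sform n G x1 x2) * sform n D x1 x2) \<noteq> 0)"

text \<open>The distinction by F selects a program text; no test takes place at run time.\<close>

definition Pair :: "nat \<Rightarrow> nat \<Rightarrow> nat \<Rightarrow> nat \<Rightarrow> prog" where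
  "Pair g d e z = (if F = \<real> then PairR d e z else PairC g d e z)"

lemma wp_Pair:
  assumes R: "R 1 = 0" "R 3 = 0" "R 4 = 0" "R 0 = n"
    and arr: "ga \<notin> {20, 22, 24}" "da \<notin> {20, 22, 24}" "ea \<notin> {20, 22, 24}" "za \<notin> {20, 22, 24}"
      "M ga = G" "M da = D" "M ea = E" "M za = Z"
    and I: "\<And>i j. i < n \<Longrightarrow> j < n \<Longrightarrow> M 14 i j = idm i j"
    and herm: "hermitian_fun n G" "hermitian_fun n D" "hermitian_fun n E" "hermitian_fun n Z"
    and matF: "matF n D" "matF n Z" and real: "F = UNIV \<or> G = (\<lambda>i j. 0)"
    and V: "vecF n (Vc M 1)" "vecF n (Vc M 2)" "\<And>i. i < n \<Longrightarrow> Vc M 3 i = 0"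
    and mv: "\<And>i. i < n \<Longrightarrow> mv n Z (Vc M 1) i = 0" "\<And>i. i < n \<Longrightarrow> mv n Z (Vc M 2) i = 0"
    and G0: "qform n G (Vc M 1) = 0" "qform n G (Vc M 2) = 0"
    and D0: "qform n D (Vc M 1) = 0" "qform n D (Vc M 2) = 0"
    and E0: "qform n E (Vc M 1) > 0" "qform n E (Vc M 2) < 0"
    and third: "independent_pair n G D (Vc M 1) (Vc M 2) \<Longrightarrow> third_vector n Z (Vc M 1) (Vc M 2)"
    and Q: "\<And>M'. (\<And>b. b \<notin> {20, 22, 24} \<Longrightarrow> M' b = M b) \<Longrightarrow> vecF n (Vc M' 0) \<Longrightarrow>
      (\<And>i. i < n \<Longrightarrow> mv n Z (Vc M' 0) i = 0) \<Longrightarrow> qform n idm (Vc M' 0) \<noteq> 0 \<Longrightarrow>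
      qform n G (Vc M' 0) = 0 \<Longrightarrow> qform n D (Vc M' 0) = 0 \<Longrightarrow> qform n E (Vc M' 0) = 0 \<Longrightarrow> Q M'"
  shows "wp R (Pair ga da ea za) Q M"
proof -
  define x1 x2 where x: "x1 = Vc M 1" "x2 = Vc M 2"
  have Vs: "Vc M 1 = x1" "Vc M (Suc 0) = x1" "Vc M 2 = x2" by (simp_all add: x)
  define \<beta>G \<beta>D where b: "\<beta>G = sform n G x1 x2" "\<beta>D = sform n D x1 x2"
  have line: "wp R (Line ea) Q M1"
    if M1: "\<And>b. b \<notin> {22, 24} \<Longrightarrow> M1 b = M b" "Vc M1 1 = x1" "Vc M1 2 = x2" "Sv M1 1 = om" "om \<noteq> 0" "om \<in> F"
      and om: "Re (om * \<beta>G) = 0" "Re (om * \<beta>D) = 0" for M1 om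
  proof (rule wp_Line[where n = n and E = E and om = om])
    fix M' t assume M': "\<And>b. b \<notin> {22, 24} \<Longrightarrow> M' b = M1 b"
      "\<And>i. i < n \<Longrightarrow> Vc M' 0 i = Vc M1 1 i + (complex_of_real t * om) * Vc M1 2 i" "qform n E (Vc M' 0) = 0"
    then have y: "\<And>i. i < n \<Longrightarrow> Vc M' 0 i = x1 i + (complex_of_real t * om) * x2 i" unfolding M1(2,3) by blast
    have "qform n E x1 > 0" "qform n E x2 < 0" using E0 by (simp_all add: Vs)
    note sol = line_solution[OF y mv[unfolded Vs] herm(3) this]
    have re: "Re (complex_of_real t * om * z) = t * Re (om * z)" for z unfolding mult.assoc by simp
    have zG: "qform n G (Vc M' 0) = 0"
      using G0 om by (intro sol(3) herm) (simp_all only: re b[symmetric] Vs mult_zero_right)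
    have zD: "qform n D (Vc M' 0) = 0"
      using D0 om by (intro sol(3) herm) (simp_all only: re b[symmetric] Vs mult_zero_right)
    have "vecF n (Vc M' 0)" using y V M1 by (simp add: vecF_def Vs)
    then show "Q M'" using M' M1 sol(1,2) zG zD by (intro Q) auto
  qed (use R arr herm E0 M1 in \<open>auto simp: Vs\<close>)
  have finish: "Q M'"
    if M2: "\<And>b. b \<notin> {20, 22, 24} \<Longrightarrow> M2 b = M b" "vecF n v3" "\<And>i. i < n \<Longrightarrow> mv n Z v3 i = 0"
        "sform n idm x1 v3 = 0" "sform n idm x2 v3 = 0" "qform n idm v3 \<noteq> 0"
      and M': "\<And>b. b \<notin> {22, 24} \<Longrightarrow> M' b = M2 b" "\<And>i. i < n \<Longrightarrow> Vc M' 0 i = a * x1 i + c * x2 i + v3 i"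
        "qform n G (Vc M' 0) = 0" "qform n D (Vc M' 0) = 0" "qform n E (Vc M' 0) = 0"
      and ac: "a \<in> F" "c \<in> F" for M2 M' a c v3
  proof (rule Q)
    show "vecF n (Vc M' 0)" using M'(2) ac V M2(2) by (auto simp: vecF_def Vs)
    show "\<And>i. i < n \<Longrightarrow> mv n Z (Vc M' 0) i = 0" "qform n idm (Vc M' 0) \<noteq> 0"
      using span_solution[OF M'(2) mv[unfolded Vs] M2(3-6)] by auto
  qed (use M2 M' in auto)
  show ?thesis
  proof (cases "F = \<real>")
    case True
    \<comment> \<open>The alternative \<open>F = UNIV\<close> is excluded because \<i> is not
      real.\<close>
    then have G: "G = (\<lambda>i j. 0)" using real by (metis Complex.Re_complex_of_real Reals_cases UNIV_I complex_i_not_one i_squared imaginary_unit.sel(1) mult_zero_left of_real_0 imaginary_unit.sel(2) zero_complex.sel(2) Im_complex_of_real one_neq_zero)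
    have GB: "\<beta>G = 0" "qform n G y = 0" for y by (simp_all add: b G sform_def qform_def)
    have bD: "\<beta>D \<in> \<real>" using sform_F[OF matF(1) V(1,2)] True by (simp add: b Vs)
    show ?thesis
      unfolding Pair_def PairR_def if_P[OF True]
    proof (rule wp_Then_FormV[where v = \<beta>D], rule wp_IfElse)
      let ?M1 = "put 0 \<beta>D M"
      assume "bval (R, ?M1) (ReLess (CNum 0) (CMul (Sc 0) (Conj (Sc 0))))"
      then have "0 < Re (\<beta>D * cnj \<beta>D)" by (simp flip: Sv_def)
      then have bD0: "\<beta>D \<noteq> 0" unfolding nonzero_test .
      from bD0 have "independent_pair n G D x1 x2" unfolding independent_pair_def if_P[OF True] by (simp add: b)
      then have th: "third_vector n Z x1 x2" using third unfolding Vs by blast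
      have re: "Re \<beta>D \<noteq> 0" using bD bD0 by (auto simp: complex_is_Real_iff complex_eq_iff)
      show "wp R (Then (FindKernel za) (Three da ea)) Q ?M1"
      proof (rule wp_Then_FindKernel[OF base_field_axioms])
        fix M2 assume M2: "\<And>b. b \<notin> {20, 22, 24} \<Longrightarrow> M2 b = ?M1 b" "\<And>k. k \<notin> {3, 4, 5, 6} \<Longrightarrow> Vc M2 k = Vc ?M1 k"
          "vecF n (Vc M2 3)" "\<And>i. i < n \<Longrightarrow> mv n (?M1 za) (Vc M2 3) i = 0"
          "sform n idm (Vc ?M1 1) (Vc M2 3) = 0" "sform n idm (Vc ?M1 2) (Vc M2 3) = 0"
          "\<And>y. qform n idm y \<noteq> 0 \<Longrightarrow> (\<And>i. i < n \<Longrightarrow> mv n (?M1 za) y i = 0) \<Longrightarrow>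
             sform n idm (Vc ?M1 1) y = 0 \<Longrightarrow> sform n idm (Vc ?M1 2) y = 0 \<Longrightarrow> qform n idm (Vc M2 3) \<noteq> 0"
        have za: "?M1 za = Z" using arr by simp
        have nz: "qform n idm (Vc M2 3) \<noteq> 0" using th M2(7)[unfolded za] by (auto simp: third_vector_def Vs)
        show "wp R (Three da ea) Q M2"
        proof (rule wp_Three[where n = n and D = D and E = E])
          fix M' a c assume "\<And>b. b \<notin> {22, 24} \<Longrightarrow> M' b = M2 b"
            "\<And>i. i < n \<Longrightarrow> Vc M' 0 i = complex_of_real a * Vc M2 1 i + complex_of_real c * Vc M2 2 i + Vc M2 3 i"
            "qform n D (Vc M' 0) = 0" "qform n E (Vc M' 0) = 0"
          then show "Q M'" using M2[unfolded za] nz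
            by (intro finish[of M2 "Vc M2 3" M' "complex_of_real a" "complex_of_real c"]) (auto simp: GB Vs)
        qed (use R arr herm D0 E0 re M2(1,2) in \<open>auto simp: Vs b\<close>)
      qed (use R arr herm matF V I in \<open>auto simp: Vs\<close>)
    next
      let ?M1 = "put 0 \<beta>D M"
      assume "\<not> bval (R, ?M1) (ReLess (CNum 0) (CMul (Sc 0) (Conj (Sc 0))))"
      then have "\<not> 0 < Re (\<beta>D * cnj \<beta>D)" by (simp flip: Sv_def)
      then have "\<beta>D = 0" unfolding nonzero_test by simp
      then show "wp R (Then (SetSc 1 (CNum 1)) (Line ea)) Q ?M1"
        by (intro wp_Then_SetSc[where v = 1] line[of _ 1]) (auto simp: Vs GB)
    qed (use R arr in \<open>auto simp: Vs b\<close>)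
  next
    case False
    then have FU: "F = UNIV" using F by blast
    show ?thesis
      unfolding Pair_def PairC_def if_not_P[OF False]
    proof (rule wp_Then_FormV[where v = \<beta>G], rule wp_Then_FormV[where v = \<beta>D],
        rule wp_Then_SetSc[where v = "complex_of_real (- 2 * Im (cnj \<beta>G * \<beta>D))"], rule wp_IfElse)
      let ?M1 = "put 2 (complex_of_real (- 2 * Im (cnj \<beta>G * \<beta>D))) (put 1 \<beta>D (put 0 \<beta>G M))"
      assume "bval (R, ?M1) (ReLess (CNum 0) (CMul (Sc 2) (Sc 2)))"
      then have im: "Im (cnj \<beta>G * \<beta>D) \<noteq> 0" by (auto simp flip: Sv_def)
      then have "independent_pair n G D x1 x2" unfolding independent_pair_def if_not_P[OF False] by (simp add: b)
      then have th: "third_vector n Z x1 x2" using third unfolding Vs by blast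
      show "wp R (Then (FindKernel za) (Then (FormV 0 ga 1 2) (Then (FormV 1 da 1 2) (Pencil ga da ea)))) Q ?M1"
      proof (rule wp_Then_FindKernel[OF base_field_axioms])
        fix M2 assume M2: "\<And>b. b \<notin> {20, 22, 24} \<Longrightarrow> M2 b = ?M1 b" "\<And>k. k \<notin> {3, 4, 5, 6} \<Longrightarrow> Vc M2 k = Vc ?M1 k"
          "vecF n (Vc M2 3)" "\<And>i. i < n \<Longrightarrow> mv n (?M1 za) (Vc M2 3) i = 0"
          "sform n idm (Vc ?M1 1) (Vc M2 3) = 0" "sform n idm (Vc ?M1 2) (Vc M2 3) = 0"
          "\<And>y. qform n idm y \<noteq> 0 \<Longrightarrow> (\<And>i. i < n \<Longrightarrow> mv n (?M1 za) y i = 0) \<Longrightarrow>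
             sform n idm (Vc ?M1 1) y = 0 \<Longrightarrow> sform n idm (Vc ?M1 2) y = 0 \<Longrightarrow> qform n idm (Vc M2 3) \<noteq> 0"
        have za: "?M1 za = Z" using arr by simp
        have nz: "qform n idm (Vc M2 3) \<noteq> 0" using th M2(7)[unfolded za] by (auto simp: third_vector_def Vs)
        show "wp R (Then (FormV 0 ga 1 2) (Then (FormV 1 da 1 2) (Pencil ga da ea))) Q M2"
        proof (rule wp_Then_FormV[where v = \<beta>G], rule wp_Then_FormV[where v = \<beta>D],
            rule wp_Pencil[where n = n and G = G and D = D and E = E and ?\<beta>1.0 = \<beta>G and ?\<beta>2.0 = \<beta>D])
          let ?M3 = "put 1 \<beta>D (put 0 \<beta>G M2)"
          fix M' a c assume "\<And>b. b \<notin> {22, 24} \<Longrightarrow> M' b = ?M3 b"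
            "\<And>i. i < n \<Longrightarrow> Vc M' 0 i = a * Vc ?M3 1 i + c * Vc ?M3 2 i + Vc ?M3 3 i"
            "qform n G (Vc M' 0) = 0" "qform n D (Vc M' 0) = 0" "qform n E (Vc M' 0) = 0"
          then show "Q M'" using M2[unfolded za] nz
            by (intro finish[of M2 "Vc M2 3" M' a c]) (auto simp: FU Vs)
        qed (use R arr herm G0 D0 E0 im M2(1,2) in \<open>auto simp: Vs b\<close>)
      qed (use R arr herm matF V I in \<open>auto simp: Vs\<close>)
    next
      let ?M1 = "put 2 (complex_of_real (- 2 * Im (cnj \<beta>G * \<beta>D))) (put 1 \<beta>D (put 0 \<beta>G M))"
      assume "\<not> bval (R, ?M1) (ReLess (CNum 0) (CMul (Sc 2) (Sc 2)))"
      then have im: "Im (cnj \<beta>G * \<beta>D) = 0"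
        by (auto simp: zero_less_mult_iff not_less simp flip: Sv_def) 
      show "wp R (Then (IfElse (ReLess (CNum 0) (CMul (Sc 0) (Conj (Sc 0)))) (SetSc 1 (CMul CUnit (Conj (Sc 0))))
               (IfElse (ReLess (CNum 0) (CMul (Sc 1) (Conj (Sc 1)))) (SetSc 1 (CMul CUnit (Conj (Sc 1)))) (SetSc 1 (CNum 1))))
            (Line ea)) Q ?M1" (is "wp R (Then (IfElse ?b1 _ (IfElse ?b2 _ _)) _) Q _")
      proof (rule wp_Then, intro wp_IfElse wp_SetSc)
        \<comment> \<open>As the imaginary part is 0, the phase \<open>\<i> * cnj \<beta>G\<close>
          removes the real parts of both cross terms; if \<beta>G is 0, \<beta>D is used in the same
          way, and if both are 0 any phase works.\<close>
        have t: "bval (R, ?M1) ?b1 \<longleftrightarrow> \<beta>G \<noteq> 0" "bval (R, ?M1) ?b2 \<longleftrightarrow> \<beta>D \<noteq> 0"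
          using nonzero_test[of \<beta>G] nonzero_test[of \<beta>D] by (simp_all del: times_complex.sel flip: Sv_def)
        { assume "bval (R, ?M1) ?b1"
          then have "\<beta>G \<noteq> 0" using t by blast
          then show "wp R (Line ea) Q (put 1 (cval (R, ?M1) (CMul CUnit (Conj (Sc 0)))) ?M1)"
            using im by (intro line[of _ "\<i> * cnj \<beta>G"]) (auto simp: FU Vs algebra_simps simp flip: Sv_def)
        next
          assume "\<not> bval (R, ?M1) ?b1" "bval (R, ?M1) ?b2"
          then have "\<beta>G = 0" "\<beta>D \<noteq> 0" using t by blast+
          then show "wp R (Line ea) Q (put 1 (cval (R, ?M1) (CMul CUnit (Conj (Sc 1)))) ?M1)"
            by (intro line[of _ "\<i> * cnj \<beta>D"]) (auto simp: FU Vs algebra_simps simp flip: Sv_def)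
        next
          assume "\<not> bval (R, ?M1) ?b1" "\<not> bval (R, ?M1) ?b2"
          then have "\<beta>G = 0" "\<beta>D = 0" using t by blast+
          then show "wp R (Line ea) Q (put 1 (cval (R, ?M1) (CNum 1)) ?M1)"
            by (intro line[of _ 1]) (auto simp: FU Vs) }
      qed
    qed (use R arr in \<open>auto simp: Vs b complex_eq_iff simp flip: Sv_def\<close>)
  qed
qed

end

section \<open>The algorithm\<close>

definition BuildForm :: "nat \<Rightarrow> nat \<Rightarrow> nat \<Rightarrow> prog" where
  "BuildForm b e i0 = Map2 b (CSub (Cell e (NReg 3) (NReg 4))
     (CMul (CDiv (Cell 23 (NNum e) (NNum 0)) (Cell 23 (NNum i0) (NNum 0))) (Cell i0 (NReg 3) (NReg 4))))"

text \<open>Parametrised by the right-hand sides: the algorithm takes for \<open>a e\<close> the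
  inner product of \<open>A e\<close> and X, which makes the form vanish against X, while Property I
  takes c and i0 = m. The two agree when all constraints are active at X.\<close>

definition eform :: "(nat \<Rightarrow> nat \<Rightarrow> nat \<Rightarrow> complex) \<Rightarrow> (nat \<Rightarrow> real) \<Rightarrow> nat \<Rightarrow> nat \<Rightarrow> nat \<Rightarrow> nat \<Rightarrow> complex" where
  "eform A a i0 e = (\<lambda>p q. A e p q - complex_of_real (a e / a i0) * A i0 p q)"

lemma wp_Then_BuildForm:
  assumes "R 3 = 0" "R 4 = 0" "R 0 = n" "b \<notin> {e, i0, 23}" "M 23 e 0 = complex_of_real (a e)" "M 23 i0 0 = complex_of_real (a i0)"
    and "M e = A e" "M i0 = A i0" and "wp R P Q (put_mat n b (eform A a i0 e) M)"
  shows "wp R (Then (BuildForm b e i0) P) Q M"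
  unfolding BuildForm_def
proof (rule wp_Then, rule wp_Map2[where v = "eform A a i0 e"])
  fix i j M' assume "agree_but {(b, k, l) |k l. k < i \<or> k = i \<and> l < j} M M'"
  then have "M' e i j = M e i j" "M' i0 i j = M i0 i j" "M' 23 e 0 = M 23 e 0" "M' 23 i0 0 = M 23 i0 0"
    using assms(4) by (auto simp: agree_but_def)
  then show "cval (R(3 := i, 4 := j), M') (CSub (Cell e (NReg 3) (NReg 4))
     (CMul (CDiv (Cell 23 (NNum e) (NNum 0)) (Cell 23 (NNum i0) (NNum 0))) (Cell i0 (NReg 3) (NReg 4)))) = eform A a i0 e i j"
    using assms by (simp add: eform_def)
qed (use assms in auto)

definition rest :: "nat \<Rightarrow> nat \<Rightarrow> nat \<Rightarrow> nat list" where
  "rest m j i0 = filter (\<lambda>e. e \<noteq> j \<and> e \<noteq> i0) [1..<Suc m]"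

lemma rest_3:
  assumes "j \<in> {1..3}" "i0 \<in> {1..3}" "j \<noteq> i0"
  shows "\<exists>e. rest 3 j i0 = [e] \<and> {1..3} = {j, i0, e}"
proof -
  have iv: "{1..3::nat} = {1, 2, 3}" and up: "[1..<Suc 3] = [1, 2, 3]" by (auto simp: upt_rec)
  have "j = 1 \<or> j = 2 \<or> j = 3" "i0 = 1 \<or> i0 = 2 \<or> i0 = 3" using assms by auto
  then show ?thesis unfolding rest_def iv up using assms(3) by (elim disjE) auto
qed

lemma rest_4:
  assumes "j \<in> {1..4}" "i0 \<in> {1..4}" "j \<noteq> i0"
  shows "\<exists>e f. rest 4 j i0 = [e, f] \<and> {1..4} = {j, i0, e, f}"
proof -
  have iv: "{1..4::nat} = {1, 2, 3, 4}" and up: "[1..<Suc 4] = [1, 2, 3, 4]" by (auto simp: upt_rec)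
  have "j = 1 \<or> j = 2 \<or> j = 3 \<or> j = 4" "i0 = 1 \<or> i0 = 2 \<or> i0 = 3 \<or> i0 = 4" using assms by auto
  then show ?thesis unfolding rest_def iv up using assms(3) by (elim disjE) auto
qed

definition BuildForms :: "nat \<Rightarrow> nat \<Rightarrow> nat \<Rightarrow> prog \<Rightarrow> prog" where
  "BuildForms m j i0 P = (if m = 3 then Then (BuildForm 12 (rest m j i0 ! 0) i0) (Then (BuildForm 13 j i0) P)
     else Then (BuildForm 11 (rest m j i0 ! 0) i0) (Then (BuildForm 12 (rest m j i0 ! 1) i0) (Then (BuildForm 13 j i0) P)))"

text \<open>In the real case the zero form in array 10 takes the place of the extra form, so that
  both fields share the passes that follow.\<close>

definition G_array :: "nat \<Rightarrow> nat" where
  "G_array m = (if m = 3 then 10 else 11)"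

text \<open>The first pass has the zero form as partner; the second annihilates the form in array 12
  while a phase preserves what the first has achieved. The form of j in array 13 is only classified
  by sign.\<close>

definition Core :: "nat \<Rightarrow> nat \<Rightarrow> nat \<Rightarrow> prog" where
  "Core m j i0 = BuildForms m j i0 (Then (Decompose (m + 1)) (Then (Pass (G_array m) 10) (Then (Pass 12 (G_array m)) (Scan 13))))"

text \<open>The vector found so far is correct up to scaling. All forms scale with the same square,
  so one square root that brings the form of i0 to \<open>a i0\<close> settles the others as
  well.\<close>

definition Finish :: "nat \<Rightarrow> nat \<Rightarrow> prog" where
  "Finish m i0 = Then (FormV 0 i0 0 0) (Then (SetSc 1 (Root [CSub (CNum 0) (CDiv (Cell 23 (NNum i0) (NNum 0)) (Sc 0)), CNum 0, CNum 1]))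
     (Map1 (m + 4) (NNum 0) (CMul (Sc 1) (Cell 22 (NReg 3) (NNum 0)))))"

definition CaseA :: "nat \<Rightarrow> nat \<Rightarrow> nat \<Rightarrow> prog" where
  "CaseA m j i0 = Then (Core m j i0) (Then (FormV 1 14 0 0)
     (Then (IfElse (ReLess (CNum 0) (Sc 1)) Skip (Copy 0 22 (NNum 2))) (Finish m i0)))"

context base_field begin

definition CaseB :: "nat \<Rightarrow> prog" where
  "CaseB m = Then (Core m (m - 1) m) (Then (FormV 1 14 0 0)
     (Then (IfElse (ReLess (CNum 0) (Sc 1)) Skip (Pair (G_array m) 12 13 (m + 2))) (Finish m m)))"

end

primrec ComputeA :: "nat \<Rightarrow> nat \<Rightarrow> prog" where
  "ComputeA xa 0 = Skip"
| "ComputeA xa (Suc k) = Then (ComputeA xa k)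
     (Then (Sum2 0 (CMul (Conj (Cell xa (NReg 3) (NReg 4))) (Cell (Suc k) (NReg 3) (NReg 4))))
           (SetCell 23 (NNum (Suc k)) (NNum 0) (CDiv (CAdd (Sc 0) (Conj (Sc 0))) (CNum 2))))"

text \<open>Unrolled into the program text, as m is fixed. If every \<open>a i\<close> with i
  \<noteq> j is 0, the output column keeps its initial zeros, and the zero vector is then a correct
  answer.\<close>

primrec SelectI :: "nat \<Rightarrow> nat \<Rightarrow> nat \<Rightarrow> prog" where
  "SelectI m j 0 = Skip"
| "SelectI m j (Suc k) = (if Suc k = j then SelectI m j k else
     IfElse (ReLess (CNum 0) (CMul (Cell 23 (NNum (Suc k)) (NNum 0)) (Cell 23 (NNum (Suc k)) (NNum 0))))
       (CaseA m j (Suc k)) (SelectI m j k))"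

text \<open>Equality with 0 is expressed by two failing comparisons. \<open>CaseB\<close> is reached
  when no inequality has a zero multiplier.\<close>

primrec (in base_field) SelectJ :: "nat \<Rightarrow> nat \<Rightarrow> prog" where
  "SelectJ m 0 = CaseB m"
| "SelectJ m (Suc k) = IfElse (BAnd (ReLess (CNum 0) (Cell (m + 3) (NNum (Suc k)) (NNum 2)))
       (BAnd (BNot (ReLess (Cell (m + 3) (NNum (Suc k)) (NNum 1)) (CNum 0)))
             (BNot (ReLess (CNum 0) (Cell (m + 3) (NNum (Suc k)) (NNum 1))))))
     (SelectI m (Suc k) m) (SelectJ m k)"

definition (in base_field) Main :: "nat \<Rightarrow> prog" where
  "Main m = Then SetIdentity (Then (ComputeA (m + 1) m) (SelectJ m m))"

section \<open>Specification and correctness of the central phase\<close>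

locale machine_pair = optimal_pair +
  assumes Fm: "F = \<real> \<and> m = 3 \<or> F = UNIV \<and> m = 4"
begin

definition a :: "nat \<Rightarrow> real" where
  "a i = minner n (A i) X"

definition ready :: "cells \<Rightarrow> bool" where
  "ready M \<longleftrightarrow> (\<forall>i\<le>m. M i = A i) \<and> M (m + 1) = X \<and> M (m + 2) = Z \<and> M 10 = (\<lambda>i j. 0) \<and>
     (\<forall>i<n. \<forall>j<n. M 14 i j = idm i j) \<and> (\<forall>i\<in>{1..m}. M 23 i 0 = complex_of_real (a i)) \<and>
     (\<forall>k i. Vc M k i = 0) \<and> (\<forall>i<n. M (m + 4) i 0 = 0)"

lemma m_le: "m \<le> 4" "m \<ge> 3"
  using Fm by auto

lemma eform_props:
  assumes "e \<in> {1..m}" "i0 \<in> {1..m}" "a i0 \<noteq> 0" and B: "\<And>i j. i < n \<Longrightarrow> j < n \<Longrightarrow> B i j = eform A a i0 e i j"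
  shows "hermitian_fun n B" "matF n B" "minner n B X = 0"
    "qform n B y = qform n (A e) y - (a e / a i0) * qform n (A i0) y"
proof -
  have Ae: "hermitian_fun n (A e)" "matF n (A e)" "hermitian_fun n (A i0)" "matF n (A i0)" using A assms by auto
  have "hermitian_fun n (eform A a i0 e)" unfolding eform_def by (rule hermitian_fun_comb(1)[OF Ae(1,3)])
  then show "hermitian_fun n B" using hermitian_fun_cong[of n B "eform A a i0 e", OF B] by simp
  show "matF n B" using Ae B by (auto simp: matF_def eform_def)
  have "minner n B X = minner n (\<lambda>p q. A e p q + complex_of_real (- (a e / a i0)) * A i0 p q) X"
    by (rule minner_cong) (simp_all add: B eform_def)
  also have "\<dots> = 0" unfolding minner_comb using assms(3) by (simp flip: a_def)
  finally show "minner n B X = 0" .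
  have "qform n B y = qform n (eform A a i0 e) y" by (rule qform_mat_cong) (rule B)
  then show "qform n B y = qform n (A e) y - (a e / a i0) * qform n (A i0) y"
    unfolding eform_def qform_def sform_mat_comb by simp
qed

definition core_post :: "nat \<Rightarrow> nat \<Rightarrow> cells \<Rightarrow> cells \<Rightarrow> bool" where
  "core_post j i0 M M' \<longleftrightarrow> (\<forall>b. b \<notin> {11, 12, 13, 20, 21, 22, 24} \<longrightarrow> M' b = M b) \<and> (\<forall>i<n. Vc M' 3 i = 0) \<and>
     hermitian_fun n (M' (G_array m)) \<and> hermitian_fun n (M' 12) \<and> matF n (M' 12) \<and> hermitian_fun n (M' 13) \<and>
     (F = UNIV \<or> M' (G_array m) = (\<lambda>i j. 0)) \<and>
     (m = 4 \<longrightarrow> (\<forall>i<n. \<forall>k<n. M' 11 i k = eform A a i0 (rest 4 j i0 ! 0) i k)) \<and>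
     (\<forall>i<n. \<forall>k<n. M' 12 i k = eform A a i0 (rest m j i0 ! (m - 3)) i k) \<and>
     (\<forall>i<n. \<forall>k<n. M' 13 i k = eform A a i0 j i k) \<and>
     decomp n X n (Lc M') \<and> (\<forall>k<n. vecF n (Lc M' k)) \<and> (\<forall>k<n. qform n (M' (G_array m)) (Lc M' k) = 0) \<and>
     (\<forall>k<n. qform n (M' 12) (Lc M' k) = 0) \<and>
     found n n (Lc M') (\<lambda>k. qform n (M' 13) (Lc M' k) = 0 \<and> qform n idm (Lc M' k) \<noteq> 0) (Vc M' 0) \<and>
     found n n (Lc M') (\<lambda>k. qform n (M' 13) (Lc M' k) > 0) (Vc M' 1) \<and>
     found n n (Lc M') (\<lambda>k. qform n (M' 13) (Lc M' k) < 0) (Vc M' 2)"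

lemma wp_Core:
  assumes R: "R 1 = 0" "R 2 = 0" "R 3 = 0" "R 4 = 0" "R 0 = n" and M: "ready M"
    and ji: "j \<in> {1..m}" "i0 \<in> {1..m}" "j \<noteq> i0" "a i0 \<noteq> 0"
    and Q: "\<And>M'. core_post j i0 M M' \<Longrightarrow> Q M'"
  shows "wp R (Core m j i0) Q M"
proof -
  have Mi: "M i = A i" if "i \<le> m" for i using M that by (simp add: ready_def)
  have M23: "M 23 i 0 = complex_of_real (a i)" if "i \<in> {1..m}" for i using M that by (simp add: ready_def)
  have M10: "M 10 = (\<lambda>i j. 0)" using M by (simp add: ready_def)
  let ?ga = "G_array m"
  have ga: "?ga \<in> {10, 11}" by (simp add: G_array_def)
  \<comment> \<open>Everything after the construction of the forms is the same for both fields; only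
    the contents of the arrays differ.\<close>
  have tail: "wp R (Then (Decompose (m + 1)) (Then (Pass ?ga 10) (Then (Pass 12 ?ga) (Scan 13)))) Q M1"
    if fr: "\<And>b. b \<notin> {11, 12, 13} \<Longrightarrow> M1 b = M b"
      and G: "hermitian_fun n (M1 ?ga)" "minner n (M1 ?ga) X = 0" "F = UNIV \<or> M1 ?ga = (\<lambda>i j. 0)"
        "m = 4 \<longrightarrow> (\<forall>i<n. \<forall>k<n. M1 11 i k = eform A a i0 (rest 4 j i0 ! 0) i k)"
      and D: "hermitian_fun n (M1 12)" "matF n (M1 12)" "minner n (M1 12) X = 0"
        "\<forall>i<n. \<forall>k<n. M1 12 i k = eform A a i0 (rest m j i0 ! (m - 3)) i k"
      and E: "hermitian_fun n (M1 13)" "\<forall>i<n. \<forall>k<n. M1 13 i k = eform A a i0 j i k" for M1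
  proof (rule wp_Then, rule wp_Decompose[where n = n])
    have mn: "m + 1 \<notin> {10, 11, 12, 13, 20, 21, 22, 24}" using m_le by auto
    have M1X: "M1 (m + 1) = X" using fr mn M by (simp add: ready_def)
    have V1: "Vc M1 k i = 0" for k i using fr[of 22] M by (simp add: ready_def Vc_def)
    have I1: "M1 14 i k = idm i k" if "i < n" "k < n" for i k using fr[of 14] M that by (simp add: ready_def)
    have Z1: "M1 10 = (\<lambda>i j. 0)" using fr[of 10] M by (simp add: ready_def)
    show "psd_fun n (M1 (m + 1))" using X M1X by simp
    show "M1 14 i k = idm i k" if "i < n" "k < n" for i k using I1[OF that] .
    show "m + 1 \<notin> {20, 21, 22, 24}" using mn by simp
    fix M2 assume M2: "\<And>b. b \<notin> {20, 21, 22, 24} \<Longrightarrow> M2 b = M1 b" "\<And>k. k \<notin> {5, 6} \<Longrightarrow> Vc M2 k = Vc M1 k"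
      "\<And>k. k < n \<Longrightarrow> vecF n (Lc M2 k)" "decomp n (M1 (m + 1)) n (Lc M2)"
    have ga2: "M2 ?ga = M1 ?ga" "M2 10 = (\<lambda>i j. 0)" using ga M2(1) Z1 by auto
    have zf: "hermitian_fun n (\<lambda>i j. 0)" "\<And>y. qform n (\<lambda>i j. 0) y = 0"
      by (auto simp: hermitian_fun_def qform_def sform_def)
    show "wp R (Then (Pass ?ga 10) (Then (Pass 12 ?ga) (Scan 13))) Q M2"
    proof (rule wp_Then, rule wp_Pass[where n = n and f = "M1 ?ga" and g = "\<lambda>i j. 0" and X = X])
      show "?ga \<notin> {21, 22, 24}" using ga by auto
      fix M3 assume M3: "\<And>b. b \<notin> {21, 22, 24} \<Longrightarrow> M3 b = M2 b" "\<And>k. k \<noteq> 7 \<Longrightarrow> Vc M3 k = Vc M2 k"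
        "decomp n X n (Lc M3)" "\<And>k. k < n \<Longrightarrow> vecF n (Lc M3 k)" "\<And>k. k < n \<Longrightarrow> qform n (M1 ?ga) (Lc M3 k) = 0"
      have ga3: "M3 ?ga = M1 ?ga" "M3 12 = M1 12" using ga M3(1) M2(1) ga2 by auto
      show "wp R (Then (Pass 12 ?ga) (Scan 13)) Q M3"
      proof (rule wp_Then, rule wp_Pass[where n = n and f = "M1 12" and g = "M1 ?ga" and X = X])
        show "?ga \<notin> {21, 22, 24}" using ga by auto
        fix M4 assume M4: "\<And>b. b \<notin> {21, 22, 24} \<Longrightarrow> M4 b = M3 b" "\<And>k. k \<noteq> 7 \<Longrightarrow> Vc M4 k = Vc M3 k"
          "decomp n X n (Lc M4)" "\<And>k. k < n \<Longrightarrow> vecF n (Lc M4 k)" "\<And>k. k < n \<Longrightarrow> qform n (M1 ?ga) (Lc M4 k) = 0"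
          "\<And>k. k < n \<Longrightarrow> qform n (M1 12) (Lc M4 k) = 0"
        have fr4: "M4 b = M1 b" if "b \<notin> {20, 21, 22, 24}" for b
          using that M4(1) M3(1) M2(1) by simp
        have V4: "Vc M4 k i = 0" if "k \<notin> {5, 6, 7}" for k i
          using that M4(2) M3(2) M2(2) V1 by simp
        show "wp R (Scan 13) Q M4"
        proof (rule wp_Scan[where n = n and e = "M1 13"])
          fix M5 assume M5: "\<And>b. b \<notin> {22, 24} \<Longrightarrow> M5 b = M4 b" "\<And>k. k \<notin> {0, 1, 2, 4} \<Longrightarrow> Vc M5 k = Vc M4 k"
            "found n n (Lc M4) (\<lambda>k. qform n (M1 13) (Lc M4 k) = 0 \<and> qform n idm (Lc M4 k) \<noteq> 0) (Vc M5 0)"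
            "found n n (Lc M4) (\<lambda>k. qform n (M1 13) (Lc M4 k) > 0) (Vc M5 1)"
            "found n n (Lc M4) (\<lambda>k. qform n (M1 13) (Lc M4 k) < 0) (Vc M5 2)"
          have L5: "Lc M5 = Lc M4" using M5(1)[of 21] by (simp add: Lc_def fun_eq_iff)
          have fr5: "M5 b = M1 b" if "b \<notin> {20, 21, 22, 24}" for b using that fr4 M5(1) by simp
          have a5: "M5 ?ga = M1 ?ga" "M5 11 = M1 11" "M5 12 = M1 12" "M5 13 = M1 13"
            using fr5 ga by auto
          have fr6: "M5 b = M b" if "b \<notin> {11, 12, 13, 20, 21, 22, 24}" for b
            using that fr5 fr by simp
          show "Q M5"
          proof (rule Q)
            show "core_post j i0 M M5"
              unfolding core_post_def L5 a5
              using fr6 M5 V4 M4 G D E by (intro conjI allI impI; simp)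
          qed
        qed (use R fr4 V4 I1 E in auto)
      qed (use R ga ga3 G D M3 in auto)
    qed (use R ga2 G zf M2 M1X in auto)
  qed (use R in auto)
  consider "m = 3" "F = \<real>" | "m = 4" "F = UNIV" using Fm by blast
  then show ?thesis
  proof cases
    case 1
    then have "j \<in> {1..3}" "i0 \<in> {1..3}" using ji by simp_all
    from rest_3[OF this ji(3)] obtain e where e: "rest 3 j i0 = [e]" "{1..3} = {j, i0, e}" by blast
    then have em: "e \<in> {1..m}" using 1 by blast
    let ?M1 = "put_mat n 13 (eform A a i0 j) (put_mat n 12 (eform A a i0 e) M)"
    have p12: "\<And>i k. i < n \<Longrightarrow> k < n \<Longrightarrow> ?M1 12 i k = eform A a i0 e i k"
      and p13: "\<And>i k. i < n \<Longrightarrow> k < n \<Longrightarrow> ?M1 13 i k = eform A a i0 j i k" by simp_all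
    note P12 = eform_props[OF em ji(2,4) p12] and P13 = eform_props[OF ji(1,2,4) p13]
    have G: "?M1 (G_array m) = (\<lambda>i j. 0)" by (simp add: G_array_def 1(1) M10)
    have "wp R (Then (Decompose (m + 1)) (Then (Pass ?ga 10) (Then (Pass 12 ?ga) (Scan 13)))) Q ?M1"
    proof (rule tail)
      show "hermitian_fun n (?M1 ?ga)" "minner n (?M1 ?ga) X = 0" "F = UNIV \<or> ?M1 ?ga = (\<lambda>i j. 0)"
        unfolding G by (auto simp: hermitian_fun_def minner_def)
    qed (use P12 P13 1 e in auto)
    then show ?thesis
      unfolding Core_def BuildForms_def if_P[OF 1(1)]
      by (intro wp_Then_BuildForm[where n = n and a = a and A = A])
         (use R ji em 1 e Mi M23 in auto)
  next
    case 2
    then have "j \<in> {1..4}" "i0 \<in> {1..4}" using ji by simp_all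
    from rest_4[OF this ji(3)] obtain e f where e: "rest 4 j i0 = [e, f]" "{1..4} = {j, i0, e, f}" by blast
    then have em: "e \<in> {1..m}" "f \<in> {1..m}" using 2 by blast+
    let ?M1 = "put_mat n 13 (eform A a i0 j) (put_mat n 12 (eform A a i0 f) (put_mat n 11 (eform A a i0 e) M))"
    have p11: "\<And>i k. i < n \<Longrightarrow> k < n \<Longrightarrow> ?M1 11 i k = eform A a i0 e i k"
      and p12: "\<And>i k. i < n \<Longrightarrow> k < n \<Longrightarrow> ?M1 12 i k = eform A a i0 f i k"
      and p13: "\<And>i k. i < n \<Longrightarrow> k < n \<Longrightarrow> ?M1 13 i k = eform A a i0 j i k" by simp_all
    note P11 = eform_props[OF em(1) ji(2,4) p11] and P12 = eform_props[OF em(2) ji(2,4) p12]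
      and P13 = eform_props[OF ji(1,2,4) p13]
    have "wp R (Then (Decompose (m + 1)) (Then (Pass ?ga 10) (Then (Pass 12 ?ga) (Scan 13)))) Q ?M1"
    proof (rule tail)
      show "hermitian_fun n (?M1 ?ga)" "minner n (?M1 ?ga) X = 0" "F = UNIV \<or> ?M1 ?ga = (\<lambda>i j. 0)"
        using P11 2 by (auto simp: G_array_def)
    qed (use P11 P12 P13 2 e in auto)
    moreover have "m \<noteq> 3" using 2 by simp
    ultimately show ?thesis
      unfolding Core_def BuildForms_def if_not_P[OF \<open>m \<noteq> 3\<close>]
      by (intro wp_Then_BuildForm[where n = n and a = a and A = A])
         (use R ji em 2 e Mi M23 in auto)
  qed
qed

end

section \<open>From kernel vectors to certificates\<close>

context machine_pair begin

lemma decomp_a: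
  assumes "decomp n X n L"
  shows "a i = (\<Sum>k<n. qform n (A i) (L k))"
  unfolding a_def using assms by (intro minner_decomp) (auto simp: decomp_def)

lemma decomp_kernel:
  assumes "decomp n X n L" "\<And>k. k < n \<Longrightarrow> vecF n (L k)" "k < n"
  shows "qform n Z (L k) = 0" "i < n \<Longrightarrow> mv n Z (L k) i = 0"
proof -
  show 0: "qform n Z (L k) = 0"
    using assms by (intro minner_zero_decomp[OF Z ZX, of "{..<n}"]) (auto simp: decomp_def)
  show "i < n \<Longrightarrow> mv n Z (L k) i = 0" by (rule psd_mv_zero[OF Z assms(2)[OF assms(3)] 0])
qed

lemma mv_qform_zero: "(\<And>i. i < n \<Longrightarrow> mv n Z y i = 0) \<Longrightarrow> qform n Z y = 0"
  by (simp add: qform_def sform_mv)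

text \<open>X is a sum of rank-one terms from the kernel of Z, and the \<delta>-combination is
  nonnegative at each of them.\<close>

lemma delta_a_nonneg:
  assumes \<delta>: "\<And>x. vecF n x \<Longrightarrow> \<exists>i<n. x i \<noteq> 0 \<Longrightarrow> qform n Z x = 0 \<Longrightarrow> (\<Sum>i=1..m. \<delta> i * qform n (A i) x) > 0"
  shows "(\<Sum>i=1..m. \<delta> i * a i) \<ge> 0"
proof -
  obtain L where L: "\<And>k. vecF n (L k)" "decomp n X n L"
    using psd_decomposition[OF X] unfolding decomp_def by blast
  have "(\<Sum>i=1..m. \<delta> i * a i) = (\<Sum>k<n. \<Sum>i=1..m. \<delta> i * qform n (A i) (L k))"
    unfolding decomp_a[OF L(2)] sum_distrib_left by (rule sum.swap)
  also have "\<dots> \<ge> 0"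
  proof (rule sum_nonneg)
    fix k assume "k \<in> {..<n}"
    then have k: "k < n" by simp
    show "0 \<le> (\<Sum>i=1..m. \<delta> i * qform n (A i) (L k))"
    proof (cases "\<exists>i<n. L k i \<noteq> 0")
      case True
      then show ?thesis using \<delta>[OF L(1) True decomp_kernel(1)[OF L(2) L(1) k]] by simp
    next
      case False
      then have "qform n (A i) (L k) = 0" for i
        using qform_cong[of n "L k" "\<lambda>_. 0" "A i"] by simp
      then show ?thesis by simp
    qed
  qed
  finally show ?thesis .
qed

text \<open>Let t be the quotient of the form of i0 at y and \<open>a i0\<close>. The
  \<delta>-combination at y is \<open>t \<Lambda> + \<delta> j s\<close> with
  \<open>\<Lambda> \<ge> 0\<close> and \<open>\<delta> j s \<le> 0\<close>, and it is positive;
  hence t > 0, and y can be divided by a square root of t. The constraint forms other than that of j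
  then take the values \<open>a i\<close>. The form of j is at most \<open>a j \<le> c j\<close>
  when s is negative, which suffices because its multiplier is 0 in that case.\<close>

lemma certificate_of_ray:
  fixes \<sigma> :: real
  assumes y: "vecF n y" "qform n idm y \<noteq> 0" "qform n Z y = 0"
    and ji: "j \<in> {1..m}" "i0 \<in> {1..m}" "j \<noteq> i0" "a i0 \<noteq> 0"
    and eq: "\<And>i. i \<in> {1..m} \<Longrightarrow> i \<noteq> j \<Longrightarrow> qform n (A i) y = (a i / a i0) * qform n (A i0) y"
    and s: "s = qform n (A j) y - (a j / a i0) * qform n (A i0) y" "s = 0 \<or> s \<le> 0 \<and> r j = Le \<and> \<mu> j = 0"
  shows "a i0 / qform n (A i0) y > 0"
    and "\<sigma>\<^sup>2 = a i0 / qform n (A i0) y \<Longrightarrow> certificate (\<lambda>i. complex_of_real \<sigma> * y i)"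
proof -
  obtain \<delta> where \<delta>: "\<And>x. vecF n x \<Longrightarrow> \<exists>i<n. x i \<noteq> 0 \<Longrightarrow> qform n Z x = 0 \<Longrightarrow> (\<Sum>i=1..m. \<delta> i * qform n (A i) x) > 0"
    and \<delta>p: "\<And>i. i \<in> {1..m} \<Longrightarrow> r i = Le \<Longrightarrow> \<mu> i = 0 \<Longrightarrow> \<delta> i > 0" using dual_kernel by blast
  define t where "t = qform n (A i0) y / a i0"
  have eq': "qform n (A i) y = t * a i" if "i \<in> {1..m}" "i \<noteq> j" for i
    using eq[OF that] by (simp add: t_def)
  have qj: "qform n (A j) y = t * a j + s" by (simp add: s(1) t_def)
  have "qform n (A i) y = t * a i + (if i = j then s else 0)" if "i \<in> {1..m}" for i
    using eq' qj that by auto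
  then have "(\<Sum>i=1..m. \<delta> i * qform n (A i) y) = (\<Sum>i=1..m. t * (\<delta> i * a i) + (if i = j then \<delta> i * s else 0))"
    by (intro sum.cong) (auto simp: algebra_simps)
  also have "\<dots> = t * (\<Sum>i=1..m. \<delta> i * a i) + \<delta> j * s"
    using ji(1) by (simp add: sum.distrib sum_distrib_left)
  finally have pos: "t * (\<Sum>i=1..m. \<delta> i * a i) + \<delta> j * s > 0"
    using \<delta>[OF y(1) _ y(3)] y(2) by (auto simp: qform_idm_zero_iff)
  define \<Lambda> where "\<Lambda> = (\<Sum>i=1..m. \<delta> i * a i)"
  have "\<Lambda> \<ge> 0" unfolding \<Lambda>_def by (rule delta_a_nonneg[OF \<delta>])
  moreover have "\<delta> j * s \<le> 0" using s(2) \<delta>p[OF ji(1)] mult_nonneg_nonpos[of "\<delta> j" s] by auto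
  then have "t * \<Lambda> > 0" using pos unfolding \<Lambda>_def by (smt (verit))
  ultimately have t: "t > 0" by (simp add: zero_less_mult_iff)
  have inv: "a i0 / qform n (A i0) y = 1 / t" by (simp add: t_def)
  show "a i0 / qform n (A i0) y > 0" unfolding inv using t by simp
  assume sg: "\<sigma>\<^sup>2 = a i0 / qform n (A i0) y"
  have q: "qform n B (\<lambda>i. complex_of_real \<sigma> * y i) = qform n B y / t" if "hermitian_fun n B" for B
    unfolding qform_scale[OF that] using sg unfolding inv by simp
  have qA: "qform n (A i) (\<lambda>k. complex_of_real \<sigma> * y k) = a i" if "i \<in> {1..m}" "i \<noteq> j \<or> s = 0" for i
  proof -
    have h: "hermitian_fun n (A i)" using A that by simp
    have "qform n (A i) y = t * a i" using eq'[OF that(1)] qj that(2) by (cases "i = j") simp_all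
    then show ?thesis unfolding q[OF h] using t by simp
  qed
  have "holds (r i) (qform n (A i) (\<lambda>k. complex_of_real \<sigma> * y k)) (c i) \<and>
      (\<mu> i = 0 \<or> qform n (A i) (\<lambda>k. complex_of_real \<sigma> * y k) = c i)" if i: "i \<in> {1..m}" for i
  proof (cases "i \<noteq> j \<or> s = 0")
    case True
    then show ?thesis using qA[OF i True] feas[OF i] slackness[OF i] by (simp add: a_def)
  next
    case False
    then have ij: "i = j" by simp
    have "hermitian_fun n (A j)" using A ji by simp
    then have "qform n (A i) (\<lambda>k. complex_of_real \<sigma> * y k) = a j + s / t"
      unfolding ij using t by (simp add: q qj add_divide_distrib)
    also have "\<dots> \<le> a j" using False s(2) t by (simp add: divide_nonpos_pos)
    also have "a j \<le> c j" using feas[OF ji(1)] s(2) False by (auto simp: a_def)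
    finally show ?thesis using False s(2) by auto
  qed
  moreover have "qform n Z (\<lambda>k. complex_of_real \<sigma> * y k) = 0"
    using y(3) Z by (subst q) (auto simp: psd_fun_def)
  moreover have "vecF n (\<lambda>k. complex_of_real \<sigma> * y k)" using y(1) by (auto simp: vecF_def)
  ultimately show "certificate (\<lambda>i. complex_of_real \<sigma> * y i)" by (auto simp only: certificate_def)
qed

text \<open>Only the term of j survives in the \<delta>-combination at X, so
  \<open>a j \<ge> 0\<close> and therefore \<open>c j \<ge> 0\<close>; the other constraints hold at
  X with value 0 and thus also at the zero vector.\<close>

lemma certificate_zero:
  assumes j: "j \<in> {1..m}" "r j = Le" "\<mu> j = 0" and 0: "\<And>i. i \<in> {1..m} \<Longrightarrow> i \<noteq> j \<Longrightarrow> a i = 0"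
  shows "certificate (\<lambda>i. 0)"
proof -
  obtain \<delta> where \<delta>: "\<And>x. vecF n x \<Longrightarrow> \<exists>i<n. x i \<noteq> 0 \<Longrightarrow> qform n Z x = 0 \<Longrightarrow> (\<Sum>i=1..m. \<delta> i * qform n (A i) x) > 0"
    and \<delta>p: "\<And>i. i \<in> {1..m} \<Longrightarrow> r i = Le \<Longrightarrow> \<mu> i = 0 \<Longrightarrow> \<delta> i > 0" using dual_kernel by blast
  have "(\<Sum>i=1..m. \<delta> i * a i) = (\<Sum>i=1..m. if i = j then \<delta> j * a j else 0)"
    using 0 by (intro sum.cong) auto
  moreover have "(\<Sum>i=1..m. \<delta> i * a i) \<ge> 0" by (rule delta_a_nonneg[OF \<delta>])
  ultimately have "\<delta> j * a j \<ge> 0" using j(1) by simp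
  moreover have "\<delta> j > 0" by (rule \<delta>p[OF j])
  ultimately have "a j \<ge> 0" by (simp add: zero_le_mult_iff)
  then have cj: "0 \<le> c j" using feas[OF j(1)] j(2) by (simp add: a_def)
  have "holds (r i) 0 (c i) \<and> (\<mu> i = 0 \<or> 0 = c i)" if i: "i \<in> {1..m}" for i
  proof (cases "i = j")
    case False
    then show ?thesis using feas[OF i] slackness[OF i] 0[OF i] by (simp add: a_def)
  qed (use cj j in simp)
  then show ?thesis by (auto simp: certificate_def vecF_def)
qed

lemma certificate_cong:
  assumes "\<And>i. i < n \<Longrightarrow> x i = y i" shows "certificate x \<longleftrightarrow> certificate y"
proof -
  have "qform n B x = qform n B y" for B by (rule qform_cong) (rule assms)
  then show ?thesis using assms by (simp add: certificate_def vecF_def)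
qed

text \<open>Vanishing of the constructed forms means that the constraint forms at y are proportional
  to the numbers \<open>a i\<close>. For i = i0 this is trivial, and \<open>rest\<close> accounts
  for all remaining indices.\<close>

lemma core_eq:
  assumes C: "core_post j i0 M M'" and ji: "j \<in> {1..m}" "i0 \<in> {1..m}" "j \<noteq> i0" "a i0 \<noteq> 0"
  shows "qform n (M' (G_array m)) y = 0 \<Longrightarrow> qform n (M' 12) y = 0 \<Longrightarrow> i \<in> {1..m} \<Longrightarrow> i \<noteq> j \<Longrightarrow>
      qform n (A i) y = (a i / a i0) * qform n (A i0) y"
    and "qform n (M' 13) y = qform n (A j) y - (a j / a i0) * qform n (A i0) y" "minner n (M' 13) X = 0"
proof -
  have p13: "\<And>p q. p < n \<Longrightarrow> q < n \<Longrightarrow> M' 13 p q = eform A a i0 j p q" using C by (simp add: core_post_def)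
  show "qform n (M' 13) y = qform n (A j) y - (a j / a i0) * qform n (A i0) y" "minner n (M' 13) X = 0"
    using eform_props(3,4)[OF ji(1,2,4) p13] by blast+
  assume G: "qform n (M' (G_array m)) y = 0" and D: "qform n (M' 12) y = 0" and i: "i \<in> {1..m}" "i \<noteq> j"
  have c12: "\<And>p q. p < n \<Longrightarrow> q < n \<Longrightarrow> M' 12 p q = eform A a i0 (rest m j i0 ! (m - 3)) p q"
    and c11: "\<And>p q. m = 4 \<Longrightarrow> p < n \<Longrightarrow> q < n \<Longrightarrow> M' 11 p q = eform A a i0 (rest 4 j i0 ! 0) p q"
    using C unfolding core_post_def by blast+
  have self: "qform n (A i0) y = (a i0 / a i0) * qform n (A i0) y" using ji by simp
  consider "m = 3" | "m = 4" using Fm by blast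
  then show "qform n (A i) y = (a i / a i0) * qform n (A i0) y"
  proof cases
    case 1
    then have "j \<in> {1..3}" "i0 \<in> {1..3}" using ji by simp_all
    from rest_3[OF this ji(3)] obtain e where e: "rest 3 j i0 = [e]" "{1..3} = {j, i0, e}" by blast
    then have em: "e \<in> {1..m}" using 1 by blast
    have "\<And>p q. p < n \<Longrightarrow> q < n \<Longrightarrow> M' 12 p q = eform A a i0 e p q"
      using c12 unfolding 1 e by simp
    from eform_props(4)[OF em ji(2,4) this, of y] D
    have e': "qform n (A e) y = (a e / a i0) * qform n (A i0) y" by simp
    have "i \<in> {1..3}" using i(1) unfolding 1 .
    then have "i = i0 \<or> i = e" using i(2) unfolding e(2) by blast
    then show ?thesis using self e' by metis
  next
    case 2
    then have "j \<in> {1..4}" "i0 \<in> {1..4}" using ji by simp_all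
    from rest_4[OF this ji(3)] obtain e f where e: "rest 4 j i0 = [e, f]" "{1..4} = {j, i0, e, f}" by blast
    then have em: "e \<in> {1..m}" "f \<in> {1..m}" using 2 by blast+
    have "\<And>p q. p < n \<Longrightarrow> q < n \<Longrightarrow> M' 12 p q = eform A a i0 f p q"
      using c12 unfolding 2 e by simp
    from eform_props(4)[OF em(2) ji(2,4) this, of y] D
    have f: "qform n (A f) y = (a f / a i0) * qform n (A i0) y" by simp
    have "\<And>p q. p < n \<Longrightarrow> q < n \<Longrightarrow> M' 11 p q = eform A a i0 e p q"
      using c11[OF 2] unfolding e by simp
    from eform_props(4)[OF em(1) ji(2,4) this, of y] G
    have e': "qform n (A e) y = (a e / a i0) * qform n (A i0) y" by (simp add: G_array_def 2)
    have "i \<in> {1..4}" using i(1) unfolding 2 .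
    then have "i = i0 \<or> i = e \<or> i = f" using i(2) unfolding e(2) by blast
    then show ?thesis using self f e' by metis
  qed
qed

lemma wp_Finish:
  assumes R: "R 3 = 0" "R 4 = 0" "R 0 = n" and M: "M i0 = A i0" "M 23 i0 0 = complex_of_real (a i0)"
    and y: "vecF n (Vc M 0)" "qform n idm (Vc M 0) \<noteq> 0" "qform n Z (Vc M 0) = 0"
    and ji: "j \<in> {1..m}" "i0 \<in> {1..m}" "j \<noteq> i0" "a i0 \<noteq> 0"
    and eq: "\<And>i. i \<in> {1..m} \<Longrightarrow> i \<noteq> j \<Longrightarrow> qform n (A i) (Vc M 0) = (a i / a i0) * qform n (A i0) (Vc M 0)"
    and s: "s = qform n (A j) (Vc M 0) - (a j / a i0) * qform n (A i0) (Vc M 0)" "s = 0 \<or> s \<le> 0 \<and> r j = Le \<and> \<mu> j = 0"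
  shows "wp R (Finish m i0) (\<lambda>M'. certificate (\<lambda>i. M' (m + 4) i 0)) M"
proof -
  let ?q = "qform n (A i0) (Vc M 0)"
  define \<sigma> where "\<sigma> = least_real_root (Poly [- (a i0 / ?q), 0, 1])"
  have "a i0 / ?q > 0" by (rule certificate_of_ray(1)[OF y ji _ s]) (rule eq)
  then have sq: "\<sigma>\<^sup>2 = a i0 / ?q" unfolding \<sigma>_def by (intro root_sqrt) simp
  have ray: "certificate (\<lambda>i. complex_of_real \<sigma> * Vc M 0 i)"
    by (rule certificate_of_ray(2)[OF y ji _ s sq]) (rule eq)
  have hA: "hermitian_fun n (A i0)" using A ji by simp
  have i24: "i0 \<noteq> 24" "m + 4 \<notin> {22, 24}" using ji m_le by auto
  let ?M2 = "put 1 (complex_of_real \<sigma>) (put 0 (complex_of_real ?q) M)"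
  show ?thesis
    unfolding Finish_def
  proof (rule wp_Then_FormV[where v = "complex_of_real ?q"], rule wp_Then_SetSc[where v = "complex_of_real \<sigma>"],
      rule wp_Map1[where v = "\<lambda>i. complex_of_real \<sigma> * Vc M 0 i" and k = 0])
    fix i M' assume "i < R 0" and M': "agree_but {(m + 4, j, 0) |j. j < i} ?M2 M'"
    have "M' 22 i 0 = Vc ?M2 0 i" "M' 24 1 0 = Sv ?M2 1" using M' i24 by (auto simp: agree_but_def Vc_def Sv_def)
    then show "cval (R(3 := i), M') (CMul (Sc 1) (Cell 22 (NReg 3) (NNum 0))) = complex_of_real \<sigma> * Vc M 0 i" by simp
  next
    show "certificate (\<lambda>i. put_col (R 0) (m + 4) 0 (\<lambda>i. complex_of_real \<sigma> * Vc M 0 i) ?M2 (m + 4) i 0)"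
      using ray R by (subst certificate_cong[of _ "\<lambda>i. complex_of_real \<sigma> * Vc M 0 i"]) (auto simp: put_col_def)
  qed (use R M i24 sform_self[OF hA] in \<open>auto simp: \<sigma>_def put_other simp flip: Sv_def\<close>)
qed

text \<open>The values of the last form add up to 0. They cannot all vanish: without isotropic
  nonzero columns all columns would be zero, against \<open>a i0 \<noteq> 0\<close>. Hence both
  signs occur.\<close>

lemma core_signs:
  assumes C: "core_post j i0 M M'" and ji: "j \<in> {1..m}" "i0 \<in> {1..m}" "j \<noteq> i0" "a i0 \<noteq> 0"
    and none: "\<not> (\<exists>k<n. qform n (M' 13) (Lc M' k) = 0 \<and> qform n idm (Lc M' k) \<noteq> 0)"
  shows "\<exists>k<n. qform n (M' 13) (Lc M' k) < 0" "\<exists>k<n. qform n (M' 13) (Lc M' k) > 0"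
proof -
  let ?e = "\<lambda>k. qform n (M' 13) (Lc M' k)"
  have dc: "decomp n X n (Lc M')" using C by (simp add: core_post_def)
  have "minner n (M' 13) X = (\<Sum>k<n. ?e k)" using dc by (intro minner_decomp) (auto simp: decomp_def)
  then have s: "(\<Sum>k<n. ?e k) = 0" using core_eq(3)[OF C ji] by simp
  have "\<exists>k<n. ?e k \<noteq> 0"
  proof (rule ccontr)
    assume "\<not> ?thesis"
    then have "\<And>k. k < n \<Longrightarrow> qform n idm (Lc M' k) = 0" using none by blast
    then have "qform n (A i0) (Lc M' k) = 0" if "k < n" for k using that qform_idm_vec_zero by blast
    then show False using decomp_a[OF dc, of i0] ji by simp
  qed
  then obtain k where k: "k < n" "?e k \<noteq> 0" by blast
  show "\<exists>k<n. ?e k < 0"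
  proof (rule ccontr)
    assume "\<not> ?thesis"
    then have "\<And>k. k \<in> {..<n} \<Longrightarrow> 0 \<le> ?e k" by force
    from sum_nonneg_eq_0_iff[OF finite_lessThan this] s k show False by auto
  qed
  show "\<exists>k<n. ?e k > 0"
  proof (rule ccontr)
    assume "\<not> ?thesis"
    then have "\<And>k. k \<in> {..<n} \<Longrightarrow> 0 \<le> - ?e k" by force
    from sum_nonneg_eq_0_iff[OF finite_lessThan this] s k show False by (auto simp: sum_negf)
  qed
qed

lemma found_qform:
  assumes "found n n L P v" "\<exists>k<n. P k"
  obtains k where "k < n" "P k" "\<And>i. i < n \<Longrightarrow> v i = L k i" "\<And>B. qform n B v = qform n B (L k)"
    "\<And>B w. sform n B v w = sform n B (L k) w" "\<And>B w. sform n B w v = sform n B w (L k)"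
proof -
  obtain k where k: "k < n" "P k" "\<forall>i<n. v i = L k i" using assms unfolding found_def by (auto split: if_splits)
  then show ?thesis by (intro that[of k]) (auto intro!: qform_cong sform_cong)
qed

lemma core_vector:
  assumes C: "core_post j i0 M M'" and ji: "j \<in> {1..m}" "i0 \<in> {1..m}" "j \<noteq> i0" "a i0 \<noteq> 0"
    and k: "k < n" "\<And>i. i < n \<Longrightarrow> v i = Lc M' k i" "\<And>B. qform n B v = qform n B (Lc M' k)"
  shows "vecF n v" "qform n Z v = 0" "i < n \<Longrightarrow> mv n Z v i = 0" "qform n (M' (G_array m)) v = 0" "qform n (M' 12) v = 0"
proof -
  have L: "decomp n X n (Lc M')" "\<And>k. k < n \<Longrightarrow> vecF n (Lc M' k)" using C by (auto simp: core_post_def)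
  show "vecF n v" using L(2)[OF k(1)] k(2) by (simp add: vecF_def)
  show "qform n Z v = 0" unfolding k(3) by (rule decomp_kernel(1)[OF L k(1)])
  show "i < n \<Longrightarrow> mv n Z v i = 0" using decomp_kernel(2)[OF L k(1)] mv_cong_vec[OF k(2), where Z = Z] by simp
  show "qform n (M' (G_array m)) v = 0" "qform n (M' 12) v = 0" unfolding k(3) using C k(1) by (auto simp: core_post_def)
qed

lemma wp_CaseA:
  assumes R: "R 1 = 0" "R 2 = 0" "R 3 = 0" "R 4 = 0" "R 0 = n" and M: "ready M"
    and ji: "j \<in> {1..m}" "i0 \<in> {1..m}" "j \<noteq> i0" "a i0 \<noteq> 0" and j: "r j = Le" "\<mu> j = 0"
  shows "wp R (CaseA m j i0) (\<lambda>M'. certificate (\<lambda>i. M' (m + 4) i 0)) M"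
  unfolding CaseA_def
proof (rule wp_Then, rule wp_Core[OF R M ji])
  fix M2 assume C: "core_post j i0 M M2"
  let ?P = "\<lambda>k. qform n (M2 13) (Lc M2 k) = 0 \<and> qform n idm (Lc M2 k) \<noteq> 0"
  have fr: "M2 b = M b" if "b \<notin> {11, 12, 13, 20, 21, 22, 24}" for b using C that by (simp add: core_post_def)
  have i0: "i0 \<notin> {11, 12, 13, 20, 21, 22, 24}" "i0 \<le> m" using ji m_le by auto
  have I: "M2 14 p q = idm p q" if "p < n" "q < n" for p q using fr[of 14] M that by (simp add: ready_def)
  have fo: "found n n (Lc M2) ?P (Vc M2 0)" "found n n (Lc M2) (\<lambda>k. qform n (M2 13) (Lc M2 k) < 0) (Vc M2 2)"
    using C by (simp_all add: core_post_def)
  have fin: "wp R (Finish m i0) (\<lambda>M'. certificate (\<lambda>i. M' (m + 4) i 0)) M3"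
    if M3: "\<And>b. b \<notin> {22, 24} \<Longrightarrow> M3 b = M2 b" and k: "k < n" "\<And>i. i < n \<Longrightarrow> Vc M3 0 i = Lc M2 k i"
      and e: "qform n (M2 13) (Lc M2 k) \<le> 0" "qform n idm (Lc M2 k) \<noteq> 0" for M3 k
  proof -
    have q: "\<And>B. qform n B (Vc M3 0) = qform n B (Lc M2 k)" using k(2) by (rule qform_cong)
    note cv = core_vector[OF C ji k q]
    show ?thesis
    proof (rule wp_Finish[where j = j and s = "qform n (M2 13) (Lc M2 k)"])
      show "M3 i0 = A i0" "M3 23 i0 0 = complex_of_real (a i0)"
        using M3 fr i0 ji M by (auto simp: ready_def)
      show "qform n (M2 13) (Lc M2 k) = qform n (A j) (Vc M3 0) - a j / a i0 * qform n (A i0) (Vc M3 0)"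
        unfolding q by (rule core_eq(2)[OF C ji])
      show "qform n (A i) (Vc M3 0) = a i / a i0 * qform n (A i0) (Vc M3 0)" if "i \<in> {1..m}" "i \<noteq> j" for i
        by (rule core_eq(1)[OF C ji cv(4,5) that])
    qed (use R ji cv(1,2) e j in \<open>auto simp: q\<close>)
  qed
  let ?v = "qform n idm (Vc M2 0)"
  show "wp R (Then (FormV 1 14 0 0) (Then (IfElse (ReLess (CNum 0) (Sc 1)) Skip (Copy 0 22 (NNum 2))) (Finish m i0)))
     (\<lambda>M'. certificate (\<lambda>i. M' (m + 4) i 0)) M2"
  proof (rule wp_Then_FormV[where v = "complex_of_real ?v"], rule wp_Then, intro wp_IfElse wp_Skip wp_Copy)
    let ?M3 = "put 1 (complex_of_real ?v) M2"
    assume "bval (R, ?M3) (ReLess (CNum 0) (Sc 1))"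
    then have nz: "?v \<noteq> 0" by (auto simp flip: Sv_def)
    have "\<exists>k<n. ?P k"
    proof (rule ccontr)
      assume "\<not> ?thesis"
      then have "\<forall>i<n. Vc M2 0 i = 0" using fo(1) unfolding found_def by (simp only: if_False)
      then show False using nz by (simp add: qform_idm_zero_iff)
    qed
    from found_qform[OF fo(1) this] obtain k where "k < n" "?P k" "\<And>i. i < n \<Longrightarrow> Vc M2 0 i = Lc M2 k i" by metis
    then show "wp R (Finish m i0) (\<lambda>M'. certificate (\<lambda>i. M' (m + 4) i 0)) ?M3" by (intro fin[of _ k]) auto
  next
    let ?M3 = "put 1 (complex_of_real ?v) M2"
    assume "\<not> bval (R, ?M3) (ReLess (CNum 0) (Sc 1))"
    then have "?v = 0" using qform_idm_nonneg[of n "Vc M2 0"] by (simp flip: Sv_def)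
    then have none: "\<not> (\<exists>k<n. ?P k)" using found_qform[OF fo(1)] by metis
    \<comment> \<open>Without an isotropic column a negative one is taken: since
      \<open>\<mu> j = 0\<close>, constraint j does not have to be active.\<close>
    from found_qform[OF fo(2) core_signs(1)[OF C ji none]] obtain k where
      k: "k < n" "qform n (M2 13) (Lc M2 k) < 0" "\<And>i. i < n \<Longrightarrow> Vc M2 2 i = Lc M2 k i" by metis
    have "(\<lambda>i. ?M3 22 i (nval R (NNum 2))) = Vc M2 2" by (simp flip: Vc_def)
    then show "wp R (Finish m i0) (\<lambda>M'. certificate (\<lambda>i. M' (m + 4) i 0)) (setV (R 0) 0 (\<lambda>i. ?M3 22 i (nval R (NNum 2))) ?M3)"
      using k R qform_idm_vec_zero[of n "Lc M2 k" "M2 13"] by (intro fin[of _ k]) (auto simp only:, auto)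
  qed (use R qform_idm_cong_mat[of n "M2 14", OF I] in \<open>auto simp: sform_self\<close>)
qed

definition Bf :: "nat \<Rightarrow> nat \<Rightarrow> nat \<Rightarrow> complex" where
  "Bf = eform A c m"

definition Gf :: "nat \<Rightarrow> nat \<Rightarrow> complex" where
  "Gf = (if m = 3 then (\<lambda>i j. 0) else Bf 1)"

definition all_active :: bool where
  "all_active \<longleftrightarrow> (\<forall>i\<in>{1..m}. r i = Le \<longrightarrow> \<mu> i \<noteq> 0)"

text \<open>The configuration in which two columns do not suffice: both passes have succeeded, the
  last form has opposite signs at columns p and q, and no phase removes both cross terms. Then
  either there is a third kernel vector or Property I holds.\<close>

definition needs_third :: "(nat \<Rightarrow> nat \<Rightarrow> complex) \<Rightarrow> nat \<Rightarrow> nat \<Rightarrow> bool" where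
  "needs_third L p q \<longleftrightarrow> decomp n X n L \<and> (\<forall>k<n. vecF n (L k)) \<and>
     (\<forall>k<n. qform n Gf (L k) = 0 \<and> qform n (Bf (m - 2)) (L k) = 0) \<and> p < n \<and> q < n \<and>
     qform n (Bf (m - 1)) (L p) > 0 \<and> qform n (Bf (m - 1)) (L q) < 0 \<and>
     independent_pair n Gf (Bf (m - 2)) (L p) (L q)"

lemma a_eq_c: "all_active \<Longrightarrow> i \<in> {1..m} \<Longrightarrow> a i = c i"
  using feas[of i] slackness[of i] by (cases "r i") (auto simp: all_active_def a_def)

lemma wp_CaseB:
  assumes R: "R 1 = 0" "R 2 = 0" "R 3 = 0" "R 4 = 0" "R 0 = n" and M: "ready M"
    and act: all_active and third: "\<And>L p q. needs_third L p q \<Longrightarrow> third_vector n Z (L p) (L q)"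
  shows "wp R (CaseB m) (\<lambda>M'. certificate (\<lambda>i. M' (m + 4) i 0)) M"
proof -
  \<comment> \<open>All multipliers of inequalities are nonzero, so every constraint is active at X
    and a agrees with c. Taking i0 = m and j = m - 1 makes the forms those of Property I, and
    \<open>c m \<noteq> 0\<close> permits the division.\<close>
  have ji: "m - 1 \<in> {1..m}" "m \<in> {1..m}" "m - 1 \<noteq> m" "a m \<noteq> 0"
    using m_le a_eq_c[OF act, of m] c_m by auto
  have ef: "eform A a m i = Bf i" if "i \<in> {1..m}" for i
    using a_eq_c[OF act] that ji by (simp add: Bf_def eform_def)
  show ?thesis
    unfolding CaseB_def
  proof (rule wp_Then, rule wp_Core[OF R M ji])
    fix M2 assume C: "core_post (m - 1) m M M2"
    let ?P = "\<lambda>k. qform n (M2 13) (Lc M2 k) = 0 \<and> qform n idm (Lc M2 k) \<noteq> 0"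
    let ?ga = "G_array m"
    have fr: "M2 b = M b" if "b \<notin> {11, 12, 13, 20, 21, 22, 24}" for b using C that by (simp add: core_post_def)
    have i0: "m \<notin> {11, 12, 13, 20, 21, 22, 24}" "m + 2 \<notin> {11, 12, 13, 20, 21, 22, 24}" using m_le by auto
    have I: "M2 14 p q = idm p q" if "p < n" "q < n" for p q using fr[of 14] M that by (simp add: ready_def)
    have fo: "found n n (Lc M2) ?P (Vc M2 0)" "found n n (Lc M2) (\<lambda>k. qform n (M2 13) (Lc M2 k) > 0) (Vc M2 1)"
      "found n n (Lc M2) (\<lambda>k. qform n (M2 13) (Lc M2 k) < 0) (Vc M2 2)"
      using C by (simp_all add: core_post_def)
    have fin: "wp R (Finish m m) (\<lambda>M'. certificate (\<lambda>i. M' (m + 4) i 0)) M3"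
      if M3: "\<And>b. b \<notin> {20, 22, 24} \<Longrightarrow> M3 b = M2 b" and v: "vecF n (Vc M3 0)" "qform n Z (Vc M3 0) = 0"
         "qform n idm (Vc M3 0) \<noteq> 0"
        and e: "qform n (M2 ?ga) (Vc M3 0) = 0" "qform n (M2 12) (Vc M3 0) = 0" "qform n (M2 13) (Vc M3 0) = 0" for M3
    proof (rule wp_Finish[where j = "m - 1" and s = 0])
      show "M3 m = A m" "M3 23 m 0 = complex_of_real (a m)"
        using M3 fr i0 ji M by (auto simp: ready_def)
      show "0 = qform n (A (m - 1)) (Vc M3 0) - a (m - 1) / a m * qform n (A m) (Vc M3 0)"
        using core_eq(2)[OF C ji, of "Vc M3 0"] e(3) by simp
      show "qform n (A i) (Vc M3 0) = a i / a m * qform n (A m) (Vc M3 0)" if "i \<in> {1..m}" "i \<noteq> m - 1" for i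
        by (rule core_eq(1)[OF C ji e(1,2) that])
    qed (use R ji v in auto)
    let ?v = "qform n idm (Vc M2 0)"
    show "wp R (Then (FormV 1 14 0 0) (Then (IfElse (ReLess (CNum 0) (Sc 1)) Skip (Pair ?ga 12 13 (m + 2))) (Finish m m)))
       (\<lambda>M'. certificate (\<lambda>i. M' (m + 4) i 0)) M2"
    proof (rule wp_Then_FormV[where v = "complex_of_real ?v"], rule wp_Then, intro wp_IfElse wp_Skip)
      let ?M3 = "put 1 (complex_of_real ?v) M2"
      assume "bval (R, ?M3) (ReLess (CNum 0) (Sc 1))"
      then have nz: "?v \<noteq> 0" by (auto simp flip: Sv_def)
      have "\<exists>k<n. ?P k"
      proof (rule ccontr)
        assume "\<not> ?thesis"
        then have "\<forall>i<n. Vc M2 0 i = 0" using fo(1) unfolding found_def by (simp only: if_False)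
        then show False using nz by (simp add: qform_idm_zero_iff)
      qed
      from found_qform[OF fo(1) this] obtain k where k: "k < n" "?P k" "\<And>i. i < n \<Longrightarrow> Vc M2 0 i = Lc M2 k i"
        "\<And>B. qform n B (Vc M2 0) = qform n B (Lc M2 k)" by metis
      note cv = core_vector[OF C ji k(1,3,4)]
      show "wp R (Finish m m) (\<lambda>M'. certificate (\<lambda>i. M' (m + 4) i 0)) ?M3"
        using cv k by (intro fin) auto
    next
      let ?M3 = "put 1 (complex_of_real ?v) M2"
      assume "\<not> bval (R, ?M3) (ReLess (CNum 0) (Sc 1))"
      then have "?v = 0" using qform_idm_nonneg[of n "Vc M2 0"] by (simp flip: Sv_def)
      then have none: "\<not> (\<exists>k<n. ?P k)" using found_qform[OF fo(1)] by metis
      from found_qform[OF fo(2) core_signs(2)[OF C ji none]] obtain p where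
        p: "p < n" "qform n (M2 13) (Lc M2 p) > 0" "\<And>i. i < n \<Longrightarrow> Vc M2 1 i = Lc M2 p i"
          "\<And>B. qform n B (Vc M2 1) = qform n B (Lc M2 p)" "\<And>B w. sform n B (Vc M2 1) w = sform n B (Lc M2 p) w" by metis
      from found_qform[OF fo(3) core_signs(1)[OF C ji none]] obtain q where
        q: "q < n" "qform n (M2 13) (Lc M2 q) < 0" "\<And>i. i < n \<Longrightarrow> Vc M2 2 i = Lc M2 q i"
          "\<And>B. qform n B (Vc M2 2) = qform n B (Lc M2 q)" "\<And>B w. sform n B (Vc M2 2) w = sform n B (Lc M2 q) w"
          "\<And>B w. sform n B w (Vc M2 2) = sform n B w (Lc M2 q)" by metis
      note cp = core_vector[OF C ji p(1,3,4)] and cq = core_vector[OF C ji q(1,3,4)]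
      have arr: "?ga \<notin> {20, 22, 24}" "m + 2 \<notin> {20, 22, 24}" using i0 by (auto simp: G_array_def)
      have Z2: "M2 (m + 2) = Z" using fr[OF i0(2)] M by (simp add: ready_def)
      have Zp: "hermitian_fun n Z" "matF n Z" using Z by (auto simp: psd_fun_def)
      have forms: "M2 ?ga i k = Gf i k" "M2 12 i k = Bf (m - 2) i k" "M2 13 i k = Bf (m - 1) i k" if "i < n" "k < n" for i k
      proof -
        have m12: "m - 2 \<in> {1..m}" "1 \<in> {1..m}" using m_le by auto
        have r34: "rest 3 2 3 = [1]" "rest 4 3 4 = [1, 2]" by (simp_all add: rest_def upt_rec)
        show "M2 13 i k = Bf (m - 1) i k" using C that ef[OF ji(1)] by (simp add: core_post_def)
        consider "m = 3" "F = \<real>" | "m = 4" using Fm by blast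
        then have "M2 ?ga i k = Gf i k \<and> M2 12 i k = Bf (m - 2) i k"
        proof cases
          case 1
          have "M2 10 = (\<lambda>i j. 0)" using fr[of 10] M by (simp add: ready_def)
          moreover have "M2 12 i k = eform A a m (rest m (m - 1) m ! (m - 3)) i k" using C that by (simp add: core_post_def)
          moreover have "rest m (m - 1) m ! (m - 3) = m - 2" using r34 by (simp add: 1)
          moreover have "Gf = (\<lambda>i j. 0)" unfolding Gf_def if_P[OF 1(1)] ..
          moreover have "?ga = 10" by (simp add: G_array_def 1(1))
          ultimately show ?thesis using ef[OF m12(1)] by simp
        next
          case 2
          have "M2 12 i k = eform A a m (rest m (m - 1) m ! (m - 3)) i k" using C that by (simp add: core_post_def)
          moreover have "rest m (m - 1) m ! (m - 3) = m - 2" using r34 by (simp add: 2)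
          moreover have "M2 11 i k = eform A a m (rest 4 (m - 1) m ! 0) i k" using C that 2 unfolding core_post_def by blast
          moreover have "rest 4 (m - 1) m ! 0 = 1" using r34 by (simp add: 2)
          moreover have "m \<noteq> 3" using 2 by simp
          then have "Gf = Bf 1" "?ga = 11" unfolding Gf_def G_array_def by (rule if_not_P)+
          ultimately show ?thesis using ef[OF m12(1)] ef[OF m12(2)] by simp
        qed
        then show "M2 ?ga i k = Gf i k" "M2 12 i k = Bf (m - 2) i k" by blast+
      qed
      have qf: "qform n (M2 ?ga) v = qform n Gf v" "qform n (M2 12) v = qform n (Bf (m - 2)) v"
          "qform n (M2 13) v = qform n (Bf (m - 1)) v" for v
        by (rule qform_mat_cong, rule forms, assumption, assumption)+
      have sf: "sform n (M2 ?ga) v w = sform n Gf v w" "sform n (M2 12) v w = sform n (Bf (m - 2)) v w" for v w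
        using forms by (auto intro!: sform_cong)
      have th: "third_vector n Z (Vc M2 1) (Vc M2 2)" if "independent_pair n (M2 ?ga) (M2 12) (Vc M2 1) (Vc M2 2)"
      proof -
        have "independent_pair n Gf (Bf (m - 2)) (Lc M2 p) (Lc M2 q)"
          using that unfolding independent_pair_def sf p(5) q(6) .
        then have "needs_third (Lc M2) p q"
          using C p q unfolding needs_third_def core_post_def qf by blast
        from third[OF this] show ?thesis unfolding third_vector_def p(5) q(5) .
      qed
      show "wp R (Pair ?ga 12 13 (m + 2)) (wp R (Finish m m) (\<lambda>M'. certificate (\<lambda>i. M' (m + 4) i 0))) ?M3"
      proof (rule wp_Pair[where n = n and G = "M2 ?ga" and D = "M2 12" and E = "M2 13" and Z = Z])
        fix M4 assume M4: "\<And>b. b \<notin> {20, 22, 24} \<Longrightarrow> M4 b = ?M3 b" "vecF n (Vc M4 0)"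
          "\<And>i. i < n \<Longrightarrow> mv n Z (Vc M4 0) i = 0" "qform n idm (Vc M4 0) \<noteq> 0"
          "qform n (M2 ?ga) (Vc M4 0) = 0" "qform n (M2 12) (Vc M4 0) = 0" "qform n (M2 13) (Vc M4 0) = 0"
        then show "wp R (Finish m m) (\<lambda>M'. certificate (\<lambda>i. M' (m + 4) i 0)) M4"
          using mv_qform_zero by (intro fin) auto
      qed (use R arr Z2 I Zp C cp cq p q th in \<open>auto simp: core_post_def\<close>)
    qed (use R qform_idm_cong_mat[of n "M2 14", OF I] in \<open>auto simp: sform_self\<close>)
  qed
qed

end

section \<open>Selecting the constraints and running the whole program\<close>

context machine_pair begin

lemma wp_ComputeA:
  assumes R: "R 3 = 0" "R 4 = 0" "R 0 = n" and M: "\<And>i. i \<le> m \<Longrightarrow> M i = A i" "M (m + 1) = X" and k: "k \<le> m"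
    and Q: "\<And>M'. (\<And>b. b \<notin> {23, 24} \<Longrightarrow> M' b = M b) \<Longrightarrow> (\<And>i. i \<in> {1..k} \<Longrightarrow> M' 23 i 0 = complex_of_real (a i)) \<Longrightarrow> Q M'"
  shows "wp R (ComputeA (m + 1) k) Q M"
  using k Q
proof (induction k arbitrary: Q)
  case 0
  then show ?case by (auto intro!: wp_Skip)
next
  case (Suc k)
  let ?s = "\<Sum>i<n. \<Sum>j<n. cnj (X i j) * A (Suc k) i j"
  show ?case
    unfolding ComputeA.simps
  proof (rule wp_Then, rule Suc.IH)
    show "k \<le> m" using Suc.prems by simp
    fix M1 assume M1: "\<And>b. b \<notin> {23, 24} \<Longrightarrow> M1 b = M b" "\<And>i. i \<in> {1..k} \<Longrightarrow> M1 23 i 0 = complex_of_real (a i)"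
    have k: "Suc k \<notin> {23, 24}" "m + 1 \<notin> {23, 24}" using Suc.prems(1) m_le by auto
    have M1A: "M1 (Suc k) = A (Suc k)" "M1 (m + 1) = X" using M1(1)[OF k(1)] M1(1)[OF k(2)] M Suc.prems(1) by simp_all
    show "wp R (Then (Sum2 0 (CMul (Conj (Cell (m + 1) (NReg 3) (NReg 4))) (Cell (Suc k) (NReg 3) (NReg 4))))
           (SetCell 23 (NNum (Suc k)) (NNum 0) (CDiv (CAdd (Sc 0) (Conj (Sc 0))) (CNum 2)))) Q M1"
    proof (rule wp_Then, rule wp_Sum2[where v = "\<lambda>i j. cnj (X i j) * A (Suc k) i j"])
      fix i j w
      have "put 0 w M1 (Suc k) = A (Suc k)" "put 0 w M1 (m + 1) = X" using k M1A by (simp_all add: put_other)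
      then show "cval (R(3 := i, 4 := j), put 0 w M1) (CMul (Conj (Cell (m + 1) (NReg 3) (NReg 4))) (Cell (Suc k) (NReg 3) (NReg 4)))
        = cnj (X i j) * A (Suc k) i j" by simp
    next
      have v: "cval (R, put 0 ?s M1) (CDiv (CAdd (Sc 0) (Conj (Sc 0))) (CNum 2)) = complex_of_real (a (Suc k))"
      proof -
        have "cval (R, put 0 ?s M1) (CDiv (CAdd (Sc 0) (Conj (Sc 0))) (CNum 2)) = (?s + cnj ?s) / 2"
          by (simp only: cval.simps nval.simps fst_conv snd_conv put_at of_int_numeral)
        also have "\<dots> = complex_of_real (a (Suc k))"
          unfolding complex_add_cnj by (simp add: a_def minner_def)
        finally show ?thesis .
      qed
      have "Q (set_cell (put 0 ?s M1) 23 (Suc k) 0 (complex_of_real (a (Suc k))))"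
      proof (rule Suc.prems(2))
        fix i assume "i \<in> {1..Suc k}"
        then show "set_cell (put 0 ?s M1) 23 (Suc k) 0 (complex_of_real (a (Suc k))) 23 i 0 = complex_of_real (a i)"
          using M1(2)[of i] by (cases "i = Suc k") (auto simp: put_other)
      qed (use M1(1) in \<open>auto simp: put_other\<close>)
      then have Q': "Q (set_cell (put 0 ?s M1) 23 (nval R (NNum (Suc k))) (nval R (NNum 0))
          (cval (R, put 0 ?s M1) (CDiv (CAdd (Sc 0) (Conj (Sc 0))) (CNum 2))))"
        unfolding v nval.simps .
      show "wp R (SetCell 23 (NNum (Suc k)) (NNum 0) (CDiv (CAdd (Sc 0) (Conj (Sc 0))) (CNum 2))) Q
         (put 0 (\<Sum>i<R 0. \<Sum>j<R 0. cnj (X i j) * A (Suc k) i j) M1)"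
        unfolding R(3) by (rule wp_SetCell) (rule Q')
    qed (use R in auto)
  qed
qed

lemma wp_SelectI:
  assumes R: "R 1 = 0" "R 2 = 0" "R 3 = 0" "R 4 = 0" "R 0 = n" and M: "ready M"
    and j: "j \<in> {1..m}" "r j = Le" "\<mu> j = 0"
    and k: "k \<le> m" "\<And>i. i \<in> {k<..m} \<Longrightarrow> i \<noteq> j \<Longrightarrow> a i = 0"
  shows "wp R (SelectI m j k) (\<lambda>M'. certificate (\<lambda>i. M' (m + 4) i 0)) M"
  using k
proof (induction k)
  case 0
  have "certificate (\<lambda>i. 0)" by (rule certificate_zero[OF j]) (use 0 in auto)
  moreover have "M (m + 4) i 0 = 0" if "i < n" for i using M that by (simp add: ready_def)
  ultimately show ?case using certificate_cong[of "\<lambda>i. M (m + 4) i 0" "\<lambda>i. 0"] by (auto intro!: wp_Skip)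
next
  case (Suc k)
  have le: "k \<le> m" using Suc.prems(1) by simp
  show ?case
  proof (cases "Suc k = j")
    case True
    have "wp R (SelectI m j k) (\<lambda>M'. certificate (\<lambda>i. M' (m + 4) i 0)) M"
    proof (rule Suc.IH[OF le])
      fix i assume "i \<in> {k<..m}" "i \<noteq> j"
      then have "i \<in> {Suc k<..m}" using True by auto
      then show "a i = 0" using Suc.prems(2) \<open>i \<noteq> j\<close> by blast
    qed
    then show ?thesis unfolding SelectI.simps if_P[OF True] .
  next
    case False
    have v: "M 23 (Suc k) 0 = complex_of_real (a (Suc k))" using M Suc.prems(1) by (simp add: ready_def)
    have "wp R (IfElse (ReLess (CNum 0) (CMul (Cell 23 (NNum (Suc k)) (NNum 0)) (Cell 23 (NNum (Suc k)) (NNum 0))))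
       (CaseA m j (Suc k)) (SelectI m j k)) (\<lambda>M'. certificate (\<lambda>i. M' (m + 4) i 0)) M"
    proof (rule wp_IfElse)
      assume "bval (R, M) (ReLess (CNum 0) (CMul (Cell 23 (NNum (Suc k)) (NNum 0)) (Cell 23 (NNum (Suc k)) (NNum 0))))"
      then have "a (Suc k) \<noteq> 0" by (auto simp: v)
      then show "wp R (CaseA m j (Suc k)) (\<lambda>M'. certificate (\<lambda>i. M' (m + 4) i 0)) M"
        using False Suc.prems(1) j by (intro wp_CaseA[OF R M]) auto
    next
      assume "\<not> bval (R, M) (ReLess (CNum 0) (CMul (Cell 23 (NNum (Suc k)) (NNum 0)) (Cell 23 (NNum (Suc k)) (NNum 0))))"
      then have 0: "a (Suc k) = 0" by (auto simp: v zero_less_mult_iff)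
      show "wp R (SelectI m j k) (\<lambda>M'. certificate (\<lambda>i. M' (m + 4) i 0)) M"
      proof (rule Suc.IH[OF le])
        fix i assume "i \<in> {k<..m}" "i \<noteq> j"
        then show "a i = 0" using 0 Suc.prems(2)[of i] by (cases "i = Suc k") auto
      qed
    qed
    then show ?thesis unfolding SelectI.simps if_not_P[OF False] .
  qed
qed

lemma wp_SelectJ:
  assumes R: "R 1 = 0" "R 2 = 0" "R 3 = 0" "R 4 = 0" "R 0 = n" and M: "ready M"
    and fl: "\<And>i. i \<in> {1..m} \<Longrightarrow> M (m + 3) i 1 = complex_of_real (\<mu> i) \<and> M (m + 3) i 2 = (if r i = Le then 1 else 0)"
    and third: "\<And>L p q. all_active \<Longrightarrow> needs_third L p q \<Longrightarrow> third_vector n Z (L p) (L q)"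
    and k: "k \<le> m" "\<And>i. i \<in> {k<..m} \<Longrightarrow> \<not> (r i = Le \<and> \<mu> i = 0)"
  shows "wp R (SelectJ m k) (\<lambda>M'. certificate (\<lambda>i. M' (m + 4) i 0)) M"
  using k
proof (induction k)
  case 0
  then have "all_active" by (auto simp: all_active_def)
  then show ?case using wp_CaseB[OF R M _ third] by simp
next
  case (Suc k)
  have i: "Suc k \<in> {1..m}" using Suc.prems(1) by simp
  let ?b = "BAnd (ReLess (CNum 0) (Cell (m + 3) (NNum (Suc k)) (NNum 2)))
       (BAnd (BNot (ReLess (Cell (m + 3) (NNum (Suc k)) (NNum 1)) (CNum 0)))
             (BNot (ReLess (CNum 0) (Cell (m + 3) (NNum (Suc k)) (NNum 1)))))"
  have b: "bval (R, M) ?b \<longleftrightarrow> r (Suc k) = Le \<and> \<mu> (Suc k) = 0"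
    using fl[OF i] by auto
  show ?case
    unfolding SelectJ.simps
  proof (rule wp_IfElse, unfold b)
    assume "r (Suc k) = Le \<and> \<mu> (Suc k) = 0"
    then show "wp R (SelectI m (Suc k) m) (\<lambda>M'. certificate (\<lambda>i. M' (m + 4) i 0)) M"
      by (intro wp_SelectI[OF R M i]) auto
  next
    assume no: "\<not> (r (Suc k) = Le \<and> \<mu> (Suc k) = 0)"
    show "wp R (SelectJ m k) (\<lambda>M'. certificate (\<lambda>i. M' (m + 4) i 0)) M"
    proof (rule Suc.IH)
      fix i assume "i \<in> {k<..m}"
      then show "\<not> (r i = Le \<and> \<mu> i = 0)" using no Suc.prems(2)[of i] by (cases "i = Suc k") auto
    qed (use Suc.prems in simp)
  qed
qed

lemma wp_Main:
  assumes R: "R 1 = 0" "R 2 = 0" "R 3 = 0" "R 4 = 0" "R 0 = n"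
    and M: "\<And>i. i \<le> m \<Longrightarrow> M i = A i" "M (m + 1) = X" "M (m + 2) = Z" "\<And>b. b > m + 3 \<Longrightarrow> M b = (\<lambda>i j. 0)"
    and fl: "\<And>i. i \<in> {1..m} \<Longrightarrow> M (m + 3) i 1 = complex_of_real (\<mu> i) \<and> M (m + 3) i 2 = (if r i = Le then 1 else 0)"
    and third: "\<And>L p q. all_active \<Longrightarrow> needs_third L p q \<Longrightarrow> third_vector n Z (L p) (L q)"
  shows "wp R (Main m) (\<lambda>M'. certificate (\<lambda>i. M' (m + 4) i 0)) M"
  unfolding Main_def
proof (rule wp_Then, rule wp_SetIdentity[where n = n])
  show "M 14 = (\<lambda>i j. 0)" using M(4)[of 14] m_le by simp
  fix M1 assume M1: "\<And>b. b \<noteq> 14 \<Longrightarrow> M1 b = M b" "\<And>i j. i < n \<Longrightarrow> j < n \<Longrightarrow> M1 14 i j = idm i j"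
  have m1: "m + 1 \<noteq> 14" "m + 2 \<noteq> 14" "m + 3 \<noteq> 14" "m + 4 \<noteq> 14" "m + 2 \<notin> {23, 24}" "m + 1 \<notin> {23, 24}" "m + 3 \<notin> {23, 24}" "m + 4 \<notin> {23, 24}"
    using m_le by auto
  show "wp R (Then (ComputeA (m + 1) m) (SelectJ m m)) (\<lambda>M'. certificate (\<lambda>i. M' (m + 4) i 0)) M1"
  proof (rule wp_Then, rule wp_ComputeA)
    show "M1 i = A i" if "i \<le> m" for i using M1(1)[of i] M(1)[OF that] that m_le by simp
    show "M1 (m + 1) = X" using M1(1)[OF m1(1)] M(2) by simp
    fix M2 assume M2: "\<And>b. b \<notin> {23, 24} \<Longrightarrow> M2 b = M1 b" "\<And>i. i \<in> {1..m} \<Longrightarrow> M2 23 i 0 = complex_of_real (a i)"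
    have M2M: "M2 b = M b" if "b \<notin> {14, 23, 24}" for b using M2(1)[of b] M1(1)[of b] that by simp
    have "ready M2"
      unfolding ready_def
    proof (intro conjI allI impI ballI)
      show "M2 i = A i" if "i \<le> m" for i using M2M[of i] M(1)[OF that] that m_le by simp
      show "M2 (m + 1) = X" "M2 (m + 2) = Z" using M2M m1 M(2,3) by auto
      show "M2 10 = (\<lambda>i j. 0)" using M2M[of 10] M(4)[of 10] m_le by simp
      show "M2 14 i j = idm i j" if "i < n" "j < n" for i j using M2(1)[of 14] M1(2)[OF that] by simp
      show "M2 23 i 0 = complex_of_real (a i)" if "i \<in> {1..m}" for i using M2(2)[OF that] .
      show "Vc M2 k i = 0" for k i using M2M[of 22] M(4)[of 22] m_le by (simp add: Vc_def)
      show "M2 (m + 4) i 0 = 0" for i using M2M[of "m + 4"] M(4)[of "m + 4"] m1 by simp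
    qed
    then show "wp R (SelectJ m m) (\<lambda>M'. certificate (\<lambda>i. M' (m + 4) i 0)) M2"
    proof (rule wp_SelectJ[OF R])
      show "M2 (m + 3) i 1 = complex_of_real (\<mu> i) \<and> M2 (m + 3) i 2 = (if r i = Le then 1 else 0)" if "i \<in> {1..m}" for i
        using fl[OF that] M2M[of "m + 3"] m1 by simp
    qed (use third in auto)
  qed (use R in auto)
qed (use R in auto)

end

section \<open>Rank and kernel\<close>

definition dot :: "complex vec \<Rightarrow> complex vec \<Rightarrow> complex" where
  "dot x y = (\<Sum>i<dim_vec x. cnj (x $ i) * y $ i)"

text \<open>One half of rank-nullity: a maximal independent set of columns stays independent when K
  is added, because K is orthogonal to the columns and consists of pairwise orthogonal nonzero
  vectors; the union therefore has at most n elements.\<close>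

lemma rank_orthogonal:
  fixes Z :: "complex mat"
  assumes Z: "Z \<in> carrier_mat n n" and K: "K \<subseteq> carrier_vec n" "finite K"
    and ne: "\<And>k. k \<in> K \<Longrightarrow> dot k k \<noteq> 0" and orth: "\<And>k l. k \<in> K \<Longrightarrow> l \<in> K \<Longrightarrow> k \<noteq> l \<Longrightarrow> dot k l = 0"
    and ker: "\<And>k j. k \<in> K \<Longrightarrow> j < n \<Longrightarrow> dot k (col Z j) = 0"
  shows "mrank n Z + card K \<le> n"
proof -
  interpret vec_space "TYPE(complex)" n .
  obtain S where S: "maximal S (\<lambda>T. T \<subseteq> set (cols Z) \<and> lin_indpt T)"
    using maximal_exists[of "(\<lambda>T. T \<subseteq> set (cols Z) \<and> lin_indpt T)" "card (set (cols Z))" "{}"]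
    by (meson List.finite_set card_mono empty_iff empty_subsetI finite_lin_indpt2 rev_finite_subset)
  then have S': "S \<subseteq> set (cols Z)" "lin_indpt S" "finite S"
    unfolding maximal_def using finite_subset by auto
  have rank: "rank Z = card S" by (rule rank_card_indpt[OF Z S])
  have Sc: "S \<subseteq> carrier_vec n" using S'(1) Z cols_dim by blast
  have perp: "dot k s = 0" if "k \<in> K" "s \<in> S" for k s
  proof -
    from that(2) S'(1) obtain j where "j < n" "s = col Z j"
      using Z by (metis carrier_matD(2) cols_length cols_nth in_set_conv_nth subsetD)
    then show ?thesis using ker that(1) by simp
  qed
  then have disj: "S \<inter> K = {}" using ne by blast
  have "lin_indpt (S \<union> K)"
  proof (rule finite_lin_indpt2)
    fix a assume 0: "lincomb a (S \<union> K) = 0\<^sub>v n"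
    have SK: "S \<union> K \<subseteq> carrier_vec n" using Sc K by blast
    have idx: "(\<Sum>x\<in>S \<union> K. a x * x $ i) = 0" if "i < n" for i
    proof -
      have "(\<Sum>x\<in>S \<union> K. a x * x $ i) = lincomb a (S \<union> K) $ i" by (rule lincomb_index[OF that SK, symmetric])
      also have "\<dots> = 0\<^sub>v n $ i" unfolding 0 ..
      finally show ?thesis using that by simp
    qed
    \<comment> \<open>Pairing the vanishing combination with k leaves only the coefficient of
      k.\<close>
    have aK: "a k = 0" if k: "k \<in> K" for k
    proof -
      have dk: "dim_vec k = n" using k K by auto
      have "0 = (\<Sum>i<n. cnj (k $ i) * (\<Sum>x\<in>S \<union> K. a x * x $ i))" using idx by simp
      also have "\<dots> = (\<Sum>x\<in>S \<union> K. a x * dot k x)"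
        unfolding sum_distrib_left dot_def dk by (subst sum.swap) (simp add: mult.left_commute)
      also have "\<dots> = (\<Sum>x\<in>S \<union> K. if x = k then a k * dot k k else 0)"
        by (rule sum.cong) (use perp[OF k] orth[OF k] disj k in auto)
      also have "\<dots> = a k * dot k k" using k S'(3) K(2) by simp
      finally show ?thesis using ne[OF k] by simp
    qed
    have "lincomb a S = 0\<^sub>v n"
    proof (rule eq_vecI)
      fix i assume "i < dim_vec (0\<^sub>v n)"
      then have i: "i < n" by simp
      have "lincomb a S $ i = (\<Sum>x\<in>S. a x * x $ i)" by (rule lincomb_index[OF i Sc])
      also have "\<dots> = (\<Sum>x\<in>S \<union> K. a x * x $ i)"
        by (rule sum.mono_neutral_left) (use S'(3) K aK in auto)
      finally show "lincomb a S $ i = 0\<^sub>v n $ i" using idx[OF i] i by simp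
    qed (use lincomb_dim[OF S'(3) Sc] in simp)
    then have "a \<in> S \<rightarrow> {\<zero>\<^bsub>class_ring\<^esub>}"
      using not_lindepD[OF S'(2) S'(3), of a] by (simp add: module_vec_simps)
    then show "\<forall>v\<in>S \<union> K. a v = 0" using aK by (auto simp: class_ring_simps)
  qed (use S' K Sc in \<open>auto simp: module_vec_simps\<close>)
  then have "card (S \<union> K) \<le> n"
    using li_le_dim(2)[OF fin_dim, of "S \<union> K"] Sc K dim_is_n by auto
  then show ?thesis using rank card_Un_disjoint[OF S'(3) K(2) disj] by simp
qed

lemma rank_outer_le: "x \<in> carrier_vec n \<Longrightarrow> mrank n (outer x) \<le> 1"
proof -
  interpret vec_space "TYPE(complex)" n .
  assume "x \<in> carrier_vec n"
  then show ?thesis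
    by (intro rank_le_1_product_entries[of _ n "\<lambda>i. x $ i" "\<lambda>j. cnj (x $ j)"]) (auto simp: outer_def)
qed

lemma outer_carrier: "x \<in> carrier_vec n \<Longrightarrow> outer x \<in> carrier_mat n n"
  by (auto simp: outer_def)

lemma rank_add: "A \<in> carrier_mat n n \<Longrightarrow> B \<in> carrier_mat n n \<Longrightarrow> mrank n (A + B) \<le> mrank n A + mrank n (B :: complex mat)"
proof -
  interpret vec_space "TYPE(complex)" n .
  assume "A \<in> carrier_mat n n" "B \<in> carrier_mat n n"
  then show ?thesis by (rule rank_subadditive)
qed

lemma rank_full:
  fixes M :: "complex mat"
  assumes M: "M \<in> carrier_mat n n" and ker: "\<And>y. (\<And>i. i < n \<Longrightarrow> mv n (mat_cells n M) y i = 0) \<Longrightarrow> \<forall>i<n. y i = 0"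
  shows "mrank n M = n"
proof -
  interpret vec_space "TYPE(complex)" n .
  have "det M \<noteq> 0"
  proof
    assume "det M = 0"
    then obtain v where v: "v \<in> carrier_vec n" "v \<noteq> 0\<^sub>v n" "M *\<^sub>v v = 0\<^sub>v n"
      using det_0_iff_vec_prod_zero_field[OF M] by blast
    have "mv n (mat_cells n M) (vec_index v) i = 0" if "i < n" for i
    proof -
      have "(M *\<^sub>v v) $ i = 0" using v(3) that by simp
      then show ?thesis using that M v(1) by (simp add: mv_def mat_cells_def scalar_prod_def atLeast0LessThan)
    qed
    then have "\<forall>i<n. v $ i = 0" by (rule ker)
    then have "v = 0\<^sub>v n" using v(1) by (intro eq_vecI) auto
    then show False using v(2) by simp
  qed
  then show ?thesis using det_rank_iff[OF M] by simp
qed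

text \<open>For Hermitian Z, kernel vectors are orthogonal to the columns. Pairwise orthogonality
  makes the family injective, so that it can be counted by its indices.\<close>

lemma rank_kernel_le:
  assumes Z: "Z \<in> carrier_mat n n" "hermitian_fun n (mat_cells n Z)" and I: "finite I"
    and ne: "\<And>k. k \<in> I \<Longrightarrow> qform n idm (u k) \<noteq> 0"
    and orth: "\<And>k l. k \<in> I \<Longrightarrow> l \<in> I \<Longrightarrow> k \<noteq> l \<Longrightarrow> sform n idm (u k) (u l) = 0"
    and ker: "\<And>k i. k \<in> I \<Longrightarrow> i < n \<Longrightarrow> mv n (mat_cells n Z) (u k) i = 0"
  shows "mrank n Z + card I \<le> n"
proof -
  let ?v = "\<lambda>k. vec n (u k)"
  have dot: "dot (?v k) (?v l) = sform n idm (u k) (u l)" for k l by (simp add: dot_def sform_idm)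
  have self: "sform n idm (u k) (u k) \<noteq> 0" if "k \<in> I" for k using ne[OF that] by (simp add: sform_self)
  have "inj_on ?v I"
  proof (rule inj_onI)
    fix k l assume kl: "k \<in> I" "l \<in> I" "?v k = ?v l"
    show "k = l"
    proof (rule ccontr)
      assume "k \<noteq> l"
      then have "dot (?v k) (?v l) = 0" unfolding dot by (rule orth[OF kl(1,2)])
      then have "dot (?v k) (?v k) = 0" unfolding kl(3) .
      then show False using self[OF kl(1)] unfolding dot by simp
    qed
  qed
  then have "card I = card (?v ` I)" by (simp add: card_image)
  moreover have "mrank n Z + card (?v ` I) \<le> n"
  proof (rule rank_orthogonal[OF Z(1)])
    fix x j assume "x \<in> ?v ` I" and j: "j < n"
    then obtain k where k: "k \<in> I" "x = ?v k" by blast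
    have "dot x (col Z j) = (\<Sum>i<n. cnj (u k i) * mat_cells n Z i j)"
      using Z(1) j by (simp add: k(2) dot_def mat_cells_def)
    also have "\<dots> = (\<Sum>i<n. cnj (mat_cells n Z j i * u k i))"
    proof (rule sum.cong[OF refl])
      fix i assume "i \<in> {..<n}"
      then have "mat_cells n Z i j = cnj (mat_cells n Z j i)" using Z(2) j unfolding hermitian_fun_def by blast
      then show "cnj (u k i) * mat_cells n Z i j = cnj (mat_cells n Z j i * u k i)" by simp
    qed
    also have "\<dots> = cnj (mv n (mat_cells n Z) (u k) j)" by (simp add: mv_def)
    finally show "dot x (col Z j) = 0" using ker[OF k(1) j] by simp
  next
    fix x y assume "x \<in> ?v ` I" "y \<in> ?v ` I" "x \<noteq> y"
    then obtain k l where kl: "k \<in> I" "l \<in> I" "x = ?v k" "y = ?v l" "k \<noteq> l" by blast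
    then show "dot x y = 0" using orth dot by simp
  qed (use self dot I in auto)
  ultimately show ?thesis by simp
qed

lemma mat_cells_add: "A \<in> carrier_mat n n \<Longrightarrow> B \<in> carrier_mat n n \<Longrightarrow> i < n \<Longrightarrow> j < n \<Longrightarrow>
    mat_cells n (A + B) i j = mat_cells n A i j + mat_cells n B i j"
  by (simp add: mat_cells_def)

lemma mv_add_mat: "A \<in> carrier_mat n n \<Longrightarrow> B \<in> carrier_mat n n \<Longrightarrow> i < n \<Longrightarrow>
    mv n (mat_cells n (A + B)) y i = mv n (mat_cells n A) y i + mv n (mat_cells n B) y i"
  by (simp add: mv_def mat_cells_add distrib_right sum.distrib)

text \<open>Gram-Schmidt for a linearly independent pair: u is x2 made orthogonal to x1,
  \<open>ca\<close> and \<open>cb\<close> are the coordinates, with respect to x1 and x2, of the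
  projection onto their span, and \<open>perp\<close> is the remainder.\<close>

locale independent2 =
  fixes n :: nat and x1 x2 :: "nat \<Rightarrow> complex"
  assumes x1: "qform n idm x1 \<noteq> 0" and x2: "\<And>t. \<exists>i<n. x2 i \<noteq> t * x1 i"
begin

definition t where "t = sform n idm x1 x2 / sform n idm x1 x1"
definition u where "u i = x2 i - t * x1 i"

lemma s11: "sform n idm x1 x1 \<noteq> 0"
  using x1 by (simp add: sform_self)

lemma u1: "sform n idm x1 u = 0" "sform n idm u x1 = 0"
proof -
  show "sform n idm x1 u = 0" unfolding u_def[abs_def] sform_linear t_def using s11 by simp
  then show "sform n idm u x1 = 0" using sform_herm[OF hermitian_idm, of n u x1] by simp
qed

lemma u_ne: "qform n idm u \<noteq> 0"
  using x2[of t] by (auto simp: qform_idm_zero_iff u_def)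

lemma suu: "sform n idm u u \<noteq> 0"
  using u_ne by (simp add: sform_self)

definition cb where "cb y = sform n idm u y / sform n idm u u"
definition ca where "ca y = sform n idm x1 y / sform n idm x1 x1 - cb y * t"

definition perp where "perp y i = y i - ca y * x1 i - cb y * x2 i"

lemma perp_eq: "perp y = (\<lambda>i. y i - (sform n idm x1 y / sform n idm x1 x1) * x1 i - cb y * u i)"
  by (simp add: perp_def ca_def u_def fun_eq_iff algebra_simps)

lemma perp_orth: "sform n idm x1 (perp y) = 0" "sform n idm u (perp y) = 0" "sform n idm x2 (perp y) = 0"
proof -
  show 1: "sform n idm x1 (perp y) = 0" using s11 unfolding perp_eq sform_linear by (simp add: u1)
  show 2: "sform n idm u (perp y) = 0" using suu unfolding perp_eq sform_linear by (simp add: u1 cb_def)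
  have "x2 = (\<lambda>i. u i + t * x1 i)" by (simp add: u_def fun_eq_iff)
  then have "sform n idm x2 (perp y) = sform n idm u (perp y) + cnj t * sform n idm x1 (perp y)"
    by (metis sform_add_left sform_scale_left)
  then show "sform n idm x2 (perp y) = 0" using 1 2 by simp
qed

lemma perp_zero: "qform n idm (perp y) = 0 \<Longrightarrow> i < n \<Longrightarrow> y i = ca y * x1 i + cb y * x2 i"
  by (auto simp: qform_idm_zero_iff perp_def algebra_simps)

lemma mv_perp:
  assumes "mv n Z x1 i = 0" "mv n Z x2 i = 0"
  shows "mv n Z (perp y) i = mv n Z y i" "mv n Z u i = 0"
proof -
  have "perp y = (\<lambda>i. 1 * y i + 1 * ((- ca y) * x1 i + (- cb y) * x2 i))" by (simp add: perp_def fun_eq_iff)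
  then have "mv n Z (perp y) i = 1 * mv n Z y i + 1 * mv n Z (\<lambda>i. (- ca y) * x1 i + (- cb y) * x2 i) i"
    by (simp only: mv_comb)
  then show "mv n Z (perp y) i = mv n Z y i" using assms by (simp only: mv_comb) simp
  have "u = (\<lambda>i. 1 * x2 i + (- t) * x1 i)" by (simp add: u_def fun_eq_iff)
  then show "mv n Z u i = 0" using assms by (simp only: mv_comb) simp
qed

end

section \<open>Property I\<close>

text \<open>The form at \<open>t x1\<close> is \<open>|t|^2\<close> times its value at x1, so
  vectors at which it has opposite signs are neither zero nor multiples of each other.\<close>

lemma independent2_of_form:
  assumes E: "hermitian_fun n E" and s: "qform n E x1 * qform n E x2 < 0"
  shows "independent2 n x1 x2"
proof
  show "qform n idm x1 \<noteq> 0"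
  proof
    assume "qform n idm x1 = 0"
    then have "qform n E x1 = qform n E (\<lambda>i. 0)" by (intro qform_cong) (simp add: qform_idm_zero_iff)
    then show False using s by simp
  qed
  show "\<exists>i<n. x2 i \<noteq> t * x1 i" for t
  proof (rule ccontr)
    assume "\<not> (\<exists>i<n. x2 i \<noteq> t * x1 i)"
    then have "qform n E x2 = qform n E (\<lambda>i. t * x1 i)" by (intro qform_cong) simp
    then have "qform n E x1 * qform n E x2 = (cmod t * qform n E x1)\<^sup>2"
      by (simp add: qform_scale[OF E] power2_eq_square algebra_simps)
    then show False using s by (simp add: not_less[symmetric])
  qed
qed

lemma (in independent2) comb_zero:
  assumes "\<And>i. i < n \<Longrightarrow> g * x1 i + h * x2 i = 0"
  shows "g = 0" "h = 0"
proof -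
  show h: "h = 0"
  proof (rule ccontr)
    assume "h \<noteq> 0"
    then have "x2 i = (- g / h) * x1 i" if "i < n" for i
      using assms[OF that] by (simp add: field_simps eq_neg_iff_add_eq_0)
    then show False using x2 by blast
  qed
  obtain i where "i < n" "x1 i \<noteq> 0" using x1 by (auto simp: qform_idm_zero_iff)
  then show "g = 0" using assms[of i] h by simp
qed

lemma (in independent2) coeff_self: "ca x1 = 1" "cb x1 = 0" "ca x2 = 0" "cb x2 = 1"
proof -
  show b1: "cb x1 = 0" by (simp add: cb_def u1)
  show "ca x1 = 1" using s11 by (simp add: ca_def b1)
  have "x2 = (\<lambda>i. u i + t * x1 i)" by (simp add: u_def fun_eq_iff)
  then have "sform n idm u x2 = sform n idm u u + t * sform n idm u x1"
    by (metis sform_add_right sform_scale_right)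
  then show b2: "cb x2 = 1" using suu by (simp add: cb_def u1)
  show "ca x2 = 0" by (simp add: ca_def b2 t_def)
qed

context base_field begin

lemma matF_idm: "matF n idm"
  by (simp add: matF_def idm_def)

text \<open>In the real case the equation for the cross term is conclusive only for real
  coordinates; these are built from inner products of vectors over F by field operations.\<close>

lemma coeff_F:
  assumes "independent2 n x1 x2" "vecF n x1" "vecF n x2" "vecF n y"
  shows "independent2.ca n x1 x2 y \<in> F" "independent2.cb n x1 x2 y \<in> F"
proof -
  interpret independent2 n x1 x2 by (rule assms)
  have t: "t \<in> F" unfolding t_def using assms by (auto intro!: F_arith sform_F matF_idm)
  have u: "vecF n u" unfolding u_def[abs_def] using assms t by (intro vecF_comb)
  show b: "cb y \<in> F" unfolding cb_def using assms u by (auto intro!: F_arith sform_F matF_idm)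
  show "ca y \<in> F" unfolding ca_def using assms t b by (auto intro!: F_arith sform_F matF_idm)
qed

end

text \<open>Cramer's rule for two real equations in the real and imaginary parts of w; the
  determinant is \<open>Im (cnj s * t)\<close> up to sign.\<close>

lemma real_system_zero:
  fixes w s t :: complex
  assumes "Re (w * s) = 0" "Re (w * t) = 0" "Im (cnj s * t) \<noteq> 0"
  shows "w = 0"
proof -
  have "Re w * Im (cnj s * t) = Im t * Re (w * s) - Im s * Re (w * t)"
    "Im w * Im (cnj s * t) = Re t * Re (w * s) - Re s * Re (w * t)"
    by (simp_all add: algebra_simps)
  then have "Re w * Im (cnj s * t) = 0" "Im w * Im (cnj s * t) = 0" unfolding assms(1,2) by simp_all
  then show ?thesis using assms(3) by (auto simp only: mult_eq_0_iff complex_eq_iff zero_complex.sel)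
qed

lemma real_product_zero: "w \<in> \<real> \<Longrightarrow> s \<in> \<real> \<Longrightarrow> Re (w * s) = 0 \<Longrightarrow> s \<noteq> 0 \<Longrightarrow> w = 0" for w s :: complex
  by (auto elim!: Reals_cases)

context machine_pair begin

lemma Bf_form: "i \<le> m \<Longrightarrow> hermitian_fun n (Bf i) \<and> matF n (Bf i)"
  unfolding Bf_def eform_def using A[of i] A[of m]
  by (auto simp: matF_def simp del: of_real_divide intro!: hermitian_fun_comb F_arith)

lemma sesq_Bmat:
  assumes "\<And>i. i \<le> m \<Longrightarrow> AM i \<in> carrier_mat n n" "\<And>i. i \<le> m \<Longrightarrow> mat_cells n (AM i) = A i"
    and "i \<le> m" "x \<in> carrier_vec n" "y \<in> carrier_vec n"
  shows "sesq (Bmat m AM c i) x y = sform n (Bf i) (vec_index x) (vec_index y)"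
proof -
  have B: "Bmat m AM c i \<in> carrier_mat n n" using assms(1)[of i] assms(1)[of m] assms(3) by (auto simp: Bmat_def)
  have "mat_cells n (Bmat m AM c i) p q = Bf i p q" if "p < n" "q < n" for p q
    using that assms(1)[of i] assms(1)[of m] assms(3) assms(2)[of i, symmetric] assms(2)[of m, symmetric]
    by (simp add: Bf_def eform_def Bmat_def mat_cells_def)
  then show ?thesis using sesq_sform[OF B assms(4,5)] by (auto intro: sform_cong)
qed

text \<open>At \<open>a' x1 + b' x2\<close> the forms reduce to their cross terms, which gives real
  linear equations for \<open>cnj a' * b'\<close>. Independence of the pair makes 0 the only
  solution, so the vector is a multiple of x1 or of x2.\<close>

lemma pair_coeff_zero:
  assumes x: "vecF n x1" "vecF n x2" "a' \<in> F" "b' \<in> F"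
    and ip: "independent_pair n Gf (Bf (m - 2)) x1 x2"
    and z: "qform n Gf x1 = 0" "qform n Gf x2 = 0" "qform n (Bf (m - 2)) x1 = 0" "qform n (Bf (m - 2)) x2 = 0"
      "qform n Gf (\<lambda>i. a' * x1 i + b' * x2 i) = 0" "qform n (Bf (m - 2)) (\<lambda>i. a' * x1 i + b' * x2 i) = 0"
  shows "cnj a' * b' = 0"
proof -
  have D: "hermitian_fun n (Bf (m - 2))" "matF n (Bf (m - 2))" using Bf_form[of "m - 2"] by auto
  have h: "Re (cnj a' * b' * sform n (Bf (m - 2)) x1 x2) = 0"
    using z(6) unfolding qform_comb2[OF D(1)] z(3,4) by simp
  show ?thesis
  proof (cases "F = \<real>")
    case True
    have s: "sform n (Bf (m - 2)) x1 x2 \<in> \<real>" "cnj a' * b' \<in> \<real>"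
      using sform_F[OF D(2) x(1,2)] F_arith(7)[OF F_arith(10)[OF x(3)] x(4)] unfolding True by auto
    have "sform n (Bf (m - 2)) x1 x2 \<noteq> 0" using ip unfolding independent_pair_def if_P[OF True] .
    then show ?thesis using real_product_zero[OF s(2,1) h] by simp
  next
    case False
    then have m: "m = 4" using Fm by auto
    then have Gf: "Gf = Bf 1" unfolding Gf_def by simp
    have "hermitian_fun n Gf" unfolding Gf using Bf_form[of 1] m by auto
    then have g: "Re (cnj a' * b' * sform n Gf x1 x2) = 0"
      using z(5) unfolding qform_comb2[OF \<open>hermitian_fun n Gf\<close>] z(1,2) by simp
    have "Im (cnj (sform n Gf x1 x2) * sform n (Bf (m - 2)) x1 x2) \<noteq> 0"
      using ip unfolding independent_pair_def if_not_P[OF False] .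
    then show ?thesis by (rule real_system_zero[OF g h])
  qed
qed

text \<open>The rank condition makes x1 and x2 span ker Z, so a certificate is a combination of the
  two. The forms force both coefficients to 0, against \<open>c m \<noteq> 0\<close>.\<close>

lemma property_I_no_certificate:
  assumes P: "property_I F n m AM c r XM ZM \<mu>"
    and AM: "\<And>i. i \<le> m \<Longrightarrow> AM i \<in> carrier_mat n n" "\<And>i. i \<le> m \<Longrightarrow> mat_cells n (AM i) = A i"
    and ZM: "ZM \<in> carrier_mat n n" "mat_cells n ZM = Z" and XM: "mat_cells n XM = X"
  shows "\<not> certificate y"
proof
  assume y: "certificate y"
  have mm: "m \<in> {1..m}" "m - 1 \<le> m" "m - 2 \<le> m" "1 \<le> m" "2 \<le> m" using Fm by auto
  have act: "all_active" and rk: "int (mrank n ZM) = int n - 2"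
    using P by (auto simp: property_I_def all_active_def)
  obtain v1 v2 where v: "v1 \<in> Fvec F n" "v2 \<in> Fvec F n" "XM = outer v1 + outer v2"
    and p1: "sesq (Bmat m AM c 1) v1 v1 = 0" "sesq (Bmat m AM c 1) v2 v2 = 0" "Re (sesq (Bmat m AM c 1) v1 v2) \<noteq> 0"
    and p2: "F = UNIV \<and> m = 4 \<Longrightarrow> sesq (Bmat m AM c 2) v1 v1 = 0 \<and> sesq (Bmat m AM c 2) v2 v2 = 0 \<and>
        Re (sesq (Bmat m AM c 2) v1 v2) = 0 \<and> Im (sesq (Bmat m AM c 2) v1 v2) \<noteq> 0"
    and p3: "Re (sesq (Bmat m AM c (m - 1)) v1 v1) * Re (sesq (Bmat m AM c (m - 1)) v2 v2) < 0"
    using P unfolding property_I_def Let_def by blast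
  define x1 x2 where x_def: "x1 = vec_index v1" "x2 = vec_index v2"
  have vc: "v1 \<in> carrier_vec n" "v2 \<in> carrier_vec n" using v(1,2) by (auto intro: Fvec_carrier)
  have sB: "sesq (Bmat m AM c i) v1 v1 = sform n (Bf i) x1 x1" "sesq (Bmat m AM c i) v2 v2 = sform n (Bf i) x2 x2"
    "sesq (Bmat m AM c i) v1 v2 = sform n (Bf i) x1 x2" if "i \<le> m" for i
    unfolding x_def using that vc by (auto intro!: sesq_Bmat AM)
  have xF: "vecF n x1" "vecF n x2" unfolding x_def using v(1,2) by (auto intro: Fvec_vecF)
  have E: "qform n (Bf (m - 1)) x1 * qform n (Bf (m - 1)) x2 < 0"
    using p3 unfolding sB[OF mm(2)] x_def qform_def .
  have q1: "qform n (Bf 1) x1 = 0" "qform n (Bf 1) x2 = 0" "Re (sform n (Bf 1) x1 x2) \<noteq> 0"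
    using p1 unfolding sB[OF mm(4)] x_def qform_def by simp_all
  have q2: "qform n (Bf 2) x1 = 0 \<and> qform n (Bf 2) x2 = 0 \<and> Re (sform n (Bf 2) x1 x2) = 0 \<and> Im (sform n (Bf 2) x1 x2) \<noteq> 0"
    if "F = UNIV \<and> m = 4"
    using p2[OF that] unfolding sB[OF mm(5)] x_def qform_def by simp
  have hE: "hermitian_fun n (Bf (m - 1))" using Bf_form[OF mm(2)] by blast
  interpret independent2 n x1 x2 by (rule independent2_of_form[OF hE E])
  define xx where "xx = (\<lambda>k::nat. if k = 1 then x1 else x2)"
  have Xe: "X i j = (\<Sum>k\<in>{1,2}. xx k i * cnj (xx k j))" if "i < n" "j < n" for i j
    using that vc unfolding XM[symmetric] v(3) xx_def x_def
    by (simp add: mat_cells_def outer_def)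
  have "qform n Z (xx k) = 0" if "k \<in> {1,2}" for k
    by (rule minner_zero_decomp[OF Z ZX, of "{1,2}" xx]) (use that xF Xe in \<open>auto simp: xx_def\<close>)
  from this[of 1] this[of 2] have "qform n Z x1 = 0" "qform n Z x2 = 0" by (simp_all add: xx_def)
  then have Zx: "mv n Z x1 i = 0" "mv n Z x2 i = 0" if "i < n" for i
    using that psd_mv_zero[OF Z] xF by auto
  have yF: "vecF n y" and Zy0: "qform n Z y = 0" using y by (auto simp: certificate_def)
  have Zy: "mv n Z y i = 0" if "i < n" for i by (rule psd_mv_zero[OF Z yF Zy0 that])
  have yA: "qform n (A i) y = c i" if "i \<in> {1..m}" for i
  proof -
    have "holds (r i) (qform n (A i) y) (c i)" "\<mu> i = 0 \<or> qform n (A i) y = c i" "r i = Le \<longrightarrow> \<mu> i \<noteq> 0"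
      using y act that unfolding certificate_def all_active_def by blast+
    then show ?thesis by (cases "r i") auto
  qed
  have yB: "qform n (Bf i) y = 0" if "i \<in> {1..m}" for i
  proof -
    have "qform n (Bf i) y = qform n (A i) y - c i / c m * qform n (A m) y"
      unfolding Bf_def eform_def qform_def sform_mat_comb by simp
    then show ?thesis using yA[OF that] yA[OF mm(1)] c_m by simp
  qed
  \<comment> \<open>A nonzero remainder would be a third orthogonal kernel vector besides x1 and u,
    and the rank of Z would be at most n - 3.\<close>
  have perp0: "qform n idm (perp y) = 0"
  proof (rule ccontr)
    assume ne: "qform n idm (perp y) \<noteq> 0"
    define kk where "kk = (\<lambda>k::nat. if k = 1 then x1 else if k = 2 then u else perp y)"
    have po: "sform n idm (perp y) x1 = 0" "sform n idm (perp y) u = 0"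
      using perp_orth(1,2)[of y] sform_herm[OF hermitian_idm, of n "perp y"] by (metis complex_cnj_zero)+
    have "mrank n ZM + card {1, 2, 3::nat} \<le> n"
    proof (rule rank_kernel_le[OF ZM(1), of _ kk])
      show "hermitian_fun n (mat_cells n ZM)" using Z unfolding ZM(2) by (simp add: psd_fun_def)
      fix k i assume "k \<in> {1, 2, 3::nat}" "i < n"
      then show "mv n (mat_cells n ZM) (kk k) i = 0"
        unfolding ZM(2) kk_def using Zx Zy mv_perp[OF Zx] by auto
    qed (use x1 u_ne ne u1 perp_orth po in \<open>auto simp: kk_def\<close>)
    then show False using rk by simp
  qed
  have ye: "y i = ca y * x1 i + cb y * x2 i" if "i < n" for i by (rule perp_zero[OF perp0 that])
  then have yq: "qform n B y = qform n B (\<lambda>i. ca y * x1 i + cb y * x2 i)" for B by (intro qform_cong)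
  have cF: "ca y \<in> F" "cb y \<in> F" by (rule coeff_F[OF independent2_axioms xF yF])+
  have h1: "hermitian_fun n (Bf 1)" "matF n (Bf 1)" using Bf_form[OF mm(4)] by auto
  have r1: "Re (cnj (ca y) * cb y * sform n (Bf 1) x1 x2) = 0"
    using yB[of 1] mm unfolding yq qform_comb2[OF h1(1)] q1(1,2) by simp
  have w: "cnj (ca y) * cb y = 0"
  proof (cases "F = \<real>")
    case True
    have s: "sform n (Bf 1) x1 x2 \<in> \<real>" "cnj (ca y) * cb y \<in> \<real>"
      using sform_F[OF h1(2) xF] F_arith(7)[OF F_arith(10)[OF cF(1)] cF(2)] unfolding True by auto
    show ?thesis by (rule real_product_zero[OF s(2,1) r1]) (use q1(3) in auto)
  next
    case False
    then have F4: "F = UNIV \<and> m = 4" using Fm by auto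
    note q = q2[OF F4]
    have h2: "hermitian_fun n (Bf 2)" using Bf_form[OF mm(5)] by auto
    have r2: "Re (cnj (ca y) * cb y * sform n (Bf 2) x1 x2) = 0"
      using yB[of 2] mm q unfolding yq qform_comb2[OF h2] by simp
    show ?thesis
    proof (rule real_system_zero[OF r1 r2])
      show "Im (cnj (sform n (Bf 1) x1 x2) * sform n (Bf 2) x1 x2) \<noteq> 0" using q q1(3) by simp
    qed
  qed
  have "qform n (Bf (m - 1)) y = 0" using mm by (intro yB) auto
  moreover have "2 * Re (cnj (ca y) * cb y * sform n (Bf (m - 1)) x1 x2) = 0" unfolding w by simp
  ultimately have e: "(cmod (ca y))\<^sup>2 * qform n (Bf (m - 1)) x1 + (cmod (cb y))\<^sup>2 * qform n (Bf (m - 1)) x2 = 0"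
    unfolding yq qform_comb2[OF hE] by linarith
  have "qform n (Bf (m - 1)) x1 \<noteq> 0" "qform n (Bf (m - 1)) x2 \<noteq> 0" using E by auto
  then have "ca y = 0" "cb y = 0" using w e by auto
  then have "qform n (A m) y = qform n (A m) (\<lambda>i. 0)" using ye by (intro qform_cong) simp
  then show False using yA[OF mm(1)] c_m by simp
qed

text \<open>In the complex case let g and d be the cross terms of \<open>Bf 1\<close> and
  \<open>Bf 2\<close>. Then \<open>\<omega> = \<i> * cnj d / |d|\<close> makes the second cross term
  purely imaginary, as Property I demands, and the real part of the first becomes
  \<open>Im (cnj g * d) / |d|\<close>. Modulus one keeps the rank-one term of x2 unchanged.\<close>

lemma phase_exists:
  assumes x: "vecF n x1" "vecF n x2" and ip: "independent_pair n Gf (Bf (m - 2)) x1 x2"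
  shows "\<exists>\<omega>. \<omega> \<in> F \<and> cmod \<omega> = 1 \<and> Re (\<omega> * sform n (Bf 1) x1 x2) \<noteq> 0 \<and>
     (F = UNIV \<and> m = 4 \<longrightarrow> Re (\<omega> * sform n (Bf 2) x1 x2) = 0 \<and> Im (\<omega> * sform n (Bf 2) x1 x2) \<noteq> 0)"
proof (cases "F = \<real>")
  case True
  have FU: "F \<noteq> UNIV"
  proof -
    have "\<i> \<notin> F" unfolding True by (simp add: complex_is_Real_iff)
    then show ?thesis by auto
  qed
  then have m: "m = 3" using Fm by blast
  have m1: "m - 2 = 1" unfolding m by simp
  have s: "sform n (Bf 1) x1 x2 \<noteq> 0" using ip unfolding independent_pair_def if_P[OF True] m1 .
  have "sform n (Bf 1) x1 x2 \<in> \<real>" using sform_F[OF _ x, of "Bf 1"] Bf_form[of 1] m_le unfolding True by auto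
  then have "Re (sform n (Bf 1) x1 x2) \<noteq> 0" using s by (auto elim!: Reals_cases)
  then show ?thesis using FU by (intro exI[of _ 1]) auto
next
  case False
  then have m: "m = 4" using Fm by blast
  have m2: "m - 2 = 2" unfolding m by simp
  have G: "Gf = Bf 1" unfolding Gf_def using m by simp
  let ?g = "sform n (Bf 1) x1 x2" and ?d = "sform n (Bf 2) x1 x2"
  have ne: "Im (cnj ?g * ?d) \<noteq> 0" using ip unfolding independent_pair_def if_not_P[OF False] G m2 .
  then have d: "cmod ?d \<noteq> 0" by auto
  define \<omega> where "\<omega> = \<i> * cnj ?d / complex_of_real (cmod ?d)"
  have "\<omega> * ?d = \<i> * complex_of_real (cmod ?d)"
    using d by (simp add: \<omega>_def divide_simps complex_norm_square[symmetric] power2_eq_square mult.commute)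
  then have "Re (\<omega> * ?d) = 0" "Im (\<omega> * ?d) \<noteq> 0" using d by simp_all
  moreover have "Re (\<omega> * ?g) \<noteq> 0"
  proof -
    have "\<omega> * ?g = (\<i> * cnj (cnj ?g * ?d)) / complex_of_real (cmod ?d)" by (simp add: \<omega>_def)
    then have "Re (\<omega> * ?g) = Im (cnj ?g * ?d) / cmod ?d" by (simp add: Re_divide_of_real del: complex_cnj_mult complex_cnj_cnj)
    then show ?thesis using ne d by simp
  qed
  moreover have "\<omega> \<in> F" using False F by auto
  moreover have "cmod \<omega> = 1" using d by (simp add: \<omega>_def norm_mult norm_divide)
  ultimately show ?thesis by blast
qed

text \<open>Without a third vector, ker Z is spanned by x1 and x2. Every column of the decomposition
  is then a multiple of one of the two, which merges the n summands of X into two. Suitable lengths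
  and a phase turn x1 and x2 into the vectors of Property I.\<close>

lemma no_third_property_I:
  assumes act: all_active and nt: "needs_third L p q" "\<not> third_vector n Z (L p) (L q)"
    and AM: "\<And>i. i \<le> m \<Longrightarrow> AM i \<in> carrier_mat n n" "\<And>i. i \<le> m \<Longrightarrow> mat_cells n (AM i) = A i"
    and ZM: "ZM \<in> carrier_mat n n" "mat_cells n ZM = Z"
    and XM: "XM \<in> carrier_mat n n" "mat_cells n XM = X"
  shows "property_I F n m AM c r XM ZM \<mu>"
proof -
  let ?D = "Bf (m - 2)" and ?E = "Bf (m - 1)"
  have mm: "m - 1 \<le> m" "m - 2 \<le> m" "1 \<le> m" "2 \<le> m" using Fm by auto
  define x1 x2 where x_def: "x1 = L p" "x2 = L q"
  have L: "decomp n X n L" "\<And>k. k < n \<Longrightarrow> vecF n (L k)"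
    and GD: "\<And>k. k < n \<Longrightarrow> qform n Gf (L k) = 0" "\<And>k. k < n \<Longrightarrow> qform n ?D (L k) = 0"
    and pq: "p < n" "q < n" and E: "qform n ?E x1 > 0" "qform n ?E x2 < 0"
    and ip: "independent_pair n Gf ?D x1 x2"
    using nt(1) unfolding needs_third_def x_def by blast+
  have xF: "vecF n x1" "vecF n x2" using L(2) pq by (simp_all add: x_def)
  have hE: "hermitian_fun n ?E" using Bf_form[OF mm(1)] by blast
  interpret independent2 n x1 x2
    by (rule independent2_of_form[OF hE]) (use E in \<open>simp add: mult_pos_neg\<close>)
  have ZL: "mv n Z (L k) i = 0" if "k < n" "i < n" for k i by (rule decomp_kernel(2)[OF L that])
  then have Zx: "mv n Z x1 i = 0" "mv n Z x2 i = 0" if "i < n" for i using that pq by (simp_all add: x_def)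
  have no: "qform n idm y = 0" if "\<And>i. i < n \<Longrightarrow> mv n Z y i = 0" "sform n idm x1 y = 0" "sform n idm x2 y = 0" for y
    using nt(2) that unfolding third_vector_def x_def by blast
  have ker: "y i = ca y * x1 i + cb y * x2 i" if "\<And>i. i < n \<Longrightarrow> mv n Z y i = 0" "i < n" for y i
  proof (rule perp_zero[OF no that(2)])
    show "mv n Z (perp y) i = 0" if "i < n" for i
      using that mv_perp(1)[OF Zx] \<open>\<And>i. i < n \<Longrightarrow> mv n Z y i = 0\<close> by simp
  qed (rule perp_orth)+
  define al be where ab_def: "al k = ca (L k)" "be k = cb (L k)" for k
  have Lk: "L k i = al k * x1 i + be k * x2 i" if "k < n" "i < n" for k i
    unfolding ab_def by (rule ker[OF ZL[OF that(1)] that(2)])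
  have LkQ: "qform n B (L k) = qform n B (\<lambda>i. al k * x1 i + be k * x2 i)" if "k < n" for B k
    using Lk[OF that] by (rule qform_cong)
  have w: "cnj (al k) * be k = 0" if k: "k < n" for k
  proof (rule pair_coeff_zero[OF xF _ _ ip])
    show "al k \<in> F" "be k \<in> F" unfolding ab_def by (rule coeff_F[OF independent2_axioms xF L(2)[OF k]])+
    show "qform n Gf x1 = 0" "qform n Gf x2 = 0" "qform n ?D x1 = 0" "qform n ?D x2 = 0"
      using GD pq by (simp_all add: x_def)
    show "qform n Gf (\<lambda>i. al k * x1 i + be k * x2 i) = 0" "qform n ?D (\<lambda>i. al k * x1 i + be k * x2 i) = 0"
      using GD[OF k] LkQ[OF k] by simp_all
  qed
  \<comment> \<open>Total weights of the columns parallel to x1 and to x2; they are positive because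
    columns p and q contribute 1 each.\<close>
  define sa sb where s_def: "sa = (\<Sum>k<n. (cmod (al k))\<^sup>2)" "sb = (\<Sum>k<n. (cmod (be k))\<^sup>2)"
  have "al p = 1" "be q = 1" using coeff_self by (simp_all add: ab_def x_def)
  then have spos: "sa > 0" "sb > 0" unfolding s_def using pq
    sum_pos2[of "{..<n}" p "\<lambda>k. (cmod (al k))\<^sup>2"] sum_pos2[of "{..<n}" q "\<lambda>k. (cmod (be k))\<^sup>2"] by auto
  obtain \<omega> where \<omega>: "\<omega> \<in> F" "cmod \<omega> = 1" "Re (\<omega> * sform n (Bf 1) x1 x2) \<noteq> 0"
    "F = UNIV \<and> m = 4 \<Longrightarrow> Re (\<omega> * sform n (Bf 2) x1 x2) = 0 \<and> Im (\<omega> * sform n (Bf 2) x1 x2) \<noteq> 0"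
    using phase_exists[OF xF ip] by blast
  define ka kb where k_def: "ka = complex_of_real (sqrt sa)" "kb = complex_of_real (sqrt sb) * \<omega>"
  have kk: "ka * cnj ka = complex_of_real sa" "kb * cnj kb = complex_of_real sb"
  proof -
    have "\<omega> * cnj \<omega> = 1" using \<omega>(2) by (simp add: complex_norm_square[symmetric])
    moreover have "complex_of_real (sqrt sb) * complex_of_real (sqrt sb) = complex_of_real sb"
      using spos by (simp flip: of_real_mult)
    ultimately show "kb * cnj kb = complex_of_real sb" by (simp add: k_def algebra_simps)
    show "ka * cnj ka = complex_of_real sa" using spos by (simp add: k_def flip: of_real_mult)
  qed
  have kF: "ka \<in> F" "kb \<in> F" using \<omega>(1) by (auto simp: k_def)
  have knz: "ka \<noteq> 0" "kb \<noteq> 0" using kk spos by auto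
  define v1 v2 where v_def: "v1 = vec n (\<lambda>i. ka * x1 i)" "v2 = vec n (\<lambda>i. kb * x2 i)"
  have vF: "v1 \<in> Fvec F n" "v2 \<in> Fvec F n" unfolding v_def using xF kF by (auto intro!: vecF_Fvec vecF_comb)
  then have vc: "v1 \<in> carrier_vec n" "v2 \<in> carrier_vec n" by (auto intro: Fvec_carrier)
  have Xc: "X i j = complex_of_real sa * (x1 i * cnj (x1 j)) + complex_of_real sb * (x2 i * cnj (x2 j))"
    if ij: "i < n" "j < n" for i j
  proof -
    have "X i j = (\<Sum>k<n. L k i * cnj (L k j))" using L(1) ij by (simp add: decomp_def)
    also have "\<dots> = (\<Sum>k<n. complex_of_real ((cmod (al k))\<^sup>2) * (x1 i * cnj (x1 j))
        + complex_of_real ((cmod (be k))\<^sup>2) * (x2 i * cnj (x2 j)))"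
    proof (rule sum.cong[OF refl])
      fix k assume "k \<in> {..<n}"
      then have k: "k < n" by simp
      have w': "al k = 0 \<or> be k = 0" using w[OF k] by auto
      then show "L k i * cnj (L k j) = complex_of_real ((cmod (al k))\<^sup>2) * (x1 i * cnj (x1 j))
        + complex_of_real ((cmod (be k))\<^sup>2) * (x2 i * cnj (x2 j))"
        unfolding Lk[OF k ij(1)] Lk[OF k ij(2)] complex_norm_square by auto
    qed
    also have "\<dots> = complex_of_real sa * (x1 i * cnj (x1 j)) + complex_of_real sb * (x2 i * cnj (x2 j))"
      by (simp add: s_def sum.distrib sum_distrib_right)
    finally show ?thesis .
  qed
  have XMe: "XM = outer v1 + outer v2"
  proof (rule eq_matI)
    fix i j assume "i < dim_row (outer v1 + outer v2)" "j < dim_col (outer v1 + outer v2)"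
    then have ij: "i < n" "j < n" using vc by (auto simp: outer_def)
    have "XM $$ (i, j) = X i j" using ij unfolding XM(2)[symmetric] by (simp add: mat_cells_def)
    also have "\<dots> = (ka * cnj ka) * (x1 i * cnj (x1 j)) + (kb * cnj kb) * (x2 i * cnj (x2 j))"
      unfolding kk by (rule Xc[OF ij])
    also have "\<dots> = (outer v1 + outer v2) $$ (i, j)" using ij by (simp add: outer_def v_def)
    finally show "XM $$ (i, j) = (outer v1 + outer v2) $$ (i, j)" .
  qed (use XM(1) vc in \<open>auto simp: outer_def\<close>)
  have "mrank n XM \<le> mrank n (outer v1) + mrank n (outer v2)"
    unfolding XMe by (rule rank_add) (use vc outer_carrier in auto)
  also have "\<dots> \<le> 1 + 1" by (intro add_mono rank_outer_le vc)
  finally have rX: "mrank n XM \<le> 2" by simp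
  have rZ: "mrank n ZM + card {1, 2::nat} \<le> n"
  proof (rule rank_kernel_le[OF ZM(1), of _ "\<lambda>k. if k = 1 then x1 else u"])
    show "hermitian_fun n (mat_cells n ZM)" using Z unfolding ZM(2) by (simp add: psd_fun_def)
    fix k i assume "k \<in> {1, 2::nat}" "i < n"
    then show "mv n (mat_cells n ZM) (if k = 1 then x1 else u) i = 0"
      unfolding ZM(2) using Zx mv_perp(2)[OF Zx] by auto
  qed (use x1 u_ne u1 in auto)
  \<comment> \<open>The ranks of Z and X are at most n - 2 and 2, and nonsingularity of Z + X makes
    both bounds sharp. If \<open>(Z + X) y = 0\<close>, then w = X y lies in ker Z and equals - Z y,
    which makes w orthogonal to itself. So y lies in ker Z and is orthogonal to x1 and x2, hence
    zero.\<close>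
  have "mrank n (ZM + XM) = n"
  proof (rule rank_full)
    fix y assume 0: "\<And>i. i < n \<Longrightarrow> mv n (mat_cells n (ZM + XM)) y i = 0"
    define w where "w i = complex_of_real sa * sform n idm x1 y * x1 i + complex_of_real sb * sform n idm x2 y * x2 i" for i
    have Xy: "mv n X y i = w i" if "i < n" for i
    proof -
      have "mv n X y i = (\<Sum>j<n. complex_of_real sa * x1 i * (cnj (x1 j) * y j) + complex_of_real sb * x2 i * (cnj (x2 j) * y j))"
        unfolding mv_def using Xc that by (intro sum.cong) (auto simp: algebra_simps)
      then show ?thesis by (simp add: w_def sform_idm sum.distrib sum_distrib_left algebra_simps)
    qed
    have Zy: "mv n Z y i = - w i" if "i < n" for i
      using 0[OF that] Xy[OF that] mv_add_mat[OF ZM(1) XM(1) that, of y] unfolding ZM(2) XM(2)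
      by (simp add: eq_neg_iff_add_eq_0)
    have Zw: "mv n Z w i = 0" if "i < n" for i unfolding w_def[abs_def] mv_comb using Zx[OF that] by simp
    have "sform n idm w w = - sform n Z w y"
      by (simp add: sform_mv[of n Z] sform_idm Zy sum_negf)
    also have "sform n Z w y = cnj (sform n Z y w)" using Z by (intro sform_herm) (simp add: psd_fun_def)
    also have "sform n Z y w = 0" using Zw by (simp add: sform_mv)
    finally have "qform n idm w = 0" by (simp add: qform_def)
    then have w0: "w i = 0" if "i < n" for i using that by (simp add: qform_idm_zero_iff)
    from comb_zero[of "complex_of_real sa * sform n idm x1 y" "complex_of_real sb * sform n idm x2 y"] w0
    have "sform n idm x1 y = 0" "sform n idm x2 y = 0" using spos by (simp_all add: w_def)
    then have "qform n idm y = 0" using Zy w0 by (intro no) auto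
    then show "\<forall>i<n. y i = 0" by (simp add: qform_idm_zero_iff)
  qed (use ZM XM in auto)
  moreover have "mrank n (ZM + XM) \<le> mrank n ZM + mrank n XM" by (rule rank_add[OF ZM(1) XM(1)])
  ultimately have rk: "int (mrank n ZM) = int n - 2" "mrank n XM = 2" using rX rZ by auto
  have sB: "sesq (Bmat m AM c i) v1 v1 = complex_of_real (sa * qform n (Bf i) x1)"
    "sesq (Bmat m AM c i) v2 v2 = complex_of_real (sb * qform n (Bf i) x2)"
    "sesq (Bmat m AM c i) v1 v2 = complex_of_real (sqrt sa * sqrt sb) * (\<omega> * sform n (Bf i) x1 x2)" if i: "i \<le> m" for i
  proof -
    have h: "hermitian_fun n (Bf i)" using Bf_form[OF i] by blast
    have v': "sform n B (vec_index v1) y = cnj ka * sform n B x1 y" "sform n B y (vec_index v1) = ka * sform n B y x1"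
      "sform n B (vec_index v2) y = cnj kb * sform n B x2 y" "sform n B y (vec_index v2) = kb * sform n B y x2" for B y
    proof -
      have "sform n B (vec_index v1) y = sform n B (\<lambda>i. ka * x1 i) y" "sform n B y (vec_index v1) = sform n B y (\<lambda>i. ka * x1 i)"
        "sform n B (vec_index v2) y = sform n B (\<lambda>i. kb * x2 i) y" "sform n B y (vec_index v2) = sform n B y (\<lambda>i. kb * x2 i)"
        by (rule sform_cong; simp add: v_def)+
      then show "sform n B (vec_index v1) y = cnj ka * sform n B x1 y" "sform n B y (vec_index v1) = ka * sform n B y x1"
        "sform n B (vec_index v2) y = cnj kb * sform n B x2 y" "sform n B y (vec_index v2) = kb * sform n B y x2"
        by (simp_all add: sform_linear)
    qed
    have "sesq (Bmat m AM c i) v1 v1 = (ka * cnj ka) * sform n (Bf i) x1 x1"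
      using sesq_Bmat[of AM, OF _ _ i vc(1) vc(1)] AM by (simp add: v')
    then show "sesq (Bmat m AM c i) v1 v1 = complex_of_real (sa * qform n (Bf i) x1)"
      unfolding kk sform_self[OF h] by simp
    have "sesq (Bmat m AM c i) v2 v2 = (kb * cnj kb) * sform n (Bf i) x2 x2"
      using sesq_Bmat[of AM, OF _ _ i vc(2) vc(2)] AM by (simp add: v')
    then show "sesq (Bmat m AM c i) v2 v2 = complex_of_real (sb * qform n (Bf i) x2)"
      unfolding kk sform_self[OF h] by simp
    show "sesq (Bmat m AM c i) v1 v2 = complex_of_real (sqrt sa * sqrt sb) * (\<omega> * sform n (Bf i) x1 x2)"
      using sesq_Bmat[of AM, OF _ _ i vc(1) vc(2)] AM by (simp add: v' k_def)
  qed
  have BGD: "qform n (Bf i) x1 = 0 \<and> qform n (Bf i) x2 = 0" if "i = 1 \<or> (i = 2 \<and> F = UNIV \<and> m = 4)" for i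
  proof -
    have "Bf i = Gf \<or> Bf i = ?D"
      using that Fm unfolding Gf_def by (elim disjE) auto
    then show ?thesis using GD pq by (auto simp: x_def)
  qed
  have "sesq (Bmat m AM c 1) v1 v1 = 0 \<and> sesq (Bmat m AM c 1) v2 v2 = 0 \<and> Re (sesq (Bmat m AM c 1) v1 v2) \<noteq> 0"
    unfolding sB[OF mm(3)] using BGD[of 1] \<omega>(3) spos by (simp add: mult.assoc del: of_real_mult)
  moreover have "sesq (Bmat m AM c 2) v1 v1 = 0 \<and> sesq (Bmat m AM c 2) v2 v2 = 0 \<and>
      Re (sesq (Bmat m AM c 2) v1 v2) = 0 \<and> Im (sesq (Bmat m AM c 2) v1 v2) \<noteq> 0" if "F = UNIV \<and> m = 4"
    unfolding sB[OF mm(4)] using BGD[of 2] that \<omega>(4)[OF that] spos by (simp del: of_real_mult)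
  moreover have "Re (sesq (Bmat m AM c (m - 1)) v1 v1) * Re (sesq (Bmat m AM c (m - 1)) v2 v2) < 0"
    unfolding sB[OF mm(1)] Re_complex_of_real using E spos by (intro mult_pos_neg mult_pos_pos) auto
  moreover have "\<forall>i\<in>{1..m}. r i = Le \<longrightarrow> \<mu> i \<noteq> 0" using act unfolding all_active_def .
  ultimately show ?thesis
    unfolding property_I_def Let_def using rk vF XMe by blast
qed

end

section \<open>The quadratic problem attains its value\<close>

text \<open>Bolzano-Weierstrass for index functions: each induction step thins out the subsequence
  once more, for the new coordinate.\<close>

lemma coordinatewise_subsequence:
  fixes y :: "nat \<Rightarrow> nat \<Rightarrow> complex"
  assumes "\<And>k i. i < n \<Longrightarrow> cmod (y k i) \<le> C"
  shows "\<exists>g l. strict_mono (g :: nat \<Rightarrow> nat) \<and> (\<forall>i<n. (\<lambda>k. y (g k) i) \<longlonglongrightarrow> l i)"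
  using assms
proof (induction n)
  case 0
  then show ?case by (intro exI[of _ id]) (auto simp: strict_mono_def)
next
  case (Suc n)
  obtain g l where g: "strict_mono g" "\<And>i. i < n \<Longrightarrow> (\<lambda>k. y (g k) i) \<longlonglongrightarrow> l i"
    using Suc.IH Suc.prems by (meson less_SucI)
  have "bounded (range (\<lambda>k. y (g k) n))" using Suc.prems by (intro boundedI[of _ C]) auto
  from bounded_imp_convergent_subsequence[OF this] obtain l' h where
    h: "strict_mono h" "((\<lambda>k. y (g k) n) \<circ> h) \<longlonglongrightarrow> l'" by blast
  have "(\<lambda>k. y ((g \<circ> h) k) i) \<longlonglongrightarrow> (l(n := l')) i" if "i < Suc n" for i
  proof (cases "i = n")
    case False
    then have "(\<lambda>k. y (g k) i) \<longlonglongrightarrow> l i" using that g(2) by simp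
    from LIMSEQ_subseq_LIMSEQ[OF this h(1)] show ?thesis using False by (simp add: comp_def)
  qed (use h(2) in \<open>simp add: comp_def\<close>)
  then show ?case using strict_mono_o[OF g(1) h(1)] by blast
qed

lemma qform_tendsto:
  assumes "\<And>i. i < n \<Longrightarrow> (\<lambda>k. y k i) \<longlonglongrightarrow> l i"
  shows "(\<lambda>k. qform n B (y k)) \<longlonglongrightarrow> qform n B l"
  unfolding qform_def sform_def by (intro tendsto_intros assms) auto

context base_field begin

lemma vecF_limit:
  assumes "\<And>i. i < n \<Longrightarrow> (\<lambda>k. y k i) \<longlonglongrightarrow> l i" "\<And>k. vecF n (y k)"
  shows "vecF n l"
proof -
  have "\<real> = {z :: complex. Im z = 0}" by (auto simp: complex_is_Real_iff)
  moreover have "closed {z :: complex. Im z = 0}" by (intro closed_Collect_eq continuous_intros)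
  ultimately have "closed F" using F by auto
  then show ?thesis
    unfolding vecF_def using closed_sequentially assms by (metis vecF_def)
qed

text \<open>Compactness of the unit sphere: otherwise unit vectors at which W is below 1 / (k + 1)
  would have a limit of norm 1 at which W is not positive.\<close>

lemma pd_coercive:
  assumes pos: "\<And>x. vecF n x \<Longrightarrow> \<exists>i<n. x i \<noteq> 0 \<Longrightarrow> qform n W x > 0" and W: "hermitian_fun n W"
  shows "\<exists>e>0. \<forall>x. vecF n x \<longrightarrow> e * qform n idm x \<le> qform n W x"
proof (rule ccontr)
  assume no: "\<not> ?thesis"
  have "\<exists>x. vecF n x \<and> qform n idm x = 1 \<and> qform n W x < 1 / real (Suc k)" for k
  proof -
    from no have "\<not> (\<forall>x. vecF n x \<longrightarrow> 1 / real (Suc k) * qform n idm x \<le> qform n W x)"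
      by (metis of_nat_0_less_iff zero_less_Suc zero_less_divide_1_iff)
    then obtain x where x: "vecF n x" "qform n W x < 1 / real (Suc k) * qform n idm x" by auto
    have "qform n idm x \<noteq> 0"
    proof
      assume 0: "qform n idm x = 0"
      then have "qform n W x = qform n W (\<lambda>i. 0)" by (intro qform_cong) (simp add: qform_idm_zero_iff)
      then show False using x(2) 0 by simp
    qed
    then have q: "qform n idm x > 0" using qform_idm_nonneg[of n x] by simp
    let ?t = "complex_of_real (1 / sqrt (qform n idm x))"
    have t: "(cmod ?t)\<^sup>2 = 1 / qform n idm x" using q by (simp add: power_divide norm_divide)
    show ?thesis
    proof (intro exI conjI)
      show "vecF n (\<lambda>i. ?t * x i)" by (rule vecF_comb(4)[OF x(1) F_arith(3)])
      show "qform n idm (\<lambda>i. ?t * x i) = 1" unfolding qform_scale[OF hermitian_idm] t using q by simp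
      show "qform n W (\<lambda>i. ?t * x i) < 1 / real (Suc k)"
        unfolding qform_scale[OF W] t using x(2) q by (simp add: field_simps)
    qed
  qed
  then obtain y where y: "\<And>k. vecF n (y k)" "\<And>k. qform n idm (y k) = 1" "\<And>k. qform n W (y k) < 1 / real (Suc k)"
    by metis
  have "cmod (y k i) \<le> 1" if "i < n" for k i
  proof -
    have "(cmod (y k i))\<^sup>2 \<le> (\<Sum>i<n. (cmod (y k i))\<^sup>2)" using that by (intro member_le_sum) auto
    also have "\<dots> = 1" using y(2)[of k] unfolding qform_idm .
    finally show ?thesis by (simp add: power_le_one_iff)
  qed
  from coordinatewise_subsequence[of n y, OF this] obtain g l where g: "strict_mono (g :: nat \<Rightarrow> nat)"
    "\<And>i. i < n \<Longrightarrow> (\<lambda>k. y (g k) i) \<longlonglongrightarrow> l i" by blast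
  have lim: "(\<lambda>k. qform n B (y (g k))) \<longlonglongrightarrow> qform n B l" for B using g(2) by (rule qform_tendsto)
  have 1: "qform n idm l = 1" using lim[of idm] unfolding y(2) by (simp add: LIMSEQ_const_iff)
  have lF: "vecF n l" by (rule vecF_limit[OF g(2) y(1)])
  have "(\<lambda>k. 1 / real (Suc k)) \<longlonglongrightarrow> 0" by (rule LIMSEQ_Suc[OF lim_1_over_n])
  from LIMSEQ_subseq_LIMSEQ[OF this g(1)] have "qform n W l \<le> 0"
    by (intro LIMSEQ_le[OF lim]) (use less_imp_le[OF y(3)] in \<open>auto simp: comp_def\<close>)
  moreover have "\<exists>i<n. l i \<noteq> 0" using 1 qform_idm_zero_iff[of n l] by auto
  ultimately show False using pos[OF lF] by simp
qed

end

lemma holds_limit: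
  assumes "f \<longlonglongrightarrow> a" "\<And>k. holds \<rho> (f k) b" shows "holds \<rho> a b"
proof (cases \<rho>)
  case Le
  then show ?thesis using LIMSEQ_le_const2[OF assms(1)] assms(2) by auto
next
  case Eq
  then have "f = (\<lambda>k. b)" using assms(2) by auto
  then show ?thesis using assms(1) Eq by (simp add: LIMSEQ_const_iff)
qed

text \<open>Along a minimising sequence the positive definite dual slack is bounded by the objective
  and the right-hand sides, so coercivity bounds the sequence. The limit of a subsequence is
  feasible and attains the bound of \<open>weak_duality\<close>.\<close>

lemma (in optimal_pair) certificate_of_infimum:
  assumes ex: "\<And>e. e > 0 \<Longrightarrow> \<exists>y. vecF n y \<and> (\<forall>i\<in>{1..m}. holds (r i) (qform n (A i) y) (c i)) \<and>
     qform n (A 0) y < - (\<Sum>i=1..m. c i * \<mu> i) + e"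
  shows "\<exists>y. certificate y"
proof -
  let ?v = "- (\<Sum>i=1..m. c i * \<mu> i)"
  have "\<forall>k. \<exists>y. vecF n y \<and> (\<forall>i\<in>{1..m}. holds (r i) (qform n (A i) y) (c i)) \<and> qform n (A 0) y < ?v + 1 / real (Suc k)"
    using ex by simp
  then obtain y where y: "\<And>k. vecF n (y k)" "\<And>k i. i \<in> {1..m} \<Longrightarrow> holds (r i) (qform n (A i) (y k)) (c i)"
    "\<And>k. qform n (A 0) (y k) < ?v + 1 / real (Suc k)" by metis
  obtain \<nu> where \<nu>: "\<And>x. vecF n x \<Longrightarrow> \<exists>i<n. x i \<noteq> 0 \<Longrightarrow> qform n (slack_fun m A \<nu>) x > 0"
    "\<And>i. i \<in> {1..m} \<Longrightarrow> r i = Le \<Longrightarrow> \<nu> i > 0" using dual_strict by blast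
  have "hermitian_fun n (slack_fun m A \<nu>)" unfolding slack_fun_sum using A by (intro hermitian_sum_mat) auto
  from pd_coercive[OF \<nu>(1) this] obtain e where e: "e > 0"
    "\<And>x. vecF n x \<Longrightarrow> e * qform n idm x \<le> qform n (slack_fun m A \<nu>) x" by blast
  define K where "K = (?v + 1 + (\<Sum>i=1..m. \<nu> i * c i)) / e"
  have K: "qform n idm (y k) \<le> K" for k
  proof -
    have "\<nu> i * qform n (A i) (y k) \<le> \<nu> i * c i" if "i \<in> {1..m}" for i
      using y(2)[OF that, of k] \<nu>(2)[OF that] by (cases "r i") auto
    then have "(\<Sum>i=1..m. \<nu> i * qform n (A i) (y k)) \<le> (\<Sum>i=1..m. \<nu> i * c i)" by (rule sum_mono)
    moreover have "1 / real (Suc k) \<le> 1" by simp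
    ultimately have "e * qform n idm (y k) \<le> ?v + 1 + (\<Sum>i=1..m. \<nu> i * c i)"
      using e(2)[OF y(1), of k] y(3)[of k] unfolding qform_slack by linarith
    then show ?thesis using e(1) by (simp add: K_def field_simps)
  qed
  have "cmod (y k i) \<le> sqrt K" if "i < n" for k i
  proof -
    have "(cmod (y k i))\<^sup>2 \<le> (\<Sum>i<n. (cmod (y k i))\<^sup>2)" using that by (intro member_le_sum) auto
    also have "\<dots> \<le> K" using K[of k] unfolding qform_idm .
    finally show ?thesis by (rule real_le_rsqrt)
  qed
  from coordinatewise_subsequence[of n y, OF this] obtain g l where g: "strict_mono (g :: nat \<Rightarrow> nat)"
    "\<And>i. i < n \<Longrightarrow> (\<lambda>k. y (g k) i) \<longlonglongrightarrow> l i" by blast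
  have lim: "(\<lambda>k. qform n B (y (g k))) \<longlonglongrightarrow> qform n B l" for B using g(2) by (rule qform_tendsto)
  have lF: "vecF n l" by (rule vecF_limit[OF g(2) y(1)])
  have hl: "holds (r i) (qform n (A i) l) (c i)" if "i \<in> {1..m}" for i
    by (rule holds_limit[OF lim]) (rule y(2)[OF that])
  have "(\<lambda>k. ?v + 1 / real (Suc k)) \<longlonglongrightarrow> ?v + 0" by (intro tendsto_intros LIMSEQ_Suc[OF lim_1_over_n])
  from LIMSEQ_subseq_LIMSEQ[OF this g(1)] have "qform n (A 0) l \<le> ?v + 0"
    by (intro LIMSEQ_le[OF lim]) (use less_imp_le[OF y(3)] in \<open>auto simp: comp_def\<close>)
  then show ?thesis using weak_duality(2)[OF lF hl] by auto
qed

section \<open>Return to the problems on matrices and vectors\<close>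

context base_field begin

lemma machine_pair_of_slater:
  assumes "slater_optimal_pair F n m A c r X Z \<mu>" "F = \<real> \<and> m = 3 \<or> F = UNIV \<and> m = 4"
  shows "machine_pair F n m (\<lambda>k. mat_cells n (A k)) c r (mat_cells n X) (mat_cells n Z) \<mu>"
  using assms optimal_pair_of_slater[OF assms(1)]
  by (auto simp: machine_pair_def machine_pair_axioms_def)

lemma HQP_feasible_iff:
  assumes A: "\<And>i. i \<le> m \<Longrightarrow> A i \<in> carrier_mat n n"
  shows "vec n y \<in> HQP_feasible F n m A c r \<longleftrightarrow>
    vecF n y \<and> (\<forall>i\<in>{1..m}. holds (r i) (qform n (mat_cells n (A i)) y) (c i))"
proof -
  have "vec n y \<in> Fvec F n \<longleftrightarrow> vecF n y" by (auto simp: Fvec_def vecF_def)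
  then show ?thesis using A by (auto simp: HQP_feasible_def sesq_vec)
qed

lemma HQP_feasible_cases:
  assumes "x \<in> HQP_feasible F n m A c r"
  obtains y where "x = vec n y"
proof
  show "x = vec n (vec_index x)" using assms by (auto simp: HQP_feasible_def Fvec_def)
qed

context
  fixes n m :: nat and A :: "nat \<Rightarrow> complex mat" and c :: "nat \<Rightarrow> real" and r :: "nat \<Rightarrow> relation"
    and X Z :: "complex mat" and \<mu> :: "nat \<Rightarrow> real"
  assumes slater: "slater_optimal_pair F n m A c r X Z \<mu>" and Fm: "F = \<real> \<and> m = 3 \<or> F = UNIV \<and> m = 4"
begin

interpretation machine_pair F n m "\<lambda>k. mat_cells n (A k)" c r "mat_cells n X" "mat_cells n Z" \<mu>
  by (rule machine_pair_of_slater[OF slater Fm])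

lemma data_carrier: "i \<le> m \<Longrightarrow> A i \<in> carrier_mat n n" "X \<in> carrier_mat n n" "Z \<in> carrier_mat n n"
  using slater
  by (auto simp: slater_optimal_pair_def problem_data_def HF_def SP_optimal_def SP_feasible_def psd_def
      SD_optimal_def SD_feasible_def)

lemma HQP_value_ge:
  assumes "x \<in> HQP_feasible F n m A c r" shows "- (\<Sum>i=1..m. c i * \<mu> i) \<le> Re (sesq (A 0) x x)"
proof -
  obtain y where y: "x = vec n y" using HQP_feasible_cases[OF assms] .
  then have "vecF n y \<and> (\<forall>i\<in>{1..m}. holds (r i) (qform n (mat_cells n (A i)) y) (c i))"
    using assms HQP_feasible_iff[of m A n y, OF data_carrier(1)] by simp
  then show ?thesis using weak_duality(1)[of y] data_carrier(1)[of 0] by (simp add: y sesq_vec)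
qed

lemma v_SP_eq: "v_SP F n m A c r = ereal (- (\<Sum>i=1..m. c i * \<mu> i))"
proof -
  have X: "X \<in> SP_feasible F n m A c r" "\<And>Y. Y \<in> SP_feasible F n m A c r \<Longrightarrow> Re (A 0 \<bullet>\<^sub>m X) \<le> Re (A 0 \<bullet>\<^sub>m Y)"
    using slater by (auto simp: slater_optimal_pair_def SP_optimal_def)
  have "v_SP F n m A c r = ereal (Re (A 0 \<bullet>\<^sub>m X))"
    unfolding v_SP_def by (rule antisym[OF INF_lower[OF X(1)] INF_greatest]) (simp add: X(2))
  then show ?thesis using X_value mat_inner_minner[OF data_carrier(1)[of 0] data_carrier(2)] by simp
qed

lemma certificate_optimal:
  assumes "certificate y" shows "HQP_optimal F n m A c r (vec n y)"
proof -
  have "vec n y \<in> HQP_feasible F n m A c r"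
    using assms by (subst HQP_feasible_iff[OF data_carrier(1)]) (auto simp: certificate_def)
  moreover have "Re (sesq (A 0) (vec n y) (vec n y)) = - (\<Sum>i=1..m. c i * \<mu> i)"
    using certificate_value[OF assms] data_carrier(1)[of 0] by (simp add: sesq_vec)
  ultimately show ?thesis using HQP_value_ge unfolding HQP_optimal_def by auto
qed

lemma gap_iff_no_certificate:
  "v_SP F n m A c r < v_HQP F n m A c r \<or> HQP_feasible F n m A c r = {} \<longleftrightarrow> \<not> (\<exists>y. certificate y)"
proof
  assume gap: "v_SP F n m A c r < v_HQP F n m A c r \<or> HQP_feasible F n m A c r = {}"
  show "\<not> (\<exists>y. certificate y)"
  proof
    assume "\<exists>y. certificate y"
    then obtain y where y: "certificate y" ..
    have f: "vec n y \<in> HQP_feasible F n m A c r" using certificate_optimal[OF y] by (simp add: HQP_optimal_def)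
    then have "v_HQP F n m A c r \<le> ereal (Re (sesq (A 0) (vec n y) (vec n y)))"
      unfolding v_HQP_def by (rule INF_lower)
    also have "\<dots> = v_SP F n m A c r"
      unfolding v_SP_eq using certificate_value[OF y] data_carrier(1)[of 0] by (simp add: sesq_vec)
    finally show False using gap f by auto
  qed
next
  assume no: "\<not> (\<exists>y. certificate y)"
  \<comment> \<open>An empty feasible set has value \<infinity> and is covered by the strict
    inequality. If that inequality fails, feasible points come arbitrarily close to the dual
    value.\<close>
  have "v_SP F n m A c r < v_HQP F n m A c r"
  proof (rule ccontr)
    assume "\<not> ?thesis"
    then have le: "v_HQP F n m A c r \<le> ereal (- (\<Sum>i=1..m. c i * \<mu> i))" unfolding v_SP_eq by simp
    have "\<exists>y. certificate y"
    proof (rule certificate_of_infimum)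
      fix e :: real assume "e > 0"
      then have "v_HQP F n m A c r < ereal (- (\<Sum>i=1..m. c i * \<mu> i) + e)"
        using le by (elim le_less_trans) simp
      then obtain x where x: "x \<in> HQP_feasible F n m A c r" "Re (sesq (A 0) x x) < - (\<Sum>i=1..m. c i * \<mu> i) + e"
        unfolding v_HQP_def INF_less_iff by auto
      obtain y where y: "x = vec n y" using HQP_feasible_cases[OF x(1)] .
      show "\<exists>y. vecF n y \<and> (\<forall>i\<in>{1..m}. holds (r i) (qform n (mat_cells n (A i)) y) (c i)) \<and>
          qform n (mat_cells n (A 0)) y < - (\<Sum>i=1..m. c i * \<mu> i) + e"
        using x HQP_feasible_iff[of m A n y, OF data_carrier(1)] data_carrier(1)[of 0]
        by (auto simp: y sesq_vec)
    qed
    then show False using no by blast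
  qed
  then show "v_SP F n m A c r < v_HQP F n m A c r \<or> HQP_feasible F n m A c r = {}" ..
qed

text \<open>If a third vector were missing where the program asks for one,
  \<open>no_third_property_I\<close> would establish Property I.\<close>

lemma Main_certificate:
  assumes "\<not> property_I F n m A c r X Z \<mu>"
  shows "\<exists>t s. exec (Main m) (input_state n m A c r X Z \<mu>) t s \<and> t \<le> poly (time_bound (Main m)) n \<and>
    certificate (\<lambda>i. snd s (m + 4) i 0)"
proof -
  let ?R = "fst (input_state n m A c r X Z \<mu>)" and ?M = "snd (input_state n m A c r X Z \<mu>)"
  have "wp ?R (Main m) (\<lambda>M'. certificate (\<lambda>i. M' (m + 4) i 0)) ?M"
  proof (rule wp_Main)
    fix L p q assume "all_active" "needs_third L p q"
    then show "third_vector n (mat_cells n Z) (L p) (L q)"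
      using no_third_property_I[of L p q A Z X] data_carrier assms by blast
  qed (auto simp: input_state_def fun_eq_iff)
  then obtain t M' where "t \<le> poly (time_bound (Main m)) (?R 0)" "exec (Main m) (?R, ?M) t (?R, M')"
    "certificate (\<lambda>i. M' (m + 4) i 0)" unfolding wp_def by blast
  then show ?thesis by (intro exI[of _ t] exI[of _ "(?R, M')"]) (auto simp: input_state_def)
qed

lemma gap_iff_property_I:
  "v_SP F n m A c r < v_HQP F n m A c r \<or> HQP_feasible F n m A c r = {} \<longleftrightarrow> property_I F n m A c r X Z \<mu>"
  unfolding gap_iff_no_certificate
  using Main_certificate property_I_no_certificate[of A X Z] data_carrier by blast

lemma Main_optimal:
  assumes "\<not> property_I F n m A c r X Z \<mu>"
  shows "\<exists>t s. exec (Main m) (input_state n m A c r X Z \<mu>) t s \<and> t \<le> poly (time_bound (Main m)) n \<and>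
    HQP_optimal F n m A c r (output_vec n m s)"
  using Main_certificate[OF assms] certificate_optimal unfolding output_vec_def by blast

end

end

theorem theorem3p7:
  fixes F :: "complex set" and m :: nat
  assumes "F = \<real> \<and> m = 3 \<or> F = UNIV \<and> m = 4"
  shows
    "(\<forall>(n::nat) (A :: nat \<Rightarrow> complex mat) (c :: nat \<Rightarrow> real) (r :: nat \<Rightarrow> relation)
        (X :: complex mat) (Z :: complex mat) (\<mu> :: nat \<Rightarrow> real).
        slater_optimal_pair F n m A c r X Z \<mu> \<longrightarrow>
        (v_SP F n m A c r < v_HQP F n m A c r \<or> HQP_feasible F n m A c r = {}
           \<longleftrightarrow> property_I F n m A c r X Z \<mu>))
     \<and>
     (\<exists>(P :: prog) (p :: nat poly).
        \<forall>(n::nat) (A :: nat \<Rightarrow> complex mat) (c :: nat \<Rightarrow> real) (r :: nat \<Rightarrow> relation)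
          (X :: complex mat) (Z :: complex mat) (\<mu> :: nat \<Rightarrow> real).
          slater_optimal_pair F n m A c r X Z \<mu> \<and> \<not> property_I F n m A c r X Z \<mu> \<longrightarrow>
          (\<exists>t s. exec P (input_state n m A c r X Z \<mu>) t s \<and> t \<le> poly p n \<and>
                 HQP_optimal F n m A c r (output_vec n m s)))"
proof -
  interpret base_field F by unfold_locales (use assms in auto)
  \<comment> \<open>Program and time polynomial are determined by F and m alone, so they can be
    given before n and the data.\<close>
  show ?thesis
    using gap_iff_property_I[OF _ assms] Main_optimal[OF _ assms]
    by (intro conjI exI[of _ "Main m"] exI[of _ "time_bound (Main m)"]) blast+
qed

end
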